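(* Let $(K_t)$ be chordal $\mathrm{SLE}_6$ in the upper half-plane. Then almost surely the Hausdorff dimension of $\partial K_1\cap\mathbb{H}$ is $4/3$.
   Context: Chordal $\mathrm{SLE}_\kappa$ in the upper half-plane $\mathbb{H}$: for $\kappa>0$ and a standard real Brownian motion $(B_t)$, for $z\in\mathbb{H}$ let $g_t(z)$ solve $\partial_t g_t(z)=\frac{2}{g_t(z)-\sqrt{\kappa}B_t}$, $g_0(z)=z$; $H_t$ is the set of $z\in\mathbb{H}$ for which this solution is defined up to time $t$, $K_t=\mathbb{H}\setminus H_t$ (the hull at time $t$), and $g_t:H_t\to\mathbb{H}$ is a conformal map. The driving process is $\beta_t=\sqrt{\kappa}B_t$. The trace is the almost surely existing continuous curve $\gamma:[0,\infty)\to\overline{\mathbb{H}}$ with $\gamma(0)=0$ such that for every $t$, $H_t$ is the unbounded connected component of $\mathbb{H}\setminus\gamma([0,t])$. *)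

theory Defs
  imports "HOL-Probability.Probability"
begin

definition standard_brownian_motion :: "'a measure \<Rightarrow> ('a \<Rightarrow> real \<Rightarrow> real) \<Rightarrow> bool" where
  "standard_brownian_motion M B \<longleftrightarrow>
     prob_space M \<and>
     (\<forall>t\<ge>0. (\<lambda>w. B w t) \<in> borel_measurable M) \<and>
     (AE w in M. B w 0 = 0 \<and> continuous_on {0..} (B w)) \<and>
     (\<forall>s t. 0 \<le> s \<and> s < t \<longrightarrow>
        distributed M lborel (\<lambda>w. B w t - B w s) (\<lambda>x. ennreal (normal_density 0 (sqrt (t - s)) x))) \<and>
     (\<forall>ts :: real list. sorted_wrt (<) ts \<and> (\<forall>t\<in>set ts. 0 \<le> t) \<longrightarrow>
        prob_space.indep_vars M (\<lambda>_. borel) (\<lambda>i w. B w (ts ! Suc i) - B w (ts ! i)) {..<length ts - 1})"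

definition upper_half_plane :: "complex set" where
  "upper_half_plane = {z. 0 < Im z}"

definition loewner_domain :: "(real \<Rightarrow> real) \<Rightarrow> real \<Rightarrow> complex set" where
  "loewner_domain \<beta> t = {z \<in> upper_half_plane. \<exists>g :: real \<Rightarrow> complex. g 0 = z \<and>
      (\<forall>s\<in>{0..t}. g s \<noteq> complex_of_real (\<beta> s) \<and>
         (g has_vector_derivative (2 / (g s - complex_of_real (\<beta> s)))) (at s within {0..t}))}"

definition loewner_hull :: "(real \<Rightarrow> real) \<Rightarrow> real \<Rightarrow> complex set" where
  "loewner_hull \<beta> t = upper_half_plane - loewner_domain \<beta> t"

definition sle_hull :: "real \<Rightarrow> ('a \<Rightarrow> real \<Rightarrow> real) \<Rightarrow> 'a \<Rightarrow> real \<Rightarrow> complex set" where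
  "sle_hull \<kappa> B w t = loewner_hull (\<lambda>s. sqrt \<kappa> * B w s) t"

definition hausdorff_pre_measure :: "real \<Rightarrow> real \<Rightarrow> 'b::metric_space set \<Rightarrow> ennreal" where
  "hausdorff_pre_measure s \<delta> A =
     (INF U \<in> {U :: nat \<Rightarrow> 'b set. A \<subseteq> (\<Union>i. U i) \<and> (\<forall>i. bounded (U i) \<and> diameter (U i) \<le> \<delta>)}.
        (\<Sum>i. ennreal (diameter (U i) powr s)))"

definition hausdorff_measure :: "real \<Rightarrow> 'b::metric_space set \<Rightarrow> ennreal" where
  "hausdorff_measure s A = (SUP \<delta> \<in> {0<..}. hausdorff_pre_measure s \<delta> A)"

definition hausdorff_dim :: "'b::metric_space set \<Rightarrow> real" where
  "hausdorff_dim A = Inf {s. 0 < s \<and> hausdorff_measure s A = 0}"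

end

theory Submission
  imports Defs "HOL-Complex_Analysis.Complex_Analysis"
begin

text \<open>Reversing time, the complement of the hull is the image of the half-plane under the reverse Loewner flow driven by
  \<open>W s = sqrt 6 * B (1 - s)\<close>, a univalent map \<open>f\<close>, so the question concerns the frontier of \<open>f ` upper_half_plane\<close> inside
  the half-plane.  All probabilistic input comes from products of powers of \<open>|f'(z)|\<close>, \<open>|f z - f w|\<close>, \<open>|f z - cnj (f w)|\<close> and \<open>|f z|\<close>.
  For suitable exponents the drift of such a product vanishes; replacing stochastic calculus by the Euler scheme with
  step \<open>d\<close>, one Gaussian step changes its mean only by a relative error \<open>O(d * sqrt d)\<close>, so the expectation is
  preserved in the limit.  With one point and exponents just beyond the critical ones, this bounds the moments of the conformal
  radius, and a Koebe-type covering of the frontier shows that every measure of exponent above 4/3 vanishes almost surely.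
  For the lower bound one restricts to points where the conformal radius has its typical size on all scales, bounds the mass of
  these points from below by a Lyapunov function, and their correlations from above by products with two and three points.
  The energy method then gives a set of positive measure of exponent below 4/3 with positive probability.  By Brownian scaling this holds
  with the same probability on all small scales, also after conditioning on a germ event, and therefore almost surely.\<close>

text \<open>The exponent 4/3 solves a quadratic. With exponent r on |f z| the drift cancels only for
  the powers (10 r - 3 r^2)/4 of |f'| and -3 r^2/4 of Im (f z) / Im z. So, away from the real line,
  the conformal radius at height y raised to the first of these has mean O(y^p), p being their sum.
  About 1/y points see the boundary at this height, and p = 1 first holds at r = 2/3, where the
  first power is 4/3. Weighted by this product, the conformal radius at height l is of order
  l^(1/3): a boundary piece of diameter x comes from an interval of length x^3, so energy exponent
  4/9 on the real line gives dimension 3 * 4/9 in the image. Two obstacles shape the lower bound.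
  Fatou's lemma yields only upper bounds on limits of expectations, so mass is bounded below through
  a bounded truncated weight. And the energy method yields only positive probability; in place of a
  zero-one law, the germ at time 0 is shown independent of all dyadic increments, which is why the
  quantities of the energy method depend on these increments alone.\<close>

abbreviation (input) "\<H> \<equiv> upper_half_plane"

abbreviation (input) "EE M f \<equiv> \<integral>\<^sup>+x. ennreal (f x) \<partial>M"

section \<open>Koebe-type distortion of univalent maps with explicit constants\<close>

text \<open>Schottky's bound for value at most 1 at the centre and radius 6/7 has the inner exponent
  2 + 2 + 12 * (6/7) / (1 - 6/7) = 76; the square undoes the square root taken of the
  function.\<close>

definition koebe_C :: real where
 "koebe_C = 2*(1+(exp (pi*exp (pi*76)))^2)"

lemma koebe_C_ge: "koebe_C >= 2" by (simp add: koebe_C_def)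

lemma koebe_C_pos: "koebe_C > 0" using koebe_C_ge by linarith

text \<open>An injective \<open>f\<close> with \<open>f 0 = 0\<close> that omits \<open>w\<close> has the square root
  \<open>g = sqrt (1 - f / w)\<close>, which omits 0 and, by injectivity, also \<open>-1\<close>, so that Schottky's
  theorem applies to \<open>-g\<close>.  This gives Koebe-type bounds with non-optimal constants.\<close>

lemma univalent_bound_by_omitted_value:
 assumes f: "f holomorphic_on ball 0 1" "inj_on f (ball 0 1)" "f 0 = 0" and w: "w ~: f ` ball 0 1" and z: "norm z <= 3/4"
 shows "norm (f z) <= norm w*(koebe_C/2)"
proof -
 have w0: "w ~= 0" using w f(3) by (metis centre_in_ball imageI zero_less_one)
 have hol: "(%z. 1-f z/w) holomorphic_on ball 0 1" by (intro holomorphic_intros f w0)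
 have nz: "1-f z/w ~= 0" if "z : ball 0 1" for z using w that w0 by (auto simp: field_simps)
 obtain g0 where g0: "g0 holomorphic_on ball 0 1" "!!z. z : ball 0 1 ==> 1-f z/w = g0 z^2"
  using contractible_imp_holomorphic_sqrt[OF hol _ nz] convex_imp_contractible convex_ball by blast
 have "g0 0^2 = 1" using g0(2)[of 0] f(3) by simp
 then have g00: "g0 0 ~= 0" "g0 0*g0 0 = 1" by (auto simp: power2_eq_square)
 \<comment> \<open>The value of \<open>g0\<close> at 0 is 1 or -1; multiplying by it selects the
   branch with value 1 at 0.\<close>
 define g where "g = (%z. g0 z*g0 0)"
 have g: "g holomorphic_on ball 0 1" "!!z. z : ball 0 1 ==> 1-f z/w = g z^2" "g 0 = 1" using g0 \<open>g0 0^2 = 1\<close> g00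
  by (auto simp: g_def power_mult_distrib intro!: holomorphic_intros)
 have gn0: "g z ~= 0" if "z : ball 0 1" for z using g(2)[OF that] nz[OF that] by auto
 have gn1: "g z ~= -1" if "z : ball 0 1" for z
 proof
  assume "g z = -1"
  then have "f z = 0" using g(2)[OF that] w0 by simp
  then have "z = 0" using f(2,3) that by (metis centre_in_ball inj_onD zero_less_one)
  then show False using \<open>g z = -1\<close> g(3) by simp
 qed
 \<comment> \<open>Schottky's theorem is stated on a closed disc, hence the shrinking by 7/8; a
   point of norm at most 3/4 becomes one of norm at most 6/7.\<close>
 define F where "F = (%z.-g (of_real (7/8)*z))"
 have sub: "of_real (7/8)*z : ball 0 (1::real)" if "z : cball 0 1" for z :: complex using that by (simp add: norm_mult)
 have "F holomorphic_on cball 0 1" unfolding F_def using sub by (intro holomorphic_intros holomorphic_on_compose_gen[OF _ g(1), unfolded o_def]) auto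
 moreover have "norm (F 0) <= 1" by (simp add: F_def g(3))
 moreover have "\<not> (F z = 0 \<or> F z = 1)" if "z : cball 0 1" for z
  using gn0[OF sub[OF that]] gn1[OF sub[OF that]] by (auto simp: F_def minus_equation_iff)
 moreover have "norm (of_real (8/7)*z) <= 6/7" using z by (simp add: norm_mult)
 ultimately have "norm (F (of_real (8/7)*z)) <= exp (pi*exp (pi*(2+2*1+12*(6/7)/(1-6/7))))" by (intro Schottky) auto
 then have gb: "norm (g z) <= exp (pi*exp (pi*76))" by (simp add: F_def)
 have "z : ball 0 1" using z by simp
 then have "f z = w*(1-g z^2)" using g(2)[of z] w0 by (simp add: field_simps)
 then have "norm (f z) <= norm w*(1+norm (g z)^2)" by (metis norm_mult mult_left_mono norm_ge_zero norm_power norm_one norm_triangle_ineq4)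
 also have "... <= norm w*(1+(exp (pi*exp (pi*76)))^2)" by (intro mult_left_mono add_left_mono power_mono gb) auto
 finally show ?thesis by (simp add: koebe_C_def algebra_simps)
qed

text \<open>Cauchy's estimate on the circle of radius 3/4 turns the growth bound into a lower bound
  for omitted values, a weak quarter theorem.\<close>

lemma univalent_omitted_value_ge:
 assumes f: "f holomorphic_on ball 0 1" "inj_on f (ball 0 1)" "f 0 = 0" and w: "w ~: f ` ball 0 1"
 shows "norm (deriv f 0) <= norm w*koebe_C"
proof -
 have "norm ((deriv ^^ 1) f 0) <= fact 1*(norm w*(koebe_C/2))/(3/4)^1"
 proof (rule Cauchy_inequality)
  show "norm (f x) <= norm w*(koebe_C/2)" if "norm (0-x) = 3/4" for x using univalent_bound_by_omitted_value[OF f w, of x] that by simp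
 qed (auto intro!: holomorphic_on_subset[OF f(1)] holomorphic_on_imp_continuous_on)
 also have "... <= norm w*koebe_C" using koebe_C_ge by (simp add: field_simps mult_left_mono)
 finally show ?thesis by simp
qed

text \<open>If the image contained the disc of radius 2 |f' 0|, the inverse would map that disc into
  the unit disc with a derivative at 0 twice as large as Cauchy's estimate permits.\<close>

lemma univalent_small_omitted_value:
 assumes f: "f holomorphic_on ball 0 1" "inj_on f (ball 0 1)" "f 0 = 0"
 obtains w where "w ~: f ` ball 0 1" "norm w <= 2*norm (deriv f 0)"
proof -
 define a where "a = norm (deriv f 0)"
 have a: "a > 0" using holomorphic_injective_imp_regular[OF f(1) _ f(2), of 0] by (simp add: a_def)
 have "EX w. w ~: f ` ball 0 1 & norm w <= 2*a"
 proof (rule ccontr)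
  assume "\<nexists>w. w ~: f ` ball 0 1 & norm w <= 2*a"
  then have im: "cball 0 (2*a) <= f ` ball 0 1" by auto
  obtain h where h: "h holomorphic_on f ` ball 0 1"
   "!!z. z : ball 0 1 ==> deriv f z*deriv h (f z) = 1"
   "!!z. z : ball 0 1 ==> h (f z) = z" using holomorphic_has_inverse[OF f(1) _ f(2)] by (metis open_ball)
  have "norm ((deriv ^^ 1) h 0) <= fact 1*1/(2*a)^1"
  proof (rule Cauchy_inequality)
   show "h holomorphic_on ball 0 (2*a)" by (rule holomorphic_on_subset[OF h(1)]) (use im in auto)
   show "continuous_on (cball 0 (2*a)) h" by (rule holomorphic_on_imp_continuous_on, rule holomorphic_on_subset[OF h(1)]) (use im in auto)
   show "norm (h x) <= 1" if "norm (0-x) = 2*a" for x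
   proof -
    have "x : f ` ball 0 1" using im that by auto
    then show ?thesis using h(3) by auto
   qed
  qed (use a in auto)
  then have "norm (deriv h 0) <= 1/(2*a)" by simp
  moreover have "norm (deriv f 0)*norm (deriv h 0) = 1" using h(2)[of 0] f(3) by (metis centre_in_ball norm_mult norm_one zero_less_one)
  ultimately have "1 <= a*(1/(2*a))" using a by (metis a_def mult_left_mono norm_ge_zero)
  then show False using a by simp
 qed
 then show ?thesis using that a_def by blast
qed

context
 fixes f :: "complex => complex" and z :: complex and R :: real
 assumes hol: "f holomorphic_on ball z R" and inj: "inj_on f (ball z R)" and R: "R > 0"
begin

definition "koebe_normalized = (%w. f (z + of_real R*w)-f z)"

lemma koebe_norm_in: "norm w < 1 ==> z + of_real R*w : ball z R" using R by (simp add: dist_norm norm_mult)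

lemma koebe_norm_props:
 "koebe_normalized holomorphic_on ball 0 1" "inj_on koebe_normalized (ball 0 1)" "koebe_normalized 0 = 0"
 "norm (deriv koebe_normalized 0) = norm (deriv f z) * R"
proof -
 show "koebe_normalized holomorphic_on ball 0 1" unfolding koebe_normalized_def
  by (intro holomorphic_intros holomorphic_on_compose_gen[OF _ hol, unfolded o_def]) (auto intro: koebe_norm_in)
 show "inj_on koebe_normalized (ball 0 1)" unfolding koebe_normalized_def by (rule inj_onI) (use R inj_onD[OF inj] koebe_norm_in in fastforce)
 show "koebe_normalized 0 = 0" by (simp add: koebe_normalized_def)
 have "(f has_field_derivative deriv f z) (at z)" using hol R by (simp add: holomorphic_derivI)
 then have "(f has_field_derivative deriv f z) (at (z + of_real R*0))" by simp
 then have "(koebe_normalized has_field_derivative deriv f z * of_real R) (at 0)" unfolding koebe_normalized_def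
  by (auto intro!: derivative_eq_intros DERIV_chain2[where g = "%w. z + of_real R*w" and s = UNIV])
 then show "norm (deriv koebe_normalized 0) = norm (deriv f z) * R" using R by (simp add: DERIV_imp_deriv norm_mult)
qed

text \<open>An omitted value of size at most twice the derivative exists, and the bound in terms of
  omitted values is applied to it.\<close>

lemma koebe_growth:
 assumes "norm (w-z) <= 3/4 * R"
 shows "norm (f w-f z) <= koebe_C*norm (deriv f z) * R"
proof -
 obtain v where v: "v ~: koebe_normalized ` ball 0 1" "norm v <= 2*norm (deriv koebe_normalized 0)"
  using univalent_small_omitted_value koebe_norm_props by metis
 have "norm ((w-z) / of_real R) <= 3/4" using assms R by (simp add: norm_divide field_simps)
 from univalent_bound_by_omitted_value[OF koebe_norm_props(1-3) v(1) this]
 have "norm (f w-f z) <= norm v * (koebe_C/2)" using R by (simp add: koebe_normalized_def)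
 also have "... <= (2*(norm (deriv f z) * R))*(koebe_C/2)" using v(2) koebe_C_pos by (intro mult_right_mono) (auto simp: koebe_norm_props(4))
 finally show ?thesis by (simp add: mult_ac)
qed

lemma koebe_quarter:
 "ball (f z) (norm (deriv f z) * R/koebe_C) <= f ` ball z R"
proof
 fix v assume v: "v : ball (f z) (norm (deriv f z) * R/koebe_C)"
 have "v-f z : koebe_normalized ` ball 0 1"
 proof (rule ccontr)
  assume "v-f z ~: koebe_normalized ` ball 0 1"
  from univalent_omitted_value_ge[OF koebe_norm_props(1-3) this]
  have "norm (deriv f z) * R <= norm (v-f z)*koebe_C" by (simp add: koebe_norm_props)
  then show False using v koebe_C_pos by (auto simp: dist_norm norm_minus_commute field_simps)
 qed
 then obtain u where "norm u < 1" "v-f z = f (z + of_real R*u)-f z" by (auto simp: koebe_normalized_def)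
 then show "v : f ` ball z R" using koebe_norm_in by auto
qed

end

section \<open>The reverse Loewner flow\<close>

lemma norm_diff_le_of_vector_derivative:
 fixes h :: "real => 'b::real_normed_vector"
 assumes d: "!!s. s : {a..b} ==> (h has_vector_derivative h' s) (at s within {a..b})" and B: "!!s. s : {a..b} ==> norm (h' s) <= B"
  and st: "s : {a..b}" "t : {a..b}"
 shows "norm (h t-h s) <= B*abs (t-s)"
proof -
 have "norm (h t-h s) <= B*norm (t-s)"
 proof (rule differentiable_bound[of "{a..b}" h "%s x. x *\<^sub>R h' s"])
  show "(h has_derivative (%x. x *\<^sub>R h' s)) (at s within {a..b})" if "s : {a..b}" for s
   using d[OF that] by (simp add: has_vector_derivative_def)
  show "onorm (%x. x *\<^sub>R h' s) <= B" if "s : {a..b}" for s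
  proof (rule onorm_le)
   fix x :: real
   have "abs x*norm (h' s) <= abs x*B" using B[OF that] by (intro mult_left_mono) auto
   then show "norm (x *\<^sub>R h' s) <= B*norm x" by (simp add: mult.commute)
  qed
 qed (use st in auto)
 then show ?thesis by simp
qed

text \<open>Integrating factor. It serves differences of two trajectories and imaginary parts:
  either solves a linear equation and so vanishes always or never.\<close>

lemma linear_ode_solution:
 fixes d :: "real => complex"
 assumes ab: "a <= b" and k: "continuous_on {a..b} k" and d: "!!s. s : {a..b} ==> (d has_vector_derivative (k s*d s)) (at s within {a..b})"
 shows "d b = d a*exp (integral {a..b} k)"
proof -
 define G where "G = (%s. d s*exp (- integral {a..s} k))"
 have I: "((%s. integral {a..s} k) has_vector_derivative k s) (at s within {a..b})" if "s : {a..b}" for s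
  using integral_has_vector_derivative[OF k that] .
 have "(G has_vector_derivative 0) (at s within {a..b})" if s: "s : {a..b}" for s
 proof -
  have "((%s.-integral {a..s} k) has_vector_derivative - k s) (at s within {a..b})" using I[OF s] by (rule has_vector_derivative_minus)
  then have "((exp \<circ> (%s.-integral {a..s} k)) has_vector_derivative (- k s*exp (- integral {a..s} k))) (at s within {a..b})"
   by (rule field_vector_diff_chain_within) (auto intro!: derivative_eq_intros)
  then have "(G has_vector_derivative (d s*(- k s*exp (- integral {a..s} k))+k s*d s*exp (- integral {a..s} k))) (at s within {a..b})"
   unfolding G_def o_def using d[OF s] by (intro has_vector_derivative_mult)
  then show ?thesis by simp
 qed
 then have "norm (G b-G a) <= 0*abs (b-a)" using ab by (intro norm_diff_le_of_vector_derivative[where h' = "%_. 0"]) auto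
 then show ?thesis by (simp add: G_def exp_minus field_simps)
qed

definition rev_sol :: "(real => real) => real => real => (real => complex) => bool" where
 "rev_sol W a b h \<longleftrightarrow> (ALL s:{a..b}. 0 < Im (h s) &
   (h has_vector_derivative (- 2/(h s-complex_of_real (W s)))) (at s within {a..b}))"

text \<open>A whole solution is chosen and evaluated at the end time, which makes the flow a total
  function; \<open>rev_flow_eq\<close> shows that the choice does not matter.\<close>

definition rev_flow :: "(real => real) => real => real => complex => complex" where
 "rev_flow W a b z = (SOME h. rev_sol W a b h & h a = z) b"

lemma Im_pos_diff_real_nonzero: "0 < Im z ==> z-complex_of_real x ~= 0" by auto

lemma Im_le_norm_diff_real: "abs (Im z) <= norm (z-complex_of_real x)" using abs_Im_le_cmod[of "z-complex_of_real x"] by simp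

lemma rev_sol_continuous: "rev_sol W a b h ==> continuous_on {a..b} h"
 unfolding rev_sol_def by (meson continuous_on_eq_continuous_within has_vector_derivative_continuous)

lemma rev_sol_subset:
 assumes h: "rev_sol W a b h" and "a <= c" "d <= b"
 shows "rev_sol W c d h" unfolding rev_sol_def
proof
 fix s assume "s : {c..d}"
 then have "s : {a..b}" using assms by simp
 then have "0 < Im (h s)"
  "(h has_vector_derivative (- 2/(h s-complex_of_real (W s)))) (at s within {a..b})" using h by (auto simp only: rev_sol_def)
 moreover have "{c..d} <= {a..b}" using assms by simp
 ultimately show "0 < Im (h s) & (h has_vector_derivative (- 2/(h s-complex_of_real (W s)))) (at s within {c..d})"
  by (blast intro: has_vector_derivative_within_subset)
qed

text \<open>The imaginary part has derivative 2 Im h / |h - W|^2, so trajectories move away from the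
  real line; this is why the reverse equation never blows up.\<close>

lemma rev_sol_Im_mono:
 assumes h: "rev_sol W a b h" and ab: "a <= s" "s <= t" "t <= b"
 shows "Im (h s) <= Im (h t)"
proof -
 have ex: "EX x:{s..t}. (%u. Im (h u)) t-(%u. Im (h u)) s = (2*Im (h x)/(norm (h x-W x))^2)*(t-s)" if "s < t"
 proof -
  have h': "rev_sol W s t h" by (rule rev_sol_subset[OF h]) (use ab in auto)
  have "((%u. Im (h u)) has_derivative (%v. v * (2*Im (h x)/(norm (h x-W x))^2))) (at x within {s..t})" if "x : {s..t}" for x
  proof -
   let ?A = "- 2/(h x-complex_of_real (W x))"
   have "(h has_vector_derivative ?A) (at x within {s..t})" using h' that by (auto simp: rev_sol_def)
   then have "((%u. Im (h u)) has_vector_derivative Im ?A) (at x within {s..t})" by (rule bounded_linear.has_vector_derivative[OF bounded_linear_Im])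
   also have "Im ?A = 2*Im (h x)/(norm (h x-W x))^2" by (simp add: Im_divide cmod_power2)
   finally show ?thesis by (simp add: has_vector_derivative_def)
  qed
  from mvt_very_simple[OF less_imp_le[OF that] this] show ?thesis by (auto simp: mult.commute)
 qed
 have pos: "Im (h x) > 0" if "x : {s..t}" for x using h ab that by (auto simp: rev_sol_def)
 show ?thesis
 proof (cases "s = t")
  case False
  then obtain x where x: "x : {s..t}" "Im (h t)-Im (h s) = (2*Im (h x)/(norm (h x-W x))^2)*(t-s)" using ex ab(2) by auto
  then have "0 <= (2*Im (h x)/(norm (h x-W x))^2)*(t-s)" using pos[OF x(1)]  by (intro mult_nonneg_nonneg divide_nonneg_nonneg) auto
  then show ?thesis using x by simp
 qed auto
qed

text \<open>The difference of two trajectories solves a linear equation. As exp has no zeros,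
  uniqueness and injectivity follow at once; bounding the integrand gives two-sided Lipschitz
  bounds.\<close>

lemma rev_sol_diff:
 assumes "rev_sol W a b h1" "rev_sol W a b h2" "continuous_on {a..b} W" "a <= b"
 shows "h1 b-h2 b = (h1 a-h2 a)*exp (integral {a..b} (%s. 2/((h1 s-W s)*(h2 s-W s))))"
proof (rule linear_ode_solution[where d = "%s. h1 s-h2 s"])
 have nz: "h1 s-W s ~= 0" "h2 s-W s ~= 0" if "s : {a..b}" for s using assms that Im_pos_diff_real_nonzero by (auto simp: rev_sol_def)
 then show "continuous_on {a..b} (%s. 2/((h1 s-W s)*(h2 s-W s)))" using rev_sol_continuous[OF assms(1)] rev_sol_continuous[OF assms(2)] assms(3)
  by (auto intro!: continuous_intros)
 fix s assume s: "s : {a..b}"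
 have "((%s. h1 s-h2 s) has_vector_derivative (- 2/(h1 s-W s)-(- 2/(h2 s-W s)))) (at s within {a..b})"
  using assms(1,2) s unfolding rev_sol_def by (intro has_vector_derivative_diff) blast+
 also have "- 2/(h1 s-W s)-(- 2/(h2 s-W s)) = 2/((h1 s-W s)*(h2 s-W s))*(h1 s-h2 s)" using nz[OF s] by (simp add: divide_simps)
 finally show "((%s. h1 s-h2 s) has_vector_derivative 2/((h1 s-W s)*(h2 s-W s))*(h1 s-h2 s)) (at s within {a..b})" .
qed (use assms in auto)

lemma rev_sol_unique:
 assumes "rev_sol W a b h1" "rev_sol W a b h2" "continuous_on {a..b} W" "a <= b" "h1 a = h2 a"
 shows "h1 b = h2 b" using rev_sol_diff[OF assms(1-4)] assms(5) by simp

lemma rev_sol_speed: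
 assumes h: "rev_sol W a b h" and ab: "a <= s" "s <= b"
 shows "norm (- 2/(h s-complex_of_real (W s))) <= 2/Im (h a)" using h ab rev_sol_Im_mono[OF h, of a s] Im_le_norm_diff_real[of "h s" "W s"] by (simp add: rev_sol_def norm_divide frac_le)

lemma rev_sol_dist:
 assumes h: "rev_sol W a b h" and ab: "s : {a..b}" "t : {a..b}"
 shows "norm (h t-h s) <= 2/Im (h a)*abs (t-s)" by (rule norm_diff_le_of_vector_derivative[of a b h "%s.-2/(h s-complex_of_real (W s))"])
   (use h ab rev_sol_speed[OF h] in "auto simp: rev_sol_def")

lemma integral_exp_weight:
 fixes K :: real
 assumes "a <= s" "K > 0"
 shows "((%u. K*exp (2*K*(u-a))) has_integral (exp (2*K*(s-a))-1)/2) {a..s}"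
proof -
 have "((%u. K*exp (2*K*(u-a))) has_integral (exp (2*K*(s-a))/2-exp (2*K*(a-a))/2)) {a..s}" by (rule fundamental_theorem_of_calculus[OF assms(1)])
    (auto intro!: derivative_eq_intros simp flip: has_real_derivative_iff_has_vector_derivative)
 then show ?thesis by (simp add: field_simps)
qed

text \<open>Picard iteration: the vector field pushes imaginary parts upwards, so the iterates stay in
  \<open>{Im \<ge> Im z}\<close>, where the field is Lipschitz.  Convergence is measured with exponential weights.\<close>

lemma rev_sol_exists:
 assumes ab: "a <= b" and W: "continuous_on {a..b} W" and z: "0 < Im z"
 obtains h where "rev_sol W a b h" "h a = z"
proof -
 define y where "y = Im z"
 have y: "y > 0" using z y_def by simp
 define K where "K = 2/y^2"
 have K: "K > 0" using y by (simp add: K_def)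
 define T where "T = (%(p :: real => complex) s. z-integral {a..s} (%u. 2/(p u-W u)))"
 define good where "good = (%p. continuous_on {a..b} p & (ALL s:{a..b}. y <= Im (p s)))"
 have low: "y <= norm (p s-W s)" if "good p" "s : {a..b}" for p s using that Im_le_norm_diff_real[of "p s" "W s"] by (smt (verit, best) good_def)
 have contq: "continuous_on {a..b} (%u. 2/(p u-W u))" if "good p" for p using that W y by (auto simp: good_def intro!: continuous_intros)
 have intq: "(%u. 2/(p u-W u)) integrable_on {a..s}" if "good p" "s : {a..b}" for p s
  using that by (intro integrable_continuous_real continuous_on_subset[OF contq[OF that(1)]]) auto
 have deriv: "(T p has_vector_derivative (- 2/(p s-W s))) (at s within {a..b})" if "good p" "s : {a..b}" for p s
 proof -
  have "(T p has_vector_derivative (0-2/(p s-W s))) (at s within {a..b})" unfolding T_def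
   by (intro has_vector_derivative_diff integral_has_vector_derivative contq that has_vector_derivative_const)
  then show ?thesis by simp
 qed
 have goodT: "good (T p)" if "good p" for p
 proof -
  have "continuous_on {a..b} (T p)" using deriv[OF that] by (meson continuous_on_eq_continuous_within has_vector_derivative_continuous)
  moreover have "y <= Im (T p s)" if s: "s : {a..b}" for s
  proof -
   have "Im (integral {a..s} (%u. 2/(p u-W u))) = integral {a..s} (%u. Im (2/(p u-W u)))"
    using integral_linear[OF intq[OF \<open>good p\<close> s] bounded_linear_Im] by (simp add: o_def)
   also have "... <= integral {a..s} (%u. 0)"
   proof (rule integral_le)
    show "(%u. Im (2/(p u-W u))) integrable_on {a..s}"
     using integrable_linear[OF intq[OF \<open>good p\<close> s] bounded_linear_Im] by (simp add: o_def)
    fix u assume "u : {a..s}"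
    then have "y <= Im (p u)" using \<open>good p\<close> s by (simp add: good_def)
     then have "0 < Im (p u)" using y by simp
    then show "Im (2/(p u-W u)) <= 0" by (simp add: Im_divide)
   qed auto
   finally show ?thesis by (simp add: T_def y_def)
  qed
  ultimately show ?thesis by (simp add: good_def)
 qed
 have eq2: "2/v-2/w = 2*(w-v)/(v * w)" if "v ~= 0" "w ~= 0" for v w :: complex using that by (simp add: divide_simps)
 have lip: "norm (2/(p u-W u)-2/(q u-W u)) <= K*norm (p u-q u)" if "good p" "good q" "u : {a..b}" for p q u
 proof -
  have l: "y <= norm (p u-W u)" "y <= norm (q u-W u)" using low that by auto
  then have "p u-W u ~= 0" "q u-W u ~= 0" using y by auto
  then have "2/(p u-W u)-2/(q u-W u) = 2*(q u-p u)/((p u-W u)*(q u-W u))" using eq2[of "p u-W u" "q u-W u"] by simp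
  then have "norm (2/(p u-W u)-2/(q u-W u)) = 2*norm (q u-p u)/(norm (p u-W u)*norm (q u-W u))" by (simp only: norm_divide norm_mult norm_numeral)
  also have "norm (q u-p u) = norm (p u-q u)" by (rule norm_minus_commute)
  finally have "norm (2/(p u-W u)-2/(q u-W u)) = 2*norm (p u-q u)/(norm (p u-W u)*norm (q u-W u))" .
  also have "... <= 2*norm (p u-q u)/(y*y)" using l y by (intro divide_left_mono mult_mono mult_pos_pos) auto
  finally show ?thesis by (simp add: K_def power2_eq_square)
 qed
 \<comment> \<open>In the weight exp (2 K (s - a)) the Picard map contracts by 1/2 on the whole
   interval, so time need not be subdivided.\<close>
 have contr: "norm (T p s-T q s) <= C/2*exp (2*K*(s-a))" if "good p" "good q" "s : {a..b}" and C: "C >= 0"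
   and pq: "!!u. u : {a..b} ==> norm (p u-q u) <= C*exp (2*K*(u-a))" for p q s C
 proof -
  have "norm (T p s-T q s) = norm (integral {a..s} (%u. 2/(p u-W u)-2/(q u-W u)))"
   using intq[OF that(1,3)] intq[OF that(2,3)] by (simp add: T_def integral_diff norm_minus_commute)
  also have "... <= integral {a..s} (%u. C*(K*exp (2*K*(u-a))))"
  proof (rule integral_norm_bound_integral)
   show "(%u. 2/(p u-W u)-2/(q u-W u)) integrable_on {a..s}" by (intro integrable_diff intq that)
   show "(%u. C*(K*exp (2*K*(u-a)))) integrable_on {a..s}" using integral_exp_weight[of a s K] K that(3) by (intro integrable_on_mult_right) auto
   fix u assume "u : {a..s}"
   then have u: "u : {a..b}" using that(3) by auto
   have "norm (2/(p u-W u)-2/(q u-W u)) <= K*norm (p u-q u)" using lip that u by blast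
   also have "... <= K*(C*exp (2*K*(u-a)))" using pq[OF u] K by (intro mult_left_mono) auto
   finally show "norm (2/(p u-W u)-2/(q u-W u)) <= C*(K*exp (2*K*(u-a)))" by (simp add: mult_ac)
  qed
  also have "... = C*((exp (2*K*(s-a))-1)/2)" using integral_exp_weight[of a s K] K that(3) by (intro integral_unique has_integral_mult_right) auto
  also have "... <= C*(exp (2*K*(s-a))/2)" using C by (intro mult_left_mono) auto
  finally show ?thesis by simp
 qed
 define P where "P = (%n. (T ^^ n) (%_. z))"
 have goodP: "good (P n)" for n by (induction n) (auto simp: P_def goodT, auto simp: good_def y_def)
 have PT: "P (Suc n) = T (P n)" for n by (simp add: P_def)
 have "bounded ((%s. P 1 s-P 0 s) ` {a..b})" using goodP[of 1] goodP[of 0]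
  by (intro compact_imp_bounded compact_continuous_image continuous_intros) (auto simp: good_def)
 then obtain C where C: "C > 0" "!!s. s : {a..b} ==> norm (P 1 s-P 0 s) <= C" unfolding bounded_pos by auto
 have step: "norm (P (Suc n) s-P n s) <= C/2^n*exp (2*K*(s-a))" if "s : {a..b}" for n s using that
 proof (induction n arbitrary: s)
  case 0
  have "C*1 <= C*exp (2*K*(s-a))" using 0 C K by (intro mult_left_mono) auto
  then show ?case using C(2)[OF 0] by simp
 next
  case (Suc n)
  then show ?case using contr[OF goodP goodP Suc.prems, of "C/2^n" "Suc n" n] C by (simp add: PT)
 qed
 define E where "E = exp (2*K*(b-a))"
 have stepE: "norm (P (Suc n) s-P n s) <= C*E*(1/2)^n" if "s : {a..b}" for n s
 proof -
  have "C/2^n*exp (2*K*(s-a)) <= C/2^n*E" using that K C by (intro mult_left_mono) (auto simp: E_def)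
  then show ?thesis using step[OF that, of n] by (simp add: power_divide)
 qed
 have "uniform_limit {a..b} (%n s. \<Sum>i<n. P (Suc i) s-P i s) (%s. \<Sum>i. P (Suc i) s-P i s) sequentially"
  by (rule Weierstrass_m_test[where M = "%n. C*E*(1/2)^n"]) (auto intro: stepE)
 moreover have "(\<Sum>i<n. P (Suc i) s-P i s) = P n s-z" for n s by (subst sum_lessThan_telescope) (simp add: P_def)
 ultimately have lim0: "uniform_limit {a..b} (%n s. P n s-z) (%s. \<Sum>i. P (Suc i) s-P i s) sequentially" by simp
 define h where "h = (%s. (\<Sum>i. P (Suc i) s-P i s)+z)"
 have lim: "uniform_limit {a..b} P h sequentially" using uniform_limit_add[OF lim0 uniform_limit_const[of "%_. z"]] unfolding h_def by simp
 have gh: "good h"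
 proof -
  have "continuous_on {a..b} h" by (rule uniform_limit_theorem[OF _ lim]) (use goodP in "auto simp: good_def")
  moreover have "y <= Im (h s)" if "s : {a..b}" for s
  proof -
   have "(%n. P n s) \<longlonglongrightarrow> h s" using lim that by (rule tendsto_uniform_limitI)
   then have "(%n. Im (P n s)) \<longlonglongrightarrow> Im (h s)" by (rule tendsto_Im)
   then show ?thesis by (rule LIMSEQ_le_const) (use goodP that in "auto simp: good_def")
  qed
  ultimately show ?thesis by (simp add: good_def)
 qed
 have fix_h: "T h s = h s" if s: "s : {a..b}" for s
 proof -
  have "norm (T h s-h s) <= e" if e: "e > 0" for e :: real
  proof -
   define e' where "e' = e/(2*E)"
   have E: "E >= 1" using K ab by (simp add: E_def)
   have e': "e' > 0" using e E by (simp add: e'_def)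
   have "\<forall>\<^sub>F n in sequentially. ALL s:{a..b}. dist (P n s) (h s) < e'" using lim e' unfolding uniform_limit_iff by blast
   then obtain n0 where n0: "!!n s. n >= n0 ==> s \<in> {a..b} ==> dist (P n s) (h s) < e'" unfolding eventually_sequentially by blast
   have "norm (T h s-T (P n0) s) <= e'/2*exp (2*K*(s-a))"
   proof (rule contr[OF gh goodP s])
    fix u assume u: "u : {a..b}"
    have "e'*1 <= e'*exp (2*K*(u-a))" using u K e' by (intro mult_left_mono) auto
    then show "norm (h u-P n0 u) <= e'*exp (2*K*(u-a))" using n0[OF order_refl u] by (simp add: dist_norm norm_minus_commute)
   qed (use e' in auto)
   also have "... <= e'/2*E" using s K e' by (intro mult_left_mono) (auto simp: E_def)
   also have "... <= e/2" using e by (simp add: e'_def)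
   finally have 1: "norm (T h s-P (Suc n0) s) <= e/2" by (simp add: PT)
   have "norm (P (Suc n0) s-h s) <= e'" using n0[of "Suc n0" s] s by (simp add: dist_norm)
   also have "e' <= e/2" using E e by (simp add: e'_def field_simps)
   finally show ?thesis using 1 norm_triangle_le[of "T h s-P (Suc n0) s" "P (Suc n0) s-h s" e] by simp
  qed
  then have "norm (T h s-h s) <= 0" by (rule field_le_epsilon) auto
  then show ?thesis by simp
 qed
 have "rev_sol W a b h" unfolding rev_sol_def
 proof safe
  fix s assume s: "s : {a..b}"
  show "0 < Im (h s)" using gh s y unfolding good_def by (meson less_le_trans)
  show "(h has_vector_derivative - 2/(h s-W s)) (at s within {a..b})"
   by (rule has_vector_derivative_transform[OF s _ deriv[OF gh s]]) (use fix_h in auto)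
 qed
 moreover have "h a = z" using fix_h[of a] ab by (simp add: T_def)
 ultimately show ?thesis using that by blast
qed

lemma rev_flow_eq:
 assumes "rev_sol W a b h" "continuous_on {a..b} W" "a <= b"
 shows "rev_flow W a b (h a) = h b"
proof -
 define g where "g = (SOME g. rev_sol W a b g & g a = h a)"
 have "rev_sol W a b g & g a = h a" unfolding g_def by (rule someI[of _ h]) (use assms in auto)
 then have "g b = h b" using rev_sol_unique[of W a b g h] assms by auto
 then show ?thesis by (simp add: rev_flow_def g_def)
qed

lemma rev_flow_sol:
 assumes "continuous_on {a..b} W" "a <= b" "0 < Im z"
 shows "rev_sol W a b (%s. rev_flow W a s z)" "rev_flow W a a z = z"
proof -
 obtain h where h: "rev_sol W a b h" "h a = z" using rev_sol_exists assms by metis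
 have eq: "rev_flow W a s z = h s" if "s : {a..b}" for s
 proof -
  have "continuous_on {a..s} W" using that by (intro continuous_on_subset[OF assms(1)]) auto
  moreover have "rev_sol W a s h" "a <= s" using that by (auto intro: rev_sol_subset[OF h(1)])
  ultimately have "rev_flow W a s (h a) = h s" by (intro rev_flow_eq)
  then show ?thesis by (simp only: h(2))
 qed
 show "rev_sol W a b (%s. rev_flow W a s z)" unfolding rev_sol_def
 proof
  fix s assume s: "s : {a..b}"
  then have "(h has_vector_derivative (- 2/(h s-complex_of_real (W s)))) (at s within {a..b})" "0 < Im (h s)" using h by (auto simp: rev_sol_def)
  then show "0 < Im (rev_flow W a s z) &
     ((%s. rev_flow W a s z) has_vector_derivative (- 2/(rev_flow W a s z-complex_of_real (W s)))) (at s within {a..b})"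
   using eq s by (auto intro: has_vector_derivative_transform)
 qed
 show "rev_flow W a a z = z" using eq[of a] h assms by simp
qed

lemma rev_flow_comp:
 assumes W: "continuous_on {a..c} W" and abc: "a <= b" "b <= c" and z: "0 < Im z"
 shows "rev_flow W a c z = rev_flow W b c (rev_flow W a b z)"
proof -
 have "rev_sol W a c (%s. rev_flow W a s z)" using rev_flow_sol W abc z by auto
 then have "rev_sol W b c (%s. rev_flow W a s z)" by (rule rev_sol_subset) (use abc in auto)
 from rev_flow_eq[OF this] show ?thesis using abc continuous_on_subset[OF W, of "{b..c}"] by auto
qed

lemma rev_flow_Im:
 assumes "continuous_on {a..b} W" "a <= b" "0 < Im z"
 shows "Im z <= Im (rev_flow W a b z)" "0 < Im (rev_flow W a b z)"
 using rev_sol_Im_mono[OF rev_flow_sol(1)[OF assms], of a b] rev_flow_sol(2)[OF assms] assms by auto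

text \<open>Both trajectories stay above height c, so the exponent in \<open>rev_sol_diff\<close>
  has modulus at most 2 (b - a) / c^2.\<close>

lemma rev_flow_diff_bounds:
 assumes W: "continuous_on {a..b} W" "a <= b" and z: "c <= Im z" "c <= Im w" "0 < c"
 shows "norm (z-w) <= exp (2*(b-a)/c^2)*norm (rev_flow W a b z-rev_flow W a b w)"
  and "norm (rev_flow W a b z-rev_flow W a b w) <= exp (2*(b-a)/c^2)*norm (z-w)"
proof -
 define h1 where "h1 = (%s. rev_flow W a s z)"
 define h2 where "h2 = (%s. rev_flow W a s w)"
 have h: "rev_sol W a b h1" "rev_sol W a b h2" "h1 a = z" "h2 a = w" using rev_flow_sol[OF W] z by (auto simp: h1_def h2_def)
 define I where "I = integral {a..b} (%s. 2/((h1 s-W s)*(h2 s-W s)))"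
 have bnd: "norm (2/((h1 s-W s)*(h2 s-W s))) <= 2/c^2" if s: "s : {a..b}" for s
 proof -
  have "c * c <= norm (h1 s-W s)*norm (h2 s-W s)" using rev_sol_Im_mono[OF h(1), of a s] rev_sol_Im_mono[OF h(2), of a s] h s z Im_le_norm_diff_real[of "h1 s" "W s"] Im_le_norm_diff_real[of "h2 s" "W s"]
 by (intro mult_mono) auto
  then show ?thesis using z by (simp add: norm_divide norm_mult power2_eq_square frac_le)
 qed
 have nz: "h1 s-W s ~= 0" "h2 s-W s ~= 0" if "s : {a..b}" for s using h that Im_pos_diff_real_nonzero by (auto simp: rev_sol_def)
 have "norm I <= 2/c^2*(b-a)" unfolding I_def using W rev_sol_continuous[OF h(1)] rev_sol_continuous[OF h(2)] bnd nz
  by (intro integral_bound) (auto intro!: continuous_intros)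
 then have I: "abs (Re I) <= 2*(b-a)/c^2" using abs_Re_le_cmod[of I] by simp
 have eq: "rev_flow W a b z-rev_flow W a b w = (z-w)*exp I" using rev_sol_diff[OF h(1,2) W] h unfolding I_def by (simp add: h1_def h2_def)
 have "norm (z-w)*exp (Re I) <= norm (z-w)*exp (2*(b-a)/c^2)" using I by (intro mult_left_mono) auto
 then show "norm (rev_flow W a b z-rev_flow W a b w) <= exp (2*(b-a)/c^2)*norm (z-w)" by (simp add: eq norm_mult mult.commute)
 have "norm (z-w)*1 <= norm (z-w)*exp (2*(b-a)/c^2+Re I)" using I by (intro mult_left_mono) auto
 then show "norm (z-w) <= exp (2*(b-a)/c^2)*norm (rev_flow W a b z-rev_flow W a b w)" by (simp add: eq norm_mult exp_add mult_ac)
qed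

lemma rev_flow_inj:
 assumes W: "continuous_on {a..b} W" "a <= b"
 shows "inj_on (rev_flow W a b) \<H>"
proof (rule inj_onI)
 fix z w assume zw: "z : \<H>" "w : \<H>" "rev_flow W a b z = rev_flow W a b w"
 define c where "c = min (Im z) (Im w)"
 show "z = w" using rev_flow_diff_bounds(1)[OF W, of c z w] zw by (auto simp: c_def upper_half_plane_def)
qed

text \<open>The squared height has derivative 4 (Im h)^2 / |h - W|^2, which is at most 4; heights
  therefore stay bounded in bounded time.\<close>

lemma rev_sol_Im_sq:
 assumes h: "rev_sol W a b h" and ab: "a <= b"
 shows "(Im (h b))^2 <= (Im (h a))^2+4*(b-a)"
proof (cases "a = b")
 case False
 have "((%u. (Im (h u))^2) has_derivative (%v. v * (4*(Im (h x))^2/(norm (h x-W x))^2))) (at x within {a..b})" if "a <= x" "x <= b" for x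
 proof -
  let ?A = "- 2/(h x-complex_of_real (W x))"
  have "(h has_vector_derivative ?A) (at x within {a..b})" using h that by (auto simp: rev_sol_def)
  then have "((%u. Im (h u)) has_vector_derivative Im ?A) (at x within {a..b})" by (rule bounded_linear.has_vector_derivative[OF bounded_linear_Im])
  also have "Im ?A = 2*Im (h x)/(norm (h x-W x))^2" by (simp add: Im_divide cmod_power2)
  finally have "((%u. Im (h u)) has_real_derivative 2*Im (h x)/(norm (h x-W x))^2) (at x within {a..b})"
   by (simp add: has_real_derivative_iff_has_vector_derivative)
  then have "((%u. (Im (h u))^2) has_real_derivative (4*(Im (h x))^2/(norm (h x-W x))^2)) (at x within {a..b})"
   by (rule DERIV_power[where n = 2, THEN DERIV_cong]) (simp add: power2_eq_square)
  then show ?thesis unfolding has_field_derivative_def by (rule has_derivative_eq_rhs) (simp add: fun_eq_iff)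
 qed
 from mvt_very_simple[OF ab this]
 obtain x where x: "x : {a..b}" "(Im (h b))^2-(Im (h a))^2 = (b-a)*(4*(Im (h x))^2/(norm (h x-W x))^2)" by auto
 have "(Im (h x))^2/(norm (h x-W x))^2 <= 1" using Im_le_norm_diff_real[of "h x" "W x"] abs_le_square_iff[of "Im (h x)" "norm (h x-W x)"]
  by (simp add: divide_le_eq_1)
 then have "(b-a)*(4*((Im (h x))^2/(norm (h x-W x))^2)) <= (b-a)*(4*1)" using ab by (intro mult_left_mono) auto
 then show ?thesis using x(2) by (simp)
qed auto

lemma rev_flow_Im_sq:
 assumes "continuous_on {a..b} W" "a <= b" "0 < Im z"
 shows "(Im (rev_flow W a b z))^2 <= (Im z)^2+4*(b-a)"
 using rev_sol_Im_sq[OF rev_flow_sol(1)[OF assms] assms(2)] by (simp only: rev_flow_sol(2)[OF assms])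

text \<open>Consider the first time at which the displacement reaches L. Until then the point is at
  distance at least 1 from the driving function, so its speed is at most 2 and it has moved less
  than L. The lemma keeps preimages of bounded sets bounded.\<close>

lemma rev_flow_far:
 assumes W: "continuous_on {a..b} W" "a <= b" "0 < Im z" and m: "!!s. s : {a..b} ==> abs (W s) <= m" and far: "norm z >= m+2*(b-a)+2"
 shows "norm (rev_flow W a b z-z) < 2*(b-a)+1"
proof (rule ccontr)
 define L where "L = 2*(b-a)+1"
 assume neg: "\<not> norm (rev_flow W a b z-z) < 2*(b-a)+1"
 define h where "h = (%s. rev_flow W a s z)"
 have h: "rev_sol W a b h" "h a = z" unfolding h_def by (rule rev_flow_sol[OF W])+
 define S where "S = {s\<in>{a..b}. L <= norm (h s-z)}"
 have bS: "b : S" using neg W(2) unfolding S_def L_def h_def mem_Collect_eq by simp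
 have "closed S" unfolding S_def by (rule continuous_on_closed_Collect_le) (use rev_sol_continuous[OF h(1)] in "auto intro!: continuous_intros")
 moreover have "bdd_below S" by (rule bdd_belowI[of _ a]) (auto simp: S_def)
 ultimately have iS: "Inf S : S" using bS by (intro closed_contains_Inf) auto
 define t where "t = Inf S"
 have t: "t : {a..b}" "L <= norm (h t-z)" using iS by (auto simp: S_def t_def)
 have lt: "norm (h s-z) < L" if "s : {a..<t}" for s
 proof (rule ccontr)
  assume "\<not> norm (h s-z) < L"
  then have "s : S" using that t by (auto simp: S_def)
  then have "t <= s" unfolding t_def using \<open>bdd_below S\<close> by (rule cInf_lower)
  then show False using that by auto
 qed
 have "at": "a < t"
 proof (rule ccontr)
  assume "\<not> a < t"
  then have "t = a" using t by auto
  then show False using t(2) h(2) W by (simp add: L_def)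
 qed
 have "norm (h s-z) <= L" if "s : {a..t}" for s
 proof -
  have "continuous_on {a..t} (%s. norm (h s-z))" using rev_sol_continuous[OF h(1)] t by (auto intro!: continuous_intros intro: continuous_on_subset)
  then have "norm (h t-z) <= L" using "at" lt by (intro continuous_le_on_closure[of "{a..<t}" "%s. norm (h s-z)" t L]) (auto simp: less_imp_le)
  then show ?thesis using lt[of s] that by (cases "s = t") auto
 qed
 then have low: "1 <= norm (h s-W s)" if "s : {a..t}" for s
 proof -
  have "norm z <= norm (h s-W s)+norm (h s-z)+abs (W s)"
   using norm_triangle_ineq4[of "h s-W s+W s" "h s-z"] norm_triangle_ineq[of "h s-W s" "complex_of_real (W s)"] by simp
  moreover have "abs (W s) <= m" using m that t by auto
  moreover have "norm (h s-z) <= L" using \<open>!!s. s \<in> {a..t} ==> norm (h s-z) <= L\<close> that by blast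
  ultimately show ?thesis using far by (simp add: L_def)
 qed
 have "norm (h t-h a) <= 2*abs (t-a)"
 proof (rule norm_diff_le_of_vector_derivative[of a t h "%s.-2/(h s-complex_of_real (W s))"])
  show "(h has_vector_derivative - 2/(h s-complex_of_real (W s))) (at s within {a..t})" if "s : {a..t}" for s
   using rev_sol_subset[OF h(1), of a t] t that by (auto simp: rev_sol_def)
  show "norm (- 2/(h s-complex_of_real (W s))) <= 2" if "s : {a..t}" for s
  proof -
   have "2/norm (h s-W s) <= 2/1" using low[OF that] by (intro divide_left_mono) auto
   then show ?thesis by (simp add: norm_divide)
  qed
 qed (use "at" in auto)
 then show False using t h(2) by (auto simp: L_def)
qed

section \<open>The Euler scheme for the centred reverse flow\<close>

text \<open>Euler scheme for Z = h - W, which obeys dZ = -2/Z ds - dW; in this form the driving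
  function enters through its increments only.\<close>

primrec eul :: "real => (nat => real) => complex => nat => complex" where
 "eul d x z 0 = z"
| "eul d x z (Suc k) = eul d x z k - of_real (2*d)/eul d x z k - of_real (x k)"

text \<open>The difference quotient of the scheme at two points, and its derivative when they
  coincide. With the conjugate as second point it measures the growth of the imaginary part.\<close>

definition eulq :: "real => (nat => real) => complex => complex => nat => complex" where
 "eulq d x z w k = (\<Prod>i<k. 1 + of_real (2*d)/(eul d x z i*eul d x w i))"

definition incr :: "(real => real) => nat => nat => real" where
 "incr W N k = W (real (Suc k)/real N)-W (real k/real N)"

text \<open>Shifted at both ends so as to be the limit of the scheme for Z, in which only increments
  of W occur.\<close>

definition cflow :: "(real => real) => complex => complex" where
 "cflow W z = rev_flow W 0 1 (z + of_real (W 0)) - of_real (W 1)"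

lemma eul_cong: "(!!i. i < k ==> x i = y i) ==> eul d x z k = eul d y z k" by (induction k) auto

lemma eul_cnj: "eul d x (cnj z) k = cnj (eul d x z k)" by (induction k) auto

lemma Im_euler_step:
 assumes "d >= 0" "Im z > 0"
 shows "Im z <= Im (z - of_real (2*d)/z)" using assms by (simp add: Im_divide)

lemma eul_Im:
 assumes "d >= 0" "Im z > 0"
 shows "Im z <= Im (eul d x z k)"
proof (induction k)
 case (Suc k)
 then have "Im (eul d x z k) <= Im (eul d x z k - of_real (2*d)/eul d x z k)" using assms by (intro Im_euler_step) auto
 also have "... = Im (eul d x z (Suc k))" by simp
 finally show ?case using Suc by linarith
qed auto

lemma eul_nonzero:
 assumes "d >= 0" "Im z ~= 0"
 shows "eul d x z k ~= 0" "Im (eul d x z k) ~= 0"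
proof -
 have "Im (eul d x z k) ~= 0"
 proof (cases "Im z > 0")
  case True
  then show ?thesis using eul_Im[of d z x k] assms by auto
 next
  case False
  then show ?thesis using eul_Im[of d "cnj z" x k] assms by (auto simp: eul_cnj)
 qed
 then show "Im (eul d x z k) ~= 0" "eul d x z k ~= 0" by auto
qed

lemma eul_diff:
 assumes "d >= 0" "Im z ~= 0" "Im w ~= 0"
 shows "eul d x z k-eul d x w k = (z-w)*eulq d x z w k"
proof (induction k)
 case (Suc k)
 let ?z = "eul d x z k" and ?w = "eul d x w k"
 have "eul d x z (Suc k)-eul d x w (Suc k) = (?z-?w)*(1 + of_real (2*d)/(?z*?w))" using eul_nonzero[OF assms(1,2)] eul_nonzero[OF assms(1,3)]
  by (simp add: divide_simps) (simp add: algebra_simps)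
 then show ?case by (simp add: Suc eulq_def)
qed (simp add: eulq_def)

lemma eul_has_deriv:
 assumes "d >= 0" "Im z ~= 0"
 shows "((%z. eul d x z k) has_field_derivative eulq d x z z k) (at z)"
proof (induction k)
 case 0
 then show ?case by (auto simp: eulq_def)
next
 case (Suc k)
 have "((%z. eul d x z k - of_real (2*d)/eul d x z k - of_real (x k)) has_field_derivative
   (eulq d x z z k-(- (of_real (2*d)*eulq d x z z k)/(eul d x z k*eul d x z k))-0)) (at z)"
  by (rule derivative_eq_intros Suc refl eul_nonzero assms)+ (simp)
 then show ?case by (simp add: eulq_def algebra_simps)
qed

text \<open>As W is merely continuous, the local error of a step is d times a modulus of continuity.
  Uniformity above height y is what later allows derivatives to pass to the limit.\<close>

lemma eul_converges:
 assumes W: "continuous_on {0..1} W" and y: "0 < y" and e: "0 < e"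
 shows "EX N0. ALL N>=N0. ALL z. y <= Im z --> norm (eul (1/real N) (incr W N) z N-cflow W z) <= e"
proof -
 have "uniformly_continuous_on {0..1} W" using W by (simp add: compact_uniformly_continuous)
 define L where "L = 2/y^2"
 have L: "L > 0" using y by (simp add: L_def)
 \<comment> \<open>Makes the accumulated error 2 L q exp L equal to e.\<close>
 define q where "q = e/(2*L*exp L)"
 have q: "q > 0" using e L by (simp add: q_def)
 obtain w where w: "w > 0" "!!s t. s : {0..1} ==> t \<in> {0..1} ==> dist s t < w ==> dist (W s) (W t) < q"
  using \<open>uniformly_continuous_on {0..1} W\<close> q unfolding uniformly_continuous_on_def by metis
 obtain N0 :: nat where N0: "real N0 > max (1/w) (max 1 (2/(y*q)))" using reals_Archimedean2 by blast
 show ?thesis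
 proof (intro exI allI impI)
  fix N z assume N: "N0 <= N" and z: "y <= Im z"
  define d where "d = 1/real N"
  have N': "real N > 1/w" "real N > 1" "real N > 2/(y*q)" using N0 N by linarith+
  have d: "0 < d" "d < w" "2*d/y < q" "real N*d = 1" using N' w q y by (auto simp: d_def field_simps)
  define h where "h = (%s. rev_flow W 0 s (z + of_real (W 0)))"
  have h: "rev_sol W 0 1 h" "h 0 = z + of_real (W 0)" using rev_flow_sol[OF W, of "z + of_real (W 0)"] y z by (auto simp: h_def)
  have hIm: "y <= Im (h s)" if "s : {0..1}" for s using rev_sol_Im_mono[OF h(1), of 0 s] h(2) z that by auto
  have hd: "norm (h s-h t) <= 2/y*abs (s-t)" if "s : {0..1}" "t : {0..1}" for s t
  proof -
   have "2/Im (h 0) <= 2/y" using hIm[of 0] y by (intro divide_left_mono) auto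
   then have "2/Im (h 0)*abs (s-t) <= 2/y*abs (s-t)" by (intro mult_right_mono) auto
   then show ?thesis using rev_sol_dist[OF h(1) that(2,1)] by linarith
  qed
  define E where "E = (%k. eul d (incr W N) z k + of_real (W (real k*d)))"
  have lip: "norm (2/u-2/v) <= L*norm (u-v)" if "y <= Im u" "y <= Im v" for u v
  proof -
   have "u ~= 0" "v ~= 0" using that y by auto
   then have "2/u-2/v = 2*(v-u)/(u * v)" by (simp add: divide_simps)
   then have "norm (2/u-2/v) = 2*norm (v-u)/(norm u*norm v)" by (simp only: norm_divide norm_mult norm_numeral)
   also have "... <= 2*norm (v-u)/(y*y)" using that y abs_Im_le_cmod[of u] abs_Im_le_cmod[of v]
    by (intro divide_left_mono mult_mono mult_pos_pos) auto
   finally show ?thesis by (simp add: L_def power2_eq_square norm_minus_commute)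
  qed
  have step: "norm (h (real (Suc k)*d)-(h (real k*d) - of_real (2*d)/(h (real k*d) - of_real (W (real k*d))))) <= 2*L*q*d" if k: "k < N" for k
  proof -
   define t where "t = real k*d"
   have t: "0 <= t" "t+d <= 1"
   proof -
    have "real (Suc k)*d <= real N*d" using k d by (intro mult_right_mono) auto
    then show "0 <= t" "t+d <= 1" using d by (auto simp: t_def algebra_simps)
   qed
   define v where "v = 2/(h t - of_real (W t))"
   \<comment> \<open>h corrected by its tangent at t: the derivative of u is the change of the
     vector field since time t, which is at most 2 L q.\<close>
   define u where "u = (%s. h s + of_real s * v)"
   have "norm (u (t+d)-u t) <= 2*L*q*abs (t+d-t)"
   proof (rule norm_diff_le_of_vector_derivative[of t "t+d" u "%s.-2/(h s-complex_of_real (W s))+v"])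
    fix s assume s: "s : {t..t+d}"
    have "(h has_vector_derivative - 2/(h s-complex_of_real (W s))) (at s within {t..t+d})" using rev_sol_subset[OF h(1)] t
     using s unfolding rev_sol_def by blast
    moreover have "((%s. of_real s * v) has_vector_derivative 1 * v) (at s within {t..t+d})"
     by (intro has_vector_derivative_mult_left has_vector_derivative_of_real[of "%x. x" 1, simplified] DERIV_ident)
    ultimately show "(u has_vector_derivative - 2/(h s-complex_of_real (W s))+v) (at s within {t..t+d})"
     unfolding u_def using has_vector_derivative_add by fastforce
    have s1: "s : {0..1}" "t : {0..1}" using s t  by auto
    have "norm (- 2/(h s-complex_of_real (W s))+v) = norm (2/(h t - of_real (W t))-2/(h s - of_real (W s)))" by (simp add: v_def)
    also have "... <= L*norm ((h t - of_real (W t))-(h s - of_real (W s)))" by (rule lip) (use hIm s1 in auto)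
    also have "(h t - of_real (W t))-(h s - of_real (W s)) = (h t-h s) - of_real (W t-W s)" by simp
    also have "norm ... <= norm (h t-h s)+abs (W t-W s)" using norm_triangle_ineq4[of "h t-h s" "of_real (W t-W s)"] by (simp only: norm_of_real)
    also have "... <= q+q"
    proof (rule add_mono)
     have "norm (h t-h s) <= 2/y*abs (t-s)" using hd s1 by blast
     also have "... <= 2/y*d" using s y by (intro mult_left_mono) auto
     finally show "norm (h t-h s) <= q" using d by simp
     show "abs (W t-W s) <= q" using w(2)[OF s1(2,1)] s d by (auto simp: dist_real_def)
    qed
    finally show "norm (- 2/(h s-complex_of_real (W s))+v) <= 2*L*q" using L by (simp)
   qed (use d in auto)
   moreover have "u (t+d)-u t = h (real (Suc k)*d)-(h t - of_real (2*d)/(h t - of_real (W t)))"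
    by (simp add: u_def v_def t_def algebra_simps add_divide_distrib)
   ultimately show ?thesis using d by (simp add: t_def)
  qed
  let ?A = "1+L*d"
  have err: "norm (E k-h (real k*d)) <= 2*L*q*(real k*d)*?A^k" if "k <= N" for k using that
  proof (induction k)
   case 0
   then show ?case by (simp add: E_def h)
  next
   case (Suc k)
   then have k: "k < N" and IH: "norm (E k-h (real k*d)) <= 2*L*q*(real k*d)*?A^k" by auto
   define t where "t = real k*d"
   have t: "t : {0..1}"
   proof -
    have "real k*d <= real N*d" using k d by (intro mult_right_mono) auto
    then show ?thesis using d by (simp add: t_def)
   qed
   define Z where "Z = eul d (incr W N) z k"
   have Z: "y <= Im Z" using eul_Im[of d z "incr W N" k] d y z by (auto simp: Z_def)
   define R where "R = h (real (Suc k)*d)-(h t - of_real (2*d)/(h t - of_real (W t)))"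
   have R: "norm R <= 2*L*q*d" using step[OF k] by (simp add: R_def t_def)
   let ?B = "2/Z-2/(h t - of_real (W t))"
   have "E (Suc k) = E k - of_real (2*d)/Z" by (simp add: E_def incr_def Z_def d_def)
   then have "E (Suc k)-h (real (Suc k)*d) = (E k-h t) - of_real d*?B-R" by (simp add: R_def algebra_simps)
   then have "norm (E (Suc k)-h (real (Suc k)*d)) <= norm (E k-h t)+norm (of_real d*?B)+norm R"
    by (metis (no_types, opaque_lifting) add_right_mono norm_triangle_ineq4 order_trans)
   also have "norm (of_real d*?B) <= d*(L*norm (Z-(h t - of_real (W t))))"
    unfolding norm_mult norm_of_real using lip[OF Z, of "h t - of_real (W t)"] hIm[OF t] d by (intro mult_mono) auto
   also have "Z-(h t - of_real (W t)) = E k-h t" by (simp add: E_def Z_def t_def)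
   finally have "norm (E (Suc k)-h (real (Suc k)*d)) <= ?A*norm (E k-h t)+2*L*q*d" using R by (simp add: algebra_simps)
   also have "... <= ?A*(2*L*q*(real k*d)*?A^k)+2*L*q*d*?A^Suc k"
   proof (rule add_mono)
    show "?A*norm (E k-h t) <= ?A*(2*L*q*(real k*d)*?A^k)" using IH L d by (intro mult_left_mono) (auto simp: t_def)
    have "1 <= ?A^Suc k" using L d by (intro one_le_power) auto
    then have "2*L*q*d*1 <= 2*L*q*d*?A^Suc k" using L q d by (intro mult_left_mono) auto
    then show "2*L*q*d <= 2*L*q*d*?A^Suc k" by simp
   qed
   also have "... = 2*L*q*(real (Suc k)*d)*?A^Suc k" by (simp add: algebra_simps)
   finally show ?case .
  qed
  have "?A^N <= exp (L*d)^N" using L d  by (intro power_mono) auto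
  also have "... = exp L" using d by (simp flip: exp_of_nat_mult)
  finally have "2*L*q*?A^N <= 2*L*q*exp L" using L q by (intro mult_left_mono) auto
  also have "... = e" using L by (simp add: q_def)
  finally have "norm (E N-h 1) <= e" using err[of N] d by simp
  then show "norm (eul (1/real N) (incr W N) z N-cflow W z) <= e" using d by (simp add: E_def h_def cflow_def d_def algebra_simps)
 qed
qed

section \<open>The centred flow as a univalent self-map of the half-plane and its link with
  hulls\<close>

definition eulW :: "(real => real) => nat => complex => complex" where
 "eulW W j z = eul (1/real (2^j)) (incr W (2^j)) z (2^j)"

definition eulWq :: "(real => real) => nat => complex => complex => complex" where
 "eulWq W j z w = eulq (1/real (2^j)) (incr W (2^j)) z w (2^j)"

lemma open_upper_half_plane: "open \<H>" unfolding upper_half_plane_def by (rule open_halfspace_Im_gt)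

lemma eulW_uniform:
 assumes W: "continuous_on {0..1} W" and y: "0 < y"
 shows "uniform_limit {z. y <= Im z} (eulW W) (cflow W) sequentially"
proof (rule uniform_limitI)
 fix e :: real assume e: "e > 0"
 obtain N0 where N0: "!!N z. N >= N0 ==> y <= Im z ==> norm (eul (1/real N) (incr W N) z N-cflow W z) <= e/2"
  using eul_converges[OF W y, of "e/2"] e by auto
 show "\<forall>\<^sub>F n in sequentially. ALL x:{z. y <= Im z}. dist (eulW W n x) (cflow W x) < e" unfolding eventually_sequentially
 proof (intro exI allI impI ballI)
  fix n x assume "N0 <= n" and x: "x : {z. y <= Im z}"
  show "dist (eulW W n x) (cflow W x) < e" using \<open>N0 <= n\<close> less_exp[of n]
   using N0[of "2^n" x] x e unfolding eulW_def dist_norm by fastforce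
 qed
qed

text \<open>The Euler maps are holomorphic and converge uniformly above each positive height, so the
  limit is holomorphic and the explicit derivative products converge to its derivative.\<close>

lemma cflow_has_deriv:
 assumes W: "continuous_on {0..1} W" and z: "0 < Im z"
 shows "(cflow W has_field_derivative deriv (cflow W) z) (at z)" and "(%j. eulWq W j z z) \<longlonglongrightarrow> deriv (cflow W) z"
proof -
 have "EX g'. ALL x:\<H>. (cflow W has_field_derivative g' x) (at x) & (%n. eulWq W n x x) \<longlonglongrightarrow> g' x"
 proof (rule has_complex_derivative_uniform_sequence[OF open_upper_half_plane, where f = "eulW W"])
  fix n x assume "x : \<H>"
  then show "(eulW W n has_field_derivative eulWq W n x x) (at x)"
   unfolding eulW_def[abs_def] eulWq_def by (intro eul_has_deriv) (auto simp: upper_half_plane_def)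
 next
  fix x assume x: "x : \<H>"
  then have pos: "0 < Im x" by (simp add: upper_half_plane_def)
  have sub: "cball x (Im x/2) <= {z. Im x/2 <= Im z}"
  proof
   fix z assume "z : cball x (Im x/2)"
   then have "abs (Im (x-z)) <= Im x/2" using abs_Im_le_cmod[of "x-z"] by (simp add: dist_norm)
   then show "z : {z. Im x/2 <= Im z}" unfolding mem_Collect_eq minus_complex.sel by linarith
  qed
  have "uniform_limit (cball x (Im x/2)) (eulW W) (cflow W) sequentially"
   by (rule uniform_limit_on_subset[OF eulW_uniform[OF W] sub]) (use pos in simp)
  moreover have "cball x (Im x/2) <= \<H>" using sub pos by (auto simp: upper_half_plane_def)
  ultimately show "EX d>0. cball x d <= \<H> & uniform_limit (cball x d) (eulW W) (cflow W) sequentially"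
   using pos by (intro exI[of _ "Im x/2"]) auto
 qed
 then obtain g' where g': "(cflow W has_field_derivative g' z) (at z)" "(%n. eulWq W n z z) \<longlonglongrightarrow> g' z"
  using z by (auto simp: upper_half_plane_def)
 then have "g' z = deriv (cflow W) z" by (simp add: DERIV_imp_deriv)
 then show "(cflow W has_field_derivative deriv (cflow W) z) (at z)" "(%j. eulWq W j z z) \<longlonglongrightarrow> deriv (cflow W) z"
  using g' by auto
qed

lemma eulW_tendsto:
 assumes W: "continuous_on {0..1} W" and z: "0 < Im z"
 shows "(%j. eulW W j z) \<longlonglongrightarrow> cflow W z" by (rule tendsto_uniform_limitI[OF eulW_uniform[OF W z]]) auto

lemma cflow_holomorphic:
 assumes "continuous_on {0..1} W"
 shows "cflow W holomorphic_on \<H>" using cflow_has_deriv(1)[OF assms]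
 by (auto simp: holomorphic_on_def field_differentiable_def upper_half_plane_def
   intro: has_field_derivative_at_within)

lemma cflow_Im:
 assumes "continuous_on {0..1} W" "0 < Im z"
 shows "Im z <= Im (cflow W z)" "0 < Im (cflow W z)" "(Im (cflow W z))^2 <= (Im z)^2+4"
 using rev_flow_Im[OF assms(1), of "z + of_real (W 0)"] rev_flow_Im_sq[OF assms(1), of "z + of_real (W 0)"] assms(2) by (simp_all add: cflow_def)

lemma cflow_inj:
 assumes "continuous_on {0..1} W"
 shows "inj_on (cflow W) \<H>"
proof (rule inj_onI)
 fix z w assume a: "z : \<H>" "w : \<H>" "cflow W z = cflow W w"
 then have "rev_flow W 0 1 (z + of_real (W 0)) = rev_flow W 0 1 (w + of_real (W 0))" by (simp add: cflow_def)
 then have "z + of_real (W 0) = w + of_real (W 0)"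
  using a by (rule_tac inj_onD[OF rev_flow_inj[OF assms zero_le_one]]) (auto simp: upper_half_plane_def)
 then show "z = w" by simp
qed

text \<open>The substitution s -> 1 - s exchanges the forward and the reverse equation: the points
  alive at time 1 are the end points of reverse trajectories.\<close>

lemma loewner_domain_eq:
 assumes b: "continuous_on {0..1} b"
 shows "loewner_domain b 1 = rev_flow (%s. b (1-s)) 0 1 ` \<H>"
proof -
 define W where "W = (%s. b (1-s))"
 have W: "continuous_on {0..1} W" unfolding W_def by (intro continuous_on_compose2[OF b] continuous_intros) auto
 have refl: "((%s. g (1-s)) has_vector_derivative - g') (at s within {0..1})"
  if "s : {0..1}" "(g has_vector_derivative g') (at (1-s) within {0..1})" for g :: "real => complex" and g' s
 proof -
  have "((%s. 1-s) has_vector_derivative (- 1::real)) (at s within {0..1})"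
   by (auto intro!: derivative_eq_intros simp flip: has_real_derivative_iff_has_vector_derivative)
  moreover have "(g has_vector_derivative g') (at (1-s) within (%s. 1-s) ` {0..1})" by (rule has_vector_derivative_within_subset[OF that(2)]) auto
  ultimately have "((g \<circ> (%s. 1-s)) has_vector_derivative (- 1) *\<^sub>R g') (at s within {0..1})" by (rule vector_diff_chain_within)
  then show ?thesis by (simp add: o_def)
 qed
 have "z : rev_flow W 0 1 ` \<H>" if z: "z : loewner_domain b 1" for z
 proof -
  obtain g where g: "g 0 = z" "!!s. s : {0..1} ==> g s ~= of_real (b s)"
   "!!s. s : {0..1} ==> (g has_vector_derivative (2/(g s - of_real (b s)))) (at s within {0..1})" and z0: "0 < Im z"
   using z by (auto simp: loewner_domain_def upper_half_plane_def)
  have gc: "continuous_on {0..1} g" using g(3) by (meson continuous_on_eq_continuous_within has_vector_derivative_continuous)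
  \<comment> \<open>A forward solution is only required to avoid the driving point. Its imaginary
    part solves a linear equation, hence never vanishes, and continuity keeps it positive.\<close>
  have nz: "Im (g t) ~= 0" if t: "t : {0..1}" for t
  proof -
   define k where "k = (%s. complex_of_real (- 2/(norm (g s - of_real (b s)))^2))"
   have "complex_of_real (Im (g t)) = complex_of_real (Im (g 0))*exp (integral {0..t} k)"
   proof (rule linear_ode_solution[where d = "%s. complex_of_real (Im (g s))"])
    show "continuous_on {0..t} k" unfolding k_def using g(2) t
     by (intro continuous_intros continuous_on_subset[OF gc] continuous_on_subset[OF b]) auto
    fix s assume s: "s : {0..t}"
    have "(g has_vector_derivative (2/(g s - of_real (b s)))) (at s within {0..t})"
     by (rule has_vector_derivative_within_subset[OF g(3)]) (use s t in auto)
    then have "((%s. complex_of_real (Im (g s))) has_vector_derivative complex_of_real (Im (2/(g s - of_real (b s))))) (at s within {0..t})"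
     by (rule bounded_linear.has_vector_derivative[OF bounded_linear_of_real
       bounded_linear.has_vector_derivative[OF bounded_linear_Im]])
    also have "Im (2/(g s - of_real (b s))) = (- 2/(norm (g s - of_real (b s)))^2)*Im (g s)" by (simp add: Im_divide cmod_power2)
    finally show "((%s. complex_of_real (Im (g s))) has_vector_derivative k s * complex_of_real (Im (g s))) (at s within {0..t})"
     by (simp only: k_def of_real_mult)
   qed (use t in auto)
   moreover have "complex_of_real (Im (g 0))*exp (integral {0..t} k) ~= 0" using g(1) z0 by simp
   ultimately show ?thesis by auto
  qed
  have pos: "0 < Im (g t)" if t: "t : {0..1}" for t
  proof (rule ccontr)
   assume "\<not> 0 < Im (g t)"
   then have "EX x>=0. x <= t & Im (g x) = 0" using z0 g(1) t by (intro IVT2') (auto intro!: continuous_intros continuous_on_subset[OF gc])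
   then show False using nz t by auto
  qed
  have "rev_sol W 0 1 (%s. g (1-s))" unfolding rev_sol_def
  proof
   fix s :: real assume s: "s : {0..1}"
   then have s': "1-s : {0..1}" by auto
   show "0 < Im (g (1-s)) & ((%s. g (1-s)) has_vector_derivative (- 2/(g (1-s)-complex_of_real (W s)))) (at s within {0..1})"
    using pos[OF s'] refl[OF s g(3)[OF s']] by (simp add: W_def)
  qed
  from rev_flow_eq[OF this W] have "rev_flow W 0 1 (g 1) = z" using g(1) by simp
  moreover have "g 1 : \<H>" using pos[of 1] by (simp add: upper_half_plane_def)
  ultimately show ?thesis by auto
 qed
 moreover have "rev_flow W 0 1 w : loewner_domain b 1" if w: "w : \<H>" for w
 proof -
  define h where "h = (%s. rev_flow W 0 s w)"
  have h: "rev_sol W 0 1 h" using rev_flow_sol[OF W] w by (auto simp: h_def upper_half_plane_def)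
  have "h (1-s) ~= of_real (b s) & ((%s. h (1-s)) has_vector_derivative (2/(h (1-s) - of_real (b s)))) (at s within {0..1})" if s: "s : {0..1}" for s
  proof -
   have s': "1-s : {0..1}" using s by auto
   have "0 < Im (h (1-s))" and
    d: "(h has_vector_derivative (- 2/(h (1-s)-complex_of_real (W (1-s))))) (at (1-s) within {0..1})" using h s' unfolding rev_sol_def by blast+
   then show ?thesis using refl[OF s d] by (auto simp: W_def)
  qed
  moreover have "0 < Im (h 1)" using h by (auto simp: rev_sol_def)
  ultimately show ?thesis unfolding loewner_domain_def upper_half_plane_def by (auto simp: h_def intro!: exI[of _ "%s. h (1-s)"])
 qed
 ultimately show ?thesis unfolding W_def by blast
qed

lemma frontier_relative_complement:
 fixes H :: "'a::topological_space set"
 assumes "open H"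
 shows "frontier (H-D) \<inter> H = frontier D \<inter> H"
proof -
 have "closure (H-D) \<inter> H = closure (- D) \<inter> H" using open_Int_closure_subset[OF assms, of "- D"] closure_mono[of "H-D" "- D"]
  by (auto simp: Diff_eq)
 moreover have "interior (H-D) \<inter> H = interior (- D) \<inter> H" using assms by (auto simp: Diff_eq interior_open)
 ultimately have "frontier (H-D) \<inter> H = frontier (- D) \<inter> H" by (auto simp: frontier_def)
 then show ?thesis by simp
qed

text \<open>The pathwise half of Brownian scaling: h (t s) / sqrt t solves the equation driven by W
  (t s) / sqrt t.\<close>

lemma rev_flow_scale:
 assumes W: "continuous_on {0..t} W" and t: "0 < t" and z: "0 < Im z"
 shows "rev_flow W 0 t (of_real (sqrt t)*z) = of_real (sqrt t)*rev_flow (%s. W (t * s)/sqrt t) 0 1 z"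
proof -
 define V where "V = (%s. W (t * s)/sqrt t)"
 have in_t: "t * s : {0..t}" if "s : {0..1}" for s using that t  by auto
 have "continuous_on {0..1} (%s. W (t * s))" by (rule continuous_on_compose2[OF W]) (use in_t in "auto simp del: atLeastAtMost_iff")
 then have V: "continuous_on {0..1} V" unfolding V_def using t by (intro continuous_intros) auto
 let ?B = "of_real (sqrt t)"
 define h where "h = (%s. rev_flow W 0 s (?B*z))"
 have h: "rev_sol W 0 t h" "h 0 = ?B*z" unfolding h_def by (rule rev_flow_sol[OF W]; use t z in simp)+
 define k where "k = (%s. h (t * s)/?B)"
 have "rev_sol V 0 1 k" unfolding rev_sol_def
 proof
  fix s :: real assume s: "s : {0..1}"
  have ts: "t * s : {0..t}" using in_t[OF s] .
  let ?A = "- 2/(h (t * s)-complex_of_real (W (t * s)))"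
  have hs: "0 < Im (h (t * s))" and d: "(h has_vector_derivative ?A) (at (t * s) within {0..t})" using h(1) ts unfolding rev_sol_def by blast+
  have "((%s. t * s) has_vector_derivative t) (at s within {0..1})" by (auto simp flip: has_real_derivative_iff_has_vector_derivative)
  moreover have "(h has_vector_derivative ?A) (at (t * s) within (%s. t * s) ` {0..1})"
   by (rule has_vector_derivative_within_subset[OF d]) (use in_t in blast)
  ultimately have "((h \<circ> (%s. t * s)) has_vector_derivative t *\<^sub>R ?A) (at s within {0..1})" by (rule vector_diff_chain_within)
  then have "(k has_vector_derivative (t *\<^sub>R ?A)/?B) (at s within {0..1})" unfolding k_def o_def by (rule has_vector_derivative_divide)
  also have "(t *\<^sub>R ?A)/?B =-2/(k s-complex_of_real (V s))"
  proof -
   have "k s-complex_of_real (V s) = (h (t * s) - of_real (W (t * s)))/?B" by (simp add: k_def V_def diff_divide_distrib)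
   moreover have "complex_of_real t = ?B*?B" using t by (simp flip: of_real_mult)
   ultimately show ?thesis by (simp add: scaleR_conv_of_real)
  qed
  finally show "0 < Im (k s) & (k has_vector_derivative (- 2/(k s-complex_of_real (V s)))) (at s within {0..1})" using hs t by (simp add: k_def)
 qed
 from rev_flow_eq[OF this V] have "rev_flow V 0 1 (k 0) = k 1" by simp
 moreover have "k 0 = z" using t by (simp add: k_def h)
 ultimately show ?thesis using t by (simp add: k_def h_def V_def)
qed

section \<open>One step of the Euler scheme\<close>

abbreviation stdn :: "real measure" where
 "stdn \<equiv> density lborel (%x. ennreal (std_normal_density x))"

lemma prob_space_stdn: "prob_space stdn" by (rule prob_space_normal_density) simp

lemma integral_stdn:
 fixes f :: "real => real"
 assumes "f : borel_measurable borel"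
 shows "integral\<^sup>L stdn f = (LINT t|lborel. std_normal_density t*f t)"
  and "integrable stdn f \<longleftrightarrow> integrable lborel (%t. std_normal_density t*f t)"
 using assms by (simp_all add: integral_density integrable_density)

lemma stdn_moments:
 "integrable stdn (%t. t)" "integral\<^sup>L stdn (%t. t) = 0"
 "integrable stdn (%t. t^2)" "integral\<^sup>L stdn (%t. t^2) = 1"
 "integrable stdn (%t. abs t^k)" using integrable_std_normal_moment[of 1] integral_std_normal_moment_odd[of 0]
  integrable_std_normal_moment[of 2] integral_std_normal_moment_even[of 1]
  integrable_std_normal_moment_abs[of k] by (simp_all add: integral_stdn)

lemma mult_first_order:
 fixes X Y w v d :: real
 assumes X: "abs (X-1-d*w) <= C1*(d * sqrt d)" and Y: "abs (Y-1-d * v) <= C2*(d * sqrt d)"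
  and K: "abs w <= K" "abs v <= K" and d: "0 < d" "d <= 1" and C: "0 <= C1" "0 <= C2"
 shows "abs (X*Y-1-d*(w+v)) <= (C1*(1+K+C2)+(1+K)*C2+K*K)*(d * sqrt d)"
proof -
 have K0: "0 <= K" using K by linarith
 have sd: "0 <= d * sqrt d" "d * sqrt d <= 1" "d*d <= d * sqrt d"
 proof -
  have "d <= sqrt d" using d by (intro real_le_rsqrt) (simp add: power2_eq_square)
  then show "d*d <= d * sqrt d" using d by (intro mult_left_mono) auto
  have "d * sqrt d <= 1*1" using d by (intro mult_mono) auto
  then show "0 <= d * sqrt d" "d * sqrt d <= 1" using d by auto
 qed
 have Yb: "abs Y <= 1+K+C2"
 proof -
  have "abs (d * v) <= 1*K" unfolding abs_mult using d K by (intro mult_mono) auto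
  moreover have "C2*(d * sqrt d) <= C2*1" using sd C by (intro mult_left_mono) auto
  ultimately show ?thesis using Y by linarith
 qed
 have Xa: "abs (1+d*w) <= 1+K"
 proof -
  have "abs (d*w) <= 1*K" unfolding abs_mult using d K by (intro mult_mono) auto
  then show ?thesis by simp
 qed
 let ?A = "abs w*abs v"
 have "X*Y-1-d*(w+v) = (X-1-d*w)*Y+(1+d*w)*(Y-1-d * v)+d*d*(w * v)" by (simp add: algebra_simps)
 then have "abs (X*Y-1-d*(w+v)) <= abs (X-1-d*w)*abs Y+abs (1+d*w)*abs (Y-1-d * v)+d*d*?A"
 proof -
  have "abs (a+b+c) <= abs a+abs b+abs c" for a b c :: real by simp
  moreover have "abs (d*d*(w * v)) = d*d*?A" by (simp add: abs_mult)
  ultimately show ?thesis using \<open>X*Y-1-d*(w+v) = _\<close> by (metis abs_mult)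
 qed
 also have "... <= (C1*(d * sqrt d))*(1+K+C2)+(1+K)*(C2*(d * sqrt d))+(d * sqrt d)*(K*K)"
 proof (intro add_mono)
  show "abs (X-1-d*w)*abs Y <= (C1*(d * sqrt d))*(1+K+C2)" by (rule mult_mono[OF X Yb]) (use C sd in auto)
  show "abs (1+d*w)*abs (Y-1-d * v) <= (1+K)*(C2*(d * sqrt d))" by (rule mult_mono[OF Xa Y]) (use K0 in auto)
  show "d*d*?A <= (d * sqrt d)*(K*K)" by (rule mult_mono[OF sd(3) mult_mono[OF K]]) (use K0 sd in auto)
 qed
 finally show ?thesis by (simp add: algebra_simps)
qed

text \<open>The product is exp of a combination of logarithms, and Ln (1 + u) - u is quadratic in u.
  The error is really O(d^2); it is stated with d sqrt d to match the Gaussian factor.\<close>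

lemma prod_norm_powr_first_order:
 fixes e :: "'k => real" and z :: "'k => complex"
 assumes K: "finite K" and Z: "0 < Z" "!!k. k : K ==> norm (z k) <= Z" and E: "(\<Sum>k\<in>K. abs (e k)) <= E" "0 < E"
  and d: "0 < d" "d <= 1" "2*d*Z <= 1" "4*d*(E*Z) <= 1"
 shows "abs ((\<Prod>k\<in>K. norm (1 + of_real d*z k) powr e k)-1-d*(\<Sum>k\<in>K. e k * Re (z k)))
  <= (2*E*Z^2+4*(E*Z)^2)*(d * sqrt d)"
proof -
 let ?A = "of_real d"
 define l where "l = (%k. ln (norm (1+?A*z k)))"
 define L where "L = (\<Sum>k\<in>K. e k*l k)"
 define S where "S = (\<Sum>k\<in>K. e k * Re (z k))"
 have small: "norm (?A*z k) <= d*Z" "norm (?A*z k) <= 1/2" if "k : K" for k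
 proof -
  have "d*norm (z k) <= d*Z" using Z(2)[OF that] d by (intro mult_left_mono) auto
  moreover have "d*Z <= 1/2" using d(3) by simp
  moreover have "norm (?A*z k) = d*norm (z k)" using d by (simp add: norm_mult)
  ultimately show "norm (?A*z k) <= d*Z" "norm (?A*z k) <= 1/2" by auto
 qed
 have nz: "norm (1+?A*z k) > 0" if "k : K" for k using norm_triangle_ineq2[of 1 "- (?A*z k)"] small[OF that] by auto
 have lk: "abs (l k-d * Re (z k)) <= 2*(d*Z)^2" if "k : K" for k
 proof -
  let ?w = "?A*z k"
  have "l k = Re (Ln (1+?w))" using nz[OF that] by (simp add: l_def)
  then have "l k-d * Re (z k) = Re (Ln (1+?w)-?w)" by simp
  then have "abs (l k-d * Re (z k)) <= norm (Ln (1+?w)-?w)" using abs_Re_le_cmod by metis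
  also have "... <= (norm ?w)^2/(1-norm ?w)" using small[OF that] by (intro Ln_approx_linear) auto
  also have "... <= (norm ?w)^2/(1/2)" using small[OF that] by (intro divide_left_mono) auto
  also have "... <= (d*Z)^2/(1/2)" using small(1)[OF that] by (intro divide_right_mono power_mono) auto
  finally show ?thesis by simp
 qed
 have LS: "abs (L-d*S) <= 2*E*(d*Z)^2"
 proof -
  have "L-d*S = (\<Sum>k\<in>K. e k*(l k-d * Re (z k)))" by (simp add: L_def S_def sum_distrib_left sum_subtractf algebra_simps)
  then have "abs (L-d*S) <= (\<Sum>k\<in>K. abs (e k)*abs (l k-d * Re (z k)))" by (simp flip: abs_mult)
  also have "... <= (\<Sum>k\<in>K. abs (e k)*(2*(d*Z)^2))" by (intro sum_mono mult_left_mono lk) auto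
  also have "... <= E*(2*(d*Z)^2)" unfolding sum_distrib_right[symmetric] using E by (intro mult_right_mono) auto
  finally show ?thesis by simp
 qed
 have Sb: "abs (d*S) <= d*(E*Z)"
 proof -
  have "abs S <= (\<Sum>k\<in>K. abs (e k)*Z)" unfolding S_def
  proof (rule order_trans[OF sum_abs sum_mono])
   fix k assume "k : K"
   then show "abs (e k * Re (z k)) <= abs (e k)*Z" unfolding abs_mult using Z(2) abs_Re_le_cmod[of "z k"] by (intro mult_left_mono) force+
  qed
  also have "... <= E*Z" unfolding sum_distrib_right[symmetric] using E Z by (intro mult_right_mono) auto
  finally show ?thesis using d by (simp add: abs_mult)
 qed
 have Lb: "abs L <= 2*(d*(E*Z))"
 proof -
  have "2*E*(d*Z)^2 = (d*(E*Z))*(2*d*Z)" by (simp add: power2_eq_square)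
  also have "... <= (d*(E*Z))*1" using d E Z by (intro mult_left_mono) auto
  finally show ?thesis using LS Sb by linarith
 qed
 have "(\<Prod>k\<in>K. norm (1+?A*z k) powr e k) = (\<Prod>k\<in>K. exp (e k*l k))" by (intro prod.cong refl) (use nz in "auto simp: powr_def l_def")
 also have "... = exp L" unfolding L_def using K by (simp add: exp_sum)
 finally have P: "(\<Prod>k\<in>K. norm (1+?A*z k) powr e k) = exp L" .
 have "abs (exp L-1-L) <= L^2"
 proof -
  have "norm (exp L-(1+L)) <= (norm L)^2"
  proof -
   have "abs L <= 1/2" using Lb d by linarith
   then have 1: "exp L <= 1+L+L^2"
   proof (cases "0 <= L")
    case False
    define u where "u =-L"
    have u: "0 <= u" "u <= 1/2" using False \<open>\<bar>L\<bar> <= 1/2\<close> by (auto simp: u_def)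
    have "exp (- u) <= 1/(1+u)" using u by (simp add: exp_minus divide_simps)
    also have "... <= 1-u+u^2" using u by (simp add: algebra_simps power2_eq_square divide_simps)
    finally show ?thesis by (simp add: u_def)
   qed (use exp_bound in auto)
   then show ?thesis by simp
  qed
  then show ?thesis by (simp add: algebra_simps)
 qed
 also have "L^2 <= (2*(d*(E*Z)))^2" using Lb by (metis abs_ge_zero power2_abs power_mono)
 finally have "abs (exp L-1-d*S) <= 2*E*(d*Z)^2+(2*(d*(E*Z)))^2" using LS by linarith
 also have "... = (2*E*Z^2+4*(E*Z)^2)*(d*d)" by (simp add: algebra_simps power2_eq_square)
 also have "... <= (2*E*Z^2+4*(E*Z)^2)*(d * sqrt d)"
 proof -
  have "d <= sqrt d" using d by (intro real_le_rsqrt) (simp add: power2_eq_square)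
  then show ?thesis using d E by (intro mult_left_mono) auto
 qed
 finally show ?thesis by (simp add: P S_def)
qed

lemma has_real_derivative_Re_inverse_power:
 assumes "Im v ~= 0"
 shows "((%x. Re (inverse ((v - of_real x)^m))) has_real_derivative real m * Re (inverse ((v - of_real x)^Suc m))) (at x)"
proof -
 have nz: "v - of_real x ~= 0" using assms by (auto)
 let ?A = "inverse ((v - of_real x)^Suc m)"
 have "((%w. inverse ((v-w)^m)) has_field_derivative of_nat m*?A) (at (of_real x))"
 proof (cases m)
  case (Suc k)
  let ?B = "inverse (v - of_real x)"
  have "((%w. inverse (v-w)) has_field_derivative ((?B)^2)) (at (of_real x))" using nz by (auto intro!: derivative_eq_intros simp: power2_eq_square)
  from DERIV_power[OF this, of m]
  have "((%w. inverse (v-w)^m) has_field_derivative of_nat m*((?B)^2*?B^k)) (at (of_real x))" by (simp add: Suc)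
  moreover have "(?B)^2*?B^k = ?A" by (simp add: Suc power2_eq_square power_inverse)
  ultimately show ?thesis by (simp only: power_inverse)
 qed auto
 then have "((%x. inverse ((v - of_real x)^m)) has_vector_derivative of_nat m*?A) (at x)" by (rule has_vector_derivative_real_field)
 then have "((%x. Re (inverse ((v - of_real x)^m))) has_vector_derivative Re (of_nat m*?A)) (at x)"
  by (rule bounded_linear.has_vector_derivative[OF bounded_linear_Re])
 then show ?thesis by (simp add: has_real_derivative_iff_has_vector_derivative)
qed

lemma has_real_derivative_ln_norm:
 assumes "Im v ~= 0"
 shows "((%x. ln (norm (v - of_real x))) has_real_derivative - Re (inverse (v - of_real x))) (at x)"
proof -
 define s where "s = (%x. (Re v-x)^2+(Im v)^2)"
 have s: "s x > 0" for x using assms by (simp add: s_def add_nonneg_pos)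
 have "ln (norm (v - of_real x)) = ln (s x)/2" for x by (simp add: cmod_def s_def ln_sqrt)
 moreover have "((%x. ln (s x)/2) has_real_derivative (- (2*(Re v-x))/s x)/2) (at x)"
 proof -
  have "(s has_real_derivative - (2*(Re v-x))) (at x)" unfolding s_def by (auto intro!: derivative_eq_intros)
  from DERIV_cdivide[OF DERIV_chain2[OF DERIV_ln_divide[OF s] this], of 2]
  show ?thesis by simp
 qed
 moreover have "- Re (inverse (v - of_real x)) = (- (2*(Re v-x))/s x)/2"
 proof -
  have "- (A/S) = (- (2*A)/S)/2" for A S :: real by simp
  from this[of "Re v-x" "s x"] show ?thesis by (simp add: s_def del: divide_minus_left)
 qed
 ultimately show ?thesis by (simp only:)
qed

text \<open>Taylor expansion to third order in x = sqrt (6 d) t: the linear term has mean 0, x^2/2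
  has mean 3 d, and the remainder is of order d sqrt d. The constant depends on y and the exponents
  only, not on the points.\<close>

lemma gauss_prod_norm_powr_first_order:
 fixes r :: "'i => real"
 assumes I: "finite I" and y: "0 < y"
 shows "EX C>=0. ALL v d. (ALL i:I. y <= abs (Im (v i))) --> 0 < d --> d <= 1 -->
  integrable stdn (%t. \<Prod>i\<in>I. (norm (v i - of_real (sqrt (6*d)*t))/norm (v i)) powr r i) &
  abs ((LINT t|stdn. (\<Prod>i\<in>I. (norm (v i - of_real (sqrt (6*d)*t))/norm (v i)) powr r i))-1
   - d*(3*((\<Sum>i\<in>I. r i * Re (inverse (v i)))^2-(\<Sum>i\<in>I. r i * Re (inverse (v i^2)))))) <= C*(d * sqrt d)"
proof -
 define R where "R = (\<Sum>i\<in>I. abs (r i))"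
 have R: "0 <= R" by (simp add: R_def)
 \<comment> \<open>The remainder grows at most like this power of 1 + |x|/y and is therefore
   integrable against the Gaussian.\<close>
 define k where "k = nat \<lceil>R\<rceil>"
 define B where "B = (R/y)^3+3*(R/y)*(R/y^2)+2*(R/y^3)"
 have B: "0 <= B" using R y by (simp add: B_def)
 define h where "h = (%t::real. abs t^3*(1+3*abs t/y)^k)"
 have h_int: "integrable stdn h"
 proof (rule Bochner_Integration.integrable_bound)
  show "integrable stdn (%t. 2^k*(abs t^3+(3/y)^k*abs t^(3+k)))" by (intro integrable_mult_right Bochner_Integration.integrable_add stdn_moments)
  show "AE t in stdn. norm (h t) <= norm (2^k*(abs t^3+(3/y)^k*abs t^(3+k)))"
  proof (rule AE_I2)
   fix t :: real
   let ?D = "3*abs t/y"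
   have "(1+3*abs t/y)^k <= (2*max 1 ?D)^k" using y by (intro power_mono) auto
   also have "... = 2^k*max 1 ?D^k" by simp
   also have "max 1 ?D^k <= 1+?D^k" using y by (auto simp: max_def)
   finally have "abs t^3*(1+3*abs t/y)^k <= abs t^3*(2^k*(1+?D^k))" by (intro mult_left_mono) auto
   also have "... = 2^k*(abs t^3+(3/y)^k*abs t^(3+k))" by (simp add: power_add power_divide algebra_simps)
   finally show "norm (h t) <= norm (2^k*(abs t^3+(3/y)^k*abs t^(3+k)))" using y by (simp add: h_def)
  qed
 qed (simp add: h_def)
 define C where "C = B*15*integral\<^sup>L stdn h"
 have h0: "0 <= h t" for t using y by (simp add: h_def)
 have C: "0 <= C" using B h0 by (simp add: C_def)
 show ?thesis
 proof (intro exI[of _ C] conjI allI impI C)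
  fix v :: "'i => complex" and d :: real
  assume v: "ALL i:I. y <= abs (Im (v i))" and d: "0 < d" "d <= 1"
  have Imv: "Im (v i) ~= 0" if "i : I" for i using v that y by force
  have dist: "y <= norm (v i - of_real x)" if "i : I" for i x using v that Im_le_norm_diff_real[of "v i" x] by force
  define e where "e = (%(m::nat) (x::real). \<Sum>i\<in>I. r i * Re (inverse ((v i - of_real x)^m)))"
  define G where "G = (%x. \<Sum>i\<in>I. r i*(ln (norm (v i - of_real x))-ln (norm (v i))))"
  have e_bound: "abs (e m x) <= R/y^m" for m x
  proof -
   have "abs (e m x) <= (\<Sum>i\<in>I. abs (r i)*(1/y^m))" unfolding e_def
   proof (rule order_trans[OF sum_abs sum_mono])
    fix i assume i: "i : I"
    have "abs (Re (inverse ((v i - of_real x)^m))) <= norm (inverse ((v i - of_real x)^m))" by (rule abs_Re_le_cmod)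
    also have "... = 1/norm (v i - of_real x)^m" by (simp add: norm_divide norm_power inverse_eq_divide)
    also have "... <= 1/y^m" using dist[OF i, of x] y by (intro divide_left_mono power_mono mult_pos_pos zero_less_power) auto
    finally show "abs (r i * Re (inverse ((v i - of_real x)^m))) <= abs (r i)*(1/y^m)" unfolding abs_mult by (rule mult_left_mono) simp
   qed
   then show ?thesis by (simp add: R_def sum_divide_distrib)
  qed
  have dG: "(G has_real_derivative - e 1 x) (at x)" for x
  proof -
   have "(G has_real_derivative (\<Sum>i\<in>I. r i*(- Re (inverse (v i - of_real x))-0))) (at x)"
    unfolding G_def by (intro DERIV_sum DERIV_cmult DERIV_diff DERIV_const has_real_derivative_ln_norm Imv)
   then show ?thesis by (simp add: e_def sum_negf)
  qed
  have de: "(e m has_real_derivative real m*e (Suc m) x) (at x)" for m x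
  proof -
   let ?G = "\<Sum>i\<in>I. r i*(real m * Re (inverse ((v i - of_real x)^Suc m)))"
   have "(e m has_real_derivative ?G) (at x)" unfolding e_def by (intro DERIV_sum DERIV_cmult has_real_derivative_Re_inverse_power Imv)
   moreover have "?G = real m*e (Suc m) x" unfolding e_def sum_distrib_left by (rule sum.cong) (simp_all only: mult.left_commute)
   ultimately show ?thesis by simp
  qed
  define F where "F = (%x. exp (G x))"
  have dF: "(F has_real_derivative - (F x*e 1 x)) (at x)" for x unfolding F_def using dG[of x] by (auto intro!: derivative_eq_intros)
  \<comment> \<open>Derivatives of exp G up to order 3, from G' = - e 1 and (e m)' = m e (m +
    1).\<close>
  define D where "D = (%(m::nat) x. if m = 0 then F x else if m = 1 then - (F x*e 1 x) else if m = 2 then F x*((e 1 x)^2-e 2 x)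
    else F x*(- ((e 1 x)^3)+3*e 1 x*e 2 x-2*e 3 x))"
  have dD: "ALL m t. m < 3 & abs t <= abs x --> (D m has_real_derivative D (Suc m) t) (at t)" for x
  proof (intro allI impI)
   fix m :: nat and t :: real assume "m < 3 & abs t <= abs x"
   then consider "m = 0" | "m = 1" | "m = 2" by linarith
   then show "(D m has_real_derivative D (Suc m) t) (at t)"
   proof cases
    case 1
    then show ?thesis using dF by (simp add: D_def)
   next
    case 2
    have "((%x.-(F x*e 1 x)) has_real_derivative - (- (F t*e 1 t)*e 1 t+(real 1*e (Suc 1) t)*F t)) (at t)" by (intro DERIV_minus DERIV_mult dF de)
    then show ?thesis using 2 by (simp add: D_def algebra_simps numeral_2_eq_2)
   next
    case 3
    let ?F = "real 2*(real 1*e (Suc 1) t*(e 1 t)^(2-Suc 0))-real 2*e (Suc 2) t"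
    have "((%x. F x*((e 1 x)^2-e 2 x)) has_real_derivative - (F t*e 1 t)*((e 1 t)^2-e 2 t)+?F*F t) (at t)"
     by (intro DERIV_mult DERIV_diff DERIV_power dF de)
    moreover have "- (F t*e 1 t)*((e 1 t)^2-e 2 t)+?F*F t = D 3 t" by (simp add: D_def numeral_2_eq_2 numeral_3_eq_3 algebra_simps)
    ultimately show ?thesis using 3 by (simp add: D_def[abs_def])
   qed
  qed
  have F_bound: "F x <= (1+abs x/y)^k" for x
  proof -
   let ?A = "ln (1+abs x/y)"
   have lnle: "abs (ln (norm (v i - of_real x))-ln (norm (v i))) <= ?A" if i: "i : I" for i
   proof -
    have a: "y <= norm (v i - of_real x)" "y <= norm (v i)" using dist[OF i, of x] dist[OF i, of 0] by auto
    have pos: "0 < 1+abs x/y" using y by (simp add: add_pos_nonneg)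
    have "norm (v i - of_real x) <= norm (v i)+abs x" using norm_triangle_ineq4[of "v i" "of_real x"] by simp
    also have "abs x <= norm (v i)*(abs x/y)" using mult_right_mono[OF a(2), of "abs x/y"] y by simp
    finally have 1: "norm (v i - of_real x) <= norm (v i)*(1+abs x/y)" by (simp add: algebra_simps)
    have "norm (v i) <= norm (v i - of_real x)+abs x" using norm_triangle_ineq[of "v i - of_real x" "of_real x"] by simp
    also have "abs x <= norm (v i - of_real x)*(abs x/y)" using mult_right_mono[OF a(1), of "abs x/y"] y by simp
    finally have 2: "norm (v i) <= norm (v i - of_real x)*(1+abs x/y)" by (simp add: algebra_simps)
    have p: "0 < norm (v i)" "0 < norm (v i - of_real x)" using a y by linarith+
    have "ln (norm (v i - of_real x)) <= ln (norm (v i))+?A" using ln_le_cancel_iff[THEN iffD2, OF p(2) _ 1] p pos by (simp add: ln_mult)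
    moreover have "ln (norm (v i)) <= ln (norm (v i - of_real x))+?A" using ln_le_cancel_iff[THEN iffD2, OF p(1) _ 2] p pos by (simp add: ln_mult)
    ultimately show ?thesis by simp
   qed
   have ln0: "0 <= ?A" using y by simp
   have "G x <= (\<Sum>i\<in>I. abs (r i)*?A)" unfolding G_def
   proof (rule sum_mono)
    fix i assume "i : I"
    have "r i*(ln (norm (v i - of_real x))-ln (norm (v i))) <= abs (r i)*abs (ln (norm (v i - of_real x))-ln (norm (v i)))"
     by (metis abs_ge_self abs_mult)
    also have "... <= abs (r i)*?A" using lnle[OF \<open>i \<in> I\<close>] by (intro mult_left_mono) auto
    finally show "r i*(ln (norm (v i - of_real x))-ln (norm (v i))) <= abs (r i)*?A" .
   qed
   also have "... = R*?A" by (simp add: R_def sum_distrib_right)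
   also have "... <= real k*?A" using ln0 R by (intro mult_right_mono) (auto simp: k_def)
   finally have "F x <= exp (real k*?A)" by (simp add: F_def)
   also have "... = (1+abs x/y)^k" using y by (simp add: exp_of_nat_mult add_pos_nonneg)
   finally show ?thesis .
  qed
  have taylor: "abs (F x-1-x*D 1 0-x^2/2*D 2 0) <= B*abs x^3*(1+abs x/y)^k" for x
  proof -
   obtain t where t: "abs t <= abs x" "F x = (\<Sum>m<3. D m 0/fact m*x^m)+D 3 t/fact 3*x^3"
    using Maclaurin_bi_le[of D F 3 x] dD[of x] by (auto simp: D_def)
   have "F 0 = 1" by (simp add: F_def G_def)
   then have "F x-1-x*D 1 0-x^2/2*D 2 0 = D 3 t/6*x^3" using t(2) by (simp add: eval_nat_numeral D_def)
   also have "abs ... = abs (D 3 t)/6*abs x^3" by (simp add: abs_mult power_abs)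
   also have "... <= (B*(1+abs x/y)^k)*abs x^3"
   proof (rule mult_right_mono)
    have "abs (- ((e 1 t)^3)+3*e 1 t*e 2 t-2*e 3 t) <= abs (e 1 t)^3+3*abs (e 1 t)*abs (e 2 t)+2*abs (e 3 t)"
    proof -
     have "abs ((e 1 t)^3) = abs (e 1 t)^3" "abs (3*e 1 t*e 2 t) = 3*abs (e 1 t)*abs (e 2 t)" by (simp_all add: power_abs abs_mult)
     then show ?thesis by linarith
    qed
    also have "... <= B" unfolding B_def using e_bound[of 1 t] e_bound[of 2 t] e_bound[of 3 t] by (intro add_mono mult_mono power_mono) auto
    finally have "abs (D 3 t) <= F t*B" by (simp add: D_def abs_mult F_def)
    also have "... <= (1+abs x/y)^k*B"
    proof (rule mult_right_mono[OF order_trans[OF F_bound] B])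
     show "(1+abs t/y)^k <= (1+abs x/y)^k" using t y by (intro power_mono add_left_mono divide_right_mono) auto
    qed
    finally have "abs (D 3 t) <= B*(1+abs x/y)^k" by (simp add: mult.commute)
    then show "abs (D 3 t)/6 <= B*(1+abs x/y)^k" by simp
   qed auto
   finally show ?thesis by (simp add: mult_ac)
  qed
  let ?B = "sqrt (6*d)"
  let ?E = "%t. \<Prod>i\<in>I. (norm (v i - of_real (?B*t))/norm (v i)) powr r i"
  define q where "q = ?E"
  have qF: "q t = F (?B*t)" for t
  proof -
   have "q t = (\<Prod>i\<in>I. exp (r i*(ln (norm (v i - of_real (?B*t)))-ln (norm (v i)))))" unfolding q_def
   proof (rule prod.cong[OF refl])
    fix i assume i: "i : I"
    have "0 < norm (v i - of_real (?B*t))" "0 < norm (v i)" using dist[OF i, of "?B*t"] dist[OF i, of 0] y by auto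
    then show "(norm (v i - of_real (?B*t))/norm (v i)) powr r i = exp (r i*(ln (norm (v i - of_real (?B*t)))-ln (norm (v i))))"
     by (simp add: powr_def ln_div)
   qed
   then show ?thesis using I by (simp add: F_def G_def exp_sum)
  qed
  have q_meas: "q : borel_measurable borel" unfolding q_def by measurable
  define m where "m = (%t. 1+?B*D 1 0*t+3*d*D 2 0*t^2)"
  have m_int: "integrable stdn m" unfolding m_def using prob_space_stdn stdn_moments(1,3)
   by (intro Bochner_Integration.integrable_add integrable_mult_right) (auto simp: finite_measure.integrable_const prob_space.finite_measure)
  have m_val: "integral\<^sup>L stdn m = 1+3*d*D 2 0"
  proof -
   interpret prob_space stdn by (rule prob_space_stdn)
   show ?thesis using stdn_moments(1,3) using stdn_moments(2,4) prob_space by (simp add: m_def)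
  qed
  let ?C = "d * sqrt d"
  have rem: "abs (q t-m t) <= B*15*?C*h t" for t
  proof -
   define x where "x = ?B*t"
   have "abs (q t-m t) = abs (F x-1-x*D 1 0-x^2/2*D 2 0)" using d by (simp add: qF m_def x_def algebra_simps)
   also have "... <= B*abs x^3*(1+abs x/y)^k" by (rule taylor)
   \<comment> \<open>Here sqrt (6 d) ^ 3 = 6 sqrt 6 d sqrt d with 6 sqrt 6 <= 15, and sqrt (6 d) <=
     3 because d <= 1.\<close>
   also have "... <= B*(15*?C*abs t^3)*(1+3*abs t/y)^k"
   proof (intro mult_mono)
    have "?B <= sqrt 9" using d by (intro real_sqrt_le_mono) auto
    then have s3: "?B <= 3" by simp
    have "abs x <= 3*abs t" unfolding x_def abs_mult using s3 d by (intro mult_right_mono) auto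
    then show "(1+abs x/y)^k <= (1+3*abs t/y)^k" using y by (intro power_mono add_left_mono divide_right_mono) auto
    have "sqrt 6 <= sqrt ((5/2)^2)" by (intro real_sqrt_le_mono) (simp add: power2_eq_square)
    then have "6 * sqrt 6*?C <= 15*?C" using d by (intro mult_right_mono) auto
    moreover have "?B^3 = 6 * sqrt 6*?C"
    proof -
     have "?B^3 = (?B)^2*?B" by (simp add: power3_eq_cube power2_eq_square)
     also have "... = 6*d*(sqrt 6 * sqrt d)" using d by (simp only: real_sqrt_mult[of 6 d, symmetric]) simp
     finally show ?thesis by simp
    qed
    ultimately have "?B^3*abs t^3 <= 15*?C*abs t^3" by (intro mult_right_mono) auto
    then show "abs x^3 <= 15*?C*abs t^3" using d by (simp add: x_def abs_mult power_mult_distrib)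
   qed (use B y d in auto)
   finally show ?thesis by (simp add: h_def)
  qed
  have q_m: "integrable stdn (%t. q t-m t)"
  proof (rule Bochner_Integration.integrable_bound)
   show "integrable stdn (%t. B*15*?C*h t)" by (intro integrable_mult_right h_int)
   show "AE t in stdn. norm (q t-m t) <= norm (B*15*?C*h t)" using rem by (intro AE_I2) (metis abs_ge_self order_trans real_norm_def)
  qed (use q_meas m_int in auto)
  then have q_int: "integrable stdn q" using Bochner_Integration.integrable_add[OF q_m m_int] by simp
  have "abs (integral\<^sup>L stdn q-(1+3*d*D 2 0)) = abs (LINT t|stdn. (q t-m t))" using q_int m_int m_val by simp
  also have "... <= (LINT t|stdn. B*15*?C*h t)" by (rule order_trans[OF integral_abs_bound integral_mono]) (use q_m h_int rem in auto)
  also have "... = C*?C" by (simp add: C_def)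
  finally have "abs (integral\<^sup>L stdn q-(1+3*d*D 2 0)) <= C*?C" .
  moreover have "D 2 0 = (\<Sum>i\<in>I. r i * Re (inverse (v i)))^2-(\<Sum>i\<in>I. r i * Re (inverse (v i^2)))"
   by (simp add: D_def F_def G_def e_def)
  ultimately show "abs ((LINT t|stdn. (\<Prod>i\<in>I. (norm (v i - of_real (?B*t))/norm (v i)) powr r i))-1
   - d*(3*((\<Sum>i\<in>I. r i * Re (inverse (v i)))^2-(\<Sum>i\<in>I. r i * Re (inverse (v i^2)))))) <= C*?C" by (simp add: q_def algebra_simps)
  show "integrable stdn ?E" using q_int unfolding q_def .
 qed
qed

text \<open>The Ito drift, relative to the product, for dZ = -2/Z dt - sqrt 6 dB. The logarithms of
  the quotient factors drift by 2 Re of the inverse products, ln |Z| drifts by (-2 - 3) Re (1/Z^2),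
  and the last term is half the quadratic variation of the logarithm.\<close>

definition vdrift :: "'i set => ('i \<times> 'i => real) => ('i \<times> 'i => real) => ('i => real) => ('i => complex) => real" where
 "vdrift I a b r w = 2*(\<Sum>p\<in>I\<times>I. a p * Re (inverse (w (fst p)*w (snd p))))
  + 2*(\<Sum>p\<in>I\<times>I. b p * Re (inverse (w (fst p) * cnj (w (snd p)))))
  - 5*(\<Sum>i\<in>I. r i * Re (inverse (w i^2)))+3*(\<Sum>i\<in>I. r i * Re (inverse (w i)))^2"

definition vratio :: "'i set => ('i \<times> 'i => real) => ('i \<times> 'i => real) => ('i => real) => real => ('i => complex) => real => real" where
 "vratio I a b r d w t = (\<Prod>p\<in>I\<times>I. norm (1 + of_real (2*d)/(w (fst p)*w (snd p))) powr a p)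
  * (\<Prod>p\<in>I\<times>I. norm (1 + of_real (2*d)/(w (fst p) * cnj (w (snd p)))) powr b p)
  * (\<Prod>i\<in>I. (norm (w i - of_real (2*d)/w i - of_real (sqrt (6*d)*t))/norm (w i)) powr r i)"

text \<open>Hides the constant, so that four factors can be multiplied one after another without
  tracking it.\<close>

lemma mult_first_order_ex:
 assumes K0: "0 <= K" and C1: "0 <= C1" and C2: "0 <= C2"
 shows "EX C>=0. ALL X Y a b d :: real. abs (X-1-d*a) <= C1*(d * sqrt d) --> abs (Y-1-d*b) <= C2*(d * sqrt d) -->
  abs a <= K --> abs b <= K --> 0 < d --> d <= 1 --> abs (X*Y-1-d*(a+b)) <= C*(d * sqrt d)"
 using assms mult_first_order[where K = K and ?C1.0 = C1 and ?C2.0 = C2] by (intro exI[of _ "C1*(1+K+C2)+(1+K)*C2+K*K"]) auto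

lemma abs_sum_mult_le:
 fixes e x :: "'k => real"
 assumes "!!k. k : K ==> abs (x k) <= B"
 shows "abs (\<Sum>k\<in>K. e k*x k) <= (\<Sum>k\<in>K. abs (e k))*B" unfolding sum_distrib_right
 by (rule order_trans[OF sum_abs sum_mono]) (simp add: abs_mult assms mult_left_mono)

lemma norm_inverse_le:
 fixes w :: complex
 assumes "0 < y" "y <= norm w"
 shows "norm (inverse w) <= inverse y" unfolding norm_inverse using assms by (intro le_imp_inverse_le)

lemma inverse_euler_shift:
 fixes w :: complex
 assumes y: "0 < y" "y <= Im w" and d: "0 <= d"
 defines "v \<equiv> w - of_real (2*d)/w"
 shows "y <= Im v" "norm (inverse v-inverse w) <= 2*d/y^3"
  "norm (inverse (v^2)-inverse (w^2)) <= 4*d/y^4"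
  "norm v/norm w = norm (1 + of_real d*(- 2*inverse (w^2)))"
proof -
 show vy: "y <= Im v" using Im_euler_step[OF d, of w] y by (simp add: v_def)
 have nv: "y <= norm v" and nw: "y <= norm w" using vy y abs_Im_le_cmod[of v] abs_Im_le_cmod[of w] by auto
 have nz: "v ~= 0" "w ~= 0" using nv y by auto
 let ?B = "inverse w"
 have "inverse v-?B = (w-v)*(inverse v * ?B)" using nz by (simp add: field_simps)
 also have "w-v = of_real (2*d)*?B" by (simp add: v_def divide_inverse)
 finally have "norm (inverse v-?B) = (2*d)*norm (?B)*(norm (inverse v)*norm (?B))" using d by (simp add: norm_mult)
 also have "... <= (2*d)*inverse y*(inverse y*inverse y)" using d y norm_inverse_le[OF y(1) nv] norm_inverse_le[OF y(1) nw] by (intro mult_mono) auto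
 finally show 1: "norm (inverse v-?B) <= 2*d/y^3" by (simp add: divide_inverse power3_eq_cube)
 let ?A = "inverse (w^2)"
 have "inverse (v^2)-?A = (inverse v-?B)*(inverse v+?B)" by (simp add: power2_eq_square algebra_simps)
 then have "norm (inverse (v^2)-?A) <= (2*d/y^3)*(2*inverse y)" unfolding norm_mult
  using norm_triangle_ineq[of "inverse v" "?B"] norm_inverse_le[OF y(1) nv] norm_inverse_le[OF y(1) nw] d y
  by (simp only: norm_mult) (intro mult_mono 1, auto)
 then show "norm (inverse (v^2)-?A) <= 4*d/y^4" by (simp add: divide_inverse eval_nat_numeral)
 have "1 + of_real d*(- 2*?A) = v/w" using nz by (simp add: v_def field_simps power2_eq_square)
 then show "norm v/norm w = norm (1 + of_real d*(- 2*?A))" by (simp only: norm_divide)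
qed

text \<open>The step is split at v = w - 2 d / w. The quotient factors and |v| / |w| are
  deterministic, and the Gaussian displacement starts from v. Its drift is thus evaluated at v
  instead of w, which costs a further O(d) and is harmless.\<close>

lemma euler_step_first_order:
 fixes r :: "'i => real"
 assumes I: "finite I" and y: "0 < y"
 shows "EX C d0. 0 <= C & 0 < d0 & d0 <= 1 & (ALL w d. (ALL i:I. y <= Im (w i)) --> 0 < d --> d <= d0 -->
   integrable stdn (vratio I a b r d w) & abs (integral\<^sup>L stdn (vratio I a b r d w)-1-d * vdrift I a b r w) <= C*(d * sqrt d))"
proof -
 define Z where "Z = 2/y^2"
 have Z: "0 < Z" using y by (simp add: Z_def)
 let ?C = "\<Sum>p\<in>I\<times>I. abs (b p)"
 let ?D = "\<Sum>p\<in>I\<times>I. abs (a p)"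
 define E where "E = 1+?D+?C+(\<Sum>i\<in>I. abs (r i))"
 define R where "R = (\<Sum>i\<in>I. abs (r i))"
 have sums0: "0 <= ?D" "0 <= ?C" "0 <= R" by (auto simp: R_def)
 have E: "0 < E" "?D <= E" "?C <= E" "(\<Sum>i\<in>I. abs (r i)) <= E" "R <= E" using sums0 unfolding E_def R_def by linarith+
 define C1 where "C1 = 2*E*Z^2+4*(E*Z)^2"
 have C1: "0 <= C1" using E by (simp add: C1_def)
 obtain C2 where C2: "0 <= C2" "!!v d. (ALL i:I. y <= abs (Im (v i))) ==> 0 < d ==> d <= 1 ==>
  integrable stdn (%t. \<Prod>i\<in>I. (norm (v i - of_real (sqrt (6*d)*t))/norm (v i)) powr r i) &
  abs ((LINT t|stdn. (\<Prod>i\<in>I. (norm (v i - of_real (sqrt (6*d)*t))/norm (v i)) powr r i))-1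
   - d*(3*((\<Sum>i\<in>I. r i * Re (inverse (v i)))^2-(\<Sum>i\<in>I. r i * Re (inverse (v i^2)))))) <= C2*(d * sqrt d)"
  using gauss_prod_norm_powr_first_order[OF I y] by blast
 let ?A = "4 * R^2/y^4+4 * R/y^4"
 define C3 where "C3 = C2+3*?A"
 have C3: "0 <= C3" using C2 sums0  by (simp add: C3_def)
 define K where "K = 4*(E*Z)+3*((R/y)^2+R/y^2)"
 have K: "0 <= K" "E*Z <= K" "2*(E*Z) <= K" "3*(E*Z) <= K" "3*((R/y)^2+R/y^2) <= K" using E Z sums0  by (auto simp: K_def)
 obtain C4 where C4: "0 <= C4" "!!X Y x g d :: real. [|\<bar>X-1-d*x\<bar> <= C1*(d * sqrt d); \<bar>Y-1-d*g\<bar> <= C1*(d * sqrt d);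
  \<bar>x\<bar> <= K; \<bar>g\<bar> <= K; 0 < d; d <= 1|] ==> \<bar>X*Y-1-d*(x+g)\<bar> <= C4*(d * sqrt d)"
  using mult_first_order_ex[OF K(1) C1 C1] by metis
 obtain C5 where C5: "0 <= C5" "!!X Y x g d :: real. [|\<bar>X-1-d*x\<bar> <= C4*(d * sqrt d); \<bar>Y-1-d*g\<bar> <= C1*(d * sqrt d);
  \<bar>x\<bar> <= K; \<bar>g\<bar> <= K; 0 < d; d <= 1|] ==> \<bar>X*Y-1-d*(x+g)\<bar> <= C5*(d * sqrt d)"
  using mult_first_order_ex[OF K(1) C4(1) C1] by metis
 obtain C6 where C6: "0 <= C6" "!!X Y x g d :: real. [|\<bar>X-1-d*x\<bar> <= C5*(d * sqrt d); \<bar>Y-1-d*g\<bar> <= C3*(d * sqrt d);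
  \<bar>x\<bar> <= K; \<bar>g\<bar> <= K; 0 < d; d <= 1|] ==> \<bar>X*Y-1-d*(x+g)\<bar> <= C6*(d * sqrt d)"
  using mult_first_order_ex[OF K(1) C5(1) C3] by metis
 define d0 where "d0 = min 1 (min (1/(2*Z)) (1/(4*(E*Z))))"
 have d0: "0 < d0" "d0 <= 1" using Z E by (auto simp: d0_def)
 show ?thesis
 proof (intro exI conjI allI impI)
  show "0 <= C6" "0 < d0" "d0 <= 1" using C6 d0 by auto
  fix w :: "'i => complex" and d :: real
  assume w: "ALL i:I. y <= Im (w i)" and d: "0 < d" "d <= d0"
  have d1: "d <= 1" "2*d*Z <= 1" "4*d*(E*Z) <= 1" using d Z E by (auto simp: d0_def field_simps)
  have wn: "y <= norm (w i)" if "i : I" for i using w that abs_Im_le_cmod[of "w i"] by force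
  have iw: "norm (inverse (w i)) <= inverse y" if "i : I" for i using norm_inverse_le[OF y wn[OF that]] .
  define v where "v = (%i. w i - of_real (2*d)/w i)"
  have v: "y <= Im (v i)" "norm (inverse (v i)-inverse (w i)) <= 2*d/y^3"
    "norm (inverse ((v i)^2)-inverse ((w i)^2)) <= 4*d/y^4"
    "norm (v i)/norm (w i) = norm (1 + of_real d*(- 2*inverse ((w i)^2)))" if "i : I" for i
   unfolding v_def by (rule inverse_euler_shift; use y w that d in auto)+
  have prodZ: "norm (2*inverse (z*z')) <= Z" if "norm (inverse z) <= inverse y" "norm (inverse z') <= inverse y" for z z' :: complex
  proof -
   have "norm (inverse z)*norm (inverse z') <= inverse y*inverse y" using that y by (intro mult_mono) auto
   then show ?thesis by (simp add: norm_mult Z_def power2_eq_square divide_inverse)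
  qed
  define X1 where "X1 = (\<Prod>p\<in>I\<times>I. norm (1 + of_real d*(2*inverse (w (fst p)*w (snd p)))) powr a p)"
  define X2 where "X2 = (\<Prod>p\<in>I\<times>I. norm (1 + of_real d*(2*inverse (w (fst p) * cnj (w (snd p))))) powr b p)"
  define X3 where "X3 = (\<Prod>i\<in>I. norm (1 + of_real d*(- 2*inverse ((w i)^2))) powr r i)"
  define q where "q = (%t. \<Prod>i\<in>I. (norm (v i - of_real (sqrt (6*d)*t))/norm (v i)) powr r i)"
  define x1 where "x1 = (\<Sum>p\<in>I\<times>I. a p * Re (2*inverse (w (fst p)*w (snd p))))"
  define x2 where "x2 = (\<Sum>p\<in>I\<times>I. b p * Re (2*inverse (w (fst p) * cnj (w (snd p)))))"
  define x3 where "x3 = (\<Sum>i\<in>I. r i * Re (- 2*inverse ((w i)^2)))"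
  define x4 where "x4 = 3*((\<Sum>i\<in>I. r i * Re (inverse (w i)))^2-(\<Sum>i\<in>I. r i * Re (inverse (w i^2))))"
  have z1: "norm (2*inverse (w (fst p)*w (snd p))) <= Z" if "p : I \<times> I" for p using that by (intro prodZ iw) auto
  have z2: "norm (2*inverse (w (fst p) * cnj (w (snd p)))) <= Z" if "p : I \<times> I" for p using that iw by (intro prodZ) (auto simp: norm_inverse)
  have z3: "norm (- 2*inverse ((w i)^2)) <= Z" if "i : I" for i using prodZ[OF iw[OF that] iw[OF that]] by (simp add: power2_eq_square)
  have f1: "abs (X1-1-d*x1) <= C1*(d * sqrt d)" unfolding X1_def x1_def C1_def by (rule prod_norm_powr_first_order) (use I Z E d d1 z1 in auto)
  have f2: "abs (X2-1-d*x2) <= C1*(d * sqrt d)" unfolding X2_def x2_def C1_def by (rule prod_norm_powr_first_order) (use I Z E d d1 z2 in auto)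
  have f3: "abs (X3-1-d*x3) <= C1*(d * sqrt d)" unfolding X3_def x3_def C1_def by (rule prod_norm_powr_first_order) (use I Z E d d1 z3 in auto)
  have b1: "abs x1 <= E*Z" unfolding x1_def by (rule order_trans[OF abs_sum_mult_le[where B = Z]], rule order_trans[OF abs_Re_le_cmod z1])
     (use E Z in auto)
  have b2: "abs x2 <= E*Z" unfolding x2_def by (rule order_trans[OF abs_sum_mult_le[where B = Z]], rule order_trans[OF abs_Re_le_cmod z2])
     (use E Z in auto)
  have b3: "abs x3 <= E*Z" unfolding x3_def by (rule order_trans[OF abs_sum_mult_le[where B = Z]], rule order_trans[OF abs_Re_le_cmod z3])
     (use E Z in auto)
  define S where "S = (%u. \<Sum>i\<in>I. r i * Re (inverse (u i)))"
  define Q where "Q = (%u. \<Sum>i\<in>I. r i * Re (inverse ((u i)^2)))"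
  have Sb: "abs (S u) <= R/y" "abs (Q u) <= R/y^2" if u: "ALL i:I. y <= Im (u i)" for u
  proof -
   have iu: "norm (inverse (u i)) <= inverse y" if "i : I" for i using u that abs_Im_le_cmod[of "u i"] by (intro norm_inverse_le y) force
   have "abs (S u) <= R*inverse y" unfolding S_def R_def by (rule abs_sum_mult_le, rule order_trans[OF abs_Re_le_cmod iu])
   then show "abs (S u) <= R/y" by (simp add: divide_inverse)
   have "abs (Q u) <= R*inverse (y^2)" unfolding Q_def R_def
   proof (rule abs_sum_mult_le, rule order_trans[OF abs_Re_le_cmod])
    fix i assume "i : I"
    have "norm (inverse (u i))^2 <= inverse y^2" using iu[OF \<open>i \<in> I\<close>] by (intro power_mono) auto
    then show "norm (inverse ((u i)^2)) <= inverse (y^2)" by (simp add: norm_inverse norm_power power_inverse)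
   qed
   then show "abs (Q u) <= R/y^2" by (simp add: divide_inverse)
  qed
  have vI: "ALL i:I. y <= Im (v i)" using v by auto
  have x4_eq: "x4 = 3*((S w)^2-Q w)" unfolding x4_def S_def Q_def ..
  have b4: "abs x4 <= 3*((R/y)^2+R/y^2)"
  proof -
   have "(S w)^2 <= (R/y)^2" using Sb(1)[OF w] by (metis abs_ge_zero power2_abs power_mono)
   then have "abs ((S w)^2) <= (R/y)^2" by simp
   from add_mono[OF this Sb(2)[OF w]] have "abs ((S w)^2-Q w) <= (R/y)^2+R/y^2"
    using abs_triangle_ineq4[of "(S w)^2" "Q w"] by (rule order_trans[rotated])
   then show ?thesis unfolding x4_eq abs_mult by simp
  qed
  have "ALL i:I. y <= abs (Im (v i))" using vI by (meson abs_ge_self order_trans)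
  note c2 = C2(2)[OF this d(1) d1(1)]
  have f4: "abs (integral\<^sup>L stdn q-1-d*x4) <= C3*(d * sqrt d)"
  proof -
   let ?B = "(S v)^2-Q v"
   have fa: "abs (integral\<^sup>L stdn q-1-d*(3*?B)) <= C2*(d * sqrt d)" using c2 unfolding q_def S_def Q_def by blast
   have "abs (3*?B-x4) <= 3*?A*d"
   proof -
    have "S v-S w = (\<Sum>i\<in>I. r i * Re (inverse (v i)-inverse (w i)))"
     by (simp only: S_def sum_subtractf[symmetric] right_diff_distrib[symmetric] minus_complex.sel)
    also have "abs ... <= R*(2*d/y^3)" unfolding R_def by (rule abs_sum_mult_le, rule order_trans[OF abs_Re_le_cmod v(2)])
    finally have 1: "abs (S v-S w) <= R*(2*d/y^3)" .
    have "Q v-Q w = (\<Sum>i\<in>I. r i * Re (inverse ((v i)^2)-inverse ((w i)^2)))"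
     by (simp only: Q_def sum_subtractf[symmetric] right_diff_distrib[symmetric] minus_complex.sel)
    also have "abs ... <= R*(4*d/y^4)" unfolding R_def by (rule abs_sum_mult_le, rule order_trans[OF abs_Re_le_cmod v(3)])
    finally have 2: "abs (Q v-Q w) <= R*(4*d/y^4)" .
    have "abs ((S v)^2-(S w)^2) = abs (S v-S w)*abs (S v+S w)" by (simp add: power2_eq_square algebra_simps flip: abs_mult)
    also have "... <= (R*(2*d/y^3))*(2*(R/y))" using Sb(1)[OF w] Sb(1)[OF vI] sums0 d y by (intro mult_mono 1) auto
    also have "... = 4 * R^2/y^4*d" by (simp add: field_simps eval_nat_numeral)
    finally have 3: "abs ((S v)^2-(S w)^2) <= 4 * R^2/y^4*d" .
    have "3*?B-x4 = 3*(((S v)^2-(S w)^2)-(Q v-Q w))" unfolding x4_eq by (simp only: right_diff_distrib)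
    then have "abs (3*?B-x4) <= 3*(4 * R^2/y^4*d+R*(4*d/y^4))"
    proof -
     have "abs (((S v)^2-(S w)^2)-(Q v-Q w)) <= 4 * R^2/y^4*d+R*(4*d/y^4)" by (rule order_trans[OF abs_triangle_ineq4 add_mono[OF 3 2]])
     then show ?thesis unfolding \<open>3*((S v)\<^sup>2-Q v)-x4 = _\<close> abs_mult by simp
    qed
    then show ?thesis by (simp add: algebra_simps)
   qed
   then have "abs (d*(3*?B-x4)) <= d*(3*?A*d)" using d by (simp only: abs_mult abs_of_pos) (intro mult_left_mono, auto)
   also have "... <= d*(3*?A * sqrt d)"
   proof -
    have "d <= sqrt d" using d d1 by (intro real_le_rsqrt) (simp add: power2_eq_square)
    then show ?thesis using d sums0  by (intro mult_left_mono) auto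
   qed
   finally have fb: "abs (d*(3*?B-x4)) <= (C3-C2)*(d * sqrt d)" by (simp add: C3_def mult_ac)
   show ?thesis using order_trans[OF abs_triangle_ineq add_mono[OF fa fb]] by (simp add: algebra_simps)
  qed
  have "abs (X1*X2-1-d*(x1+x2)) <= C4*(d * sqrt d)" by (rule C4(2)[OF f1 f2]) (use b1 b2 K d d1 in auto)
  then have "abs (X1*X2*X3-1-d*(x1+x2+x3)) <= C5*(d * sqrt d)" by (rule C5(2)[OF _ f3]) (use b1 b2 b3 K d d1 in auto)
  then have main: "abs (X1*X2*X3*integral\<^sup>L stdn q-1-d*(x1+x2+x3+x4)) <= C6*(d * sqrt d)"
   by (rule C6(2)[OF _ f4]) (use b1 b2 b3 b4 K d d1 in auto)
  have ratio: "vratio I a b r d w = (%t. X1*X2*X3*q t)"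
  proof
   fix t
   have "(\<Prod>i\<in>I. (norm (w i - of_real (2*d)/w i - of_real (sqrt (6*d)*t))/norm (w i)) powr r i) = X3*q t"
    unfolding X3_def q_def prod.distrib[symmetric]
   proof (rule prod.cong[OF refl])
    fix i assume i: "i : I"
    have vn: "norm (v i) > 0" using vI i y  by force
    have "norm (w i - of_real (2*d)/w i - of_real (sqrt (6*d)*t))/norm (w i)
     = (norm (v i)/norm (w i))*(norm (v i - of_real (sqrt (6*d)*t))/norm (v i))" using vn by (simp add: v_def)
    then show "(norm (w i - of_real (2*d)/w i - of_real (sqrt (6*d)*t))/norm (w i)) powr r i
     = norm (1 + of_real d*(- 2*inverse ((w i)^2))) powr r i*(norm (v i - of_real (sqrt (6*d)*t))/norm (v i)) powr r i"
     by (simp only: v(4)[OF i] powr_mult)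
   qed
   then show "vratio I a b r d w t = X1*X2*X3*q t" unfolding vratio_def X1_def X2_def by (simp add: divide_inverse mult_ac)
  qed
  have "integrable stdn q" using c2 unfolding q_def by blast
  then show "integrable stdn (vratio I a b r d w)" by (simp add: ratio)
  have "vdrift I a b r w = x1+x2+x3+x4" unfolding vdrift_def x1_def x2_def x3_def x4_def by (simp add: sum_negf) (simp add: sum_distrib_left mult_ac)
  then show "abs (integral\<^sup>L stdn (vratio I a b r d w)-1-d * vdrift I a b r w) <= C6*(d * sqrt d)" using main  by (simp add: ratio)
 qed
qed

section \<open>Vertex products along the Euler scheme\<close>

definition nseq :: "real => (nat => real) => nat => real" where
 "nseq d t k = sqrt (6*d)*t k"

definition vM :: "'i set => ('i \<times> 'i => real) => ('i \<times> 'i => real) => ('i => real) => real => ('i => complex) => (nat => real) => nat => real" where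
 "vM I a b r d z t k = (\<Prod>p\<in>I\<times>I. norm (eulq d (nseq d t) (z (fst p)) (z (snd p)) k) powr a p)
  * (\<Prod>p\<in>I\<times>I. norm (eulq d (nseq d t) (z (fst p)) (cnj (z (snd p))) k) powr b p)
  * (\<Prod>i\<in>I. norm (eul d (nseq d t) (z i) k) powr r i)"

definition eulz :: "real => ('i => complex) => (nat => real) => nat => 'i => complex" where
 "eulz d z t k = (%i. eul d (nseq d t) (z i) k)"

abbreviation stdnP :: "nat => (nat => real) measure" where
 "stdnP n \<equiv> PiM {..<n} (%_. stdn)"

lemma vM_nonneg: "0 <= vM I a b r d z t k" by (simp add: vM_def prod_nonneg)

lemma vM_0: "vM I a b r d z t 0 = (\<Prod>i\<in>I. norm (z i) powr r i)" by (simp add: vM_def eulq_def)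

lemma eulq_cong: "(!!i. i < k ==> x i = y i) ==> eulq d x z w k = eulq d y z w k"
 unfolding eulq_def by (intro prod.cong refl arg_cong2[where f = "%u v. 1 + of_real (2*d)/(u * v)"] eul_cong) auto

text \<open>Non-anticipation: the state after k steps does not see the normal with index k, which
  drives the next step.\<close>

lemma vM_upd: "vM I a b r d z (t(k := u)) k = vM I a b r d z t k"
proof -
 have "eul d (nseq d (t(k := u))) w k = eul d (nseq d t) w k" for w by (rule eul_cong) (simp add: nseq_def)
 moreover have "eulq d (nseq d (t(k := u))) w w' k = eulq d (nseq d t) w w' k" for w w' by (rule eulq_cong) (simp add: nseq_def)
 ultimately show ?thesis by (simp add: vM_def)
qed

lemma eulz_upd: "eulz d z (t(k := u)) k = eulz d z t k" unfolding eulz_def by (intro ext eul_cong) (simp add: nseq_def)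

lemma vM_Suc:
 assumes d: "0 <= d" and z: "!!i. i : I ==> 0 < Im (z i)"
 shows "vM I a b r d z t (Suc k) = vM I a b r d z t k * vratio I a b r d (eulz d z t k) (t k)"
proof -
 let ?e = "eulz d z t k"
 have A: "(\<Prod>p\<in>I\<times>I. norm (eulq d (nseq d t) (z (fst p)) (z (snd p)) (Suc k)) powr a p) =
   (\<Prod>p\<in>I\<times>I. norm (eulq d (nseq d t) (z (fst p)) (z (snd p)) k) powr a p) *
   (\<Prod>p\<in>I\<times>I. norm (1 + of_real (2*d)/(?e (fst p)*?e (snd p))) powr a p)"
  unfolding prod.distrib[symmetric] by (intro prod.cong refl) (simp add: eulq_def eulz_def norm_mult powr_mult)
 have B: "(\<Prod>p\<in>I\<times>I. norm (eulq d (nseq d t) (z (fst p)) (cnj (z (snd p))) (Suc k)) powr b p) =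
   (\<Prod>p\<in>I\<times>I. norm (eulq d (nseq d t) (z (fst p)) (cnj (z (snd p))) k) powr b p) *
   (\<Prod>p\<in>I\<times>I. norm (1 + of_real (2*d)/(?e (fst p) * cnj (?e (snd p)))) powr b p)"
  unfolding prod.distrib[symmetric] by (intro prod.cong refl) (simp add: eulq_def eulz_def norm_mult powr_mult eul_cnj)
 have C: "(\<Prod>i\<in>I. norm (eul d (nseq d t) (z i) (Suc k)) powr r i) = (\<Prod>i\<in>I. norm (eul d (nseq d t) (z i) k) powr r i) *
   (\<Prod>i\<in>I. (norm (?e i - of_real (2*d)/?e i - of_real (sqrt (6*d)*t k))/norm (?e i)) powr r i)" unfolding prod.distrib[symmetric]
 proof (intro prod.cong refl)
  fix i assume "i : I"
  then have "norm (eul d (nseq d t) (z i) k) ~= 0" using eul_nonzero(1)[OF d, of "z i"] z[of i] by auto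
  then have "norm (eul d (nseq d t) (z i) (Suc k)) = norm (eul d (nseq d t) (z i) k) *
    (norm (?e i - of_real (2*d)/?e i - of_real (sqrt (6*d)*t k))/norm (?e i))" by (simp add: eulz_def nseq_def)
  then show "norm (eul d (nseq d t) (z i) (Suc k)) powr r i = norm (eul d (nseq d t) (z i) k) powr r i *
    (norm (?e i - of_real (2*d)/?e i - of_real (sqrt (6*d)*t k))/norm (?e i)) powr r i" by (simp only: powr_mult)
 qed
 show ?thesis unfolding vM_def vratio_def A B C by (simp)
qed

lemma sets_stdnP: "sets (stdnP n) = sets (PiM {..<n} (%_. borel))" by (intro sets_PiM_cong) auto

lemma measurable_eul:
 assumes "k <= n"
 shows "(%t. eul d (nseq d t) z k) : borel_measurable (stdnP n)" using assms
proof (induction k)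
 case (Suc k)
 have "(%t. t k) : borel_measurable (stdnP n)" unfolding measurable_cong_sets[OF sets_stdnP refl]
  using Suc.prems by (intro measurable_component_singleton) auto
 then have "(%t. nseq d t k) : borel_measurable (stdnP n)" unfolding nseq_def by (intro borel_measurable_times borel_measurable_const)
 moreover have "(%t. eul d (nseq d t) z k) : borel_measurable (stdnP n)" using Suc by simp
 ultimately show ?case by simp
qed simp

lemma measurable_eulq:
 assumes "k <= n"
 shows "(%t. eulq d (nseq d t) z w k) : borel_measurable (stdnP n)" unfolding eulq_def
 by (intro borel_measurable_prod borel_measurable_add borel_measurable_divide borel_measurable_times borel_measurable_const measurable_eul)
   (use assms in auto)

lemma borel_measurable_cnj [measurable]: "cnj : borel_measurable borel" by (intro borel_measurable_continuous_onI continuous_intros)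

lemma measurable_vM:
 assumes "k <= n"
 shows "(%t. vM I a b r d z t k) : borel_measurable (stdnP n)"
proof -
 have [measurable]: "(%t. eulq d (nseq d t) z w k) : borel_measurable (stdnP n)" for z w by (rule measurable_eulq[OF assms])
 have [measurable]: "(%t. eul d (nseq d t) z k) : borel_measurable (stdnP n)" for z by (rule measurable_eul[OF assms])
 show ?thesis unfolding vM_def by measurable
qed

lemma vdrift_bounded:
 assumes y: "0 < y"
 shows "EX D>=0. ALL w. (ALL i:I. y <= Im (w i)) --> abs (vdrift I a b r w) <= D"
proof -
 define A where "A = (\<Sum>p\<in>I\<times>I. abs (a p))"
 define B where "B = (\<Sum>p\<in>I\<times>I. abs (b p))"
 define R where "R = (\<Sum>i\<in>I. abs (r i))"
 define Y where "Y = inverse y*inverse y"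
 define D where "D = 2*(A*Y)+2*(B*Y)+5*(R*Y)+3*(R*inverse y)^2"
 have "0 <= D" unfolding D_def A_def B_def R_def Y_def using y by (intro add_nonneg_nonneg mult_nonneg_nonneg sum_nonneg) auto
 moreover have "abs (vdrift I a b r w) <= D" if w: "ALL i:I. y <= Im (w i)" for w
 proof -
  have iw: "norm (inverse (w i)) <= inverse y" if "i : I" for i using w that abs_Im_le_cmod[of "w i"] by (intro norm_inverse_le y) force
  have prodY: "abs (Re (inverse (u * v))) <= Y" if "norm (inverse u) <= inverse y" "norm (inverse v) <= inverse y" for u v
  proof -
   have "abs (Re (inverse (u * v))) <= norm (inverse u)*norm (inverse v)"
    using abs_Re_le_cmod[of "inverse (u * v)"] by (simp only: inverse_mult_distrib norm_mult)
   also have "... <= Y" unfolding Y_def using that y by (intro mult_mono) auto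
   finally show ?thesis .
  qed
  have 1: "abs (\<Sum>p\<in>I\<times>I. a p * Re (inverse (w (fst p)*w (snd p)))) <= A*Y" unfolding A_def by (intro abs_sum_mult_le prodY iw) auto
  have 2: "abs (\<Sum>p\<in>I\<times>I. b p * Re (inverse (w (fst p) * cnj (w (snd p))))) <= B*Y"
   unfolding B_def using iw by (intro abs_sum_mult_le prodY) (auto simp: norm_inverse)
  have 3: "abs (\<Sum>i\<in>I. r i * Re (inverse (w i^2))) <= R*Y" unfolding R_def power2_eq_square by (intro abs_sum_mult_le prodY iw) auto
  have "abs (\<Sum>i\<in>I. r i * Re (inverse (w i))) <= R*inverse y"
   unfolding R_def by (rule abs_sum_mult_le, rule order_trans[OF abs_Re_le_cmod iw])
  then have 4: "abs ((\<Sum>i\<in>I. r i * Re (inverse (w i)))^2) <= (R*inverse y)^2" by (metis abs_ge_zero abs_power2 power2_abs power_mono)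
  have sc: "abs (c*x) <= c*X" if "abs x <= X" "0 <= c" for c x X :: real using that by (simp add: abs_mult mult_left_mono)
  show ?thesis unfolding vdrift_def D_def
   by (intro order_trans[OF abs_triangle_ineq add_mono] order_trans[OF abs_triangle_ineq4 add_mono] sc 1 2 3 4) auto
 qed
 ultimately show ?thesis by auto
qed

lemma eulz_Im:
 assumes "0 <= d" "ALL i:I. y <= Im (z i)" "0 < y"
 shows "ALL i:I. y <= Im (eulz d z t k i)" using eul_Im[OF assms(1)] assms(2,3) unfolding eulz_def by (meson less_le_trans order_trans)

lemma measurable_vdrift:
 assumes "k <= n"
 shows "(%t. vdrift I a b r (eulz d z t k)) : borel_measurable (stdnP n)"
proof -
 have [measurable]: "(%t. eulz d z t k i) : borel_measurable (stdnP n)" for i unfolding eulz_def by (rule measurable_eul[OF assms])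
 show ?thesis unfolding vdrift_def by measurable
qed

lemma measurable_vratio:
 assumes "k <= n"
 shows "(%(t, u). vratio I a b r d (eulz d z t k) u) : borel_measurable (stdnP n \<Otimes>\<^sub>M stdn)"
proof -
 have [measurable]: "(%t. eulz d z t k i) : borel_measurable (stdnP n)" for i unfolding eulz_def by (rule measurable_eul[OF assms])
 show ?thesis unfolding vratio_def by measurable
qed

lemma vratio_nonneg: "0 <= vratio I a b r d w u" by (simp add: vratio_def prod_nonneg)

lemma prob_space_stdnP: "prob_space (stdnP n)" by (intro prob_space_PiM prob_space_stdn)

text \<open>Integrating out the newest coordinate replaces the one-step ratio by its conditional
  mean \<open>x t\<close>, the Markov property in product form. Integrability passes to the next
  step because this mean is bounded.\<close>

lemma vM_chain_step:
 fixes r :: "'i => real"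
 assumes I: "finite I" and y: "0 < y"
 shows "EX C d0. 0 <= C & 0 < d0 & d0 <= 1 & (ALL z d k. (ALL i:I. y <= Im (z i)) --> 0 < d --> d <= d0 -->
   integrable (stdnP k) (%t. vM I a b r d z t k) --> integrable (stdnP (Suc k)) (%t. vM I a b r d z t (Suc k)) &
   integrable (stdnP k) (%t. vM I a b r d z t k * vdrift I a b r (eulz d z t k)) &
   abs ((LINT t|stdnP (Suc k). vM I a b r d z t (Suc k))-(LINT t|stdnP k. vM I a b r d z t k)
     - d*(LINT t|stdnP k. vM I a b r d z t k * vdrift I a b r (eulz d z t k))) <= C*(d * sqrt d)*(LINT t|stdnP k. vM I a b r d z t k))"
proof -
 obtain C d0 where C: "0 <= C" "0 < d0" "d0 <= 1" "!!w d. (ALL i:I. y <= Im (w i)) ==> 0 < d ==> d <= d0 ==> integrable stdn (vratio I a b r d w) &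
   abs (integral\<^sup>L stdn (vratio I a b r d w)-1-d * vdrift I a b r w) <= C*(d * sqrt d)" using euler_step_first_order[OF I y, of a b r] by blast
 obtain D where D: "0 <= D" "!!w. (ALL i:I. y <= Im (w i)) ==> abs (vdrift I a b r w) <= D" using vdrift_bounded[OF y, of I a b r] by blast
 show ?thesis
 proof (rule exI[of _ C], rule exI[of _ d0], rule conjI[OF C(1)], rule conjI[OF C(2)], rule conjI[OF C(3)], intro allI impI)
  fix z :: "'i => complex" and d :: real and k :: nat
  assume z: "ALL i:I. y <= Im (z i)" and d: "0 < d" "d <= d0" and int: "integrable (stdnP k) (%t. vM I a b r d z t k)"
  interpret S: prob_space stdn by (rule prob_space_stdn)
  interpret product_sigma_finite "%_::nat. stdn" by (intro product_sigma_finite.intro) (rule S.sigma_finite_measure_axioms)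
  define m where "m = (%t. vM I a b r d z t k)"
  define x where "x = (%t. integral\<^sup>L stdn (vratio I a b r d (eulz d z t k)))"
  define v where "v = (%t. vdrift I a b r (eulz d z t k))"
  have ez: "ALL i:I. y <= Im (eulz d z t k i)" for t using eulz_Im[of d I y z] z d y by auto
  have x: "integrable stdn (vratio I a b r d (eulz d z t k))" "abs (x t-1-d * v t) <= C*(d * sqrt d)" for t
   using C(4)[OF ez d] by (auto simp: x_def v_def)
  have v: "abs (v t) <= D" for t using D(2)[OF ez] by (simp add: v_def)
  have m_meas: "m : borel_measurable (stdnP k)" using measurable_vM[of k k] by (simp add: m_def)
  have v_meas: "v : borel_measurable (stdnP k)" using measurable_vdrift[of k k] by (simp add: v_def)
  have x_meas: "x : borel_measurable (stdnP k)" unfolding x_def by (rule S.borel_measurable_lebesgue_integral[OF measurable_vratio]) simp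
  have m0: "0 <= m t" for t by (simp add: m_def vM_nonneg)
  have x0: "0 <= x t" for t unfolding x_def by (intro integral_nonneg_AE AE_I2 vratio_nonneg)
  have m_int: "integrable (stdnP k) m" using int by (simp add: m_def)
  have mv_int: "integrable (stdnP k) (%t. m t * v t)"
  proof (rule Bochner_Integration.integrable_bound[OF integrable_mult_right[OF m_int, of D]])
   show "AE t in stdnP k. norm (m t * v t) <= norm (D*m t)"
   proof (rule AE_I2)
    fix t
    have "m t*abs (v t) <= m t*D" using v m0 by (intro mult_left_mono) auto
    then show "norm (m t * v t) <= norm (D*m t)" using m0[of t] D(1) by (simp add: abs_mult mult.commute)
   qed
  qed (use m_meas v_meas in measurable)
  have xb: "abs (x t) <= 1+d*D+C*(d * sqrt d)" for t
  proof -
   have "abs (d * v t) <= d*D" using v[of t] d by (simp add: abs_mult)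
   then show ?thesis using x(2)[of t] by linarith
  qed
  have mx_int: "integrable (stdnP k) (%t. m t*x t)"
  proof (rule Bochner_Integration.integrable_bound[OF integrable_mult_right[OF m_int, of "1+d*D+C*(d * sqrt d)"]])
   show "AE t in stdnP k. norm (m t*x t) <= norm ((1+d*D+C*(d * sqrt d))*m t)"
   proof (rule AE_I2)
    fix t
    have "m t*abs (x t) <= m t*(1+d*D+C*(d * sqrt d))" using xb m0 by (intro mult_left_mono) auto
    then show "norm (m t*x t) <= norm ((1+d*D+C*(d * sqrt d))*m t)" using m0[of t] D C d by (simp add: abs_mult mult.commute)
   qed
  qed (use m_meas x_meas in measurable)
  let ?A = "\<integral>\<^sup>+t. ennreal (m t*x t) \<partial>stdnP k"
  let ?C = "\<integral>\<^sup>+t. ennreal (vM I a b r d z t (Suc k)) \<partial>stdnP (Suc k)"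
  have nn: "?C = ?A"
  proof -
   have ins: "{..<Suc k} = insert k {..<k}" by auto
   have "?C = (\<integral>\<^sup>+t. (\<integral>\<^sup>+u. ennreal (vM I a b r d z (t(k := u)) (Suc k)) \<partial>stdn) \<partial>stdnP k)"
    unfolding ins by (rule product_nn_integral_insert) (use measurable_vM[of "Suc k" "Suc k" I a b r d z] in "auto simp: ins")
   also have "... = ?A"
   proof (rule nn_integral_cong)
    fix t
    have "vM I a b r d z (t(k := u)) (Suc k) = m t * vratio I a b r d (eulz d z t k) u" for u
     using vM_Suc[of d I z a b r "t(k := u)" k] z y d by (force simp: vM_upd eulz_upd m_def)
    then have "(\<integral>\<^sup>+u. ennreal (vM I a b r d z (t(k := u)) (Suc k)) \<partial>stdn) = (\<integral>\<^sup>+u. ennreal (m t * vratio I a b r d (eulz d z t k) u) \<partial>stdn)"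
     by simp
    also have "... = ennreal (LINT u|stdn. m t * vratio I a b r d (eulz d z t k) u)"
     by (rule nn_integral_eq_integral) (use x(1) m0 vratio_nonneg in "auto intro!: AE_I2 mult_nonneg_nonneg")
    finally show "(\<integral>\<^sup>+u. ennreal (vM I a b r d z (t(k := u)) (Suc k)) \<partial>stdn) = ennreal (m t*x t)" by (simp add: x_def)
   qed
   finally show ?thesis .
  qed
  let ?B = "\<integral>t. m t*x t \<partial>stdnP k"
  have nn2: "?A = ennreal ?B" by (rule nn_integral_eq_integral[OF mx_int]) (use m0 x0 in "auto intro!: mult_nonneg_nonneg")
  let ?D = "integrable (stdnP (Suc k)) (%t. vM I a b r d z t (Suc k))"
  have int1: "?D" by (rule integrableI_nonneg) (use measurable_vM[of "Suc k" "Suc k"] vM_nonneg nn nn2 in "auto intro!: AE_I2")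
  have val: "(LINT t|stdnP (Suc k). vM I a b r d z t (Suc k)) = ?B" using m0 x0 integral_eq_nn_integral[OF borel_measurable_integrable[OF int1] AE_I2[OF vM_nonneg]] nn nn2 by simp
  have "?B-integral\<^sup>L (stdnP k) m-d*(LINT t|stdnP k. m t * v t)
   = (LINT t|stdnP k. m t*(x t-1-d * v t))" using mx_int m_int mv_int by (simp add: algebra_simps)
  also have "abs ... <= (LINT t|stdnP k. C*(d * sqrt d)*m t)"
  proof (rule order_trans[OF integral_abs_bound integral_mono])
   show "integrable (stdnP k) (%t. abs (m t*(x t-1-d * v t)))" using mx_int m_int mv_int by (intro integrable_abs) (simp add: algebra_simps)
   show "abs (m t*(x t-1-d * v t)) <= C*(d * sqrt d)*m t" for t
    using mult_left_mono[OF x(2)[of t] m0[of t]] m0[of t] by (simp add: abs_mult mult.commute)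
  qed (use m_int in simp)
  finally show "?D & integrable (stdnP k) (%t. vM I a b r d z t k * vdrift I a b r (eulz d z t k)) &
   abs ((LINT t|stdnP (Suc k). vM I a b r d z t (Suc k))-(LINT t|stdnP k. vM I a b r d z t k)
     - d*(LINT t|stdnP k. vM I a b r d z t k * vdrift I a b r (eulz d z t k))) <= C*(d * sqrt d)*(LINT t|stdnP k. vM I a b r d z t k)"
   using int1 mv_int val by (simp add: m_def v_def)
 qed
qed

text \<open>N relative errors of size d sqrt d with N d = 1 accumulate to a factor that tends to
  1.\<close>

lemma sqrt_pow_bound:
 assumes "0 <= C" "0 < N"
 shows "(1+C*(1/real N * sqrt (1/real N)))^N <= exp (C * sqrt (1/real N))"
proof -
 have "(1+C*(1/real N * sqrt (1/real N)))^N <= exp (C*(1/real N * sqrt (1/real N)))^N" using assms by (intro power_mono exp_ge_add_one_self) auto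
 also have "... = exp (C * sqrt (1/real N))" by (simp flip: exp_of_nat_mult)
 finally show ?thesis .
qed

definition vexp :: "'i set => ('i \<times> 'i => real) => ('i \<times> 'i => real) => ('i => real) => real => ('i => complex) => nat => real" where
 "vexp I a b r d z k = (LINT t|stdnP k. vM I a b r d z t k)"

lemma vexp_0:
 shows "vexp I a b r d z 0 = (\<Prod>i\<in>I. norm (z i) powr r i)" and "integrable (stdnP 0) (%t. vM I a b r d z t 0)"
proof -
 interpret prob_space "PiM ({} :: nat set) (%_. stdn)" using prob_space_stdnP[of 0] by simp
 show "vexp I a b r d z 0 = (\<Prod>i\<in>I. norm (z i) powr r i)" by (simp add: vexp_def vM_0 prob_space)
 show "integrable (stdnP 0) (%t. vM I a b r d z t 0)" by (simp add: vM_0)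
qed

lemma vexp_step:
 fixes r :: "'i => real"
 assumes I: "finite I" and y: "0 < y"
 shows "EX C d0. 0 <= C & 0 < d0 & d0 <= 1 & (ALL z d k. (ALL i:I. y <= Im (z i)) --> 0 < d --> d <= d0 -->
   integrable (stdnP k) (%t. vM I a b r d z t k) & integrable (stdnP k) (%t. vM I a b r d z t k * vdrift I a b r (eulz d z t k))
   & abs (vexp I a b r d z (Suc k)-vexp I a b r d z k - d*(LINT t|stdnP k. vM I a b r d z t k * vdrift I a b r (eulz d z t k)))
    <= C*(d * sqrt d) * vexp I a b r d z k)"
proof -
 obtain C d0 where C: "0 <= C" "0 < d0" "d0 <= 1"
  "!!z d k. [|ALL i:I. y <= Im (z i); 0 < d; d <= d0; integrable (stdnP k) (%t. vM I a b r d z t k)|] ==>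
   integrable (stdnP (Suc k)) (%t. vM I a b r d z t (Suc k)) & integrable (stdnP k) (%t. vM I a b r d z t k * vdrift I a b r (eulz d z t k)) &
   abs ((LINT t|stdnP (Suc k). vM I a b r d z t (Suc k))-(LINT t|stdnP k. vM I a b r d z t k)
     - d*(LINT t|stdnP k. vM I a b r d z t k * vdrift I a b r (eulz d z t k))) <= C*(d * sqrt d)*(LINT t|stdnP k. vM I a b r d z t k)"
  using vM_chain_step[OF I y, of a b r] by blast
 have int: "integrable (stdnP k) (%t. vM I a b r d z t k)" if "ALL i:I. y <= Im (z i)" "0 < d" "d <= d0" for z d k
  by (induction k) (use vexp_0(2) C(4) that in blast)+
 show ?thesis unfolding vexp_def
  by (rule exI[of _ C], rule exI[of _ d0], rule conjI[OF C(1)], rule conjI[OF C(2)], rule conjI[OF C(3)], intro allI impI) (use C(4) int in blast)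
qed

lemma vexp_supermartingale:
 fixes r :: "'i => real"
 assumes I: "finite I" and y: "0 < y" and drift: "!!w. ALL i:I. y <= Im (w i) ==> vdrift I a b r w <= 0"
 shows "EX C d0. 0 <= C & 0 < d0 & (ALL z N. (ALL i:I. y <= Im (z i)) --> 0 < N --> 1/real N <= d0 -->
   integrable (stdnP N) (%t. vM I a b r (1/real N) z t N) &
   vexp I a b r (1/real N) z N <= exp (C * sqrt (1/real N))*(\<Prod>i\<in>I. norm (z i) powr r i))"
proof -
 obtain C d0 where C: "0 <= C" "0 < d0" "d0 <= 1"
  "!!z d k. [|ALL i:I. y <= Im (z i); 0 < d; d <= d0|] ==> integrable (stdnP k) (%t. vM I a b r d z t k)
   & integrable (stdnP k) (%t. vM I a b r d z t k * vdrift I a b r (eulz d z t k)) & abs (vexp I a b r d z (Suc k)-vexp I a b r d z k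
     - d*(LINT t|stdnP k. vM I a b r d z t k * vdrift I a b r (eulz d z t k))) <= C*(d * sqrt d) * vexp I a b r d z k"
  using vexp_step[OF I y, of a b r] by blast
 show ?thesis
 proof (rule exI[of _ C], rule exI[of _ d0], rule conjI[OF C(1)], rule conjI[OF C(2)], intro allI impI conjI)
  fix z :: "'i => complex" and N :: nat
  assume z: "ALL i:I. y <= Im (z i)" and N: "0 < N" "1/real N <= d0"
  define d where "d = 1/real N"
  have d: "0 < d" "d <= d0" using N by (auto simp: d_def)
  show "integrable (stdnP N) (%t. vM I a b r (1/real N) z t N)" using C(4)[OF z d] by (simp add: d_def)
  let ?A = "\<Prod>i\<in>I. norm (z i) powr r i"
  let ?B = "1+C*(d * sqrt d)"
  have "vexp I a b r d z k <= ?B^k*?A" for k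
  proof (induction k)
   case 0
   then show ?case by (simp add: vexp_0)
  next
   case (Suc k)
   have "(LINT t|stdnP k. vM I a b r d z t k * vdrift I a b r (eulz d z t k)) <= (LINT t|stdnP k. 0)"
   proof (rule integral_mono)
    fix t
    have "vdrift I a b r (eulz d z t k) <= 0" by (rule drift[OF eulz_Im]) (use d z y in auto)
    then show "vM I a b r d z t k * vdrift I a b r (eulz d z t k) <= 0" using vM_nonneg by (intro mult_nonneg_nonpos)
   qed (use C(4)[OF z d] in auto)
   then have "d*(LINT t|stdnP k. vM I a b r d z t k * vdrift I a b r (eulz d z t k)) <= 0" using d by (simp add: mult_nonneg_nonpos)
   moreover have "abs (vexp I a b r d z (Suc k)-vexp I a b r d z k - d*(LINT t|stdnP k. vM I a b r d z t k * vdrift I a b r (eulz d z t k)))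
    <= C*(d * sqrt d) * vexp I a b r d z k" using C(4)[OF z d] by blast
   ultimately have "vexp I a b r d z (Suc k) <= ?B * vexp I a b r d z k" by (simp add: distrib_right)
   also have "... <= ?B*(?B^k*?A)" using Suc C(1) d by (intro mult_left_mono) auto
   finally show ?case by simp
  qed
  then have "vexp I a b r d z N <= ?B^N*?A" .
  also have "... <= exp (C * sqrt d)*?A" unfolding d_def by (intro mult_right_mono sqrt_pow_bound C N prod_nonneg) auto
  finally show "vexp I a b r (1/real N) z N <= exp (C * sqrt (1/real N))*?A" by (simp add: d_def)
 qed
qed

section \<open>Vertex products for the continuous flow\<close>

text \<open>The divisor is the standard deviation of an increment of sqrt 6 times Brownian motion;
  the restriction makes the sequence a point of the product space.\<close>

definition nincr :: "(real => real) => nat => nat => real" where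
 "nincr W j = (\<lambda>k\<in>{..<2^j}. incr W (2^j) k/sqrt (6/2^j))"

text \<open>A process on the unit interval whose dyadic increments are those of \<open>sqrt 6\<close> times a Brownian motion;
  no initial value is prescribed.\<close>

definition rbm :: "'a measure => ('a => real => real) => bool" where
 "rbm M W \<longleftrightarrow> prob_space M & (ALL t:{0..1}. (%w. W w t) : borel_measurable M) & (AE w in M. continuous_on {0..1} (W w)) &
   (ALL j. distr M (PiM {..<2^j} (%_. borel)) (%w. nincr (W w) j) = stdnP (2^j))"

text \<open>Taken as a limit of Euler schemes rather than as \<open>cflow\<close>: this gives
  measurability in the sample point at once and dependence on the dyadic increments alone, which the
  germ argument relies on.\<close>

definition fl :: "(real => real) => complex => complex" where
 "fl W z = lim (%j. eulW W j z)"

definition qf :: "(real => real) => complex => complex => complex" where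
 "qf W z w = lim (%j. eulWq W j z w)"

definition vL :: "'i set => ('i \<times> 'i => real) => ('i \<times> 'i => real) => ('i => real) => ('i => complex) => (real => real) => real" where
 "vL I a b r z W = (\<Prod>p\<in>I\<times>I. norm (qf W (z (fst p)) (z (snd p))) powr a p)
  * (\<Prod>p\<in>I\<times>I. norm (qf W (z (fst p)) (cnj (z (snd p)))) powr b p) * (\<Prod>i\<in>I. norm (fl W (z i)) powr r i)"

lemma eulW_nincr:
 "eul (1/2^j) (nseq (1/2^j) (nincr W j)) z (2^j) = eulW W j z"
 "eulq (1/2^j) (nseq (1/2^j) (nincr W j)) z w (2^j) = eulWq W j z w"
proof -
 have "nseq (1/2^j) (nincr W j) k = incr W (2^j) k" if "k < 2^j" for k using that by (simp add: nseq_def nincr_def)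
 then show "eul (1/2^j) (nseq (1/2^j) (nincr W j)) z (2^j) = eulW W j z"
  "eulq (1/2^j) (nseq (1/2^j) (nincr W j)) z w (2^j) = eulWq W j z w" unfolding eulW_def eulWq_def by (auto intro!: eul_cong eulq_cong)
qed

lemma fl_continuous:
 assumes W: "continuous_on {0..1} W" and z: "0 < Im z"
 shows "(%j. eulW W j z) \<longlonglongrightarrow> fl W z" "fl W z = cflow W z" using eulW_tendsto[OF W z] by (auto simp: fl_def limI)

lemma eulW_cnj: "eulW W j (cnj z) = cnj (eulW W j z)" by (simp add: eulW_def eul_cnj)

lemma qf_continuous:
 assumes W: "continuous_on {0..1} W" and z: "0 < Im z" "0 < Im w"
 shows "qf W z z = deriv (cflow W) z" "(%j. eulWq W j z z) \<longlonglongrightarrow> qf W z z"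
  and "z ~= w ==> qf W z w = (cflow W z-cflow W w)/(z-w)" "(%j. eulWq W j z w) \<longlonglongrightarrow> qf W z w"
  and "qf W z (cnj w) = (cflow W z-cnj (cflow W w))/(z-cnj w)" "(%j. eulWq W j z (cnj w)) \<longlonglongrightarrow> qf W z (cnj w)"
proof -
 show 1: "qf W z z = deriv (cflow W) z" and t1: "(%j. eulWq W j z z) \<longlonglongrightarrow> qf W z z"
  using cflow_has_deriv(2)[OF W z(1)] by (auto simp: qf_def limI)
 have quot: "eulWq W j z w' = (eulW W j z-eulW W j w')/(z-w')" if "z ~= w'" "Im w' ~= 0" for w' j
  using eul_diff[of "1/real (2^j)" z w' "incr W (2^j)" "2^j"] that z by (simp add: eulWq_def eulW_def)
 have t2: "(%j. eulWq W j z w) \<longlonglongrightarrow> (cflow W z-cflow W w)/(z-w)" if "z ~= w"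
  using that z by (auto simp: quot intro!: tendsto_intros eulW_tendsto[OF W])
 then show "qf W z w = (cflow W z-cflow W w)/(z-w)" if "z ~= w" using that by (simp add: qf_def limI)
 then show "(%j. eulWq W j z w) \<longlonglongrightarrow> qf W z w" using t1 t2 by (cases "z = w") auto
 have "z ~= cnj w" using z by (metis cnj.sel(2) less_asym neg_less_0_iff_less)
 then have t3: "(%j. eulWq W j z (cnj w)) \<longlonglongrightarrow> (cflow W z-cnj (cflow W w))/(z-cnj w)"
  using z by (auto simp: quot eulW_cnj intro!: tendsto_intros eulW_tendsto[OF W])
 then show "qf W z (cnj w) = (cflow W z-cnj (cflow W w))/(z-cnj w)" by (simp add: qf_def limI)
 then show "(%j. eulWq W j z (cnj w)) \<longlonglongrightarrow> qf W z (cnj w)" using t3 by simp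
qed

lemma qf_nonzero:
 assumes W: "continuous_on {0..1} W" and z: "0 < Im z" "0 < Im w"
 shows "qf W z w ~= 0" "qf W z (cnj w) ~= 0" "fl W z ~= 0"
proof -
 show "qf W z w ~= 0"
 proof (cases "z = w")
  case True
  then show ?thesis using holomorphic_injective_imp_regular[OF cflow_holomorphic[OF W] open_upper_half_plane cflow_inj[OF W], of z]
    qf_continuous(1)[OF W z] z by (auto simp: upper_half_plane_def)
 next
  case False
  then have "cflow W z ~= cflow W w" using inj_onD[OF cflow_inj[OF W], of z w] z by (auto simp: upper_half_plane_def)
  then show ?thesis using qf_continuous(3)[OF W z False] False by simp
 qed
 have p: "0 < Im (cflow W z)" "0 < Im (cflow W w)" using cflow_Im(2)[OF W] z by auto
 have "cflow W z ~= cnj (cflow W w)" "z ~= cnj w" using p z by (metis cnj.sel(2) less_asym neg_less_0_iff_less)+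
 then show "qf W z (cnj w) ~= 0" using qf_continuous(5)[OF W z] by simp
 show "fl W z ~= 0" using p fl_continuous(2)[OF W z(1)] by auto
qed

lemma vM_tendsto_vL:
 assumes W: "continuous_on {0..1} W" and z: "!!i. i : I ==> 0 < Im (z i)" and I: "finite I"
 shows "(%j. vM I a b r (1/2^j) z (nincr W j) (2^j)) \<longlonglongrightarrow> vL I a b r z W" unfolding vM_def vL_def eulW_nincr
 by (intro tendsto_mult tendsto_prod tendsto_powr tendsto_norm tendsto_const qf_continuous fl_continuous W z) (use qf_nonzero[OF W z z] in auto)

lemma incr_points:
 assumes "k < 2^j"
 shows "real k/real (2^j) : {0..1}" "real (Suc k)/real (2^j) : {0..1}"
proof -
 show "real k/real (2^j) : {0..1}" "real (Suc k)/real (2^j) : {0..1}" using assms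
  by (auto simp only: atLeastAtMost_iff divide_le_eq_1 of_nat_0_le_iff divide_nonneg_nonneg)
qed

lemma measurable_nincr:
 assumes "!!t. t : {0..1} ==> (%w. W w t) : borel_measurable N"
 shows "(%w. nincr (W w) j) : measurable N (PiM {..<2^j} (%_. borel))" unfolding nincr_def incr_def
 by (intro measurable_restrict borel_measurable_divide borel_measurable_diff borel_measurable_const assms incr_points) auto

lemma measurable_eulW:
 assumes W: "!!t. t : {0..1} ==> (%v. W v t) : borel_measurable N"
 shows "(%v. eulW (W v) j z) : borel_measurable N" "(%v. eulWq (W v) j z w) : borel_measurable N"
proof -
 have m: "(%v. nincr (W v) j) : measurable N (stdnP (2^j))" unfolding measurable_cong_sets[OF refl sets_stdnP] by (rule measurable_nincr[OF W])
 show "(%v. eulW (W v) j z) : borel_measurable N" using measurable_compose[OF m measurable_eul[OF order_refl, where d = "1/2^j" and z = z]]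
  by (simp add: eulW_nincr)
 show "(%v. eulWq (W v) j z w) : borel_measurable N"
  using measurable_compose[OF m measurable_eulq[OF order_refl, where d = "1/2^j" and z = z and w = w]] by (simp add: eulW_nincr)
qed

lemma measurable_fl:
 assumes W: "!!t. t : {0..1} ==> (%v. W v t) : borel_measurable N"
 shows "(%v. fl (W v) z) : borel_measurable N" "(%v. qf (W v) z w) : borel_measurable N" unfolding fl_def qf_def
 by (rule borel_measurable_lim_metric[OF measurable_eulW(1)[OF W]], simp) (rule borel_measurable_lim_metric[OF measurable_eulW(2)[OF W]], simp)

lemma rbm_nn_integral:
 assumes "rbm M W" "f : borel_measurable (stdnP (2^j))"
 shows "(\<integral>\<^sup>+w. f (nincr (W w) j) \<partial>M) = (\<integral>\<^sup>+t. f t \<partial>stdnP (2^j))"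
proof -
 have m: "(%w. nincr (W w) j) : measurable M (PiM {..<2^j} (%_. borel))" using assms(1) by (intro measurable_nincr) (auto simp: rbm_def)
 have "(\<integral>\<^sup>+t. f t \<partial>stdnP (2^j)) = (\<integral>\<^sup>+t. f t \<partial>distr M (PiM {..<2^j} (%_. borel)) (%w. nincr (W w) j))"
  using assms(1) by (simp add: rbm_def)
 also have "... = (\<integral>\<^sup>+w. f (nincr (W w) j) \<partial>M)"
  by (rule nn_integral_distr[OF m]) (use assms(2) in "simp add: measurable_cong_sets[OF sets_stdnP refl]")
 finally show ?thesis by simp
qed

lemma half_pow_tendsto_0: "(%j. 1/(2::real)^j) \<longlonglongrightarrow> 0" using LIMSEQ_realpow_zero[of "1/2 :: real"] by (simp add: power_divide)

text \<open>Fatou's lemma along dyadic meshes, with no uniform integrability; the price is that only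
  an upper bound survives the limit.\<close>

lemma vL_supermartingale:
 fixes r :: "'i => real"
 assumes M: "rbm M W" and I: "finite I" and y: "0 < y" and z: "!!i. i : I ==> y <= Im (z i)"
  and drift: "!!w. ALL i:I. y <= Im (w i) ==> vdrift I a b r w <= 0"
 shows "(EE M (%u. vL I a b r z (W u))) <= ennreal (\<Prod>i\<in>I. norm (z i) powr r i)"
proof -
 let ?P = "\<Prod>i\<in>I. norm (z i) powr r i"
 define v where "v = (%j u. vM I a b r (1/2^j) z (nincr (W u) j) (2^j))"
 obtain C d0 where C: "0 <= C" "0 < d0"
  "!!z N. [|ALL i:I. y <= Im (z i); 0 < N; 1/real N <= d0|] ==> integrable (stdnP N) (%t. vM I a b r (1/real N) z t N) &
   vexp I a b r (1/real N) z N <= exp (C * sqrt (1/real N))*(\<Prod>i\<in>I. norm (z i) powr r i)" using vexp_supermartingale[OF I y drift] by blast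
 have ev: "\<forall>\<^sub>F j in sequentially. 1/(2::real)^j < d0" by (rule order_tendstoD(2)[OF half_pow_tendsto_0 C(2)])
 have bound: "\<forall>\<^sub>F j in sequentially. (EE M (%u. v j u)) <= ennreal (exp (C * sqrt (1/2^j))*?P)" using ev
 proof eventually_elim
  case (elim j)
  have c: "integrable (stdnP (2^j)) (%t. vM I a b r (1/2^j) z t (2^j))"
   "vexp I a b r (1/2^j) z (2^j) <= exp (C * sqrt (1/2^j))*?P" using C(3)[of z "2^j"] z elim by auto
  have "(EE M (%u. v j u)) = (\<integral>\<^sup>+t. ennreal (vM I a b r (1/2^j) z t (2^j)) \<partial>stdnP (2^j))" unfolding v_def
   by (rule rbm_nn_integral[OF M, of "%t. ennreal (vM I a b r (1/2^j) z t (2^j))"])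
     (intro measurable_compose[OF measurable_vM[OF order_refl] measurable_ennreal])
  also have "... = ennreal (vexp I a b r (1/2^j) z (2^j))" unfolding vexp_def by (rule nn_integral_eq_integral[OF c(1)]) (auto intro!: vM_nonneg)
  finally show ?case using c(2) by (simp add: ennreal_leI)
 qed
 have lim: "(%j. ennreal (exp (C * sqrt (1/2^j))*?P)) \<longlonglongrightarrow> ennreal (exp (C * sqrt 0)*?P)"
  by (intro tendsto_ennrealI tendsto_intros half_pow_tendsto_0)
 have meas: "v j : borel_measurable M" for j
 proof -
  have "(%u. nincr (W u) j) : measurable M (stdnP (2^j))" unfolding measurable_cong_sets[OF refl sets_stdnP]
   using M by (intro measurable_nincr) (auto simp: rbm_def)
  from measurable_compose[OF this measurable_vM[OF order_refl]] show ?thesis by (simp add: v_def)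
 qed
 have "AE u in M. continuous_on {0..1} (W u)" using M by (simp add: rbm_def)
 then have "AE u in M. ennreal (vL I a b r z (W u)) = liminf (%j. ennreal (v j u))"
 proof eventually_elim
  case (elim u)
  have "(%j. v j u) \<longlonglongrightarrow> vL I a b r z (W u)" unfolding v_def by (rule vM_tendsto_vL[OF elim _ I]) (use z y in force)
  then have "(%j. ennreal (v j u)) \<longlonglongrightarrow> ennreal (vL I a b r z (W u))" by simp
  then show ?case using lim_imp_Liminf by (metis sequentially_bot)
 qed
 then have "(EE M (%u. vL I a b r z (W u))) = (\<integral>\<^sup>+u. liminf (%j. ennreal (v j u)) \<partial>M)" by (rule nn_integral_cong_AE)
 also have "... <= liminf (%j. \<integral>\<^sup>+u. ennreal (v j u) \<partial>M)" by (rule nn_integral_liminf) (use meas in measurable)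
 also have "... <= liminf (%j. ennreal (exp (C * sqrt (1/2^j))*?P))" by (rule Liminf_mono[OF bound])
 also have "... = ennreal (exp (C * sqrt 0)*?P)" using lim by (intro lim_imp_Liminf) auto
 finally show ?thesis by simp
qed

text \<open>Exponents of a vertex product with charges \<open>r\<close>, for which the drift cancels identically.\<close>

definition chA :: "('i => real) => 'i \<times> 'i => real" where
 "chA r p =-3*r (fst p)*r (snd p)/4+(if fst p = snd p then 5*r (fst p)/2 else 0)"

definition chB :: "('i => real) => 'i \<times> 'i => real" where
 "chB r p =-3*r (fst p)*r (snd p)/4"

text \<open>Since Re u Re v = (Re (u v) + Re (u cnj v)) / 2, the squared sum splits into the two
  kinds of pair sums, which the exponents -3 r s / 4 cancel; the diagonal surplus 5 r / 2 cancels
  the terms -5 r Re (u^2).\<close>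

lemma vdrift_charges:
 assumes I: "finite I"
 shows "vdrift I (chA r) (chB r) r w = 0"
proof -
 define u where "u = (%i. inverse (w i))"
 define S where "S = (\<Sum>i\<in>I. r i * Re (u i))"
 define Q where "Q = (\<Sum>i\<in>I. r i * Re (u i*u i))"
 let ?A = "\<Sum>p\<in>I\<times>I. chB r p * Re (u (fst p) * cnj (u (snd p)))"
 let ?B = "\<Sum>p\<in>I\<times>I. (- 3/4)*(r (fst p)*r (snd p))*(Re (u (fst p)*u (snd p))+Re (u (fst p) * cnj (u (snd p))))"
 let ?C = "\<Sum>p\<in>I\<times>I. chA r p * Re (u (fst p)*u (snd p))"
 let ?D = "\<Sum>p\<in>I\<times>I. (if fst p = snd p then 5*r (fst p)/2 else 0) * Re (u (fst p)*u (snd p))"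
 let ?E = "\<Sum>p\<in>I\<times>I. (r (fst p) * Re (u (fst p)))*(r (snd p) * Re (u (snd p)))"
 have "?C+?A = ?B + ?D" unfolding sum.distrib[symmetric] by (intro sum.cong refl) (simp only: chA_def chB_def distrib_left distrib_right, simp)
 also have "?B = (- 3/2)*?E" unfolding  sum_distrib_left by (intro sum.cong refl) (simp)
 also have "?E = S*S" unfolding S_def sum_product sum.cartesian_product by (intro sum.cong refl) auto
 also have "?D = (\<Sum>i\<in>I. \<Sum>j\<in>I. (if i = j then 5*r i/2 * Re (u i*u j) else 0))"
  unfolding sum.cartesian_product by (intro sum.cong refl) auto
 also have "... = (\<Sum>i\<in>I. 5/2*(r i * Re (u i*u i)))" using I by (intro sum.cong refl) (simp only: sum.delta' sum.delta, simp)
 also have "... = 5/2*Q" unfolding Q_def sum_distrib_left ..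
 finally have eq: "?C+?A =-3/2*(S*S)+5/2*Q" .
 have "vdrift I (chA r) (chB r) r w = 2*(?C+?A) - 5*Q+3*S^2"
  unfolding vdrift_def u_def S_def Q_def inverse_mult_distrib power2_eq_square complex_cnj_inverse distrib_left ..
 then show ?thesis unfolding eq by (simp add: power2_eq_square)
qed

lemma vertex_expectation:
 fixes r :: "'i => real"
 assumes "rbm M W" "finite I" "!!i. i : I ==> 0 < Im (z i)"
 shows "(EE M (%w. vL I (chA r) (chB r) r z (W w))) <= ennreal (\<Prod>i\<in>I. norm (z i) powr r i)"
proof (cases "I = {}")
 case True
 interpret prob_space M using assms(1) by (simp add: rbm_def)
 show ?thesis by (simp add: True vL_def emeasure_space_1)
next
 case False
 show ?thesis by (rule vL_supermartingale[OF assms(1,2), where y = "Min ((%i. Im (z i)) ` I)"]) (use assms(2,3) False in "auto simp: vdrift_charges")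
qed

section \<open>Hausdorff measures\<close>

lemma hausdorff_pre_measure_le:
 fixes U :: "nat => 'b::metric_space set"
 assumes "A <= (\<Union>i. U i)" "!!i. bounded (U i)" "!!i. diameter (U i) <= d"
 shows "hausdorff_pre_measure s d A <= (\<Sum>i. ennreal (diameter (U i) powr s))"
 unfolding hausdorff_pre_measure_def by (rule INF_lower) (use assms in auto)

lemma hausdorff_pre_measure_finite_cover:
 fixes U :: "'i => 'b::metric_space set"
 assumes F: "finite F" "A <= (\<Union>i\<in>F. U i)" and b: "!!i. i : F ==> bounded (U i)" and d: "!!i. i : F ==> diameter (U i) <= w" and w: "0 <= w"
 shows "hausdorff_pre_measure s w A <= ennreal (\<Sum>i\<in>F. diameter (U i) powr s)"
proof -
 obtain f where f: "bij_betw f {..<card F} F" using ex_bij_betw_nat_finite[OF F(1)] by (auto simp: atLeast0LessThan)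
 define V where "V = (%k. if k < card F then U (f k) else {})"
 have fF: "f k : F" if "k < card F" for k using f that by (auto simp: bij_betw_def)
 have "A <= (\<Union>k. V k)"
 proof
  fix x assume "x : A"
  then obtain i where i: "i : F" "x : U i" using F(2) by auto
  have "i : f ` {..<card F}" using f i(1) by (simp add: bij_betw_def)
  then obtain k where "k < card F" "f k = i" by auto
  then have "x : V k" using i by (simp add: V_def)
  then show "x : (\<Union>k. V k)" by auto
 qed
 then have "hausdorff_pre_measure s w A <= (\<Sum>k. ennreal (diameter (V k) powr s))"
  by (rule hausdorff_pre_measure_le) (use b d fF w in "auto simp: V_def diameter_empty")
 also have "... = (\<Sum>k<card F. ennreal (diameter (V k) powr s))" by (rule suminf_finite) (auto simp: V_def)
 also have "... = (\<Sum>k<card F. ennreal (diameter (U (f k)) powr s))" by (intro sum.cong refl) (simp add: V_def)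
 also have "... = (\<Sum>i\<in>F. ennreal (diameter (U i) powr s))" by (rule sum.reindex_bij_betw[OF f])
 also have "... = ennreal (\<Sum>i\<in>F. diameter (U i) powr s)" by simp
 finally show ?thesis .
qed

lemma hausdorff_measure_eq_0_iff:
 "hausdorff_measure s A = 0 \<longleftrightarrow> (ALL d>0. hausdorff_pre_measure s d A = 0)"
 unfolding hausdorff_measure_def by (auto simp: bot_ennreal[symmetric])

lemma ennreal_eq_0_I:
 assumes "!!e::real. 0 < e ==> x <= ennreal e"
 shows "x = 0"
proof -
 have "x <= 0" by (rule ennreal_le_epsilon) (simp add: assms)
 then show ?thesis by simp
qed

lemma hausdorff_pre_measure_mono:
 assumes "A <= B"
 shows "hausdorff_pre_measure s d A <= hausdorff_pre_measure s d B"
 unfolding hausdorff_pre_measure_def by (rule INF_superset_mono) (use assms in auto)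

lemma hausdorff_measure_null_subset:
 assumes "hausdorff_measure s B = 0" "A <= B"
 shows "hausdorff_measure s A = 0" using assms hausdorff_pre_measure_mono[OF assms(2)] unfolding hausdorff_measure_eq_0_iff by (metis le_zero_eq)

lemma hausdorff_measure_null_cover:
 fixes A :: "'b::metric_space set"
 assumes "hausdorff_measure s A = 0" "0 < d" "0 < e"
 shows "EX U. A <= (\<Union>i::nat. U i) & (ALL i. bounded (U i)) & (ALL i. diameter (U i) <= d) &
  (\<Sum>i. ennreal (diameter (U i) powr s)) < e"
proof -
 have "(INF U \<in> {U :: nat => 'b set. A <= (\<Union>i. U i) & (ALL i. bounded (U i) & diameter (U i) <= d)}.
    (\<Sum>i. ennreal (diameter (U i) powr s))) < e" using assms unfolding hausdorff_measure_eq_0_iff hausdorff_pre_measure_def by simp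
 then show ?thesis unfolding INF_less_iff by blast
qed

lemma suminf_ennreal_prod_decode:
 fixes f :: "nat => nat => ennreal"
 shows "(\<Sum>n. case prod_decode n of (i, j) => f i j) = (\<Sum>i. \<Sum>j. f i j)"
proof -
 have "(\<Sum>n. case prod_decode n of (i, j) => f i j) = (\<integral>\<^sup>+n. (case prod_decode n of (i, j) => f i j) \<partial>count_space UNIV)"
  by (rule nn_integral_count_space_nat[symmetric])
 also have "... = (\<integral>\<^sup>+p. (case p of (i, j) => f i j) \<partial>count_space UNIV)"
  by (rule nn_integral_bij_count_space[OF bij_prod_decode])
 also have "... = (\<integral>\<^sup>+i. \<integral>\<^sup>+j. f i j \<partial>count_space UNIV \<partial>count_space UNIV)"
  by (subst nn_integral_fst_count_space[symmetric]) simp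
 finally show ?thesis by (simp add: nn_integral_count_space_nat)
qed

lemma hausdorff_measure_null_UN:
 fixes A :: "nat => 'b::metric_space set"
 assumes null: "!!k. hausdorff_measure s (A k) = 0"
 shows "hausdorff_measure s (\<Union>k. A k) = 0" unfolding hausdorff_measure_eq_0_iff
proof (intro allI impI)
 fix d :: real assume d: "0 < d"
 let ?A = "hausdorff_pre_measure s d (\<Union>k. A k)"
 have "?A <= ennreal e" if e: "0 < e" for e :: real
 proof -
  have "EX U. A k <= (\<Union>i::nat. U i) & (ALL i. bounded (U i)) & (ALL i. diameter (U i) <= d) &
    (\<Sum>i. ennreal (diameter (U i) powr s)) < ennreal (e*(1/2)^Suc k)" for k by (rule hausdorff_measure_null_cover[OF null d]) (use e in simp)
  then have "EX U. ALL k. A k <= (\<Union>i::nat. U k i) & (ALL i. bounded (U k i)) & (ALL i. diameter (U k i) <= d) &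
    (\<Sum>i. ennreal (diameter (U k i) powr s)) < ennreal (e*(1/2)^Suc k)" by (intro choice allI)
  then obtain U where U: "!!k. A k <= (\<Union>i::nat. U k i)" "!!k i. bounded (U k i)" "!!k i. diameter (U k i) <= d"
    "!!k. (\<Sum>i. ennreal (diameter (U k i) powr s)) < ennreal (e*(1/2)^Suc k)" by blast
  define V where "V = (%n. case prod_decode n of (k, i) => U k i)"
  have "(\<Union>k. A k) <= (\<Union>n. V n)"
  proof
   fix x assume "x : (\<Union>k. A k)"
   then obtain k i where "x : U k i" using U(1) by blast
   then have "x : V (prod_encode (k, i))" by (simp add: V_def)
   then show "x : (\<Union>n. V n)" by auto
  qed
  then have "?A <= (\<Sum>n. ennreal (diameter (V n) powr s))" by (rule hausdorff_pre_measure_le) (auto simp: V_def U split: prod.splits)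
  also have "... = (\<Sum>n. case prod_decode n of (k, i) => ennreal (diameter (U k i) powr s))"
   by (intro suminf_cong) (simp add: V_def split: prod.splits)
  also have "... = (\<Sum>k. \<Sum>i. ennreal (diameter (U k i) powr s))" by (rule suminf_ennreal_prod_decode)
  also have "... <= (\<Sum>k. ennreal (e*(1/2)^Suc k))" by (intro suminf_le less_imp_le U) auto
  also have "... = ennreal (\<Sum>k. e*(1/2)^Suc k)" using e by (intro suminf_ennreal2 summable_mult) (auto)
  also have "(\<Sum>k. e*(1/2)^Suc k) = e" using sums_mult[OF power_half_series, of e] by (simp add: sums_iff)
  finally show ?thesis by simp
 qed
 then show "?A = 0" by (rule ennreal_eq_0_I)
qed

lemma hausdorff_measure_null_mono_exponent:
 fixes A :: "'b::metric_space set"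
 assumes null: "hausdorff_measure s A = 0" and ss: "s <= s'"
 shows "hausdorff_measure s' A = 0" unfolding hausdorff_measure_eq_0_iff
proof (intro allI impI)
 fix d :: real assume d: "0 < d"
 let ?A = "hausdorff_pre_measure s' d A"
 have "?A <= ennreal e" if e: "0 < e" for e :: real
 proof -
  obtain U where U: "A <= (\<Union>i::nat. U i)" "!!i. bounded (U i)" "!!i. diameter (U i) <= min d 1"
   "(\<Sum>i. ennreal (diameter (U i) powr s)) < ennreal e"
  proof -
   have "0 < min d 1" "0 < ennreal e" using d e by auto
   from hausdorff_measure_null_cover[OF null this] show ?thesis using that by blast
  qed
  have "?A <= (\<Sum>i. ennreal (diameter (U i) powr s'))" using U by (intro hausdorff_pre_measure_le) (auto)
  also have "... <= (\<Sum>i. ennreal (diameter (U i) powr s))"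
  proof (intro suminf_le ennreal_leI)
   fix i
   have "0 <= diameter (U i)" by (rule diameter_ge_0[OF U(2)])
   then show "diameter (U i) powr s' <= diameter (U i) powr s" using U(3)[of i] ss by (cases "diameter (U i) = 0") (auto intro: powr_mono')
  qed auto
  finally show ?thesis using U(4) by simp
 qed
 then show "?A = 0" by (rule ennreal_eq_0_I)
qed

text \<open>A cover of the image pulls back to a cover of A whose diameters grow at most by the
  factor L.\<close>

lemma hausdorff_measure_null_expanding:
 fixes g :: "complex => complex"
 assumes null: "hausdorff_measure s (g ` A) = 0" and L: "0 < L" and g: "!!x y. x : A ==> y \<in> A ==> dist x y <= L*dist (g x) (g y)" and s: "0 < s"
 shows "hausdorff_measure s A = 0" unfolding hausdorff_measure_eq_0_iff
proof (intro allI impI)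
 fix d :: real assume d: "0 < d"
 let ?A = "hausdorff_pre_measure s d A"
 have "?A <= ennreal e" if e: "0 < e" for e :: real
 proof -
  obtain U where U: "g ` A <= (\<Union>i::nat. U i)" "!!i. bounded (U i)" "!!i. diameter (U i) <= d/L"
   "(\<Sum>i. ennreal (diameter (U i) powr s)) < ennreal (e/L powr s)"
  proof -
   have "0 < d/L" "0 < ennreal (e/L powr s)" using d e L by auto
   from hausdorff_measure_null_cover[OF null this] show ?thesis using that by blast
  qed
  define V where "V = (%i. {x\<in>A. g x : U i})"
  have dV: "dist x y <= L*diameter (U i)" if "x : V i" "y : V i" for x y i
  proof -
   have "dist x y <= L*dist (g x) (g y)" using g that by (auto simp: V_def)
   also have "... <= L*diameter (U i)" using that L by (intro mult_left_mono diameter_bounded_bound U) (auto simp: V_def)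
   finally show ?thesis .
  qed
  have bV: "bounded (V i)" for i using dV unfolding bounded_two_points by blast
  have diaV: "diameter (V i) <= L*diameter (U i)" for i
  proof -
   show ?thesis using L diameter_ge_0[OF U(2)] using dV by (intro diameter_le disjI2) (simp_all add: dist_norm)
  qed
  have "A <= (\<Union>i. V i)" using U(1) by (auto simp: V_def)
  then have "?A <= (\<Sum>i. ennreal (diameter (V i) powr s))"
  proof (rule hausdorff_pre_measure_le[OF _ bV])
   fix i
   have "L*diameter (U i) <= L*(d/L)" using U(3) L by (intro mult_left_mono) auto
   then show "diameter (V i) <= d" using diaV[of i] L by simp
  qed
  also have "... <= (\<Sum>i. ennreal (L powr s)*ennreal (diameter (U i) powr s))"
  proof (intro suminf_le)
   fix i
   have "diameter (V i) powr s <= (L*diameter (U i)) powr s" using diaV[of i] diameter_ge_0[OF bV] s by (intro powr_mono2) auto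
   also have "... = L powr s*diameter (U i) powr s" by (simp add: powr_mult)
   finally show "ennreal (diameter (V i) powr s) <= ennreal (L powr s)*ennreal (diameter (U i) powr s)" by (simp add: ennreal_mult' [symmetric])
  qed auto
  also have "... = ennreal (L powr s)*(\<Sum>i. ennreal (diameter (U i) powr s))" by simp
  also have "... <= ennreal (L powr s)*ennreal (e/L powr s)" using U(4) by (intro mult_left_mono) auto
  also have "... = ennreal e" using L  by (simp add: ennreal_mult'[symmetric])
  finally show ?thesis by simp
 qed
 then show "?A = 0" by (rule ennreal_eq_0_I)
qed

lemma hausdorff_dim_eqI:
 fixes A :: "'b::metric_space set"
 assumes "0 < D" and up: "!!s. D < s ==> hausdorff_measure s A = 0" and low: "!!s. 0 < s ==> s < D ==> hausdorff_measure s A ~= 0"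
 shows "hausdorff_dim A = D" unfolding hausdorff_dim_def
proof (rule cInf_eq)
 show "D <= x" if "x : {s. 0 < s & hausdorff_measure s A = 0}" for x using low that by force
 show "y <= D" if y: "!!x. x : {s. 0 < s & hausdorff_measure s A = 0} ==> y <= x" for y
 proof (rule dense_ge)
  fix x assume "D < x"
  then show "y <= x" using y[of x] up assms(1) by auto
 qed
qed

text \<open>Compactness replaces an arbitrary cover of small cost by finitely many open sets of positive diameter.\<close>

lemma hausdorff_null_compact_open_cover:
 fixes A :: "complex set"
 assumes null: "hausdorff_measure s A = 0" and A: "compact A" and s: "0 < s" and d: "0 < d" and e: "0 < e"
 obtains F :: "nat set" and V w where "finite F" "A <= (\<Union>i\<in>F. V i)" "!!i. i : F ==> open (V i)"
  "!!i. i : F ==> bounded (V i)"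
  "!!i. i : F ==> 0 < w i" "!!i. i : F ==> w i <= d" "!!i x y. i : F ==> x \<in> V i ==> y \<in> V i ==> dist x y <= w i"
  "(\<Sum>i\<in>F. w i powr s) <= e"
proof -
 define K where "K = (6::real) powr s"
 have K: "0 < K" by (simp add: K_def)
 obtain U where U: "A <= (\<Union>i::nat. U i)" "!!i. bounded (U i)" "!!i. diameter (U i) <= d/6"
   "(\<Sum>i. ennreal (diameter (U i) powr s)) < ennreal (e/(2*K))"
 proof -
  have "0 < d/6" "0 < ennreal (e/(2*K))" using d e K by auto
  from hausdorff_measure_null_cover[OF null this] show ?thesis using that by blast
 qed
 define \<tau> where "\<tau> = (%i::nat. min (d/6) ((e/(2*K)*(1/2)^Suc i) powr (1/s)))"
 have \<tau>: "0 < \<tau> i" for i using d e K by (simp add: \<tau>_def)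
 define r where "r = (%i. max (diameter (U i)) (\<tau> i))"
 have r: "0 < r i" "r i <= d/6" for i
 proof -
  show "0 < r i" using \<tau>[of i] by (simp only: r_def less_max_iff_disj simp_thms)
  show "r i <= d/6" using U(3)[of i] by (simp add: r_def \<tau>_def)
 qed
 define V where "V = (%i. \<Union>x\<in>U i. ball x (r i))"
 have dV: "dist x y <= 6*r i" if xy: "x : V i" "y : V i" for x y i
 proof -
  obtain x' y' where x': "x' : U i" "dist x' x < r i" and y': "y' : U i" "dist y' y < r i" using xy by (auto simp: V_def)
  have "dist x' y' <= diameter (U i)" by (rule diameter_bounded_bound[OF U(2) x'(1) y'(1)])
  also have "... <= r i" by (simp add: r_def)
  finally have "dist x y <= r i+r i+r i" using x' y' dist_triangle[of x y x'] dist_triangle[of x' y y'] by (simp add: dist_commute)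
  then show ?thesis using r(1)[of i] by linarith
 qed
 have "open (V i)" for i by (auto simp: V_def)
 moreover have "A <= (\<Union>i. V i)" using U(1) r(1) by (force simp: V_def)
 ultimately obtain F where F: "finite F" "A <= (\<Union>i\<in>F. V i)" using compactE_image[OF A, of UNIV V] by (metis (no_types, lifting) UNIV_I)
 let ?A = "\<Sum>i\<in>F. diameter (U i) powr s"
 have sumU: "?A <= e/(2*K)"
 proof -
  have "ennreal ?A = (\<Sum>i\<in>F. ennreal (diameter (U i) powr s))" by simp
  also have "... <= (\<Sum>i. ennreal (diameter (U i) powr s))" by (rule sum_le_suminf[OF _ F(1)]) auto
  finally have "ennreal ?A <= ennreal (e/(2*K))" using U(4) by simp
  then show ?thesis using e K by (simp)
 qed
 have sum\<tau>: "(\<Sum>i\<in>F. \<tau> i powr s) <= e/(2*K)"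
 proof -
  have "(\<Sum>i\<in>F. \<tau> i powr s) <= (\<Sum>i\<in>F. e/(2*K)*(1/2)^Suc i)"
  proof (rule sum_mono)
   fix i
   have "\<tau> i powr s <= ((e/(2*K)*(1/2)^Suc i) powr (1/s)) powr s" using \<tau>[of i] s by (intro powr_mono2) (auto simp: \<tau>_def)
   also have "... = e/(2*K)*(1/2)^Suc i" using s e K by (simp add: powr_powr)
   finally show "\<tau> i powr s <= e/(2*K)*(1/2)^Suc i" .
  qed
  also have "... <= (\<Sum>i. e/(2*K)*(1/2)^Suc i)" using e K by (intro sum_le_suminf F(1) summable_mult) (auto)
  also have "... = e/(2*K)" using sums_mult[OF power_half_series, of "e/(2*K)"] by (simp add: sums_iff)
  finally show ?thesis .
 qed
 show thesis
 proof (rule that[of F V "%i. 6*r i"])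
  show "bounded (V i)" for i using dV unfolding bounded_two_points by blast
  have "(\<Sum>i\<in>F. (6*r i) powr s) <= (\<Sum>i\<in>F. K*(diameter (U i) powr s+\<tau> i powr s))"
  proof (rule sum_mono)
   fix i
   have "(6*r i) powr s = K*r i powr s" by (simp add: K_def powr_mult)
   moreover have "r i powr s <= diameter (U i) powr s+\<tau> i powr s" by (auto simp: r_def max_def)
   ultimately show "(6*r i) powr s <= K*(diameter (U i) powr s+\<tau> i powr s)" using K by (simp)
  qed
  also have "... = K*(?A+(\<Sum>i\<in>F. \<tau> i powr s))" by (simp only: sum.distrib[symmetric] sum_distrib_left)
  also have "... <= K*(e/(2*K)+e/(2*K))" using K sumU sum\<tau> by (intro mult_left_mono add_mono) auto
  also have "... = e" using K by simp
  finally show "(\<Sum>i\<in>F. (6*r i) powr s) <= e" .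
 qed (use F dV r \<open>!!i. open (V i)\<close> in "auto simp: field_simps")
qed

section \<open>Conformal maps of the half-plane into itself\<close>

locale half_plane_map =
 fixes f :: "complex => complex"
 assumes hol: "f holomorphic_on \<H>" and inj: "inj_on f \<H>" and into: "!!z. 0 < Im z ==> 0 < Im (f z)"
begin

text \<open>Half the conformal radius of the image seen from f z, hence comparable to the distance
  from f z to the boundary of the image.\<close>

definition dl :: "complex => real" where
 "dl z = norm (deriv f z)*Im z"

lemma ball_subset: "0 < Im z ==> ball z (Im z) <= \<H>"
proof
 fix w assume "0 < Im z" "w : ball z (Im z)"
 then have "abs (Im (z-w)) < Im z" using abs_Im_le_cmod[of "z-w"] by (simp add: dist_norm)
 then show "w : \<H>" by (simp add: upper_half_plane_def)
qed

lemma hol_ball: "0 < Im z ==> r <= Im z ==> f holomorphic_on ball z r" "0 < Im z ==> r <= Im z ==> inj_on f (ball z r)"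
 using ball_subset[of z] subset_ball[of r "Im z" z] holomorphic_on_subset[OF hol] inj_on_subset[OF inj] by (meson order_trans)+

lemma dl_pos: "0 < Im z ==> 0 < dl z" using holomorphic_injective_imp_regular[OF hol open_upper_half_plane inj, of z]
 by (simp add: dl_def upper_half_plane_def)

lemma growth:
 assumes "0 < Im z" "norm (w-z) <= 3/4*Im z"
 shows "norm (f w-f z) <= koebe_C*dl z" using koebe_growth[OF hol_ball[OF assms(1) order_refl] assms(1,2)] by (simp add: dl_def)

text \<open>The image contains a disc of radius dl z / koebe_C about f z and does not meet the real
  line.\<close>

lemma dl_le_Im:
 assumes "0 < Im z"
 shows "dl z <= koebe_C*Im (f z)"
proof (rule ccontr)
 assume "\<not> ?thesis"
 then have lt: "Im (f z) < dl z/koebe_C" using koebe_C_pos by (simp add: field_simps)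
 define w where "w = f z-\<i> * of_real (Im (f z))"
 have "w : ball (f z) (norm (deriv f z)*Im z/koebe_C)" using lt into[OF assms] by (simp add: w_def norm_mult dl_def)
 then have "w : f ` ball z (Im z)" using koebe_quarter[OF hol_ball[OF assms order_refl] assms] by blast
 then have "0 < Im w" using ball_subset[OF assms] into by (auto simp: upper_half_plane_def)
 then show False by (simp add: w_def)
qed

text \<open>By the quarter theorem a disc of radius dl z / (2 koebe_C) about f z is filled by images
  of points closer than Im z / 2 to z; injectivity keeps all other images out of it.\<close>

lemma separation:
 assumes z: "0 < Im z" and w: "0 < Im w" "Im z/2 <= norm (w-z)"
 shows "dl z <= 2*koebe_C*norm (f w-f z)"
proof (rule ccontr)
 assume "\<not> ?thesis"
 then have "f w : ball (f z) (norm (deriv f z)*(Im z/2)/koebe_C)" using koebe_C_pos by (simp add: dist_norm dl_def norm_minus_commute field_simps)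
 then have "f w : f ` ball z (Im z/2)" using koebe_quarter[OF hol_ball[of z "Im z/2"]] z by auto
 then obtain v where v: "v : ball z (Im z/2)" "f w = f v" by auto
 have vH: "v : \<H>" using v(1) ball_subset[OF z] z by auto
 have "w = v" by (rule inj_onD[OF inj v(2) _ vH]) (simp add: upper_half_plane_def w)
 then show False using v(1) w(2) by (simp add: dist_norm norm_minus_commute)
qed

lemma open_image: "open (f ` \<H>)" by (rule open_mapping_thm3[OF hol open_upper_half_plane inj])

lemma continuous: "continuous_on \<H> f" by (rule holomorphic_on_imp_continuous_on[OF hol])

text \<open>If the limit were f w, the open mapping theorem and injectivity would force zs l into a
  disc about w, away from the real line.\<close>

lemma limit_in_frontier:
 assumes z: "!!l. 0 < Im (zs l)" and im: "(%l. Im (zs l)) \<longlonglongrightarrow> 0" and lim: "(%l. f (zs l)) \<longlonglongrightarrow> u"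
 shows "u : frontier (f ` \<H>)"
proof -
 have "u : closure (f ` \<H>)"
  unfolding closure_sequential using z lim by (auto simp: upper_half_plane_def intro!: exI[of _ "%l. f (zs l)"])
 moreover have "u ~: f ` \<H>"
 proof
  assume "u : f ` \<H>"
  then obtain w where w: "0 < Im w" "u = f w" by (auto simp: upper_half_plane_def)
  have sub: "ball w (Im w/2) <= \<H>" using ball_subset[OF w(1)] w(1) by auto
  have "open (f ` ball w (Im w/2))" by (rule open_mapping_thm3[OF holomorphic_on_subset[OF hol sub] open_ball inj_on_subset[OF inj sub]])
  moreover have "u : f ` ball w (Im w/2)" using w by auto
  ultimately have ev: "\<forall>\<^sub>F l in sequentially. f (zs l) : f ` ball w (Im w/2)" using lim by (rule topological_tendstoD[rotated])
  have "\<forall>\<^sub>F l in sequentially. Im (zs l) < Im w/2" using order_tendstoD(2)[OF im, of "Im w/2"] w by simp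
  with ev have "\<forall>\<^sub>F l in sequentially. False"
  proof eventually_elim
   case (elim l)
   then obtain v where v: "v : ball w (Im w/2)" "f (zs l) = f v" by auto
   have "zs l = v" by (rule inj_onD[OF inj v(2)]) (use v(1) sub z in "auto simp: upper_half_plane_def")
   then have "abs (Im (w-zs l)) < Im w/2" using v(1) abs_Im_le_cmod[of "w-v"] by (simp add: dist_norm)
   then have "Im w-Im (zs l) < Im w/2" by (simp only: minus_complex.sel)
   then show False using elim(2) by linarith
  qed
  then show False by simp
 qed
 ultimately show ?thesis using open_image by (simp add: frontier_def interior_open)
qed

text \<open>The hypothesis \<open>far\<close> bounds the preimages. If their heights did not tend to
  0, a subsequence would converge inside the half-plane and the frontier point would be
  attained.\<close>

lemma frontier_sequence:
 assumes v: "v : frontier (f ` \<H>)" and far: "!!z. 0 < Im z ==> m0 <= norm z ==> norm (f z-z) <= b0"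
 obtains zs R where "!!l. 0 < Im (zs l)" "!!l. norm (zs l) <= R" "(%l. Im (zs l)) \<longlonglongrightarrow> 0" "(%l. f (zs l)) \<longlonglongrightarrow> v"
proof -
 have "v : closure (f ` \<H>)" and nin: "v ~: f ` \<H>" using v open_image by (auto simp: frontier_def interior_open)
 then obtain us where us: "!!l. us l : f ` \<H>" "us \<longlonglongrightarrow> v" by (auto simp: closure_sequential)
 then have "EX z. 0 < Im z & us l = f z" for l by (auto simp: upper_half_plane_def)
 then obtain zs where zs: "!!l. 0 < Im (zs l)" "!!l. us l = f (zs l)" by metis
 have lim: "(%l. f (zs l)) \<longlonglongrightarrow> v" using us(2)  by (simp flip: zs(2))
 obtain B where B: "!!l. norm (f (zs l)) <= B" using convergent_imp_Bseq[OF convergentI[OF lim]] by (auto simp: Bseq_def)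
 define R where "R = max m0 (B+b0)"
 have R: "norm (zs l) <= R" for l
 proof (cases "m0 <= norm (zs l)")
  case True
  then have "norm (zs l) <= norm (f (zs l))+b0" using far[OF zs(1) True] norm_triangle_ineq4[of "f (zs l)" "f (zs l)-zs l"] by simp
  then show ?thesis using B[of l] by (simp add: R_def)
 qed (simp add: R_def)
 have "(%l. Im (zs l)) \<longlonglongrightarrow> 0"
 proof (rule ccontr)
  assume "\<not> ?thesis"
  then obtain e where e: "0 < e" "\<exists>\<^sub>F l in sequentially. \<not> abs (Im (zs l)) < e"
   unfolding tendsto_iff by (auto simp: frequently_def)
  then have inf: "infinite {l. e <= Im (zs l)}"
   using zs(1) unfolding frequently_cofinite[symmetric] cofinite_eq_sequentially by (auto elim!: frequently_elim1 simp: less_imp_le)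
  define \<sigma> where "\<sigma> = enumerate {l. e <= Im (zs l)}"
  have \<sigma>: "strict_mono \<sigma>" "!!l. e <= Im (zs (\<sigma> l))"
   using strict_mono_enumerate[OF inf] enumerate_in_set[OF inf] by (auto simp: \<sigma>_def)
  define K where "K = cball 0 R \<inter> {z. e <= Im z}"
  have "compact K" unfolding K_def by (intro compact_Int_closed compact_cball closed_halfspace_Im_ge)
  moreover have "ALL l. (zs \<circ> \<sigma>) l : K" using R \<sigma> by (auto simp: K_def)
  ultimately obtain w t where w: "w : K" "strict_mono t" "(zs \<circ> \<sigma> \<circ> t) \<longlonglongrightarrow> w" unfolding compact_def by blast
  have wH: "w : \<H>" using w(1) e by (auto simp: K_def upper_half_plane_def)
  have "isCont f w" using continuous open_upper_half_plane wH by (simp add: continuous_on_eq_continuous_at)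
  then have "(%l. f ((zs \<circ> \<sigma> \<circ> t) l)) \<longlonglongrightarrow> f w" using w(3) by (rule isCont_tendsto_compose)
  moreover have "(%l. f ((zs \<circ> \<sigma> \<circ> t) l)) \<longlonglongrightarrow> v"
   using LIMSEQ_subseq_LIMSEQ[OF lim strict_mono_o[OF \<sigma>(1) w(2)]] by (simp add: o_def)
  ultimately have "f w = v" by (rule LIMSEQ_unique)
  then show False using nin wH by blast
 qed
 then show thesis using that[of zs R] zs(1) R lim by blast
qed

end

section \<open>An upper bound for the dimension of the boundary\<close>

text \<open>The spacing is a quarter of the height: a move to the next level costs at most 1/4
  horizontally and 1/2 vertically, together the 3/4 that \<open>growth\<close> admits.\<close>

definition gz :: "nat => int => complex" where
 "gz k i = Complex (of_int i/2^(k+2)) (1/2^k)"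

definition ci :: "nat => real => int" where
 "ci k x = \<lfloor>2^(k+2)*x\<rfloor>"

definition IR :: "nat => nat => int set" where
 "IR R k = {- (int (R+1)*2^(k+2)) .. int (R+1)*2^(k+2)}"

lemma gz_Im: "Im (gz k i) = 1/2^k" "0 < Im (gz k i)" by (auto simp: gz_def)

lemma ci_close: "abs (x - of_int (ci k x)/2^(k+2)) <= 1/4/2^k"
 "of_int (ci k x)/2^(k+2) <= x" "x <= of_int (ci k x)/2^(k+2)+1/4/2^k"
proof -
 define t where "t = (2::real)^(k+2)"
 have t: "0 < t" "t = 4*2^k" by (auto simp: t_def)
 have "of_int (ci k x) <= t*x" "t*x < of_int (ci k x)+1" unfolding ci_def t_def by linarith+
 then have "of_int (ci k x)/t <= x" "x <= of_int (ci k x)/t+1/t" using t(1) by (auto simp: field_simps)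
 then show "abs (x - of_int (ci k x)/2^(k+2)) <= 1/4/2^k"
  "of_int (ci k x)/2^(k+2) <= x" "x <= of_int (ci k x)/2^(k+2)+1/4/2^k" unfolding t_def by auto
qed

text \<open>Cells are nested, and integer division finds the ancestor l levels up; descendants are
  grouped by it.\<close>

lemma ci_div: "ci (n+l) x div 2^l = ci n x"
proof -
 have "\<lfloor>2^(n+l+2)*x / of_int (2^l)\<rfloor> = ci (n+l) x div 2^l" unfolding ci_def by (rule floor_divide_real_eq_div) simp
 moreover have "2^(n+l+2)*x / of_int (2^l) = 2^(n+2)*x" by (simp add: power_add)
 ultimately show ?thesis by (simp add: ci_def)
qed

lemma ci_IR: "abs x <= real R ==> ci k x : IR R k"
proof -
 assume x: "abs x <= real R"
 define t where "t = (2::real)^(k+2)"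
 have t: "1 <= t" unfolding t_def by (rule one_le_power) simp
 have "t*x <= t*real R" "t * - real R <= t*x" using x t by (intro mult_left_mono; simp add: abs_le_iff)+
 moreover have "real (R+1)*t = t*real R+t" by (simp add: algebra_simps)
 ultimately have "- (real (R+1)*t) <= t*x-1" "t*x <= real (R+1)*t" using t by (simp_all only: mult_minus_right)
 then have "- (real (R+1)*2^(k+2)) <= 2^(k+2)*x-1" "2^(k+2)*x <= real (R+1)*2^(k+2)" by (simp_all only: t_def)
 moreover have "of_int (int (R+1)*2^(k+2)) = real (R+1)*2^(k+2)" by simp
 ultimately show ?thesis unfolding IR_def ci_def atLeastAtMost_iff by linarith
qed

lemma IR_div: "i : IR R (n+l) ==> i div 2^l : IR R n"
proof -
 assume "i : IR R (n+l)"
 then have "- (int (R+1)*2^(n+2))*2^l <= i" "i <= (int (R+1)*2^(n+2))*2^l" by (auto simp: IR_def power_add)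
 then have "(- (int (R+1)*2^(n+2))*2^l) div 2^l <= i div 2^l" "i div 2^l <= ((int (R+1)*2^(n+2))*2^l) div 2^l" by (intro zdiv_mono1; simp)+
 moreover have "(x*2^l) div 2^l = x" for x :: int by simp
 ultimately show ?thesis by (simp only: IR_def atLeastAtMost_iff simp_thms)
qed

lemma norm_le_abs_add: "norm z <= abs (Re z)+abs (Im z)" by (rule cmod_le)

lemma dyadic_scale:
 fixes t :: real
 assumes "0 < t" "t <= 1/2^n"
 shows "EX m>=n. 1/2^Suc m <= t & t <= 1/2^m"
proof -
 have "EX m. 1/2^m < t" using real_arch_pow_inv[of t "1/2"] assms by (simp add: power_divide)
 define k where "k = (LEAST m. 1/2^m < t)"
 have k: "1/2^k < t" unfolding k_def by (rule LeastI_ex) fact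
 have kl: "t <= 1/2^m" if "m < k" for m using not_less_Least[of m "%m. 1/2^m < t"] that by (simp add: k_def)
 have "n < k"
 proof (rule ccontr)
  assume "\<not> n < k"
  then have "1/(2::real)^n <= 1/2^k" by (intro divide_left_mono) auto
  then show False using k assms by linarith
 qed
 then obtain m where m: "k = Suc m" "n <= m" by (cases k) auto
 then show ?thesis using k kl[of m] by (intro exI[of _ m]) auto
qed

context half_plane_map
begin

text \<open>Between z and level k the chain runs through the grid points of the cells containing Re
  z, one per scale, and \<open>growth\<close> bounds the image of every move.\<close>

lemma grid_chain:
 assumes z: "0 < Im z" "1/2^Suc m <= Im z" "Im z <= 1/2^m" and k: "k <= m"
 shows "norm (f z-f (gz k (ci k (Re z)))) <= koebe_C*(\<Sum>l=k..m. dl (gz l (ci l (Re z))))" using k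
proof (induction k rule: inc_induct)
 case base
 let ?g = "gz m (ci m (Re z))"
 have "norm (z-?g) <= abs (Re (z-?g))+abs (Im (z-?g))" by (rule norm_le_abs_add)
 also have "... <= 1/4/2^m+1/2/2^m" using ci_close(1)[of "Re z" m] z by (intro add_mono) (auto simp: gz_def)
 also have "... = 3/4*Im ?g" by (simp add: gz_Im)
 finally show ?case using growth[OF gz_Im(2)] by simp
next
 case (step k)
 let ?g = "gz k (ci k (Re z))" and ?g' = "gz (Suc k) (ci (Suc k) (Re z))"
 have "norm (?g'-?g) <= abs (Re (?g'-?g))+abs (Im (?g'-?g))" by (rule norm_le_abs_add)
 also have "... <= 1/4/2^k+1/2/2^k" using ci_close(2,3)[where k = k and x = "Re z"] ci_close(2,3)[where k = "Suc k" and x = "Re z"] by (simp add: gz_def)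
 also have "... = 3/4*Im ?g" by (simp add: gz_Im)
 finally have "norm (f ?g'-f ?g) <= koebe_C*dl ?g" using growth[OF gz_Im(2)] by simp
 then have "norm (f z-f ?g) <= koebe_C*dl ?g+koebe_C*(\<Sum>l=Suc k..m. dl (gz l (ci l (Re z))))"
  using step.IH norm_triangle_ineq[of "f z-f ?g'" "f ?g'-f ?g"] by simp
 also have "... = koebe_C*(\<Sum>l=k..m. dl (gz l (ci l (Re z))))" using step.hyps by (simp add: sum.atLeast_Suc_atMost[of k m] distrib_left)
 finally show ?case .
qed

text \<open>Every frontier point in the half-plane belongs to such a set for small c and large R.
  The margin between c and 2 c pays for the variation of the height along a chain.\<close>

definition bset :: "real => nat => complex set" where
 "bset c R = {z. 2 * c <= Im z & (EX zs. (ALL l. 0 < Im (zs l) & abs (Re (zs l)) <= real R) &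
   (%l. Im (zs l)) \<longlonglongrightarrow> 0 & (%l. f (zs l)) \<longlonglongrightarrow> z)}"

lemma geometric_sum_le:
 fixes x :: real
 assumes "0 <= x" "x < 1"
 shows "(\<Sum>l=k..m. x^l) <= x^k/(1-x)"
proof -
 have "(\<Sum>l=k..m. x^l) <= (\<Sum>l. x^(l+k))"
 proof (cases "k <= m")
  case True
  then have "(\<Sum>l=k..m. x^l) = (\<Sum>l<Suc m-k. x^(l+k))" using sum.shift_bounds_nat_ivl[of "%l. x^l" 0 k "Suc m-k"]
   by (simp add: atLeast0LessThan[symmetric] atLeastLessThanSuc_atLeastAtMost)
  also have "... <= (\<Sum>l. x^(l+k))" using assms by (intro sum_le_suminf) (auto)
  finally show ?thesis .
 qed (use assms in "auto intro!: suminf_nonneg simp: summable_iff_shift intro: summable_geometric")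
 also have "... = x^k/(1-x)" using sums_mult2[OF geometric_sums[of x], of "x^k"] assms by (simp add: power_add sums_iff)
 finally show ?thesis .
qed

text \<open>A cell of level n is charged V i, the sum over its descendants of dl powr s with weight
  h^l at depth l. The weight forces dl <= V i powr (1/s) * t^l along any chain below the cell, so
  the images near the cell lie in one disc whose radius to the power s is proportional to V i. The
  total charge is bounded by a tail of the convergent series \<open>S\<close>.\<close>

lemma bset_null:
 fixes c s w w' :: real
 assumes c: "0 < c" and s: "0 < s" and w: "0 < w" and w': "0 < w'"
  and S: "summable (%m. (2 powr w)^m*(\<Sum>i\<in>IR R m. if c <= Im (f (gz m i)) then dl (gz m i) powr s else 0))"
  and Hoelder: "!!m i. i : IR R m ==> dl (gz m i) <= C*(2 powr - w')^m"
 shows "hausdorff_measure s (bset c R) = 0" unfolding hausdorff_measure_eq_0_iff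
proof (intro allI impI)
 fix d :: real assume d: "0 < d"
 define g where "g = (%m i. if c <= Im (f (gz m i)) then dl (gz m i) powr s else 0)"
 have g0: "0 <= g m i" for m i by (simp add: g_def)
 define h where "h = (2::real) powr w"
 have h: "1 < h" using w by (simp add: h_def)
 define b where "b = (%m. h^m*(\<Sum>i\<in>IR R m. g m i))"
 have b: "summable b" "0 <= b m" for m using S  by (auto simp: b_def g_def h_def intro!: mult_nonneg_nonneg sum_nonneg)
 define t where "t = h powr (- 1/s)"
 have t: "0 < t" "t < 1" using h s by (auto simp: t_def powr_less_one)
 define x where "x = (2::real) powr - w'"
 have x: "0 < x" "x < 1" using w' by (auto simp: x_def powr_less_one)
 have C: "0 <= C" using Hoelder[of 0 0] dl_pos[OF gz_Im(2), of 0 0] by (simp add: IR_def)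
 define K where "K = (4*(koebe_C/(1-t))) powr s"
 have K: "0 < K" using koebe_C_pos t by (simp add: K_def)
 let ?B = "hausdorff_pre_measure s d (bset c R)"
 have "?B <= ennreal e" if e: "0 < e" for e :: real
 proof -
  \<comment> \<open>Bounds the cost by e and also, as a single charge is at most the sum of all,
    every diameter by d.\<close>
  define e' where "e' = min e (d powr s)/K"
  have e': "0 < e'" using e d K by (simp add: e'_def)
  have "\<forall>\<^sub>F n in sequentially. (\<Sum>l. b (l+n)) < e'"
  proof -
   show ?thesis using suminf_exist_split[OF e' b(1)] unfolding eventually_sequentially real_norm_def by (meson abs_ge_self le_less_trans)
  qed
  moreover have "\<forall>\<^sub>F n in sequentially. koebe_C*C*(x^n/(1-x)) < c/2"
  proof -
   have "(%n. koebe_C*C*(x^n/(1-x))) \<longlonglongrightarrow> koebe_C*C*(0/(1-x))" using x by (intro tendsto_intros LIMSEQ_realpow_zero) auto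
   then show ?thesis using c by (intro order_tendstoD) auto
  qed
  ultimately have "\<forall>\<^sub>F n in sequentially. (\<Sum>l. b (l+n)) < e' & koebe_C*C*(x^n/(1-x)) < c/2" by (rule eventually_conj)
  then obtain n where n: "(\<Sum>l. b (l+n)) < e'" "koebe_C*C*(x^n/(1-x)) < c/2" by (auto simp: eventually_sequentially)
  define a where "a = (%i l. h^l*(\<Sum>i'\<in>{i'\<in>IR R (n+l). i' div 2^l = i}. g (n+l) i'))"
  have a0: "0 <= a i l" for i l using h g0 by (auto simp: a_def intro!: mult_nonneg_nonneg sum_nonneg)
  have fin: "finite (IR R k)" for k by (simp add: IR_def)
  have ab: "a i l <= b (l+n)" for i l
  proof -
   have "a i l <= h^l*(\<Sum>i'\<in>IR R (n+l). g (n+l) i')" unfolding a_def using h g0 fin by (intro mult_left_mono sum_mono2) auto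
   also have "... <= h^(l+n)*(\<Sum>i'\<in>IR R (n+l). g (n+l) i')" using h g0 by (intro mult_right_mono power_increasing sum_nonneg) auto
   finally show ?thesis by (simp add: b_def add.commute)
  qed
  have suma: "summable (a i)" for i by (rule summable_comparison_test[of _ "%l. b (l+n)"]) (use a0 ab b(1) in "auto simp: summable_iff_shift")
  define V where "V = (%i. \<Sum>l. a i l)"
  have V0: "0 <= V i" for i unfolding V_def by (rule suminf_nonneg[OF suma a0])
  have aV: "a i l <= V i" for i l unfolding V_def using sum_le_suminf[OF suma, of "{l}" i] a0 by simp
  let ?C = "\<Sum>i\<in>IR R n. V i"
  have sumV: "?C < e'"
  proof -
   have "?C = (\<Sum>l. \<Sum>i\<in>IR R n. a i l)" unfolding V_def by (rule suminf_sum[symmetric]) (rule suma)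
   also have "... <= (\<Sum>l. b (l+n))"
   proof (rule suminf_le)
    fix l
    have "(\<Sum>i\<in>IR R n. a i l) = h^l*(\<Sum>i'\<in>IR R (n+l). g (n+l) i')" unfolding a_def sum_distrib_left[symmetric]
     by (subst sum.group) (use fin IR_div in auto)
    also have "... <= h^(l+n)*(\<Sum>i'\<in>IR R (n+l). g (n+l) i')" using h g0 by (intro mult_right_mono power_increasing sum_nonneg) auto
    finally show "(\<Sum>i\<in>IR R n. a i l) <= b (l+n)" by (simp add: b_def add.commute)
   qed (use suma b(1) in "auto simp: summable_iff_shift intro!: summable_sum")
   finally show ?thesis using n by simp
  qed
  define T where "T = (%i. koebe_C*(V i powr (1/s)/(1-t)))"
  have T: "(4*T i) powr s = K*V i" for i
  proof -
   have "4*T i = (4*(koebe_C/(1-t)))*V i powr (1/s)" by (simp add: T_def)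
   then have "(4*T i) powr s = K*(V i powr (1/s)) powr s" by (simp only: K_def powr_mult)
   then show ?thesis using s V0 by (simp add: powr_powr)
  qed
  have T0: "0 <= T i" for i using koebe_C_pos t by (simp add: T_def)
  have Tpos: "0 < T i" if "0 < V i" for i using koebe_C_pos t that by (simp add: T_def)
  define F where "F = {i\<in>IR R n. 0 < V i}"
  \<comment> \<open>Twice the radius T i, because a boundary point is only a limit of images that
    lie within T i of the centre.\<close>
  define U where "U = (%i. cball (f (gz n i)) (2*T i))"
  have near: "ci n (Re z) : F & norm (f z-f (gz n (ci n (Re z)))) <= T (ci n (Re z))"
   if z: "0 < Im z" "Im z <= 1/2^n" "abs (Re z) <= real R" "3/2 * c <= Im (f z)" for z
  proof -
   obtain m where m: "n <= m" "1/2^Suc m <= Im z" "Im z <= 1/2^m" using dyadic_scale[OF z(1,2)] by blast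
   define i where "i = ci n (Re z)"
   define p where "p = (%l. gz l (ci l (Re z)))"
   have pIR: "ci l (Re z) : IR R l" for l by (rule ci_IR[OF z(3)])
   \<comment> \<open>The Hoelder bound makes the chain short, so all its points keep image height at
     least c and the cut-off in g does not remove them.\<close>
   have rel: "c <= Im (f (p k))" if k: "n <= k" "k <= m" for k
   proof -
    have "norm (f z-f (p k)) <= koebe_C*(\<Sum>l=k..m. dl (p l))" unfolding p_def by (rule grid_chain[OF z(1) m(2,3) k(2)])
    also have "... <= koebe_C*(\<Sum>l=k..m. C*x^l)" using koebe_C_pos Hoelder[OF pIR] unfolding p_def x_def by (intro mult_left_mono sum_mono) auto
    also have "... <= koebe_C*(C*(x^k/(1-x)))" unfolding sum_distrib_left[symmetric]
     using koebe_C_pos C x by (intro mult_left_mono geometric_sum_le) auto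
    also have "... <= koebe_C*(C*(x^n/(1-x)))" using koebe_C_pos C x k by (intro mult_left_mono divide_right_mono power_decreasing) auto
    also have "... <= c/2" using n by (simp)
    finally have "abs (Im (f z-f (p k))) <= c/2" using abs_Im_le_cmod[of "f z-f (p k)"] by linarith
    then have "Im (f z)-Im (f (p k)) <= c/2" by (simp only: minus_complex.sel)
    then show ?thesis using z(4) by linarith
   qed
   have dlV: "h^l*dl (p (n+l)) powr s <= V i" if l: "n+l <= m" for l
   proof -
    have "g (n+l) (ci (n+l) (Re z)) <= (\<Sum>i'\<in>{i'\<in>IR R (n+l). i' div 2^l = i}. g (n+l) i')"
     using fin g0 pIR by (intro member_le_sum) (auto simp: i_def ci_div)
    then have "h^l*g (n+l) (ci (n+l) (Re z)) <= a i l" unfolding a_def using h by (intro mult_left_mono) auto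
    moreover have "g (n+l) (ci (n+l) (Re z)) = dl (p (n+l)) powr s" using rel[of "n+l"] l by (simp add: g_def p_def)
    ultimately show ?thesis using aV[of i l] by simp
   qed
   have "0 < h^0*dl (p (n+0)) powr s" using dl_pos[OF gz_Im(2)] by (simp add: p_def) (metis less_irrefl)
   also have "... <= V i" by (rule dlV) (use m in simp)
   finally have Vi: "0 < V i" .
   have dlb: "dl (p (n+l)) <= V i powr (1/s)*t^l" if l: "n+l <= m" for l
   proof -
    have "dl (p (n+l)) powr s <= V i/h^l" using dlV[OF l] h by (simp add: field_simps)
    then have "(dl (p (n+l)) powr s) powr (1/s) <= (V i/h^l) powr (1/s)" using s by (intro powr_mono2) auto
    moreover have "(dl (p (n+l)) powr s) powr (1/s) = dl (p (n+l))" using s dl_pos[OF gz_Im(2)] by (simp add: powr_powr p_def less_imp_le)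
    moreover have "(V i/h^l) powr (1/s) = V i powr (1/s)*t^l"
    proof -
     have "t^l = h powr (- (real l/s))" using h by (simp add: t_def powr_power)
     moreover have "(V i/h^l) powr (1/s) = V i powr (1/s)/(h^l) powr (1/s)" by (rule powr_divide)
     moreover have "(h^l) powr (1/s) = h powr (real l/s)" using h by (simp add: powr_realpow[symmetric] powr_powr)
     ultimately show ?thesis by (simp add: powr_minus_divide)
    qed
    ultimately show ?thesis by simp
   qed
   have "norm (f z-f (p n)) <= koebe_C*(\<Sum>l=n..m. dl (p l))" unfolding p_def by (rule grid_chain[OF z(1) m(2,3,1)])
   also have "(\<Sum>l=n..m. dl (p l)) = (\<Sum>l=0..m-n. dl (p (n+l)))"
    using sum.shift_bounds_cl_nat_ivl[of "%l. dl (p l)" 0 n "m-n"] m(1) by (simp add: add.commute)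
   also have "... <= (\<Sum>l=0..m-n. V i powr (1/s)*t^l)" using dlb m(1) by (intro sum_mono) auto
   also have "... <= V i powr (1/s)*(t^0/(1-t))" unfolding sum_distrib_left[symmetric] using t by (intro mult_left_mono geometric_sum_le) auto
   finally have "norm (f z-f (p n)) <= T i" using koebe_C_pos by (simp add: T_def)
   then show ?thesis using Vi pIR by (simp add: F_def i_def p_def)
  qed
  have "bset c R <= (\<Union>i\<in>F. U i)"
  proof
   fix \<zeta> assume "\<zeta> : bset c R"
   then obtain zs where zs: "!!l. 0 < Im (zs l)" "!!l. abs (Re (zs l)) <= real R"
    "(%l. Im (zs l)) \<longlonglongrightarrow> 0" "(%l. f (zs l)) \<longlonglongrightarrow> \<zeta>" and Im\<zeta>: "2 * c <= Im \<zeta>"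
    by (auto simp: bset_def)
   define v where "v = min (c/2) (Min (insert 1 (T ` F)))"
   have finF: "finite F" using fin by (simp add: F_def)
   have v: "0 < v" using c Tpos finF by (auto simp: v_def F_def)
   have "\<forall>\<^sub>F l in sequentially. Im (zs l) < 1/2^n" by (rule order_tendstoD(2)[OF zs(3)]) simp
   moreover have "\<forall>\<^sub>F l in sequentially. dist (f (zs l)) \<zeta> < v" using zs(4) v by (rule tendstoD)
   ultimately have "\<forall>\<^sub>F l in sequentially. Im (zs l) < 1/2^n & dist (f (zs l)) \<zeta> < v" by (rule eventually_conj)
   then obtain l where l: "Im (zs l) < 1/2^n" "dist (f (zs l)) \<zeta> < v" by (auto simp: eventually_sequentially)
   let ?A = "ci n (Re (zs l))"
   have "abs (Im (f (zs l)-\<zeta>)) < c/2" using l(2) abs_Im_le_cmod[of "f (zs l)-\<zeta>"] by (simp add: dist_norm v_def)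
   then have "Im \<zeta>-Im (f (zs l)) < c/2" by (simp only: minus_complex.sel)
   then have "3/2 * c <= Im (f (zs l))" using Im\<zeta> by linarith
   with near[of "zs l"] zs(1,2) l(1)
   have i: "?A : F" "norm (f (zs l)-f (gz n (?A))) <= T (?A)" by auto
   have "v <= T (?A)" using i(1) finF by (auto simp: v_def intro!: min.coboundedI2)
   then have "dist (f (gz n (?A))) \<zeta> <= 2*T (?A)" using l(2) i(2) dist_triangle[of "f (gz n (?A))" \<zeta> "f (zs l)"]
    by (simp add: dist_norm norm_minus_commute)
   then show "\<zeta> : (\<Union>i\<in>F. U i)" using i(1) by (auto simp: U_def)
  qed
  then have "?B <= ennreal (\<Sum>i\<in>F. diameter (U i) powr s)"
  proof (rule hausdorff_pre_measure_finite_cover[rotated])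
   fix i assume i: "i : F"
   have "V i <= ?C" using i fin V0 by (intro member_le_sum) (auto simp: F_def)
   then have "K*V i <= K*e'" using K sumV by (intro mult_left_mono) auto
   also have "... <= d powr s" by (simp add: e'_def)
   finally have "(4*T i) powr s <= d powr s" by (simp only: T)
   then have "4*T i <= d" using powr_less_mono2[OF s, of d "4*T i"] d by linarith
   then show "diameter (U i) <= d" using T0[of i] by (simp add: U_def)
  qed (use fin d in "auto simp: F_def U_def")
  also have "(\<Sum>i\<in>F. diameter (U i) powr s) = (\<Sum>i\<in>F. K*V i)"
  proof (rule sum.cong[OF refl])
   fix i
   have "diameter (U i) = 4*T i" using T0[of i] by (simp add: U_def)
   then show "diameter (U i) powr s = K*V i" by (simp only: T)
  qed
  also have "... <= K*?C" unfolding sum_distrib_left[symmetric] using K V0 fin by (intro mult_left_mono sum_mono2) (auto simp: F_def)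
  also have "... <= K*e'" using K sumV by (intro mult_left_mono) auto
  also have "... <= e" using K by (simp add: e'_def)
  finally show ?thesis by (simp add: ennreal_leI)
 qed
 then show "?B = 0" by (rule ennreal_eq_0_I)
qed

lemma frontier_null:
 fixes s h :: real
 assumes s: "0 < s" and h: "0 < h" "0 < h'"
  and S: "!!k R. summable (%m. (2 powr h)^m*(\<Sum>i\<in>IR R m. if 1/real (Suc k) <= Im (f (gz m i)) then dl (gz m i) powr s else 0))"
  and Hoelder: "!!R. EX C. ALL m. ALL i:IR R m. dl (gz m i) <= C*(2 powr - h')^m" and far: "!!z. 0 < Im z ==> m0 <= norm z ==> norm (f z-z) <= b0"
 shows "hausdorff_measure s (frontier (f ` \<H>) \<inter> \<H>) = 0"
proof (rule hausdorff_measure_null_subset)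
 let ?A = "\<Union>k. bset (1/real (Suc k)) k"
 show "hausdorff_measure s ?A = 0"
 proof (rule hausdorff_measure_null_UN)
  fix k
  obtain C where "!!m i. i : IR k m ==> dl (gz m i) <= C*(2 powr - h')^m" using Hoelder by blast
  then show "hausdorff_measure s (bset (1/real (Suc k)) k) = 0" by (intro bset_null[OF _ s h S]) auto
 qed
 show "frontier (f ` \<H>) \<inter> \<H> <= ?A"
 proof
  fix w assume w: "w : frontier (f ` \<H>) \<inter> \<H>"
  obtain zs R where zs: "!!l. 0 < Im (zs l)" "!!l. norm (zs l) <= R" "(%l. Im (zs l)) \<longlonglongrightarrow> 0" "(%l. f (zs l)) \<longlonglongrightarrow> w"
   using frontier_sequence[of w m0 b0] w far by auto
  have pos: "0 < Im w" using w by (simp add: upper_half_plane_def)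
  obtain k :: nat where k: "max R (2/Im w) < real k" using reals_Archimedean2 by blast
  have "2*(1/real (Suc k)) <= Im w" using k pos by (simp add: field_simps)
  moreover have "abs (Re (zs l)) <= real k" for l using abs_Re_le_cmod[of "zs l"] zs(2)[of l] k by linarith
  ultimately have "w : bset (1/real (Suc k)) k" using zs(1,3,4) unfolding bset_def by blast
  then show "w : ?A" by auto
 qed
qed

end

lemma cflow_half_plane_map: "continuous_on {0..1} W ==> half_plane_map (cflow W)" by unfold_locales (auto intro: cflow_holomorphic cflow_inj cflow_Im)

lemma cflow_far:
 assumes W: "continuous_on {0..1} W"
 shows "EX m0 b0. ALL z. 0 < Im z --> m0 <= norm z --> norm (cflow W z-z) <= b0"
proof -
 have "bounded (W ` {0..1})" by (intro compact_imp_bounded compact_continuous_image W compact_Icc)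
 then obtain m where "ALL x:W ` {0..1}. norm x <= m" unfolding bounded_iff by blast
 then have m: "!!s. s : {0..1} ==> abs (W s) <= m" by simp
 have "norm (cflow W z-z) <= 3+2*m" if z: "0 < Im z" "2*m+4 <= norm z" for z
 proof -
  have w: "abs (W 0) <= m" "abs (W 1) <= m" using m by auto
  let ?A = "z + of_real (W 0)"
  have "m+2*(1-0)+2 <= norm ?A" using norm_triangle_ineq4[of "z + of_real (W 0)" "of_real (W 0)"] w(1) using z by simp
  then have 1: "norm (rev_flow W 0 1 ?A-?A) < 2*(1-0)+1" using z m by (intro rev_flow_far[OF W]) auto
  have 2: "cflow W z-z = (rev_flow W 0 1 ?A-?A) + of_real (W 0-W 1)" by (simp add: cflow_def)
  have 3: "norm (complex_of_real (W 0-W 1)) <= 2*m" unfolding norm_of_real using w by linarith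
  show ?thesis unfolding 2 using norm_triangle_le[OF add_mono[OF less_imp_le[OF 1] 3]] by simp
 qed
 then show ?thesis by auto
qed

section \<open>Moments of the conformal radius and the upper bound\<close>

text \<open>With \<open>qE\<close>, the diagonal exponents of a single charge. Their sum (5 r - 3
  r^2)/2 exceeds 1 exactly for 2/3 < r < 1.\<close>

definition pE :: "real => real" where "pE r = (10*r-3*r^2)/4"
definition qE :: "real => real" where "qE r =-3*r^2/4"

lemma one_charge_expectation:
 assumes "rbm M W" "0 < Im z"
 shows "(EE M (%w. norm (qf (W w) z z) powr pE r*norm (qf (W w) z (cnj z)) powr qE r*norm (fl (W w) z) powr r))
  <= ennreal (norm z powr r)" using vertex_expectation[OF assms(1), of "{0::nat}" "%_. z" "%_. r"] assms(2)
 by (simp add: vL_def chA_def chB_def pE_def qE_def power2_eq_square field_simps)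

definition dlW :: "(real => real) => complex => real" where
 "dlW W z = norm (qf W z z)*Im z"

lemma norm_qf_cnj:
 assumes W: "continuous_on {0..1} W" and z: "0 < Im z"
 shows "norm (qf W z (cnj z)) = Im (fl W z)/Im z" using z cflow_Im(2)[OF W z] fl_continuous(2)[OF W z] by (simp add: qf_continuous(5)[OF W z z] complex_diff_cnj norm_divide)

lemma fl_bounds:
 assumes W: "continuous_on {0..1} W" and z: "0 < Im z" "Im z <= 1"
 shows "0 < Im (fl W z)" "Im z <= Im (fl W z)" "Im (fl W z) <= 3" "0 < dlW W z" "dlW W z <= koebe_C*Im (fl W z)"
  "dlW W z = half_plane_map.dl (cflow W) z"
proof -
 interpret half_plane_map "cflow W" by (rule cflow_half_plane_map[OF W])
 note fl = fl_continuous(2)[OF W z(1)]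
 show "0 < Im (fl W z)" "Im z <= Im (fl W z)" using cflow_Im[OF W z(1)] fl by auto
 have "(Im z)^2 <= 1" using z by (simp add: power_le_one)
 then have "(Im (fl W z))^2 <= 3^2" using cflow_Im(3)[OF W z(1)] fl by simp
 then show "Im (fl W z) <= 3" by (rule power2_le_imp_le) simp
 show eq: "dlW W z = half_plane_map.dl (cflow W) z" using qf_continuous(1)[OF W z(1) z(1)] by (simp add: dlW_def dl_def)
 show "0 < dlW W z" "dlW W z <= koebe_C*Im (fl W z)" using dl_pos[OF z(1)] dl_le_Im[OF z(1)] eq fl by simp_all
qed

text \<open>The first bound discards the factors other than \<open>dlW\<close> using c <= Im (fl W
  z) <= 3. The second needs no cut-off: the remaining power qE r + r of the height is positive and
  is bounded below through dlW <= koebe_C * Im, which raises the exponent to pE r + qE r +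
  r.\<close>

lemma one_charge_bounds:
 assumes W: "continuous_on {0..1} W" and z: "0 < Im z" "Im z <= 1" and r: "0 < r" "r < 4/3"
 defines "N \<equiv> norm (qf W z z) powr pE r*norm (qf W z (cnj z)) powr qE r*norm (fl W z) powr r"
 shows "0 < c ==> c <= Im (fl W z) ==> dlW W z powr pE r <= (3 powr (- qE r) * c powr (- r)*Im z powr (pE r+qE r))*N"
  and "dlW W z powr (pE r+qE r+r) <= (koebe_C powr (qE r+r)*Im z powr (pE r+qE r))*N"
proof -
 define Y where "Y = Im (fl W z)"
 define y where "y = Im z"
 define D where "D = dlW W z"
 have fb: "0 < Y" "Y <= 3" "0 < D" "D <= koebe_C*Y" using fl_bounds[OF W z] by (auto simp: Y_def D_def)
 have y: "0 < y" using z by (simp add: y_def)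
 have q: "qE r <= 0" by (simp add: qE_def)
 have qr: "0 < qE r+r" using r by (simp add: qE_def power2_eq_square)
 have n1: "norm (qf W z z) = D/y" using y by (simp add: D_def dlW_def y_def)
 have n2: "norm (qf W z (cnj z)) = Y/y" using norm_qf_cnj[OF W z(1)] by (simp add: Y_def y_def)
 have n3: "Y <= norm (fl W z)" using abs_Im_le_cmod[of "fl W z"]  by (simp add: Y_def)
 let ?A = "Y powr qE r*norm (fl W z) powr r"
 let ?B = "pE r+qE r"
 have N: "N = D powr pE r*y powr (- ?B)*?A"
 proof -
  have "N = (D/y) powr pE r*(Y/y) powr qE r*norm (fl W z) powr r" by (simp add: N_def n1 n2)
  also have "... = (D powr pE r/y powr pE r)*(Y powr qE r/y powr qE r)*norm (fl W z) powr r" by (simp only: powr_divide)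
  also have "... = D powr pE r*y powr (- ?B)*?A" unfolding powr_minus_divide powr_add by simp
  finally show ?thesis .
 qed
 have ypow: "y powr ?B*y powr (- ?B) = 1" using y by (simp flip: powr_add)
 show "dlW W z powr pE r <= (3 powr (- qE r) * c powr (- r)*Im z powr ?B)*N" if c: "0 < c" "c <= Im (fl W z)"
 proof -
  let ?C = "3 powr (- qE r) * c powr (- r)"
  have "1 = (3 powr (- qE r)*3 powr qE r)*(c powr (- r) * c powr r)" using c by (simp flip: powr_add)
  also have "... = ?C*(3 powr qE r * c powr r)" by simp
  also have "... <= ?C*?A"
  proof (intro mult_left_mono mult_mono)
   show "3 powr qE r <= Y powr qE r" using fb q by (intro powr_mono2') auto
   have "c <= norm (fl W z)" using c n3 by (simp add: Y_def)
   then show "c powr r <= norm (fl W z) powr r" using c r by (intro powr_mono2) auto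
  qed auto
  finally have "D powr pE r*1 <= D powr pE r*(?C*?A)" by (intro mult_left_mono) auto
  also have "... = ?C*(y powr ?B*y powr (- ?B))*(D powr pE r*?A)" by (simp only: ypow mult_1_right mult_ac)
  also have "... = (3 powr (- qE r) * c powr (- r)*y powr ?B)*N" unfolding N by (simp only: mult_ac)
  finally show ?thesis by (simp add: D_def y_def)
 qed
 let ?D = "qE r+r"
 have "D powr (pE r+qE r+r) = D powr pE r*D powr ?D" by (simp flip: powr_add add: add.assoc)
 also have "... <= D powr pE r*(koebe_C powr ?D*?A)"
 proof (rule mult_left_mono)
  have "D powr ?D <= (koebe_C*Y) powr ?D" using fb qr by (intro powr_mono2) auto
  also have "... = koebe_C powr ?D*(Y powr qE r*Y powr r)" by (simp add: powr_mult powr_add)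
  also have "... <= koebe_C powr ?D*?A" using n3 fb r by (intro mult_left_mono powr_mono2) auto
  finally show "D powr ?D <= koebe_C powr ?D*?A" .
 qed simp
 also have "... = koebe_C powr ?D*(y powr ?B*y powr (- ?B))*(D powr pE r*?A)" by (simp only: ypow mult_1_right mult_ac)
 also have "... = (koebe_C powr ?D*y powr ?B)*N" unfolding N by (simp only: mult_ac)
 finally show "dlW W z powr (pE r+qE r+r) <= (koebe_C powr ?D*Im z powr ?B)*N" by (simp add: D_def y_def)
qed

lemma rbmD:
 assumes "rbm M W"
 shows "prob_space M" "!!t. t : {0..1} ==> (%w. W w t) : borel_measurable M" "AE w in M. continuous_on {0..1} (W w)"
 using assms by (auto simp: rbm_def)

lemma measurable_dlW:
 assumes W: "!!t. t : {0..1} ==> (%w. W w t) : borel_measurable N"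
 shows "(%w. dlW (W w) z) : borel_measurable N"
proof -
 note [measurable] = measurable_fl[OF W]
 show ?thesis unfolding dlW_def by measurable
qed

lemma one_charge_estimates:
 assumes M: "rbm M W" and z: "0 < Im z" "Im z <= 1" "norm z <= B" and r: "0 < r" "r < 4/3"
 shows "0 < c ==> (EE M (%w. if c <= Im (fl (W w) z) then dlW (W w) z powr pE r else 0))
   <= ennreal (3 powr (- qE r) * c powr (- r)*B powr r*Im z powr (pE r+qE r))" and "(EE M (%w. dlW (W w) z powr (pE r+qE r+r)))
   <= ennreal (koebe_C powr (qE r+r)*B powr r*Im z powr (pE r+qE r))"
proof -
 define N where "N = (%w. norm (qf (W w) z z) powr pE r*norm (qf (W w) z (cnj z)) powr qE r*norm (fl (W w) z) powr r)"
 note [measurable] = measurable_fl[OF rbmD(2)[OF M]]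
 have Nm: "N : borel_measurable M" unfolding N_def by measurable
 have E: "(EE M (%w. C*N w)) <= ennreal (C*B powr r)" if C: "0 <= C" for C
 proof -
  have "(EE M (%w. C*N w)) = ennreal C*(EE M (%w. N w))" using C Nm by (simp add: ennreal_mult' nn_integral_cmult)
  also have "... <= ennreal C*ennreal (norm z powr r)" unfolding N_def by (intro mult_left_mono one_charge_expectation[OF M z(1)]) auto
  also have "... <= ennreal C*ennreal (B powr r)" using z r by (intro mult_left_mono ennreal_leI powr_mono2) auto
  finally show ?thesis using C by (simp add: ennreal_mult')
 qed
 let ?A = "\<integral>\<^sup>+w. ennreal (if c <= Im (fl (W w) z) then dlW (W w) z powr pE r else 0) \<partial>M"
 show "?A <= ennreal (3 powr (- qE r) * c powr (- r)*B powr r*Im z powr (pE r+qE r))" if c: "0 < c"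
 proof -
  let ?C = "3 powr (- qE r) * c powr (- r)*Im z powr (pE r+qE r)"
  have "?A <= (EE M (%w. ?C*N w))"
  proof (rule nn_integral_mono_AE)
   show "AE w in M. ennreal (if c <= Im (fl (W w) z) then dlW (W w) z powr pE r else 0) <= ennreal (?C*N w)" using rbmD(3)[OF M]
   proof eventually_elim
    case (elim w)
    have "(if c <= Im (fl (W w) z) then dlW (W w) z powr pE r else 0) <= ?C*N w" using one_charge_bounds(1)[OF elim z(1,2) r c]  by (simp add: N_def)
    then show ?case by (rule ennreal_leI)
   qed
  qed
  also have "... <= ennreal (?C*B powr r)" by (rule E) simp
  finally show ?thesis by (simp add: mult_ac)
 qed
 let ?C = "koebe_C powr (qE r+r)*Im z powr (pE r+qE r)"
 let ?B = "\<integral>\<^sup>+w. ennreal (dlW (W w) z powr (pE r+qE r+r)) \<partial>M"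
 have "?B <= (EE M (%w. ?C*N w))"
 proof (rule nn_integral_mono_AE)
  show "AE w in M. ennreal (dlW (W w) z powr (pE r+qE r+r)) <= ennreal (?C*N w)" using rbmD(3)[OF M]
  proof eventually_elim
   case (elim w)
   show ?case using one_charge_bounds(2)[OF elim z(1,2) r] by (intro ennreal_leI) (simp add: N_def)
  qed
 qed
 also have "... <= ennreal (?C*B powr r)" by (rule E) simp
 finally show "?B <= ennreal (koebe_C powr (qE r+r)*B powr r*Im z powr (pE r+qE r))" by (simp add: mult_ac)
qed

text \<open>About 2^m indices with means of order 2^(- m (1 + 2 h)) leave room for the weight 2^(h
  m) and still give a geometric series of expectations.\<close>

lemma AE_summable_geometric:
 fixes X :: "nat => int => 'a => real"
 assumes meas: "!!m i. X m i : borel_measurable M" and nn: "!!m i w. 0 <= X m i w"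
  and mean: "!!m i. i : IR R m ==> (EE M (%w. X m i w)) <= ennreal (K*(1/2^m) powr (1+2*h))" and h: "0 < h" and K: "0 <= K"
 shows "AE w in M. summable (%m. (2 powr h)^m*(\<Sum>i\<in>IR R m. X m i w))"
proof -
 define x where "x = (2::real) powr - h"
 have x: "0 < x" "x < 1" using h by (auto simp: x_def powr_less_one)
 let ?C = "2 powr h"
 define S where "S = (%m w. ?C^m*(\<Sum>i\<in>IR R m. X m i w))"
 have S0: "0 <= S m w" for m w by (auto simp: S_def nn intro!: mult_nonneg_nonneg sum_nonneg)
 have [measurable]: "S m : borel_measurable M" for m using meas unfolding S_def by measurable
 let ?B = "real (R+1)"
 have ES: "(EE M (%w. S m w)) <= ennreal (9*?B*K*x^m)" for m
 proof -
  have card: "real (card (IR R m)) <= 9*?B*2^m"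
  proof -
   have "card (IR R m) = nat (2*(int (R+1)*2^(m+2))+1)" by (simp add: IR_def)
   then have "real (card (IR R m)) = 2*(?B*2^(m+2))+1" by simp
   also have "... <= 9*?B*2^m"
   proof -
    have "1*1 <= ?B*2^m" by (intro mult_mono one_le_power) auto
    then show ?thesis by (simp add: algebra_simps)
   qed
   finally show ?thesis .
  qed
  let ?A = "K*(1/2^m) powr (1+2*h)"
  have "(EE M (%w. S m w)) = ennreal (?C^m)*(\<Sum>i\<in>IR R m. \<integral>\<^sup>+w. ennreal (X m i w) \<partial>M)"
   using meas nn by (simp add: S_def ennreal_mult' nn_integral_cmult nn_integral_sum flip: sum_ennreal)
  also have "... <= ennreal (?C^m)*(\<Sum>i\<in>IR R m. ennreal ?A)" by (intro mult_left_mono sum_mono mean) auto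
  also have "... = ennreal (?C^m*(real (card (IR R m))*?A))" by (simp add: ennreal_mult' ennreal_of_nat_eq_real_of_nat)
  also have "... <= ennreal (?C^m*((9*?B*2^m)*?A))" using card K by (intro ennreal_leI mult_left_mono mult_right_mono) auto
  also have "?C^m*((9*?B*2^m)*?A) = 9*?B*K*x^m"
  proof -
   have "(1/2^m) powr (1+2*h) = (2::real) powr (- (real m*(1+2*h)))" by (simp add: powr_divide powr_minus_divide powr_powr flip: powr_realpow)
   moreover have "?C^m = 2 powr (h*real m)" by (simp add: powr_power mult.commute)
   moreover have "(2::real)^m = 2 powr real m" by (simp add: powr_realpow)
   moreover have "x^m = 2 powr (- h*real m)" by (simp add: x_def powr_power mult.commute)
   moreover have "(2::real) powr (h*real m)*(2 powr real m*2 powr (- (real m*(1+2*h)))) = 2 powr (- h*real m)"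
    by (simp flip: powr_add add: algebra_simps)
   ultimately show ?thesis by simp
  qed
  finally show ?thesis .
 qed
 let ?D = "\<integral>\<^sup>+w. (\<Sum>m. ennreal (S m w)) \<partial>M"
 have "?D = (\<Sum>m. \<integral>\<^sup>+w. ennreal (S m w) \<partial>M)" by (rule nn_integral_suminf) simp
 also have "... <= (\<Sum>m. ennreal (9*?B*K*x^m))" by (intro suminf_le ES) auto
 also have "... = ennreal (\<Sum>m. 9*?B*K*x^m)" using K x by (intro suminf_ennreal2 summable_mult summable_geometric) auto
 finally have "?D ~= \<infinity>" by (metis ennreal_less_top infinity_ennreal_def leD)
 then have "AE w in M. (\<Sum>m. ennreal (S m w)) ~= \<infinity>" by (intro nn_integral_PInf_AE) auto
 then show ?thesis
 proof eventually_elim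
  case (elim w)
  then have "summable (%m. S m w)" by (intro summable_suminf_not_top S0) (auto)
  then show ?case by (simp add: S_def)
 qed
qed

lemma gz_norm:
 assumes "i : IR R m"
 shows "norm (gz m i) <= real R+2"
proof -
 have "abs (of_int i) <= real (R+1)*(2::real)^(m+2)"
 proof -
  have "abs i <= int (R+1)*2^(m+2)" using assms unfolding IR_def by auto
  then have "real_of_int (abs i) <= of_int (int (R+1)*2^(m+2))" by (rule of_int_le_iff[THEN iffD2])
  then show ?thesis by simp
 qed
 then have "abs (Re (gz m i)) <= real (R+1)" by (simp add: gz_def divide_le_eq)
 moreover have "abs (Im (gz m i)) <= 1" by (simp add: gz_Im)
 ultimately show ?thesis using norm_le_abs_add[of "gz m i"] by linarith
qed

text \<open>In this range pE r + qE r beats the number of cells. The moment with cut-off supplies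
  the series of charges, the one without cut-off the Hoelder bound for all cells at once.\<close>

lemma boundary_null_one_exponent:
 assumes M: "rbm M W" and r: "2/3 < r" "r < 1"
 shows "AE w in M. hausdorff_measure (pE r) (frontier (cflow (W w) ` \<H>) \<inter> \<H>) = 0"
proof -
 define h where "h = (pE r+qE r-1)/2"
 have h: "0 < h"
 proof -
  have "pE r+qE r-1 = (3*r-2)*(1-r)/2" by (simp add: pE_def qE_def power2_eq_square field_simps)
  moreover have "0 < (3*r-2)*(1-r)" using r by (intro mult_pos_pos) auto
  ultimately show ?thesis by (simp add: h_def)
 qed
 have pos: "0 < pE r" "0 < qE r+r" using r by (auto simp: pE_def qE_def power2_eq_square)
 define \<sigma> where "\<sigma> = pE r+qE r+r"
 have \<sigma>: "0 < \<sigma>" using pos by (simp add: \<sigma>_def)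
 have eta1: "pE r+qE r = 1+2*h" by (simp add: h_def field_simps)
 note [measurable] = measurable_fl[OF rbmD(2)[OF M]] measurable_dlW[OF rbmD(2)[OF M]]
 have y1: "Im (gz m i) <= 1" for m i by (simp add: gz_Im)
 let ?A = "2 powr h"
 have A: "AE w in M. summable (%m. ?A^m*(\<Sum>i\<in>IR R m. if 1/real (Suc k) <= Im (fl (W w) (gz m i)) then dlW (W w) (gz m i) powr pE r else 0))" for k R
 proof (rule AE_summable_geometric[OF _ _ _ h, where K = "3 powr (- qE r)*(1/real (Suc k)) powr (- r)*(real R+2) powr r"])
  show "(EE M (%w. if 1/real (Suc k) <= Im (fl (W w) (gz m i)) then dlW (W w) (gz m i) powr pE r else 0))
   <= ennreal (3 powr (- qE r)*(1/real (Suc k)) powr (- r)*(real R+2) powr r*(1/2^m) powr (1+2*h))" if "i : IR R m" for m i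
   using one_charge_estimates(1)[OF M gz_Im(2) y1 gz_norm[OF that], of r "1/real (Suc k)"] r by (simp only: gz_Im(1) eta1) simp
 qed auto
 have B: "AE w in M. summable (%m. ?A^m*(\<Sum>i\<in>IR R m. dlW (W w) (gz m i) powr \<sigma>))" for R
 proof (rule AE_summable_geometric[OF _ _ _ h, where K = "koebe_C powr (qE r+r)*(real R+2) powr r"])
  show "(EE M (%w. dlW (W w) (gz m i) powr \<sigma>))
   <= ennreal (koebe_C powr (qE r+r)*(real R+2) powr r*(1/2^m) powr (1+2*h))" if "i : IR R m" for m i
   using one_charge_estimates(2)[OF M gz_Im(2) y1 gz_norm[OF that], of r] r by (simp only: gz_Im(1) eta1 \<sigma>_def)
 qed auto
 have "AE w in M. ALL k R. summable (%m. ?A^m*(\<Sum>i\<in>IR R m. if 1/real (Suc k) <= Im (fl (W w) (gz m i)) then dlW (W w) (gz m i) powr pE r else 0))"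
  using A by (simp add: AE_all_countable)
 moreover have "AE w in M. ALL R. summable (%m. ?A^m*(\<Sum>i\<in>IR R m. dlW (W w) (gz m i) powr \<sigma>))" using B by (simp add: AE_all_countable)
 ultimately show ?thesis using rbmD(3)[OF M]
 proof eventually_elim
  case (elim w)
  interpret half_plane_map "cflow (W w)" by (rule cflow_half_plane_map[OF elim(3)])
  have eq: "fl (W w) (gz m i) = cflow (W w) (gz m i)" "dlW (W w) (gz m i) = dl (gz m i)" for m i
   using fl_continuous(2)[OF elim(3) gz_Im(2)] fl_bounds(6)[OF elim(3) gz_Im(2) y1] by auto
  obtain m0 b0 where far: "!!z. 0 < Im z ==> m0 <= norm z ==> norm (cflow (W w) z-z) <= b0" using cflow_far[OF elim(3)] by blast
  show ?case
  proof (rule frontier_null[OF pos(1) h _ _ _ far])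
   show "0 < h/\<sigma>" using h \<sigma> by simp
   show "summable (%m. ?A^m*(\<Sum>i\<in>IR R m. if 1/real (Suc k) <= Im (cflow (W w) (gz m i)) then dl (gz m i) powr pE r else 0))" for k R
    using elim(1) by (simp only: eq)
   let ?B = "2 powr - (h/\<sigma>)"
   show "EX C. ALL m. ALL i:IR R m. dl (gz m i) <= C*?B^m" for R
   proof -
    have "summable (%m. ?A^m*(\<Sum>i\<in>IR R m. dl (gz m i) powr \<sigma>))" using elim(2) by (simp only: eq)
    from convergent_imp_Bseq[OF summable_LIMSEQ_zero[OF this, THEN convergentI]]
    obtain B where B: "0 < B" "!!m. abs (?A^m*(\<Sum>i\<in>IR R m. dl (gz m i) powr \<sigma>)) <= B" by (auto simp: Bseq_def)
    have "dl (gz m i) <= B powr (1/\<sigma>)*?B^m" if i: "i : IR R m" for m i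
    proof -
     have d: "0 < dl (gz m i)" by (rule dl_pos[OF gz_Im(2)])
     have "dl (gz m i) powr \<sigma> <= (\<Sum>i\<in>IR R m. dl (gz m i) powr \<sigma>)" using i by (intro member_le_sum) (auto simp: IR_def)
     then have "?A^m*dl (gz m i) powr \<sigma> <= ?A^m*(\<Sum>i\<in>IR R m. dl (gz m i) powr \<sigma>)" by simp
     also have "... <= B" using B(2)[of m] by linarith
     finally have "dl (gz m i) powr \<sigma> <= B/?A^m" by (simp add: field_simps)
     then have "(dl (gz m i) powr \<sigma>) powr (1/\<sigma>) <= (B/?A^m) powr (1/\<sigma>)" using \<sigma> by (intro powr_mono2) auto
     moreover have "(dl (gz m i) powr \<sigma>) powr (1/\<sigma>) = dl (gz m i)" using \<sigma> d by (simp add: powr_powr)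
     moreover have "(B/?A^m) powr (1/\<sigma>) = B powr (1/\<sigma>)*?B^m"
     proof -
      have "?A^m = 2 powr (h*real m)" "?B^m = 2 powr (- (h*real m/\<sigma>))" by (simp_all add: powr_power mult.commute)
      then show ?thesis by (simp add: powr_divide powr_powr powr_minus_divide)
     qed
     ultimately show ?thesis by simp
    qed
    then show ?thesis by auto
   qed
  qed
 qed
qed

theorem boundary_dimension_upper:
 assumes M: "rbm M W"
 shows "AE w in M. ALL s>4/3. hausdorff_measure s (frontier (cflow (W w) ` \<H>) \<inter> \<H>) = 0"
proof -
 \<comment> \<open>Decreases to 2/3, where pE is 4/3; the 4 keeps it below 1.\<close>
 define r where "r = (%n::nat. 2/3+1/(real n+4))"
 have r: "2/3 < r n" "r n < 1" for n by (auto simp: r_def field_simps)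
 have "AE w in M. ALL n. hausdorff_measure (pE (r n)) (frontier (cflow (W w) ` \<H>) \<inter> \<H>) = 0"
  unfolding AE_all_countable using boundary_null_one_exponent[OF M r] by blast
 then show ?thesis
 proof eventually_elim
  case (elim w)
  show ?case
  proof (intro allI impI)
   fix s :: real assume s: "4/3 < s"
   obtain n :: nat where n: "2/(s-4/3) < real n" using reals_Archimedean2 by blast
   have "pE (r n) <= s"
   proof -
    define u where "u = 1/(real n+4)"
    have u: "0 < u" by (simp add: u_def)
    have "r n = 2/3+u" by (simp add: r_def u_def)
    then have "pE (r n) = 4/3+3/2*u-3/4*u^2" by (simp add: pE_def power2_eq_square field_simps)
    also have "... <= 4/3+2*u" using u by (simp add: algebra_simps)
    also have "2*u < s-4/3" using n s by (simp add: field_simps u_def)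
    finally show ?thesis by simp
   qed
   then show "hausdorff_measure s (frontier (cflow (W w) ` \<H>) \<inter> \<H>) = 0"
    using elim by (blast intro: hausdorff_measure_null_mono_exponent)
  qed
 qed
qed

section \<open>The one-point estimate\<close>

text \<open>At b = r = 0 this is the product of charge 2/3, with vanishing drift; b and r insert the
  test functions (Im Z / Im z) powr b and |Z| powr r.\<close>

abbreviation sM :: "real => real => real => complex => (nat => real) => nat => real" where
 "sM b r d z t k \<equiv> vM {()} (%_. 4/3) (%_.-1/3+b) (%_. 2/3+r) d (%_. z) t k"

abbreviation sE :: "real => real => real => complex => nat => real" where
 "sE b r d z k \<equiv> vexp {()} (%_. 4/3) (%_.-1/3+b) (%_. 2/3+r) d (%_. z) k"

abbreviation sD :: "real => real => complex => real" where
 "sD b r w \<equiv> vdrift {()} (%_. 4/3) (%_.-1/3+b) (%_. 2/3+r) (%_. w)"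

text \<open>The generator of the process weighted by the product of charge 2/3, applied to these
  test functions and divided by them.\<close>

lemma sD_eq:
 assumes "w ~= 0"
 shows "sD b r w = (2*b-r+3*r^2+(6*r-3*r^2)*(Im w/norm w)^2)/(norm w)^2"
proof -
 define X where "X = Re w"
 define Y where "Y = Im w"
 define n where "n = (norm w)^2"
 have n: "n = X^2+Y^2" by (simp add: n_def cmod_power2 X_def Y_def)
 have n2: "n ~= 0" using assms by (simp add: n_def)
 have re1: "Re (inverse w) = X/n" by (simp add: X_def n Y_def)
 have im1: "Im (inverse w) =-(Y/n)" by (simp add: X_def n Y_def)
 let ?A = "X^2-Y^2"
 have w2: "Re (inverse (w*w)) = ?A/n^2" unfolding inverse_mult_distrib times_complex.sel re1 im1 by (simp add: power2_eq_square diff_divide_distrib)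
 have wb: "Re (inverse (w * cnj w)) = 1/n"
 proof -
  have "w * cnj w = of_real n" by (simp only: n_def complex_norm_square)
  then show ?thesis by (metis Re_complex_of_real inverse_eq_divide of_real_inverse)
 qed
 have q: "(Im w/norm w)^2 = Y^2/n" by (simp add: power_divide n_def Y_def)
 have sums: "(\<Sum>p\<in>{()} \<times> {()}. f p) = f ((), ())" "(\<Sum>i\<in>{()}. g i) = g ()" for f :: "unit \<times> unit => real" and g :: "unit => real" by auto
 have "sD b r w = 2*(4/3*(?A/n^2))+2*((- 1/3+b)*(1/n))-5*((2/3+r)*(?A/n^2)) + 3*((2/3+r)*(X/n))^2"
  unfolding vdrift_def power2_eq_square[of w] by (simp only: sums fst_conv snd_conv w2 wb re1 sum.insert)
 also have "... = (2*(4/3*?A)+2*((- 1/3+b)*n)-5*((2/3+r)*?A)+3*(2/3+r)^2*X^2)/n^2" using n2 by (simp add: power2_eq_square field_simps)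
 also have "X^2 = n-Y^2" using n by simp
 also have "(2*(4/3*(n-Y^2-Y^2))+2*((- 1/3+b)*n)-5*((2/3+r)*(n-Y^2-Y^2))+3*(2/3+r)^2*(n-Y^2))/n^2 = (2*b-r+3*r^2+(6*r-3*r^2)*(Y^2/n))/n"
  using n2 by (simp add: power2_eq_square field_simps)
 finally show ?thesis unfolding q n_def[symmetric] .
qed

lemma sM_eq:
 assumes d: "0 <= d" and z: "0 < Im z"
 shows "sM b r d z t k = sM 0 0 d z t k*(Im (eul d (nseq d t) z k)/Im z) powr b*norm (eul d (nseq d t) z k) powr r"
  and "norm (eulq d (nseq d t) z (cnj z) k) = Im (eul d (nseq d t) z k)/Im z"
proof -
 let ?A = "eul d (nseq d t) z k"
 have "?A-eul d (nseq d t) (cnj z) k = (z-cnj z)*eulq d (nseq d t) z (cnj z) k" using z by (intro eul_diff[OF d]) auto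
 then have "norm (?A-cnj (?A)) = norm (z-cnj z)*norm (eulq d (nseq d t) z (cnj z) k)" unfolding eul_cnj norm_mult[symmetric] by (rule arg_cong)
 moreover have "norm (w-cnj w) = 2*Im w" if "0 < Im w" for w unfolding complex_diff_cnj using that by (simp add: norm_mult)
 moreover have im: "0 < Im (?A)" using eul_Im[OF d z, of "nseq d t" k] z by simp
 ultimately show q: "norm (eulq d (nseq d t) z (cnj z) k) = Im (?A)/Im z" using z by (simp)
 show "sM b r d z t k = sM 0 0 d z t k*(Im (?A)/Im z) powr b*norm (?A) powr r" unfolding vM_def powr_add by (simp add: q)
qed

text \<open>The function \<open>|w| powr (1/6) - 3 * Im w powr (1/6)\<close> is a strict supersolution for the weighted process.\<close>

lemma one_point_drift_ineq:
 fixes R Y :: real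
 assumes Y: "0 < Y" "Y <= R"
 shows "R powr (1/6)*(- 1/12+11/12*(Y/R)^2)/R^2+(1/25-R^2/625)/12 <= Y powr (1/6)/R^2"
proof -
 define u where "u = Y/R"
 have u: "0 < u" "u <= 1" using Y by (auto simp: u_def)
 have R: "0 < R" using Y by simp
 have "u^2 = u powr 2" using u by simp
 also have "... <= u powr (1/6)" using u by (intro powr_mono') auto
 finally have "R powr (1/6)*u^2 <= R powr (1/6)*u powr (1/6)" by (intro mult_left_mono) auto
 also have "... = Y powr (1/6)" using R by (simp add: u_def flip: powr_mult)
 finally have 1: "R powr (1/6)*u^2 <= Y powr (1/6)" .
 let ?A = "1/25-R^2/625"
 \<comment> \<open>The factor is positive only for R < 5 and at most 1/25, so the left side stays
   below both R^2 and 1.\<close>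
 have 2: "?A * R^2 <= R powr (1/6)"
 proof (cases "R <= 5")
  case True
  show ?thesis
  proof (cases "R <= 1")
   case True
   have "?A * R^2 <= 1 * R^2" by (rule mult_right_mono) (use zero_le_power2[of R] in linarith, simp)
   also have "... = R powr 2" using R by simp
   also have "... <= R powr (1/6)" using True R by (intro powr_mono') auto
   finally show ?thesis .
  next
   case False
   have "R^2 <= 5^2" using \<open>R <= 5\<close> R by (intro power_mono) auto
   have "?A * R^2 <= (1/25)*25" using \<open>R\<^sup>2 <= 5\<^sup>2\<close> by (intro mult_mono) auto
   also have "... <= R powr (1/6)" using False by (simp add: ge_one_powr_ge_zero)
   finally show ?thesis .
  qed
 next
  case False
  then have "5^2 <= R^2" by (intro power_mono) auto
  then have "?A * R^2 <= 0" by (intro mult_nonpos_nonneg) auto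
  then show ?thesis using powr_ge_zero[of R "1/6"] by linarith
 qed
 have "R powr (1/6)*(- 1/12+11/12*u^2)+?A/12 * R^2 =-(1/12) * R powr (1/6)+11/12*(R powr (1/6)*u^2)+(1/12)*(?A * R^2)"
  by (simp only: distrib_left) simp
 also have "... <=-(1/12) * R powr (1/6)+11/12*Y powr (1/6)+(1/12) * R powr (1/6)" using 1 2 by linarith
 also have "... <= Y powr (1/6)" by simp
 finally have "(R powr (1/6)*(- 1/12+11/12*u^2)+?A/12 * R^2)/R^2 <= Y powr (1/6)/R^2" by (rule divide_right_mono) simp
 moreover have "(A+B * R^2)/R^2 = A/R^2+B" for A B using R by (simp add: field_simps)
 ultimately show ?thesis by (simp only: u_def)
qed

text \<open>A discrete Gronwall argument. Up to errors of order sqrt d, m is conserved and p gains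
  at most 10 m 0, so p <= 11 m 0. Then q - 3 s falls by at least (1/25 - 11/625)/12 = 14/7500 times
  m 0 from a start of at most m 0 / 1000. This forces s N to be about 0.00029 m 0, enough to absorb
  p N and m N divided by 100000.\<close>

lemma drift_recursion:
 fixes m p q s :: "nat => real"
 assumes d: "0 < d" "C * sqrt d <= 1" "real N*d = 1" and C: "0 <= C"
  and nn: "!!k. 0 <= m k" "!!k. 0 <= p k" "!!k. 0 <= s k" "!!k. s k <= q k" "!!k. q k <= m k+p k"
  and m: "!!k. abs (m (Suc k)-m k) <= C*(d * sqrt d)*m k" and p: "!!k. abs (p (Suc k)-p k-d*(10*m k)) <= C*(d * sqrt d)*p k"
  and sq: "!!k. (q (Suc k)-3 * s (Suc k))-(q k-3 * s k)+d*((m k/25-p k/625)/12) <= C*(d * sqrt d)*(q k+3 * s k)"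
  and q0: "p 0 <= m 0" "q 0 <= m 0/1000"
 shows "m 0/10000 <= s N-p N/100000-m N/100000+100*C * sqrt d*(m 0*exp 11)"
proof -
 \<comment> \<open>m + p starts at no more than 2 m 0 and grows at rate at most 11; this crude bound
   enters the error terms only.\<close>
 define E where "E = 2*m 0*exp 11"
 define e where "e = C * sqrt d"
 have e: "0 <= e" "e <= 1" using C d by (auto simp: e_def)
 have ed: "C*(d * sqrt d) = e*d" by (simp add: e_def)
 have E: "m k+p k <= E" if "k <= N" for k
 proof -
  have step: "m (Suc k)+p (Suc k) <= (m k+p k)*(1+11*d)" for k
  proof -
   have "m (Suc k) <= m k+e*d*m k" "p (Suc k) <= p k+d*(10*m k)+e*d*p k" using m[of k] p[of k] unfolding ed by (auto)
   moreover have "e*d*m k <= d*m k" "e*d*p k <= d*p k" using e d nn(1,2)[of k] by (auto intro!: mult_left_le_one_le)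
   moreover have "0 <= d*p k" using d nn by simp
   ultimately show ?thesis by (simp add: algebra_simps)
  qed
  have "m k+p k <= (m 0+p 0)*(1+11*d)^k"
  proof (induction k)
   case (Suc k)
   have "(m k+p k)*(1+11*d) <= ((m 0+p 0)*(1+11*d)^k)*(1+11*d)" using Suc d by (intro mult_right_mono) auto
   then show ?case using step[of k] by (simp add: mult_ac)
  qed simp
  also have "... <= (2*m 0)*exp 11"
  proof (intro mult_mono)
   have "(1+11*d)^k <= exp (11*d)^k" using d by (intro power_mono) (auto)
   also have "... = exp (real k*d*11)" by (simp add: exp_of_nat_mult[symmetric])
   also have "... <= exp 11"
   proof -
    have "real k*d <= real N*d" using that d by (intro mult_right_mono) auto
    then show ?thesis using d by simp
   qed
   finally show "(1+11*d)^k <= exp 11" .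
  qed (use q0 nn[of 0] d in auto)
  finally show ?thesis by (simp add: E_def)
 qed
 have E0: "0 <= E" using nn[of 0] by (simp add: E_def)
 have mE: "m k <= E" "p k <= E" "q k <= E" "s k <= E" if "k <= N" for k using E[OF that] nn(1,2,4,5)[of k] by auto
 have kd: "real k*d <= 1" if "k <= N" for k using mult_right_mono[of "real k" "real N" d] that d by simp
 have keE: "real k*d*e*E <= e*E" if "k <= N" for k
 proof -
  have "(real k*d)*(e*E) <= 1*(e*E)" by (rule mult_right_mono[OF kd[OF that]]) (use e E0 in auto)
  then show ?thesis by simp
 qed
 have deE: "e*d*x <= d*e*E" if "x <= E" for x using mult_left_mono[OF that, of "e*d"] e d by (simp add: mult_ac)
 have mk: "abs (m k-m 0) <= real k*d*e*E" if "k <= N" for k using that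
 proof (induction k)
  case (Suc k)
  have "abs (m (Suc k)-m k) <= d*e*E" using m[of k] deE[OF mE(1)[of k]] Suc.prems unfolding ed by simp
  moreover have "abs (m k-m 0) <= real k*d*e*E" using Suc by simp
  moreover have "real (Suc k)*d*e*E = d*e*E+real k*d*e*E" by (simp add: algebra_simps)
  ultimately show ?case by simp
 qed simp
 have m1: "m k <= m 0+e*E" "m 0-e*E <= m k" if "k <= N" for k using mk[OF that] keE[OF that] by (auto)
 let ?B = "10*m 0+11*(e*E)"
 have pk: "p k <= m 0+real k*d*?B" if "k <= N" for k using that
 proof (induction k)
  case (Suc k)
  have "p (Suc k) <= p k+d*(10*m k)+d*e*E" using p[of k] deE[OF mE(2)[of k]] Suc.prems unfolding ed by (simp)
  moreover have "d*(10*m k) <= d*(10*(m 0+e*E))" using m1[of k] Suc.prems d by (intro mult_left_mono) auto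
  moreover have "p k <= m 0+real k*d*?B" using Suc by simp
  ultimately show ?case by (simp add: algebra_simps)
 qed (use q0 in simp)
 have p1: "p k <= 11*m 0+11*(e*E)" if "k <= N" for k
 proof -
  have "real k*d*?B <= 1*?B" using kd[OF that] nn[of 0] e E0 by (intro mult_right_mono) auto
  then show ?thesis using pk[OF that] by simp
 qed
 define f where "f = (%k. q k-3 * s k)"
 let ?A = "5*(e*E)-m 0*(14/7500)"
 have fk: "f k <= m 0/1000+real k*d*?A" if "k <= N" for k using that
 proof (induction k)
  case 0
  then show ?case using q0 nn(3)[of 0] by (simp add: f_def)
 next
  case (Suc k)
  have k: "k <= N" using Suc.prems by simp
  have "C*(d * sqrt d)*(q k+3 * s k) <= 4*(d*e*E)" using deE[OF mE(3)[OF k]] deE[OF mE(4)[OF k]] unfolding ed distrib_left by simp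
  then have "f (Suc k) <= f k-d*((m k/25-p k/625)/12)+4*(d*e*E)" using sq[of k] unfolding f_def by simp
  also have "... = f k+d*(4*(e*E)-(m k/25-p k/625)/12)" by (simp add: algebra_simps)
  also have "... <= f k+d*?A"
  proof -
   have "m 0*(14/7500)-e*E <= (m k/25-p k/625)/12" using m1(2)[OF k] p1[OF k] mult_nonneg_nonneg[OF e(1) E0] by (simp)
   then have "4*(e*E)-(m k/25-p k/625)/12 <= 5*(e*E)-m 0*(14/7500)" by linarith
   then show ?thesis using d by (intro add_left_mono mult_left_mono) auto
  qed
  also have "... <= m 0/1000+real (Suc k)*d*?A"
  proof -
   have "real (Suc k)*d*x = real k*d*x+d*x" for x by (simp add: algebra_simps)
   from this[of "5*(e*E)-m 0*(14/7500)"] show ?thesis using Suc.IH[OF k] by linarith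
  qed
  finally show ?case .
 qed
 have "f N <= m 0/1000+?A" using fk[of N] d by simp
 then have "3 * s N >= m 0*(14/7500)-m 0/1000-5*(e*E)" using nn(3,4)[of N] unfolding f_def by linarith
 moreover have "p N <= 11*m 0+11*(e*E)" "m N <= m 0+e*E" using p1[of N] m1[of N] by auto
 moreover have "0 <= e*E" using e E0 by simp
 moreover have "0 <= m 0" by (rule nn)
 moreover have "100*C * sqrt d*(m 0*exp 11) = 50*(e*E)" by (simp add: e_def E_def)
 ultimately show ?thesis by linarith
qed

text \<open>Holds for every noise sequence; it dominates the derivative factor when the mesh tends
  to 0.\<close>

lemma eulq_norm_le:
 assumes d: "0 <= d" and y: "0 < y" "y <= Im z"
 shows "norm (eulq d x z z k) <= exp (2*d*real k/y^2)"
proof -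
 let ?A = "exp (2*d/y^2)"
 have "norm (1 + of_real (2*d)/(eul d x z i*eul d x z i)) <= ?A" for i
 proof -
  have "y^2 <= norm (eul d x z i*eul d x z i)" using eul_Im[OF d, of z x i] abs_Im_le_cmod[of "eul d x z i"] y
   unfolding norm_mult power2_eq_square by (intro mult_mono) auto
  then have "2*d/norm (eul d x z i*eul d x z i) <= 2*d/y^2"
   using d y by (intro divide_left_mono mult_pos_pos less_le_trans[of 0 "y^2" "norm (eul d x z i*eul d x z i)"]) auto
  then have "norm (of_real (2*d)/(eul d x z i*eul d x z i)) <= 2*d/y^2"
   using d by (simp only: norm_divide norm_of_real abs_of_nonneg mult_nonneg_nonneg zero_le_numeral)
  then have "norm (1 + of_real (2*d)/(eul d x z i*eul d x z i)) <= 1+2*d/y^2" by (metis norm_one norm_triangle_mono order_refl)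
  also have "... <= ?A" by simp
  finally show ?thesis .
 qed
 then have "(\<Prod>i<k. norm (1 + of_real (2*d)/(eul d x z i*eul d x z i))) <= (\<Prod>i<k. ?A)" by (intro prod_mono conjI norm_ge_zero)
 then have "norm (eulq d x z z k) <= ?A^k" unfolding eulq_def prod_norm[symmetric] prod_constant card_lessThan .
 also have "... = exp (2*d*real k/y^2)" by (simp add: exp_of_nat_mult[symmetric])
 finally show ?thesis .
qed

text \<open>Where the test function is positive, Y powr (1/6) exceeds d, and R powr (1/6) exceeds w
  R^2; so its positive part lives on heights at least d^6 and moduli at most K.\<close>

lemma truncated_weight_bounds:
 fixes M Y R :: real
 assumes e: "0 < w" "0 < d" and Y: "0 < Y" "Y <= R" and M: "0 <= M" and K: "K = (1/w) powr (6/11)"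
 shows "max 0 (M*(Y powr (1/6)-w * R^2-d)) <= (if d powr 6 <= Y & R <= K then M*K powr (1/6) else 0)"
proof -
 have R: "0 < R" using Y by simp
 have pos: "d powr 6 <= Y & R <= K" if p: "0 < Y powr (1/6)-w * R^2-d"
 proof
  have "d <= Y powr (1/6)" using p mult_nonneg_nonneg[OF less_imp_le[OF e(1)] zero_le_power2[of R]] by linarith
  then have "d powr 6 <= (Y powr (1/6)) powr 6" using e by (intro powr_mono2) auto
  then show "d powr 6 <= Y" using Y by (simp add: powr_powr)
  have "w * R powr 2 < R powr (1/6)" using p e powr_mono2[of "1/6" Y R] Y by simp
  also have "R powr (1/6) = R powr 2 * R powr (- (11/6))" by (simp only: powr_add[symmetric]) simp
  finally have "w < R powr (- (11/6))" using R by (simp)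
  then have "R powr (11/6) < 1/w" using R e by (simp add: powr_minus_divide field_simps)
  then have "(R powr (11/6)) powr (6/11) <= (1/w) powr (6/11)" by (intro powr_mono2) auto
  then show "R <= K" by (simp add: powr_powr K)
 qed
 show ?thesis
 proof (cases "0 < Y powr (1/6)-w * R^2-d")
  case True
  then have b: "d powr 6 <= Y" "R <= K" using pos by auto
  have "Y powr (1/6)-w * R^2-d <= Y powr (1/6)" using mult_nonneg_nonneg[OF less_imp_le[OF e(1)] zero_le_power2[of R]] e by linarith
  also have "... <= K powr (1/6)" using b Y by (intro powr_mono2) auto
  finally have "M*(Y powr (1/6)-w * R^2-d) <= M*K powr (1/6)" using M by (rule mult_left_mono)
  then show ?thesis using b M by simp
 next
  case False
  then have "M*(Y powr (1/6)-w * R^2-d) <= 0" using M by (intro mult_nonneg_nonpos) auto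
  then show ?thesis using M by auto
 qed
qed

text \<open>The weighted moments \<open>m\<close>, \<open>p\<close>, \<open>q\<close>, \<open>s\<close> of \<open>drift_recursion\<close> carry the extra factors
  \<open>1\<close>, \<open>|Z|\<^sup>2\<close>, \<open>|Z| powr (1/6)\<close> and \<open>(Im Z) powr (1/6)\<close>.\<close>

lemma vexp_step_single:
 fixes a b :: "unit \<times> unit => real" and r :: "unit => real"
 assumes y: "0 < y" "y <= Im z"
 shows "EX C d0. 0 <= C & 0 < d0 & d0 <= 1 & (ALL d k. 0 < d --> d <= d0 -->
   integrable (stdnP k) (%t. vM {()} a b r d (%_. z) t k)
   & integrable (stdnP k) (%t. vM {()} a b r d (%_. z) t k * vdrift {()} a b r (%_. eul d (nseq d t) z k))
   & abs (vexp {()} a b r d (%_. z) (Suc k)-vexp {()} a b r d (%_. z) k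
     - d*(LINT t|stdnP k. vM {()} a b r d (%_. z) t k * vdrift {()} a b r (%_. eul d (nseq d t) z k)))
    <= C*(d * sqrt d) * vexp {()} a b r d (%_. z) k)"
proof -
 obtain C d0 where C: "0 <= C" "0 < d0" "d0 <= 1"
  "!!z d k. [|ALL i:{()}. y <= Im (z i); 0 < d; d <= d0|] ==> integrable (stdnP k) (%t. vM {()} a b r d z t k)
   & integrable (stdnP k) (%t. vM {()} a b r d z t k * vdrift {()} a b r (eulz d z t k)) & abs (vexp {()} a b r d z (Suc k)-vexp {()} a b r d z k
     - d*(LINT t|stdnP k. vM {()} a b r d z t k * vdrift {()} a b r (eulz d z t k))) <= C*(d * sqrt d) * vexp {()} a b r d z k"
  using vexp_step[OF finite.insertI[OF finite.emptyI] y(1), of "()" a b r] by blast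
 let ?A = "%_. z"
 have e: "eulz d ?A t k = (%_::unit. eul d (nseq d t) z k)" for d t k by (simp add: eulz_def)
 show ?thesis
 proof (rule exI[of _ C], rule exI[of _ d0], rule conjI[OF C(1)], rule conjI[OF C(2)], rule conjI[OF C(3)], intro allI impI conjI)
  fix d k assume d: "0 < d" "d <= d0"
  have pr: "ALL i:{()}. y <= Im z" using y by blast
  note c = C(4)[of "%_. z", OF pr d, of k, unfolded e]
  show "integrable (stdnP k) (%t. vM {()} a b r d ?A t k)" by (rule c[THEN conjunct1])
  show "integrable (stdnP k) (%t. vM {()} a b r d ?A t k * vdrift {()} a b r (%_. eul d (nseq d t) z k))" by (rule c[THEN conjunct2, THEN conjunct1])
  show "abs (vexp {()} a b r d ?A (Suc k)-vexp {()} a b r d ?A k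
     - d*(LINT t|stdnP k. vM {()} a b r d ?A t k * vdrift {()} a b r (%_. eul d (nseq d t) z k))) <= C*(d * sqrt d) * vexp {()} a b r d ?A k"
   by (rule c[THEN conjunct2, THEN conjunct2])
 qed
qed

text \<open>The first term of the test function is small near the real line and the second is very
  negative far away. Its mean being bounded below shows that a fixed share of the weighted mass
  neither sticks to the line nor escapes to infinity.\<close>

lemma one_point_discrete:
 assumes z: "0 < Im z" "norm z <= 1" "norm z powr (1/6) <= 1/1000"
 shows "EX C d0. 0 < d0 & (ALL N. 0 < N --> 1/real N <= d0 -->
   integrable (stdnP N) (%t. sM 0 0 (1/real N) z t N*(Im (eul (1/real N) (nseq (1/real N) t) z N) powr (1/6)
    - 1/100000*(norm (eul (1/real N) (nseq (1/real N) t) z N))^2-1/100000)) & norm z powr (2/3)/10000-C * sqrt (1/real N) <=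
   (LINT t|stdnP N. sM 0 0 (1/real N) z t N*(Im (eul (1/real N) (nseq (1/real N) t) z N) powr (1/6)
    - 1/100000*(norm (eul (1/real N) (nseq (1/real N) t) z N))^2-1/100000)))"
proof -
 define y where "y = Im z"
 have y: "0 < y" "y <= Im z" using z by (simp_all add: y_def)
 obtain Cm dm where m: "0 <= Cm" "0 < dm" "dm <= 1" "!!d k. 0 < d ==> d <= dm ==> integrable (stdnP k) (%t. sM 0 0 d z t k)
   & integrable (stdnP k) (%t. sM 0 0 d z t k * sD 0 0 (eul d (nseq d t) z k))
   & abs (sE 0 0 d z (Suc k)-sE 0 0 d z k-d*(LINT t|stdnP k. sM 0 0 d z t k * sD 0 0 (eul d (nseq d t) z k))) <= Cm*(d * sqrt d) * sE 0 0 d z k"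
  using vexp_step_single[OF y, of "%_. 4/3" "%_.-1/3+0" "%_. 2/3+0"] by blast
 obtain Cp dp where p: "0 <= Cp" "0 < dp" "dp <= 1" "!!d k. 0 < d ==> d <= dp ==> integrable (stdnP k) (%t. sM 0 2 d z t k)
   & integrable (stdnP k) (%t. sM 0 2 d z t k * sD 0 2 (eul d (nseq d t) z k))
   & abs (sE 0 2 d z (Suc k)-sE 0 2 d z k-d*(LINT t|stdnP k. sM 0 2 d z t k * sD 0 2 (eul d (nseq d t) z k))) <= Cp*(d * sqrt d) * sE 0 2 d z k"
  using vexp_step_single[OF y, of "%_. 4/3" "%_.-1/3+0" "%_. 2/3+2"] by blast
 obtain Cq dq where q: "0 <= Cq" "0 < dq" "dq <= 1" "!!d k. 0 < d ==> d <= dq ==> integrable (stdnP k) (%t. sM 0 (1/6) d z t k)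
   & integrable (stdnP k) (%t. sM 0 (1/6) d z t k * sD 0 (1/6) (eul d (nseq d t) z k))
   & abs (sE 0 (1/6) d z (Suc k)-sE 0 (1/6) d z k-d*(LINT t|stdnP k. sM 0 (1/6) d z t k * sD 0 (1/6) (eul d (nseq d t) z k))) <= Cq*(d * sqrt d) * sE 0 (1/6) d z k"
  using vexp_step_single[OF y, of "%_. 4/3" "%_.-1/3+0" "%_. 2/3+(1/6)"] by blast
 obtain Cs ds where s: "0 <= Cs" "0 < ds" "ds <= 1" "!!d k. 0 < d ==> d <= ds ==> integrable (stdnP k) (%t. sM (1/6) 0 d z t k)
   & integrable (stdnP k) (%t. sM (1/6) 0 d z t k * sD (1/6) 0 (eul d (nseq d t) z k))
   & abs (sE (1/6) 0 d z (Suc k)-sE (1/6) 0 d z k-d*(LINT t|stdnP k. sM (1/6) 0 d z t k * sD (1/6) 0 (eul d (nseq d t) z k))) <= Cs*(d * sqrt d) * sE (1/6) 0 d z k"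
  using vexp_step_single[OF y, of "%_. 4/3" "%_.-1/3+(1/6)" "%_. 2/3+0"] by blast
 define C where "C = Cm+Cp+Cq+Cs"
 have C: "0 <= C" "Cm <= C" "Cp <= C" "Cq <= C" "Cs <= C" using m(1) p(1) q(1) s(1) by (auto simp: C_def)
 define d0 where "d0 = Min {dm, dp, dq, ds, 1/(C+1)^2}"
 have d0: "0 < d0" "d0 <= dm" "d0 <= dp" "d0 <= dq" "d0 <= ds" "d0 <= 1/(C+1)^2" using m(2) p(2) q(2) s(2) C by (auto simp: d0_def)
 have "integrable (stdnP N) (%t. sM 0 0 d z t N*(Im (eul d (nseq d t) z N) powr (1/6) - 1/100000*(norm (eul d (nseq d t) z N))^2-1/100000)) &
   norm z powr (2/3)/10000-100*C*(norm z powr (2/3)*exp 11) * sqrt d <= (LINT t|stdnP N. sM 0 0 d z t N*(Im (eul d (nseq d t) z N) powr (1/6)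
    - 1/100000*(norm (eul d (nseq d t) z N))^2-1/100000))" if N: "0 < N" "d = 1/real N" "d <= d0" for N d
 proof -
  have d: "0 < d" "0 <= d" "d <= dm" "d <= dp" "d <= dq" "d <= ds" "real N*d = 1" using N d0 by auto
  have Cd: "C * sqrt d <= 1"
  proof -
   have "sqrt d <= sqrt (1/(C+1)^2)" using N d0 by (intro real_sqrt_le_mono) auto
   also have "... = 1/(C+1)" using C by (simp add: real_sqrt_divide)
   finally have "C * sqrt d <= C*(1/(C+1))" using C by (intro mult_left_mono) auto
   also have "... <= 1" using C by (simp)
   finally show ?thesis .
  qed
  note m4 = m(4)[OF d(1,3)] and p4 = p(4)[OF d(1,4)] and q4 = q(4)[OF d(1,5)] and s4 = s(4)[OF d(1,6)]
  define Z where "Z = (%t k. eul d (nseq d t) z k)"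
  define v where "v = (%t k. sM 0 0 d z t k)"
  have Zp: "0 < Im (Z t k)" "0 < norm (Z t k)" "Im (Z t k) <= norm (Z t k)" for t k
   using eul_Im[OF d(2) z(1), of "nseq d t" k] z(1) abs_Im_le_cmod[of "Z t k"] by (auto simp: Z_def)
  have v0: "0 <= v t k" for t k unfolding v_def by (rule vM_nonneg)
  have vp: "sM 0 2 d z t k = v t k*(norm (Z t k))^2" for t k using sM_eq(1)[OF d(2) z(1), of 0 2 t k] Zp[of t k] z(1) by (simp add: v_def Z_def)
  have vq: "sM 0 (1/6) d z t k = v t k*norm (Z t k) powr (1/6)" for t k
   using sM_eq(1)[OF d(2) z(1), of 0 "1/6" t k] Zp[of t k] z(1) by (simp add: v_def Z_def)
  have vs: "sM (1/6) 0 d z t k = y powr (- (1/6))*(v t k*Im (Z t k) powr (1/6))" for t k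
   using sM_eq(1)[OF d(2) z(1), of "1/6" 0 t k] Zp[of t k] z(1) by (simp add: v_def Z_def y_def powr_divide powr_minus_divide)
  have yy: "y powr (1/6)*(y powr (- (1/6))*x) = x" for x using y by (simp flip: powr_add)
  define mm pp qq ss where "mm = (%k. \<integral>t. v t k \<partial>stdnP k)" and "pp = (%k. \<integral>t. v t k*(norm (Z t k))^2 \<partial>stdnP k)"
   and "qq = (%k. \<integral>t. v t k*norm (Z t k) powr (1/6) \<partial>stdnP k)" and "ss = (%k. \<integral>t. v t k*Im (Z t k) powr (1/6) \<partial>stdnP k)"
  have im: "integrable (stdnP k) (%t. v t k)" and ip: "integrable (stdnP k) (%t. v t k*(norm (Z t k))^2)"
   and iq: "integrable (stdnP k) (%t. v t k*norm (Z t k) powr (1/6))" for k using m4 p4 q4 unfolding vp vq by (auto simp: v_def)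
  have is': "integrable (stdnP k) (%t. y powr (1/6)*(y powr (- (1/6))*(v t k*Im (Z t k) powr (1/6))))" for k
   using s4 unfolding vs by (intro integrable_mult_right) auto
  then have isn: "integrable (stdnP k) (%t. v t k*Im (Z t k) powr (1/6))" for k by (simp only: yy)
  have Em: "sE 0 0 d z k = mm k" "sE 0 2 d z k = pp k" "sE 0 (1/6) d z k = qq k" "y powr (1/6) * sE (1/6) 0 d z k = ss k" for k
   unfolding vexp_def vp vq vs mm_def pp_def qq_def ss_def by (simp_all add: v_def yy)
  have fin: "mm 0 = norm z powr (2/3)" "pp 0 = norm z powr (2/3)*(norm z)^2" "qq 0 = norm z powr (2/3)*norm z powr (1/6)"
   unfolding Em[symmetric] vexp_0(1) powr_add by simp_all
  have Zne: "Z t k ~= 0" for t k using Zp(2)[of t k] by auto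
  have D0: "sD 0 0 (Z t k) = 0" "sD 0 2 (Z t k) = 10/(norm (Z t k))^2"
   "sD 0 (1/6) (Z t k) = (- 1/12+11/12*(Im (Z t k)/norm (Z t k))^2)/(norm (Z t k))^2"
   "sD (1/6) 0 (Z t k) = (1/3)/(norm (Z t k))^2" for t k unfolding sD_eq[OF Zne] by (simp_all add: power2_eq_square)
  have mono: "c*(d * sqrt d)*x <= C*(d * sqrt d)*x" if "c <= C" "0 <= x" for c x using that d by (intro mult_right_mono) auto
  have nn: "0 <= mm k" "0 <= pp k" "0 <= ss k" "0 <= qq k" for k
   unfolding mm_def pp_def ss_def qq_def by (intro integral_nonneg_AE AE_I2 mult_nonneg_nonneg v0; simp)+
  have "norm z powr (2/3)/10000 <= ss N-pp N/100000-mm N/100000+100*C * sqrt d*(norm z powr (2/3)*exp 11)" unfolding fin(1)[symmetric]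
  proof (rule drift_recursion[OF d(1) Cd d(7) C(1), where q = qq])
   show "0 <= mm k" "0 <= pp k" "0 <= ss k" for k by (rule nn)+
   show "ss k <= qq k" for k unfolding ss_def qq_def
    by (intro integral_mono isn iq mult_left_mono powr_mono2 v0) (use Zp[of _ k] in "auto intro: less_imp_le")
   show "qq k <= mm k+pp k" for k
   proof -
    have "R powr (1/6) <= 1+R^2" if R: "0 < R" for R :: real
    proof (cases "R <= 1")
     case True
     then have "R powr (1/6) <= 1" using R by (intro powr_le1) auto
     then show ?thesis using zero_le_power2[of R] by linarith
    next
     case False
     then have "R powr (1/6) <= R powr 2" by (intro powr_mono) auto
     then show ?thesis using R by simp
    qed
    then have "v t k*norm (Z t k) powr (1/6) <= v t k*(1+(norm (Z t k))^2)" for t using Zp v0 by (intro mult_left_mono) auto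
    then have "v t k*norm (Z t k) powr (1/6) <= v t k+v t k*(norm (Z t k))^2" for t by (simp add: distrib_left)
    then have "qq k <= (LINT t|stdnP k. v t k+v t k*(norm (Z t k))^2)"
     unfolding qq_def by (intro integral_mono iq Bochner_Integration.integrable_add im ip)
    then show ?thesis unfolding mm_def pp_def by (simp add: Bochner_Integration.integral_add[OF im ip])
   qed
   show "abs (mm (Suc k)-mm k) <= C*(d * sqrt d)*mm k" for k using m4[of k, THEN conjunct2, THEN conjunct2] mono[OF C(2) nn(1)[of k]]
    unfolding Em D0[unfolded Z_def] by simp
   show "abs (pp (Suc k)-pp k-d*(10*mm k)) <= C*(d * sqrt d)*pp k" for k
   proof -
    have "v t k*(norm (Z t k))^2*(10/(norm (Z t k))^2) = 10 * v t k" for t using Zp(2)[of t k] by simp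
    then have "(LINT t|stdnP k. v t k*(norm (Z t k))^2*(10/(norm (Z t k))^2)) = 10*mm k" by (simp add: mm_def)
    then show ?thesis using p4[of k, THEN conjunct2, THEN conjunct2] mono[OF C(3) nn(2)[of k]] unfolding Em vp D0[unfolded Z_def] by (simp add: Z_def)
   qed
   show "(qq (Suc k)-3 * ss (Suc k))-(qq k-3 * ss k)+d*((mm k/25-pp k/625)/12) <= C*(d * sqrt d)*(qq k+3 * ss k)" for k
   proof -
    define Q where "Q = (%t. v t k*norm (Z t k) powr (1/6)*((- 1/12+11/12*(Im (Z t k)/norm (Z t k))^2)/(norm (Z t k))^2))"
    define S where "S = (%t. v t k*Im (Z t k) powr (1/6)*((1/3)/(norm (Z t k))^2))"
    have Q': "sM 0 (1/6) d z t k * sD 0 (1/6) (Z t k) = Q t" for t unfolding vq D0 Q_def ..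
    have iQ: "integrable (stdnP k) Q" using q4[of k, THEN conjunct2, THEN conjunct1] unfolding Q'[unfolded Z_def] .
    have S': "sM (1/6) 0 d z t k * sD (1/6) 0 (Z t k) = y powr (- (1/6))*S t" for t unfolding vs D0 S_def by (simp only: mult.assoc)
    have "integrable (stdnP k) (%t. y powr (- (1/6))*S t)" using s4[of k, THEN conjunct2, THEN conjunct1] unfolding S'[unfolded Z_def] .
    from integrable_mult_right[OF this, of "y powr (1/6)"] have iS: "integrable (stdnP k) S" unfolding yy .
    let ?A = "\<integral>t. S t \<partial>stdnP k"
    have "y powr (1/6)*(LINT t|stdnP k. sM (1/6) 0 d z t k * sD (1/6) 0 (eul d (nseq d t) z k)) = (LINT t|stdnP k. y powr (1/6)*(y powr (- (1/6))*S t))"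
     unfolding S'[unfolded Z_def] by simp
    then have IS: "y powr (1/6)*(LINT t|stdnP k. sM (1/6) 0 d z t k * sD (1/6) 0 (eul d (nseq d t) z k)) = ?A" by (simp only: yy)
    let ?B = "\<integral>t. Q t \<partial>stdnP k"
    have q5: "qq (Suc k)-qq k-d*?B <= C*(d * sqrt d)*qq k" using q4[of k, THEN conjunct2, THEN conjunct2] mono[OF C(4) nn(4)[of k]]
     unfolding Em Q'[unfolded Z_def] by (simp)
    have "y powr (1/6)*abs (sE (1/6) 0 d z (Suc k)-sE (1/6) 0 d z k-d*(LINT t|stdnP k. sM (1/6) 0 d z t k * sD (1/6) 0 (eul d (nseq d t) z k)))
     <= y powr (1/6)*(Cs*(d * sqrt d) * sE (1/6) 0 d z k)" using s4[of k, THEN conjunct2, THEN conjunct2] by (intro mult_left_mono) auto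
    then have "abs (y powr (1/6) * sE (1/6) 0 d z (Suc k)-y powr (1/6) * sE (1/6) 0 d z k-d*(y powr (1/6)*(LINT t|stdnP k. sM (1/6) 0 d z t k * sD (1/6) 0 (eul d (nseq d t) z k))))
     <= Cs*(d * sqrt d)*(y powr (1/6) * sE (1/6) 0 d z k)" by (simp only: abs_mult_pos'[OF powr_ge_zero] right_diff_distrib mult_ac)
    then have s5: "- (ss (Suc k)-ss k-d*?A) <= C*(d * sqrt d) * ss k" using mono[OF C(5) nn(3)[of k]] unfolding IS Em by (simp)
    have i0: "integrable (stdnP k) (%t. (v t k/25-v t k*(norm (Z t k))^2/625)/12)"
     by (intro integrable_divide Bochner_Integration.integrable_diff im ip)
    have I0: "(LINT t|stdnP k. (v t k/25-v t k*(norm (Z t k))^2/625)/12) = (mm k/25-pp k/625)/12" using im[of k] ip[of k] by (simp add: mm_def pp_def)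
    have "Q t+(v t k/25-v t k*(norm (Z t k))^2/625)/12 <= 3*S t" for t
    proof -
     define R where "R = norm (Z t k)"
     define Y where "Y = Im (Z t k)"
     have "v t k*(R powr (1/6)*(- 1/12+11/12*(Y/R)^2)/R^2+(1/25-R^2/625)/12) <= v t k*(Y powr (1/6)/R^2)"
      using Zp[of t k] by (intro mult_left_mono v0 one_point_drift_ineq) (auto simp: R_def Y_def)
     then show ?thesis unfolding Q_def S_def R_def[symmetric] Y_def[symmetric] by (simp add: algebra_simps)
    qed
    then have "(LINT t|stdnP k. Q t+(v t k/25-v t k*(norm (Z t k))^2/625)/12) <= (LINT t|stdnP k. 3*S t)"
     by (intro integral_mono Bochner_Integration.integrable_add iQ i0 integrable_mult_right iS)
    then have "?B+(mm k/25-pp k/625)/12 <= 3*?A" unfolding Bochner_Integration.integral_add[OF iQ i0] I0 by simp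
    then have "d*(?B+(mm k/25-pp k/625)/12) <= d*(3*?A)" using d by (intro mult_left_mono) auto
    then show ?thesis using q5 s5 by (simp only: distrib_left)
   qed
   have "norm z powr (2/3)*(norm z)^2 <= norm z powr (2/3)*1" using z by (intro mult_left_mono power_le_one) auto
   then show "pp 0 <= mm 0" unfolding fin by simp
   have "norm z powr (2/3)*norm z powr (1/6) <= norm z powr (2/3)*(1/1000)" using z by (intro mult_left_mono) auto
   then show "qq 0 <= mm 0/1000" unfolding fin by simp
  qed
  moreover have "integrable (stdnP N) (%t. v t N*Im (Z t N) powr (1/6)-1/100000*(v t N*(norm (Z t N))^2)-1/100000 * v t N)"
   by (intro Bochner_Integration.integrable_diff isn integrable_mult_right im ip)
  moreover have "(LINT t|stdnP N. v t N*Im (Z t N) powr (1/6)-1/100000*(v t N*(norm (Z t N))^2)-1/100000 * v t N) = ss N-pp N/100000-mm N/100000"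
   using isn[of N] im[of N] ip[of N] by (simp add: mm_def pp_def ss_def)
  moreover have "v t N*Im (Z t N) powr (1/6)-1/100000*(v t N*(norm (Z t N))^2)-1/100000 * v t N
   = v t N*(Im (Z t N) powr (1/6)-1/100000*(norm (Z t N))^2-1/100000)" for t by (simp add: algebra_simps)
  ultimately show ?thesis unfolding v_def Z_def by (simp add: mult_ac)
 qed
 then show ?thesis using d0(1) by (intro exI[of _ "100*C*(norm z powr (2/3)*exp 11)"] exI[of _ d0]) auto
qed

text \<open>The positive part of the truncated weight is bounded uniformly in the mesh, so dominated
  convergence carries a lower bound to the limit, which Fatou's lemma could not.\<close>

lemma one_point_lower:
 assumes M: "rbm M W" and z: "0 < Im z" "norm z <= 1" "norm z powr (1/6) <= 1/1000"
 defines "c \<equiv> (1/100000) powr 6" and "K \<equiv> 100000 powr (6/11)"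
 shows "ennreal (norm z powr (2/3)/10000) <=
  (EE M (%v. if c <= Im (fl (W v) z) & norm (fl (W v) z) <= K
    then norm (qf (W v) z z) powr (4/3)*norm (qf (W v) z (cnj z)) powr (- 1/3)*norm (fl (W v) z) powr (2/3)*K powr (1/6) else 0))"
proof -
 define y where "y = Im z"
 have y: "0 < y" "y <= Im z" using z by (auto simp: y_def)
 interpret prob_space M by (rule rbmD(1)[OF M])
 define m where "m = (%(q :: complex) (b :: complex) (Z :: complex). norm q powr (4/3)*norm b powr (- 1/3)*norm Z powr (2/3) :: real)"
 define U where "U = (%(q :: complex) (b :: complex) (Z :: complex). max 0 (m q b Z*(Im Z powr (1/6)-1/100000*(norm Z)^2-1/100000)))"
 define u where "u = (%j v. U (eulWq (W v) j z z) (eulWq (W v) j z (cnj z)) (eulW (W v) j z))"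
 define g where "g = (%v. U (qf (W v) z z) (qf (W v) z (cnj z)) (fl (W v) z))"
 have Ule: "U q b Z <= (if c <= Im Z & norm Z <= K then m q b Z*K powr (1/6) else 0)" if "0 < Im Z" for q b Z
  unfolding U_def c_def using that abs_Im_le_cmod[of Z] by (intro truncated_weight_bounds) (auto simp: m_def K_def)
 note [measurable] = measurable_fl[OF rbmD(2)[OF M]] measurable_eulW[OF rbmD(2)[OF M]]
 have [measurable]: "u j : borel_measurable M" "g : borel_measurable M" for j unfolding u_def g_def U_def m_def by measurable
 define B where "B = exp (2/y^2) powr (4/3)*1*K powr (2/3)*K powr (1/6)"
 have ub: "norm (u j v) <= B" for j v
 proof -
  define Z where "Z = eulW (W v) j z"
  have d: "0 <= 1/(2::real)^j" by simp
  have Z: "y <= Im Z" using eul_Im[of "1/2^j" z "incr (W v) (2^j)" "2^j"] z by (simp add: Z_def eulW_def y_def)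
  have q: "norm (eulWq (W v) j z z) <= exp (2/y^2)" using eulq_norm_le[of "1/2^j" y z "incr (W v) (2^j)" "2^j"] y by (simp add: eulWq_def)
  have b: "norm (eulWq (W v) j z (cnj z)) = Im Z/y"
   using sM_eq(2)[OF d z(1), of "nincr (W v) j" "2^j"] unfolding eulW_nincr by (simp add: Z_def y_def)
  have b1: "norm (eulWq (W v) j z (cnj z)) powr (- 1/3) <= 1" using Z y powr_mono[of "- 1/3" 0 "Im Z/y"] by (simp add: b)
  have K: "0 < K" by (simp add: K_def)
  have "u j v <= (if c <= Im Z & norm Z <= K then m (eulWq (W v) j z z) (eulWq (W v) j z (cnj z)) Z*K powr (1/6) else 0)"
   unfolding u_def Z_def[symmetric] using Z y by (intro Ule) auto
  also have "... <= B"
  proof (cases "norm Z <= K")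
   case True
   have "m (eulWq (W v) j z z) (eulWq (W v) j z (cnj z)) Z*K powr (1/6) <= B"
    unfolding m_def B_def using True q b1 K by (intro mult_mono powr_mono2) auto
   moreover have "0 <= B" by (simp add: B_def)
   ultimately show ?thesis by simp
  qed (simp add: B_def)
  finally have "u j v <= B" .
  moreover have "0 <= u j v" by (simp add: u_def U_def)
  ultimately show ?thesis by simp
 qed
 have lim: "AE v in M. (%j. u j v) \<longlonglongrightarrow> g v" using rbmD(3)[OF M]
 proof eventually_elim
  case (elim v)
  note nz = qf_nonzero[OF elim z(1) z(1)]
  show ?case using cflow_Im(2)[OF elim z(1)] fl_continuous(2)[OF elim z(1)] unfolding u_def g_def U_def m_def using nz
   by (intro tendsto_max tendsto_mult tendsto_diff tendsto_powr tendsto_power tendsto_norm tendsto_Im tendsto_const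
     qf_continuous[OF elim z(1) z(1)] fl_continuous[OF elim z(1)]) auto
 qed
 let ?A = "\<integral>v. g v \<partial>M"
 have conv: "(%j. \<integral>v. u j v \<partial>M) \<longlonglongrightarrow> ?A"
  by (rule integral_dominated_convergence[where w = "%_. B"]) (use lim ub in auto)
 have ig: "integrable M g" by (rule integrable_dominated_convergence[where w = "%_. B" and s = u]) (use lim ub in auto)
 obtain C d0 where C: "0 < d0" and est: "!!N. 0 < N ==> 1/real N <= d0 ==>
   integrable (stdnP N) (%t. sM 0 0 (1/real N) z t N*(Im (eul (1/real N) (nseq (1/real N) t) z N) powr (1/6)
    - 1/100000*(norm (eul (1/real N) (nseq (1/real N) t) z N))^2-1/100000)) & norm z powr (2/3)/10000-C * sqrt (1/real N) <=
   (LINT t|stdnP N. sM 0 0 (1/real N) z t N*(Im (eul (1/real N) (nseq (1/real N) t) z N) powr (1/6)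
    - 1/100000*(norm (eul (1/real N) (nseq (1/real N) t) z N))^2-1/100000))" using one_point_discrete[OF z] by blast
 have ev: "\<forall>\<^sub>F j in sequentially. 1/(2::real)^j < d0" by (rule order_tendstoD(2)[OF half_pow_tendsto_0 C])
 have 1: "\<forall>\<^sub>F j in sequentially. norm z powr (2/3)/10000-C * sqrt (1/2^j) <= (LINT v|M. u j v)" using ev
 proof eventually_elim
  case (elim j)
  define d where "d = 1/(2::real)^j"
  define h where "h = (%t. sM 0 0 d z t (2^j)*(Im (eul d (nseq d t) z (2^j)) powr (1/6) - 1/100000*(norm (eul d (nseq d t) z (2^j)))^2-1/100000))"
  have h: "integrable (stdnP (2^j)) h" "norm z powr (2/3)/10000-C * sqrt d <= (LINT t|stdnP (2^j). h t)"
   using est[of "2^j"] elim unfolding h_def d_def by auto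
  have hm: "h : borel_measurable (stdnP (2^j))" using h(1) by auto
  have u: "u j v = max 0 (h (nincr (W v) j))" for v unfolding u_def U_def h_def m_def vM_def d_def eulW_nincr by simp
  have nm: "(%v. nincr (W v) j) : measurable M (PiM {..<2^j} (%_. borel))" using M by (intro measurable_nincr) (auto simp: rbm_def)
  have ds: "distr M (PiM {..<2^j} (%_. borel)) (%v. nincr (W v) j) = stdnP (2^j)" using M by (simp add: rbm_def)
  have "(LINT t|stdnP (2^j). h t) <= (LINT t|stdnP (2^j). max 0 (h t))" using h(1) by (intro integral_mono) auto
  also have "... = (LINT v|M. max 0 (h (nincr (W v) j)))" unfolding ds[symmetric]
   by (rule integral_distr[OF nm]) (use hm in "simp add: measurable_cong_sets[OF sets_stdnP refl]")
  finally show ?case using h(2) by (simp add: u d_def)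
 qed
 have 2: "(%j. norm z powr (2/3)/10000-C * sqrt (1/2^j)) \<longlonglongrightarrow> norm z powr (2/3)/10000-C * sqrt 0"
  by (intro tendsto_intros half_pow_tendsto_0)
 have "norm z powr (2/3)/10000 <= ?A" using tendsto_le[OF sequentially_bot conv 2 1] by simp
 then have "ennreal (norm z powr (2/3)/10000) <= ennreal ?A" by (rule ennreal_leI)
 also have "... = (EE M (%v. g v))" by (rule nn_integral_eq_integral[symmetric, OF ig]) (auto simp: g_def U_def)
 also have "... <= (EE M (%v. if c <= Im (fl (W v) z) & norm (fl (W v) z) <= K then m (qf (W v) z z) (qf (W v) z (cnj z)) (fl (W v) z)*K powr (1/6) else 0))"
 proof (rule nn_integral_mono_AE)
  show "AE v in M. ennreal (g v) <= ennreal (if c <= Im (fl (W v) z) & norm (fl (W v) z) <= K then m (qf (W v) z z) (qf (W v) z (cnj z)) (fl (W v) z)*K powr (1/6) else 0)"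
   using rbmD(3)[OF M]
  proof eventually_elim
   case (elim v)
   have "0 < Im (fl (W v) z)" using cflow_Im(2)[OF elim z(1)] fl_continuous(2)[OF elim z(1)] by simp
   then show ?case unfolding g_def by (intro ennreal_leI Ule)
  qed
 qed
 finally show ?thesis unfolding m_def .
qed

section \<open>Products with two and three points\<close>

text \<open>Building blocks: a vertex product factors into one \<open>oc\<close> per charge and one
  \<open>pc\<close> per unordered pair, with exponent -3 r s / 2 since the exponents of both
  orderings add up.\<close>

definition oc :: "real => (real => real) => complex => real" where
 "oc r W z = norm (qf W z z) powr pE r*norm (qf W z (cnj z)) powr qE r*norm (fl W z) powr r"

definition pc :: "real => (real => real) => complex => complex => real" where
 "pc a W z w = (norm (qf W z w)*norm (qf W z (cnj w))) powr a"

lemma oc_pc_nonneg: "0 <= oc r W z" "0 <= pc a W z w" by (auto simp: oc_def pc_def)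

lemma qf_sym:
 assumes W: "continuous_on {0..1} W" and z: "0 < Im z" "0 < Im w"
 shows "norm (qf W w z) = norm (qf W z w)" "norm (qf W w (cnj z)) = norm (qf W z (cnj w))"
proof -
 show "norm (qf W w z) = norm (qf W z w)" using qf_continuous(3)[OF W z] qf_continuous(3)[OF W z(2,1)]
  by (cases "z = w") (auto simp: norm_divide norm_minus_commute)
 have "norm (a-cnj b) = norm (b-cnj a)" for a b :: complex by (metis complex_cnj_cnj complex_cnj_diff complex_mod_cnj norm_minus_commute)
 then show "norm (qf W w (cnj z)) = norm (qf W z (cnj w))" unfolding qf_continuous(5)[OF W z] qf_continuous(5)[OF W z(2,1)] norm_divide by metis
qed

lemma vL_two:
 fixes r s :: real
 assumes W: "continuous_on {0..1} W" and z: "0 < Im z" "0 < Im w"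
 defines "h \<equiv> (%i :: nat. if i = 0 then r else s)"
 shows "vL {0, 1 :: nat} (chA h) (chB h) h (%i. if i = 0 then z else w) W = oc r W z * oc s W w*pc (- 3*r * s/2) W z w"
proof -
 have sq: "x powr (- (3*r * s)/4)*x powr (- (3 * s*r)/4) = x powr (- 3*r * s/2)" for x :: real
  unfolding powr_add[symmetric] by (rule arg_cong[where f = "(powr) x"]) (simp)
 have e: "- 3*r*r/4+5*r/2 = pE r" "- 3*r*r/4 = qE r" for r by (simp_all add: pE_def qE_def power2_eq_square)
 define p where "p = (%z w r s. norm (qf W z w) powr (- (3*r * s)/4))"
 define pb where "pb = (%z w r s. norm (qf W z (cnj w)) powr (- (3*r * s)/4))"
 have "vL {0, 1 :: nat} (chA h) (chB h) h (%i. if i = 0 then z else w) W =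
   ((norm (qf W z z) powr pE r*p z w r s)*(p z w s r*norm (qf W w w) powr pE s))
  * ((norm (qf W z (cnj z)) powr qE r*pb z w r s)*(pb z w s r*norm (qf W w (cnj w)) powr qE s)) * (norm (fl W z) powr r*norm (fl W w) powr s)"
  unfolding vL_def prod.cartesian_product[symmetric, where g = "%i j. h (i, j)" for h, simplified] h_def
  by (simp add: chA_def chB_def qf_sym[OF W z] e[simplified] p_def pb_def)
 also have "... = oc r W z * oc s W w*((p z w r s*p z w s r)*(pb z w r s*pb z w s r))" unfolding oc_def by (simp only: mult_ac)
 also have "... = oc r W z * oc s W w*pc (- 3*r * s/2) W z w" unfolding pc_def powr_mult p_def pb_def sq ..
 finally show ?thesis .
qed

lemma oc_eq:
 assumes W: "continuous_on {0..1} W" and z: "0 < Im z"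
 shows "oc r W z = dlW W z powr pE r*Im z powr (- (pE r+qE r))*(Im (fl W z) powr qE r*norm (fl W z) powr r)"
proof -
 have n1: "norm (qf W z z) = dlW W z/Im z" using z by (simp add: dlW_def)
 have "oc r W z = (dlW W z/Im z) powr pE r*(Im (fl W z)/Im z) powr qE r*norm (fl W z) powr r" by (simp add: oc_def n1 norm_qf_cnj[OF W z])
 also have "... = (dlW W z powr pE r/Im z powr pE r)*(Im (fl W z) powr qE r/Im z powr qE r)*norm (fl W z) powr r" by (simp only: powr_divide)
 also have "... = dlW W z powr pE r*Im z powr (- (pE r+qE r))*(Im (fl W z) powr qE r*norm (fl W z) powr r)"
  unfolding powr_minus_divide powr_add by simp
 finally show ?thesis .
qed

lemma pc_eq:
 assumes W: "continuous_on {0..1} W" and z: "0 < Im z" "0 < Im w" "z ~= w"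
 shows "pc a W z w = (norm (fl W z-fl W w)*norm (fl W z-cnj (fl W w))) powr a*(norm (z-w)*norm (z-cnj w)) powr (- a)"
 unfolding pc_def qf_continuous(3)[OF W z] qf_continuous(5)[OF W z(1,2)] fl_continuous(2)[OF W z(1)] fl_continuous(2)[OF W z(2)]
 by (simp add: norm_divide powr_minus_divide powr_divide)

lemma two_charge_expectation:
 assumes M: "rbm M W" and z: "0 < Im z" "0 < Im w"
 shows "(EE M (%v. oc r (W v) z * oc s (W v) w*pc (- 3*r * s/2) (W v) z w)) <= ennreal (norm z powr r*norm w powr s)"
proof -
 let ?A = "%i. if i = 0 then r else s"
 have "(EE M (%v. oc r (W v) z * oc s (W v) w*pc (- 3*r * s/2) (W v) z w)) = (EE M (%v. vL {0, 1 :: nat} (chA ?A) (chB ?A) ?A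
   (%i. if i = 0 then z else w) (W v)))"
 proof (rule nn_integral_cong_AE)
  show "AE v in M. ennreal (oc r (W v) z * oc s (W v) w*pc (- 3*r * s/2) (W v) z w) = ennreal (vL {0, 1 :: nat} (chA ?A) (chB ?A) ?A
   (%i. if i = 0 then z else w) (W v))" using rbmD(3)[OF M] by eventually_elim (simp only: vL_two[OF _ z])
 qed
 also have "... <= ennreal (\<Prod>i\<in>{0, 1 :: nat}. norm (if i = 0 then z else w) powr (if i = 0 then r else s))"
  by (rule vertex_expectation[OF M]) (use z in auto)
 finally show ?thesis by simp
qed

lemma vL_three:
 fixes r s u :: real
 assumes W: "continuous_on {0..1} W" and z: "0 < Im z" "0 < Im w" "0 < Im v"
 defines "h \<equiv> (%i :: nat. if i = 0 then r else if i = 1 then s else u)"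
 shows "vL {0, 1, 2 :: nat} (chA h) (chB h) h (%i. if i = 0 then z else if i = 1 then w else v) W
  = (oc r W z * oc s W w * oc u W v)*(pc (- 3*r * s/2) W z w*pc (- 3*r*u/2) W z v * pc (- 3 * s*u/2) W w v)"
proof -
 have sq: "x powr (- (3*r * s)/4)*x powr (- (3 * s*r)/4) = x powr (- 3*r * s/2)" for x r s :: real
  unfolding powr_add[symmetric] by (rule arg_cong[where f = "(powr) x"]) (simp)
 have e: "- 3*r*r/4+5*r/2 = pE r" "- 3*r*r/4 = qE r" for r by (simp_all add: pE_def qE_def power2_eq_square)
 define p where "p = (%z w r s. norm (qf W z w) powr (- (3*r * s)/4))"
 define pb where "pb = (%z w r s. norm (qf W z (cnj w)) powr (- (3*r * s)/4))"
 have "vL {0, 1, 2 :: nat} (chA h) (chB h) h (%i. if i = 0 then z else if i = 1 then w else v) W =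
   ((norm (qf W z z) powr pE r*(p z w r s*p z v r u))*((p z w s r*(norm (qf W w w) powr pE s*p w v s u))*(p z v u r*(p w v u s*norm (qf W v v) powr pE u))))
  * ((norm (qf W z (cnj z)) powr qE r*(pb z w r s*pb z v r u))*((pb z w s r*(norm (qf W w (cnj w)) powr qE s*pb w v s u))*(pb z v u r*(pb w v u s*norm (qf W v (cnj v)) powr qE u))))
  * (norm (fl W z) powr r*(norm (fl W w) powr s*norm (fl W v) powr u))"
  unfolding vL_def prod.cartesian_product[symmetric, where g = "%i j. h (i, j)" for h, simplified] h_def
  by (simp add: chA_def chB_def qf_sym[OF W z(1,2)] qf_sym[OF W z(1,3)] qf_sym[OF W z(2,3)] e[simplified] p_def pb_def)
 also have "... = (oc r W z * oc s W w * oc u W v)*((p z w r s*p z w s r)*(pb z w r s*pb z w s r)*((p z v r u*p z v u r)*(pb z v r u*pb z v u r))*((p w v s u*p w v u s)*(pb w v s u*pb w v u s)))"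
  unfolding oc_def by (simp only: mult_ac)
 also have "... = (oc r W z * oc s W w * oc u W v)*(pc (- 3*r * s/2) W z w*pc (- 3*r*u/2) W z v * pc (- 3 * s*u/2) W w v)"
  unfolding pc_def powr_mult p_def pb_def sq ..
 finally show ?thesis .
qed

lemma three_charge_expectation:
 assumes M: "rbm M W" and z: "0 < Im z" "0 < Im w" "0 < Im v"
 shows "(EE M (%x. (oc r (W x) z * oc s (W x) w * oc u (W x) v)*(pc (- 3*r * s/2) (W x) z w*pc (- 3*r*u/2) (W x) z v * pc (- 3 * s*u/2) (W x) w v)))
  <= ennreal (norm z powr r*(norm w powr s*norm v powr u))"
proof -
 define h where "h = (%i :: nat. if i = 0 then r else if i = 1 then s else u)"
 define g where "g = (%i :: nat. if i = 0 then z else if i = 1 then w else v)"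
 have "(EE M (%x. (oc r (W x) z * oc s (W x) w * oc u (W x) v)*(pc (- 3*r * s/2) (W x) z w*pc (- 3*r*u/2) (W x) z v * pc (- 3 * s*u/2) (W x) w v)))
  = (EE M (%x. vL {0, 1, 2 :: nat} (chA h) (chB h) h g (W x)))"
  by (rule nn_integral_cong_AE, use rbmD(3)[OF M] in eventually_elim) (simp only: vL_three[OF _ z] h_def g_def)
 also have "... <= ennreal (\<Prod>i\<in>{0, 1, 2 :: nat}. norm (g i) powr h i)" by (rule vertex_expectation[OF M]) (use z in "auto simp: g_def")
 finally show ?thesis by (simp add: g_def h_def)
qed

lemma measurable_oc_pc:
 assumes W: "!!t. t : {0..1} ==> (%v. W v t) : borel_measurable N"
 shows "(%v. oc r (W v) z) : borel_measurable N" "(%v. pc a (W v) z w) : borel_measurable N"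
proof -
 note [measurable] = measurable_fl[OF W]
 show "(%v. oc r (W v) z) : borel_measurable N" unfolding oc_def by measurable
 show "(%v. pc a (W v) z w) : borel_measurable N" unfolding pc_def by measurable
qed

lemma pE_qE_two_thirds: "pE (2/3) = 4/3" "qE (2/3) =-1/3" "pE (- 2/3) =-2" "qE (- 2/3) =-1/3" by (simp_all add: pE_def qE_def power2_eq_square)

text \<open>As pE + qE = 1 at charge 2/3, \<open>oc\<close> times the height y is dlW powr (4/3) up
  to powers of the image point, which are bounded when the image point is.\<close>

lemma oc_mass:
 assumes W: "continuous_on {0..1} W" and z: "0 < Im z" "Im z <= 1" and c: "0 < c" "c <= Im (fl W z)"
 shows "dlW W z powr (4/3) <= 3 powr (1/3) * c powr (- 2/3)*Im z * oc (2/3) W z"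
  and "norm (fl W z) <= K ==> oc (2/3) W z*Im z <= c powr (- 1/3)*K powr (2/3)*dlW W z powr (4/3)"
proof -
 define Y where "Y = Im (fl W z)"
 define D where "D = dlW W z powr (4/3)"
 have Y: "0 < Y" "Y <= 3" "c <= Y" using fl_bounds[OF W z] c by (auto simp: Y_def)
 have n3: "c <= norm (fl W z)" using abs_Im_le_cmod[of "fl W z"] c by linarith
 let ?A = "Y powr (- 1/3)*norm (fl W z) powr (2/3)"
 have o: "oc (2/3) W z*Im z = D*?A" unfolding oc_eq[OF W z(1)] pE_qE_two_thirds Y_def D_def using z by (simp)
 have D: "0 <= D" by (simp add: D_def)
 have "D = D*((3 powr (1/3)*3 powr (- 1/3))*(c powr (- 2/3) * c powr (2/3)))" using c by (simp flip: powr_add)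
 also have "... = 3 powr (1/3) * c powr (- 2/3)*(D*(3 powr (- 1/3) * c powr (2/3)))" by simp
 also have "... <= 3 powr (1/3) * c powr (- 2/3)*(D*?A)" using Y n3 c D by (intro mult_left_mono mult_mono powr_mono2 powr_mono2') auto
 also have "... = 3 powr (1/3) * c powr (- 2/3)*Im z * oc (2/3) W z" unfolding o[symmetric] by (simp only: mult_ac)
 finally show "dlW W z powr (4/3) <= 3 powr (1/3) * c powr (- 2/3)*Im z * oc (2/3) W z" by (simp only: D_def)
 show "oc (2/3) W z*Im z <= c powr (- 1/3)*K powr (2/3)*dlW W z powr (4/3)" if K: "norm (fl W z) <= K"
 proof -
  have "D*?A <= D*(c powr (- 1/3)*K powr (2/3))" using Y K c D by (intro mult_left_mono mult_mono powr_mono2 powr_mono2') auto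
  then show ?thesis unfolding o by (simp add: D_def mult_ac)
 qed
qed

text \<open>A second charge placed above z at height l weights the mass at z by a power of the
  conformal radius at scale l; \<open>ratio\<close> converts the pair factor, which involves f z - f
  w, into such a power.\<close>

lemma two_charge_bound:
 assumes W: "continuous_on {0..1} W" and y: "0 < y" "2*y <= l" "l <= 1" and c: "0 < c" "c <= Im (fl W (Complex x y))" and a: "0 < a"
 defines "z \<equiv> Complex x y" and "w \<equiv> Complex x l"
 assumes ratio: "a*dlW W w powr (- \<sigma>) <= (norm (fl W z-fl W w)*norm (fl W z-cnj (fl W w))/norm (fl W w)) powr (- \<sigma>)"
 shows "dlW W z powr (4/3)*(dlW W w powr (pE \<sigma>-\<sigma>)*l powr (- (pE \<sigma>+qE \<sigma>)+2*\<sigma>))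
  <= (3 powr (1/3) * c powr (- 2/3)*3 powr (- qE \<sigma>)*2 powr abs (\<sigma>)/a)*y*(oc (2/3) W z * oc \<sigma> W w*pc (- \<sigma>) W z w)"
proof -
 have z: "0 < Im z" "Im z <= 1" "0 < Im w" "Im w <= 1" "z ~= w" "Im z = y" "Im w = l" using y by (auto simp: z_def w_def)
 have lp: "0 < l" using y by simp
 define X where "X = dlW W w"
 define Yw where "Yw = Im (fl W w)"
 have Yw: "0 < Yw" "Yw <= 3" "0 < X" using fl_bounds[OF W z(3,4)] by (auto simp: Yw_def X_def)
 have q: "qE \<sigma> <= 0" by (simp add: qE_def)
 have A: "dlW W z powr (4/3) <= 3 powr (1/3) * c powr (- 2/3)*y * oc (2/3) W z" using oc_mass(1)[OF W z(1,2) c(1)] c(2) by (simp add: z_def)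
 define r where "r = norm (fl W z-fl W w)*norm (fl W z-cnj (fl W w))/norm (fl W w)"
 have dist: "norm (z-w)*norm (z-cnj w) = (l-y)*(l+y)"
 proof -
  have "z-w = Complex 0 (y-l)" "z-cnj w = Complex 0 (y+l)" by (simp_all add: z_def w_def complex_eq_iff)
  then show ?thesis using y by (simp add: complex_norm)
 qed
 let ?C = "- \<sigma>"
 have dl: "2 powr (- abs (\<sigma>))*l powr (2*\<sigma>) <= ((l-y)*(l+y)) powr \<sigma>"
 proof -
  have sq: "(l-y)*(l+y) = l^2-y^2" by (simp add: power2_eq_square algebra_simps)
  have y2: "y^2 <= (l/2)^2" using y by (intro power_mono) auto
  have "y^2 <= l^2/4" "0 < l^2" using y2 lp by (simp_all add: power_divide)
  then have b: "l^2/2 <= l^2-y^2" "l^2-y^2 <= l^2" "0 < l^2/2" "0 < l^2-y^2" using zero_le_power2[of y] by linarith+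
  have l2: "l powr (2*\<sigma>) = (l^2) powr \<sigma>" using lp by (simp add: powr_powr[symmetric])
  show ?thesis
  proof (cases "0 <= \<sigma>")
   case True
   have "2 powr ?C*(l^2) powr \<sigma> = (l^2/2) powr \<sigma>" by (simp add: powr_divide powr_minus_divide)
   also have "... <= (l^2-y^2) powr \<sigma>" using b True by (intro powr_mono2) auto
   finally show ?thesis using True by (simp add: l2 sq)
  next
   case False
   have "2 powr (- abs (\<sigma>))*(l^2) powr \<sigma> <= 1*(l^2) powr \<sigma>"
    by (rule mult_right_mono) (use powr_mono[of "- abs (\<sigma>)" 0 "2::real"] in auto)
   also have "... <= (l^2-y^2) powr \<sigma>" using b False by (simp, intro powr_mono2') auto
   finally show ?thesis by (simp add: l2 sq)
  qed
 qed
 let ?E = "pE \<sigma>"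
 let ?A = "?E+qE \<sigma>"
 let ?B = "3 powr (- qE \<sigma>)*2 powr abs (\<sigma>)/a"
 let ?D = "Yw powr qE \<sigma>*(r powr ?C*((l-y)*(l+y)) powr \<sigma>)"
 have "X powr (?E-\<sigma>)*l powr (- ?A+2*\<sigma>) = X powr ?E*l powr (- ?A)*(X powr ?C*l powr (2*\<sigma>))"
  using powr_add[of X "?E" "- \<sigma>"] powr_add[of l "- ?A" "2*\<sigma>"] by simp
 also have "... = ?B*(X powr ?E*l powr (- ?A)*(3 powr qE \<sigma>*((a*X powr ?C)*(2 powr (- abs (\<sigma>))*l powr (2*\<sigma>)))))"
  using a by (simp add: powr_minus_divide)
 also have "... <= ?B*(X powr ?E*l powr (- ?A)*?D)"
 proof (intro mult_left_mono mult_mono dl)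
  show "3 powr qE \<sigma> <= Yw powr qE \<sigma>" using Yw q by (intro powr_mono2') auto
  show "a*X powr ?C <= r powr ?C" using ratio by (simp add: X_def r_def)
 qed (use a in auto)
 also have "X powr ?E*l powr (- ?A)*?D = oc \<sigma> W w*pc ?C W z w" unfolding oc_eq[OF W z(3)] pc_eq[OF W z(1,3,5)] dist r_def X_def Yw_def z(7)
  by (simp add: powr_divide powr_minus_divide)
 finally have B: "X powr (?E-\<sigma>)*l powr (- ?A+2*\<sigma>) <= ?B*(oc \<sigma> W w*pc ?C W z w)" .
 have "dlW W z powr (4/3)*(X powr (?E-\<sigma>)*l powr (- ?A+2*\<sigma>))
  <= (3 powr (1/3) * c powr (- 2/3)*y * oc (2/3) W z)*(?B*(oc \<sigma> W w*pc ?C W z w))" using y by (intro mult_mono A B) (auto simp: oc_pc_nonneg)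
 then show ?thesis by (simp add: X_def mult_ac)
qed

text \<open>The ratio is comparable to the conformal radius at w: from below by separation, from
  above as soon as f z is within C * dlW W w of f w.\<close>

lemma two_level_ratio:
 fixes x :: real
 assumes W: "continuous_on {0..1} W" and y: "0 < y" "2*y <= l" "l <= 1" and c: "0 < c"
 defines "z \<equiv> Complex x y" and "w \<equiv> Complex x l"
 assumes z: "c <= Im (fl W z)" "norm (fl W z) <= K"
 shows "dlW W w <= (2*koebe_C*(K/c+1))*(norm (fl W z-fl W w)*norm (fl W z-cnj (fl W w))/norm (fl W w))"
  and "norm (fl W z-fl W w) <= C*dlW W w ==> 0 <= C ==>
   norm (fl W z-fl W w)*norm (fl W z-cnj (fl W w))/norm (fl W w) <= (C*(K*(1+C*koebe_C)/c+1))*dlW W w"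
proof -
 interpret half_plane_map "cflow W" by (rule cflow_half_plane_map[OF W])
 define Z where "Z = fl W z"
 define V where "V = fl W w"
 have im: "0 < Im z" "Im z <= 1" "0 < Im w" "Im w <= 1" using y by (auto simp: z_def w_def)
 have V: "0 < Im V" "0 < dlW W w" "dlW W w <= koebe_C*Im V" "dlW W w = dl w" using fl_bounds[OF W im(3,4)] by (auto simp: V_def)
 have Vn: "Im V <= norm V" "0 < norm V" using abs_Im_le_cmod[of V] V by auto
 have Zb: "c <= Im Z" "norm Z <= K" using z by (auto simp: Z_def)
 have K: "0 <= K" using Zb norm_ge_zero[of Z] by linarith
 have kc: "0 < koebe_C" using koebe_C_pos .
 let ?A = "norm (Z-cnj V)"
 let ?C = "norm (Z-V)"
 have bar: "c <= ?A" "?C <= ?A"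
 proof -
  have "abs (Im (Z-cnj V)) <= ?A" by (rule abs_Im_le_cmod)
  then show "c <= ?A" using Zb V by simp
  have "(Im Z-Im V)^2 <= (Im Z+Im V)^2" using Zb c V by (intro power2_mono) auto
  then show "?C <= ?A" by (simp add: cmod_def)
 qed
 have "dl w <= 2*koebe_C*norm (cflow W z-cflow W w)"
 proof (rule separation[OF im(3,1)])
  have "z-w = Complex 0 (y-l)" by (simp add: z_def w_def complex_eq_iff)
  then show "Im w/2 <= norm (z-w)" using y by (simp add: complex_norm w_def)
 qed
 then have sep: "dlW W w <= 2*koebe_C*?C" using V(4) by (simp add: Z_def V_def fl_continuous(2)[OF W im(1)] fl_continuous(2)[OF W im(3)])
 have "norm V <= norm Z+?C" using norm_triangle_ineq4[of Z "Z-V"] by simp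
 also have "... <= K/c*?A+?A"
 proof (rule add_mono[OF _ bar(2)])
  have "norm Z <= K/c * c" using Zb c by simp
  also have "... <= K/c*?A" using bar K c by (intro mult_left_mono) auto
  finally show "norm Z <= K/c*?A" .
 qed
 finally have n1: "norm V <= (K/c+1)*?A" by (simp add: distrib_right)
 have "dlW W w*norm V <= (2*koebe_C*?C)*((K/c+1)*?A)" using sep n1 kc by (intro mult_mono) auto
 then show "dlW W w <= (2*koebe_C*(K/c+1))*(norm (fl W z-fl W w)*norm (fl W z-cnj (fl W w))/norm (fl W w))"
  using Vn unfolding Z_def[symmetric] V_def[symmetric] by (simp add: field_simps)
 let ?B = "1+C*koebe_C"
 show "norm (fl W z-fl W w)*norm (fl W z-cnj (fl W w))/norm (fl W w) <= (C*(K*?B/c+1))*dlW W w" if up: "norm (fl W z-fl W w) <= C*dlW W w" "0 <= C"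
 proof -
  have "Im Z <= Im V+?C" using abs_Im_le_cmod[of "Z-V"] by simp
  also have "... <= norm V+C*(koebe_C*norm V)"
  proof (rule add_mono[OF Vn(1)])
   have "C*dlW W w <= C*(koebe_C*norm V)" using Vn kc up by (intro mult_left_mono order_trans[OF V(3)]) auto
   then show "?C <= C*(koebe_C*norm V)" using up by (simp add: Z_def V_def)
  qed
  finally have "c <= ?B*norm V" using Zb by (simp add: algebra_simps)
  then have "(K/c) * c <= (K/c)*(?B*norm V)" using K c by (intro mult_left_mono) auto
  then have "K <= K*?B/c*norm V" using c by simp
  moreover have "?A <= norm Z+norm V" using norm_triangle_ineq4[of Z "cnj V"] by simp
  ultimately have n2: "?A <= (K*?B/c+1)*norm V" using Zb by (simp add: distrib_right)
  have "?C*?A <= (C*dlW W w)*((K*?B/c+1)*norm V)" using up n2 V by (intro mult_mono) (auto simp: Z_def V_def)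
  then show ?thesis using Vn unfolding Z_def[symmetric] V_def[symmetric] by (simp add: divide_le_eq mult_ac)
 qed
qed

text \<open>Markov's inequality: on P the factor of scale l is at least T, while the two-charge
  product has bounded mean. The bound x0 <= x keeps negative powers of |w| under control.\<close>

lemma two_charge_tail:
 assumes M: "rbm M W" and y: "0 < y" "2*y <= l" "l <= 1" and c: "0 < c" and a: "0 < a" and A: "0 < T" and x: "0 < x0" "x0 <= x" "x <= 1"
  and meas: "Measurable.pred M P" and P: "!!v. P v ==> continuous_on {0..1} (W v) ==> c <= Im (fl (W v) (Complex x y)) &
   a*dlW (W v) (Complex x l) powr (- \<sigma>) <= (norm (fl (W v) (Complex x y)-fl (W v) (Complex x l))*norm (fl (W v) (Complex x y)-cnj (fl (W v) (Complex x l)))/norm (fl (W v) (Complex x l))) powr (- \<sigma>) &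
   T <= dlW (W v) (Complex x l) powr (pE \<sigma>-\<sigma>)*l powr (- (pE \<sigma>+qE \<sigma>)+2*\<sigma>)"
 shows "(EE M (%v. if P v then dlW (W v) (Complex x y) powr (4/3) else 0))
  <= ennreal ((3 powr (1/3) * c powr (- 2/3)*3 powr (- qE \<sigma>)*2 powr abs (\<sigma>)/a)*(2 powr (2/3)*(2 powr abs (\<sigma>)+x0 powr (- abs (\<sigma>))))*y/T)"
proof -
 define z where "z = Complex x y"
 define w where "w = Complex x l"
 define C where "C = 3 powr (1/3) * c powr (- 2/3)*3 powr (- qE \<sigma>)*2 powr abs (\<sigma>)/a"
 have C: "0 <= C" using a by (simp add: C_def)
 have im: "0 < Im z" "0 < Im w" using y by (auto simp: z_def w_def)
 define N where "N = (%v. oc (2/3) (W v) z * oc \<sigma> (W v) w*pc (- \<sigma>) (W v) z w)"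
 have Nm [measurable]: "N : borel_measurable M" unfolding N_def by (intro borel_measurable_times measurable_oc_pc rbmD(2)[OF M])
 have nz: "norm z <= 2" "norm w <= 2" "x0 <= norm w" using norm_le_abs_add[of z] norm_le_abs_add[of w] x y abs_Re_le_cmod[of w] by (auto simp: z_def w_def)
 let ?A = "2 powr abs (\<sigma>)+x0 powr (- abs (\<sigma>))"
 have pw: "norm z powr (2/3)*norm w powr \<sigma> <= 2 powr (2/3)*?A"
 proof (intro mult_mono powr_mono2)
  show "norm w powr \<sigma> <= 2 powr abs (\<sigma>)+x0 powr (- abs (\<sigma>))"
  proof (cases "0 <= \<sigma>")
   case True
   then have "norm w powr \<sigma> <= 2 powr abs (\<sigma>)" using nz by (auto intro!: powr_mono2)
   then show ?thesis by (simp add: add_increasing2)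
  next
   case False
   then have "norm w powr \<sigma> <= x0 powr (- abs (\<sigma>))" using nz x by (auto intro!: powr_mono2')
   then show ?thesis by (simp add: add_increasing)
  qed
 qed (use nz in auto)
 have "(EE M (%v. if P v then dlW (W v) z powr (4/3) else 0)) <= (EE M (%v. (C*y/T)*N v))"
 proof (rule nn_integral_mono_AE, use rbmD(3)[OF M] in eventually_elim)
  case (elim v)
  show ?case
  proof (cases "P v")
   case True
   let ?m = "dlW (W v) z powr (4/3)"
   note p = P[OF True elim]
   have "?m*T <= ?m*(dlW (W v) w powr (pE \<sigma>-\<sigma>)*l powr (- (pE \<sigma>+qE \<sigma>)+2*\<sigma>))"
    using p by (intro mult_left_mono) (auto simp: w_def)
   also have "... <= C*y*N v" unfolding N_def C_def z_def w_def using p by (intro two_charge_bound[OF elim y c _ a]) auto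
   finally show ?thesis using A True by (intro ennreal_leI) (simp add: field_simps)
  next
   case False
   then show ?thesis by simp
  qed
 qed
 also have "... = ennreal (C*y/T)*(EE M (%v. N v))"
 proof -
  define D where "D = C*y/T"
  have D: "0 <= D" using C y A by (simp add: D_def)
  show ?thesis unfolding D_def[symmetric] ennreal_mult'[OF D] by (rule nn_integral_cmult) measurable
 qed
 also have "... <= ennreal (C*y/T)*ennreal (norm z powr (2/3)*norm w powr \<sigma>)"
  using two_charge_expectation[OF M im, of "2/3" \<sigma>] unfolding N_def by (intro mult_left_mono) simp_all
 also have "... <= ennreal (C*y/T)*ennreal (2 powr (2/3)*?A)" by (intro mult_left_mono ennreal_leI pw) simp
 also have "... = ennreal (C*(2 powr (2/3)*?A)*y/T)" using C y A by (simp flip: ennreal_mult')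
 finally show ?thesis unfolding C_def z_def w_def .
qed

text \<open>This is where the exponent 1/3 originates: at X = l powr (1/3) the terms linear in the
  charge cancel. A deviation by e leaves a quadratic gain, so the tail decays like l powr (e^2/4)
  and can be summed over dyadic scales.\<close>

lemma lower_tail_exponent:
 fixes e :: real
 assumes e: "0 < e" "e <= 1" and X: "0 < X" "X <= l powr (1/3+e)/A" and l: "0 < l" "l <= 1" and A: "1 <= A"
 defines "\<sigma> \<equiv>-e/2"
 shows "A powr (e/2)*l powr (- (e^2/4)) <= X powr (pE \<sigma>-\<sigma>)*l powr (- (pE \<sigma>+qE \<sigma>)+2*\<sigma>)"
proof -
 define p where "p =-(3*e/4+3*e^2/16)"
 have p: "pE \<sigma>-\<sigma> = p" by (simp add: p_def pE_def \<sigma>_def field_simps)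
 have e3: "0 < e^2" "0 < e^3" using e by auto
 let ?A = "7*e^2/16+3*e^3/16"
 have q: "- (pE \<sigma>+qE \<sigma>)+2*\<sigma>+(1/3+e)*p =-?A"
  by (simp add: p_def pE_def qE_def \<sigma>_def power2_eq_square power3_eq_cube field_simps)
 have pneg: "p <=-(e/2)" unfolding p_def using e e3 by linarith
 let ?B = "- (pE \<sigma>+qE \<sigma>)+2*\<sigma>"
 have "A powr (e/2)*l powr (- (e^2/4)) <= A powr (- p)*l powr (- ?A)"
 proof (intro mult_mono)
  show "A powr (e/2) <= A powr (- p)" using A pneg by (intro powr_mono) auto
  have "- ?A <=-(e^2/4)" using e3 by linarith
  then show "l powr (- (e^2/4)) <= l powr (- ?A)" using l by (intro powr_mono') auto
 qed auto
 also have "... = A powr (- p)*(l powr ((1/3+e)*p)*l powr ?B)" unfolding q[symmetric] powr_add[symmetric] by (simp add: add.commute)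
 also have "... = (l powr (1/3+e)/A) powr p*l powr ?B" by (simp add: powr_divide powr_powr powr_minus_divide)
 also have "... <= X powr p*l powr ?B" using X pneg e by (intro mult_right_mono powr_mono2') auto
 finally show ?thesis by (simp only: p)
qed

lemma upper_tail_exponent:
 fixes e :: real
 assumes e: "0 < e" "e <= 1/3" and X: "A*l powr (1/3-e) <= X" and l: "0 < l" "l <= 1" and A: "1 <= A"
 defines "\<sigma> \<equiv> e/2"
 shows "A powr (e/2)*l powr (- (e^2/4)) <= X powr (pE \<sigma>-\<sigma>)*l powr (- (pE \<sigma>+qE \<sigma>)+2*\<sigma>)"
proof -
 define p where "p = 3*e/4-3*e^2/16"
 have p: "pE \<sigma>-\<sigma> = p" by (simp add: p_def pE_def \<sigma>_def field_simps)
 have e2: "e^2 <= e" "e^3 <= e^2" using e by (auto simp: power2_eq_square power3_eq_cube)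
 let ?B = "7*e^2/16-3*e^3/16"
 have q: "- (pE \<sigma>+qE \<sigma>)+2*\<sigma>+(1/3-e)*p =-?B"
  by (simp add: p_def pE_def qE_def \<sigma>_def power2_eq_square power3_eq_cube field_simps)
 have ppos: "e/2 <= p" using e e2 by (simp add: p_def)
 let ?A = "- (pE \<sigma>+qE \<sigma>)+2*\<sigma>"
 have "A powr (e/2)*l powr (- (e^2/4)) <= A powr p*l powr (- ?B)"
 proof (intro mult_mono)
  show "A powr (e/2) <= A powr p" using A ppos by (intro powr_mono) auto
  show "l powr (- (e^2/4)) <= l powr (- ?B)" using e2 using l by (intro powr_mono') auto
 qed auto
 also have "... = A powr p*(l powr ((1/3-e)*p)*l powr ?A)" unfolding q[symmetric] powr_add[symmetric] by (simp add: add.commute)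
 also have "... = (A*l powr (1/3-e)) powr p*l powr ?A" by (simp add: powr_mult powr_powr)
 also have "... <= X powr p*l powr ?A" using X ppos e A by (intro mult_right_mono powr_mono2) auto
 finally show ?thesis by (simp only: p)
qed

section \<open>Good points\<close>

lemma half_pow_powr: "(1/2^k) powr a = ((2::real) powr (- a))^k"
proof -
 have "1/2^k = (2::real) powr (- real k)" by (simp add: powr_minus_divide powr_realpow)
 then have "(1/2^k) powr a = (2::real) powr (- real k*a)" by (simp only: powr_powr)
 also have "... = (2 powr (- a))^k" by (simp add: powr_power)
 finally show ?thesis .
qed

text \<open>The constants must not depend on the process, since the bounds are also applied after conditioning.\<close>

lemma two_level_tails:
 assumes c: "0 < c" "0 <= K" and e: "0 < e" "e <= 1/3" and x0: "0 < x0" and C1: "0 <= C1"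
 shows "EX C>=0. \<forall>(M :: 'a measure) W. rbm M W --> (ALL x y l A. x0 <= x --> x <= 1 --> 0 < y --> 2*y <= l --> l <= 1 --> 1 <= A -->
  (EE M (%u. if c <= Im (fl (W u) (Complex x y)) & norm (fl (W u) (Complex x y)) <= K &
    dlW (W u) (Complex x l) <= l powr (1/3+e)/A then dlW (W u) (Complex x y) powr (4/3) else 0)) <= ennreal (C*y*A powr (- (e/2))*l powr (e^2/4)) &
  (EE M (%u. if c <= Im (fl (W u) (Complex x y)) & norm (fl (W u) (Complex x y)) <= K & A*l powr (1/3-e) <= dlW (W u) (Complex x l) &
    norm (fl (W u) (Complex x y)-fl (W u) (Complex x l)) <= C1*dlW (W u) (Complex x l) then dlW (W u) (Complex x y) powr (4/3) else 0))
   <= ennreal (C*y*A powr (- (e/2))*l powr (e^2/4)))"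
proof -
 define b1 where "b1 = 2*koebe_C*(K/c+1)"
 define b2 where "b2 = C1*(K*(1+C1*koebe_C)/c+1)+1"
 have kc: "0 < koebe_C" by (rule koebe_C_pos)
 have b: "0 < b1" "0 < b2" using c C1 kc by (auto simp: b1_def b2_def intro!: mult_pos_pos add_nonneg_pos)
 define H where "H = (%\<sigma> a. (3 powr (1/3) * c powr (- 2/3)*3 powr (- qE \<sigma>)*2 powr abs (\<sigma>)/a)*(2 powr (2/3)*(2 powr abs (\<sigma>)+x0 powr (- abs (\<sigma>)))))"
 have H0: "0 <= H \<sigma> a" if "0 < a" for \<sigma> a using that by (auto simp: H_def)
 let ?C = "- (e/2)"
 define a1 where "a1 = b1 powr ?C"
 define a2 where "a2 = b2 powr ?C"
 have a: "0 < a1" "0 < a2" using b by (auto simp: a1_def a2_def)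
 let ?B = "- e/2"
 define C where "C = H ?B a1+H (e/2) a2"
 have C: "0 <= C" "H ?B a1 <= C" "H (e/2) a2 <= C" using H0 a by (auto simp: C_def)
 show ?thesis
 proof (rule exI[of _ C], rule conjI[OF C(1)], intro allI impI conjI)
  fix M :: "'a measure" and W and x y l A :: real
  assume M: "rbm M W" and x: "x0 <= x" "x <= 1" and y: "0 < y" "2*y <= l" "l <= 1" and A: "1 <= A"
  note [measurable] = measurable_fl[OF rbmD(2)[OF M]] measurable_dlW[OF rbmD(2)[OF M]]
  define T where "T = A powr (e/2)*l powr (- (e^2/4))"
  have lp: "0 < l" using y by simp
  have T: "0 < T" using A lp by (simp add: T_def)
  let ?A = "ennreal (C*y*A powr ?C*l powr (e^2/4))"
  have fin: "ennreal (H \<sigma> a*y/T) <= ?A" if "H \<sigma> a <= C" for \<sigma> a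
  proof (rule ennreal_leI)
   have "H \<sigma> a*y/T = H \<sigma> a*(y*A powr ?C*l powr (e^2/4))" by (simp add: T_def powr_minus_divide)
   also have "... <= C*(y*A powr ?C*l powr (e^2/4))" using that y by (intro mult_right_mono) auto
   finally show "H \<sigma> a*y/T <= C*y*A powr ?C*l powr (e^2/4)" by simp
  qed
  let ?z = "Complex x y" and ?w = "Complex x l"
  have dlp: "0 < dlW (W u) ?w" if "continuous_on {0..1} (W u)" for u using fl_bounds(4)[OF that, of ?w] lp y by simp
  show "(EE M (%u. if c <= Im (fl (W u) ?z) & norm (fl (W u) ?z) <= K & dlW (W u) ?w <= l powr (1/3+e)/A then dlW (W u) ?z powr (4/3) else 0)) <= ?A"
  proof (rule order_trans[OF two_charge_tail[OF M y c(1) a(1) T x0 x, where \<sigma> = "- e/2"]])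
   show "Measurable.pred M (%u. c <= Im (fl (W u) ?z) & norm (fl (W u) ?z) <= K & dlW (W u) ?w <= l powr (1/3+e)/A)" by simp
   fix u assume P: "c <= Im (fl (W u) ?z) & norm (fl (W u) ?z) <= K & dlW (W u) ?w <= l powr (1/3+e)/A" and W: "continuous_on {0..1} (W u)"
   let ?v = "norm (fl (W u) ?z-fl (W u) ?w)*norm (fl (W u) ?z-cnj (fl (W u) ?w))/norm (fl (W u) ?w)"
   have "dlW (W u) ?w <= b1*?v" using two_level_ratio(1)[OF W y c(1)] P unfolding b1_def by blast
   then have "dlW (W u) ?w/b1 <= ?v" using b by (simp add: divide_le_eq mult.commute)
   then have "(dlW (W u) ?w/b1) powr (e/2) <= ?v powr (e/2)" using dlp[OF W] b e by (intro powr_mono2) auto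
   then have "a1*dlW (W u) ?w powr (e/2) <= ?v powr (e/2)" by (simp only: powr_divide a1_def powr_minus_divide) (simp)
   moreover have "T <= dlW (W u) ?w powr (pE ?B - - e/2)*l powr (- (pE ?B+qE ?B)+2*?B)"
    unfolding T_def using e P dlp[OF W] y A by (intro lower_tail_exponent) auto
   ultimately show "c <= Im (fl (W u) ?z) & a1*dlW (W u) ?w powr - ?B <= ?v powr - ?B &
    T <= dlW (W u) ?w powr (pE ?B - - e/2)*l powr (- (pE ?B+qE ?B)+2*?B)" using P by simp
  next
   show "ennreal (3 powr (1/3) * c powr (- 2/3)*3 powr - qE ?B*2 powr abs (- e/2)/a1*(2 powr (2/3)*(2 powr abs (- e/2)+x0 powr - abs (- e/2)))*y/T)
    <= ?A" using fin[OF C(2)] unfolding H_def .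
  qed
  show "(EE M (%u. if c <= Im (fl (W u) ?z) & norm (fl (W u) ?z) <= K &
    A*l powr (1/3-e) <= dlW (W u) ?w & norm (fl (W u) ?z-fl (W u) ?w) <= C1*dlW (W u) ?w then dlW (W u) ?z powr (4/3) else 0)) <= ?A"
  proof (rule order_trans[OF two_charge_tail[OF M y c(1) a(2) T x0 x, where \<sigma> = "e/2"]])
   show "Measurable.pred M (%u. c <= Im (fl (W u) ?z) & norm (fl (W u) ?z) <= K & A*l powr (1/3-e) <= dlW (W u) ?w &
    norm (fl (W u) ?z-fl (W u) ?w) <= C1*dlW (W u) ?w)" by simp
   fix u assume P: "c <= Im (fl (W u) ?z) & norm (fl (W u) ?z) <= K & A*l powr (1/3-e) <= dlW (W u) ?w &
    norm (fl (W u) ?z-fl (W u) ?w) <= C1*dlW (W u) ?w" and W: "continuous_on {0..1} (W u)"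
   let ?v = "norm (fl (W u) ?z-fl (W u) ?w)*norm (fl (W u) ?z-cnj (fl (W u) ?w))/norm (fl (W u) ?w)"
   have im: "0 < Im ?z" "0 < Im ?w" "?z ~= ?w" using y  by auto
   have "?v <= C1*(K*(1+C1*koebe_C)/c+1)*dlW (W u) ?w" using two_level_ratio(2)[OF W y c(1), of x K C1] P C1 by blast
   also have "... <= b2*dlW (W u) ?w" unfolding b2_def using dlp[OF W] by (intro mult_right_mono) auto
   finally have r: "?v <= b2*dlW (W u) ?w" .
   have "0 < ?v"
   proof -
    have "0 < Im (fl (W u) ?z)" "0 < Im (fl (W u) ?w)" using fl_bounds(1)[OF W, of ?z] fl_bounds(1)[OF W, of ?w] y by auto
    moreover have "fl (W u) ?z ~= fl (W u) ?w"
     using qf_nonzero(1)[OF W im(1,2)] qf_continuous(3)[OF W im(1,2,3)] fl_continuous(2)[OF W im(1)] fl_continuous(2)[OF W im(2)] by auto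
    ultimately show ?thesis by (auto simp: complex_eq_iff)
   qed
   then have "(b2*dlW (W u) ?w) powr ?C <= ?v powr ?C" using e r by (intro powr_mono2') auto
   then have "a2*dlW (W u) ?w powr ?C <= ?v powr ?C" by (simp only: powr_mult a2_def)
   moreover have "T <= dlW (W u) ?w powr (pE (e/2)-e/2)*l powr (- (pE (e/2)+qE (e/2))+2*(e/2))"
    unfolding T_def using e P y A by (intro upper_tail_exponent) auto
   ultimately show "c <= Im (fl (W u) ?z) & a2*dlW (W u) ?w powr - (e/2) <= ?v powr - (e/2) &
    T <= dlW (W u) ?w powr (pE (e/2)-e/2)*l powr (- (pE (e/2)+qE (e/2))+2*(e/2))" using P by blast
  next
   show "ennreal (3 powr (1/3) * c powr (- 2/3)*3 powr - qE (e/2)*2 powr abs (e/2)/a2*(2 powr (2/3)*(2 powr abs (e/2)+x0 powr - abs (e/2)))*y/T)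
    <= ?A" using fin[OF C(3)] unfolding H_def .
  qed
 qed
qed

definition base_ev :: "real => real => nat => real => (real => real) => bool" where
 "base_ev c K n x W \<longleftrightarrow> c <= Im (fl W (Complex x (1/2^n))) & norm (fl W (Complex x (1/2^n))) <= K"

text \<open>Good points: the conformal radius at scale \<open>l\<close> is \<open>l powr (1/3)\<close> up to \<open>l powr e\<close>, on all scales.\<close>

definition good_ev :: "real => real => real => real => nat => real => (real => real) => bool" where
 "good_ev c K A e n x W \<longleftrightarrow> base_ev c K n x W & (ALL k<n. (1/2^k) powr (1/3+e)/A <= dlW W (Complex x (1/2^k)) &
      dlW W (Complex x (1/2^k)) <= A*(1/2^k) powr (1/3-e))"

lemma vertical_chain:
 assumes W: "continuous_on {0..1} W" and k: "k <= n"
 shows "norm (fl W (Complex x (1/2^n))-fl W (Complex x (1/2^k))) <= koebe_C*(\<Sum>j=k..<n. dlW W (Complex x (1/2^j)))" using k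
proof (induction n rule: dec_induct)
 case base
 then show ?case by simp
next
 case (step n)
 interpret half_plane_map "cflow W" by (rule cflow_half_plane_map[OF W])
 let ?z = "%j. Complex x (1/2^j)"
 have "?z (Suc n)-?z n = Complex 0 (- (1/2^Suc n))" by (simp add: complex_eq_iff)
 then have "norm (?z (Suc n)-?z n) = 1/2^Suc n" by (simp add: complex_norm)
 then have "norm (cflow W (?z (Suc n))-cflow W (?z n)) <= koebe_C*dl (?z n)" by (intro growth) (auto simp: field_simps)
 moreover have "dlW W (?z n) = dl (?z n)" by (rule fl_bounds(6)[OF W]) (auto)
 moreover have "fl W (?z j) = cflow W (?z j)" for j by (rule fl_continuous(2)[OF W]) simp
 ultimately have "norm (fl W (?z (Suc n))-fl W (?z n)) <= koebe_C*dlW W (?z n)" by metis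
 then have "norm (fl W (?z (Suc n))-fl W (?z k)) <= koebe_C*dlW W (?z n)+koebe_C*(\<Sum>j=k..<n. dlW W (?z j))"
  using norm_triangle_ineq[of "fl W (?z (Suc n))-fl W (?z n)" "fl W (?z n)-fl W (?z k)"] step.IH by simp
 also have "... = koebe_C*(\<Sum>j=k..<Suc n. dlW W (?z j))" using step.hyps by (simp add: distrib_left)
 finally show ?case .
qed

lemma geometric_bound:
 fixes q :: real
 assumes "0 <= q" "q < 1"
 shows "(\<Sum>i<m. q^i) <= 1/(1-q)" using sum_gp_strict[of q m] assms by (simp add: divide_right_mono)

text \<open>If the upper bound fails, take the scale k at which dlW / q^k is maximal. All finer
  scales are then geometrically dominated by it, so f at the lowest point lies within C1 * dlW of f
  at scale k, the proximity that the upper tail bound demands.\<close>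

lemma not_good_cases:
 assumes W: "continuous_on {0..1} W" and b: "base_ev c K n x W" and ng: "\<not> good_ev c K A e n x W" and e: "0 < e" "e < 1/3"
 defines "C1 \<equiv> koebe_C/(1-2 powr (- (1/3-e)))"
 shows "(EX k<n. dlW W (Complex x (1/2^k)) <= (1/2^k) powr (1/3+e)/A) \<or>
  (EX k<n. A*(1/2^k) powr (1/3-e) <= dlW W (Complex x (1/2^k)) &
    norm (fl W (Complex x (1/2^n))-fl W (Complex x (1/2^k))) <= C1*dlW W (Complex x (1/2^k)))"
proof (cases "EX k<n. dlW W (Complex x (1/2^k)) <= (1/2^k) powr (1/3+e)/A")
 case False
 define D where "D = (%k. dlW W (Complex x (1/2^k)))"
 define q where "q = (2::real) powr (- (1/3-e))"
 define g where "g = (%k. D k/q^k)"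
 have q: "0 < q" "q < 1"
 proof -
  have "q < 2 powr 0" unfolding q_def using e by (intro powr_less_mono) auto
  then show "0 < q" "q < 1" by (auto simp: q_def)
 qed
 have qk: "(1/2^k) powr (1/3-e) = q^k" for k by (simp only: q_def half_pow_powr)
 obtain k0 where k0: "k0 < n" "A*q^k0 < D k0" using False b ng unfolding good_ev_def D_def qk by (auto)
 have ne: "finite (g ` {..<n})" "g ` {..<n} ~= {}" using k0 by auto
 obtain k where "Max (g ` {..<n}) = g k" "k : {..<n}" by (rule imageE[OF Max_in[OF ne]])
 then have k: "k < n" "!!j. j < n ==> g j <= g k" using Max_ge[OF ne(1)] by auto
 have "A < g k0" using k0(2) q by (simp add: g_def less_divide_eq)
 then have "A <= g k" using k(2)[OF k0(1)] by simp
 then have 1: "A*q^k <= D k" using q by (simp add: g_def le_divide_eq)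
 have Dj: "D j <= D k*q^(j-k)" if "k <= j" "j < n" for j
 proof -
  have "D j = g j*q^j" using q by (simp add: g_def)
  also have "... <= g k*q^j" using k(2)[OF that(2)] q by (intro mult_right_mono) auto
  also have "q^j = q^k*q^(j-k)" using that by (simp flip: power_add)
  finally show ?thesis using q by (simp add: g_def)
 qed
 have Dk: "0 <= D k" using fl_bounds(4)[OF W, of "Complex x (1/2^k)"] by (simp add: D_def)
 have "(\<Sum>j=k..<n. D j) <= (\<Sum>j=k..<n. D k*q^(j-k))" by (intro sum_mono Dj) auto
 also have "... = D k*(\<Sum>i<n-k. q^i)" unfolding sum_distrib_left by (intro sum.reindex_bij_witness[of _ "%i. i+k" "%j. j-k"]) auto
 also have "... <= D k*(1/(1-q))" using Dk q by (intro mult_left_mono geometric_bound) auto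
 finally have s: "(\<Sum>j=k..<n. D j) <= D k*(1/(1-q))" .
 have "norm (fl W (Complex x (1/2^n))-fl W (Complex x (1/2^k))) <= koebe_C*(\<Sum>j=k..<n. D j)"
  using vertical_chain[OF W, of k n x] k(1) by (simp add: D_def)
 also have "... <= koebe_C*(D k*(1/(1-q)))" using s koebe_C_pos by (intro mult_left_mono) auto
 also have "... = C1*D k" by (simp add: C1_def q_def)
 finally show ?thesis using 1 k(1) unfolding D_def qk by blast
qed blast

lemma measurable_good_ev:
 assumes W: "!!t. t : {0..1} ==> (%w. W w t) : borel_measurable N"
 shows "Measurable.pred N (%w. base_ev c K n x (W w))" "Measurable.pred N (%w. good_ev c K A e n x (W w))"
proof -
 note [measurable] = measurable_fl[OF W] measurable_dlW[OF W]
 show [measurable]: "Measurable.pred N (%w. base_ev c K n x (W w))" unfolding base_ev_def by measurable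
 show "Measurable.pred N (%w. good_ev c K A e n x (W w))" unfolding good_ev_def by measurable
qed

text \<open>Each scale contributes two tails of size A powr (- (e/2)) * q^k relative to the height.
  The sum over scales converges, and a large A makes it an arbitrarily small fraction h.\<close>

lemma bad_mass:
 assumes c: "0 < c" "0 <= K" and e: "0 < e" "e < 1/3" and x0: "0 < x0" and h: "0 < h"
 shows "EX A>=1. \<forall>(M :: 'a measure) W n x. rbm M W --> x0 <= x --> x <= 1 -->
  (EE M (%w. if base_ev c K n x (W w) & \<not> good_ev c K A e n x (W w) then dlW (W w) (Complex x (1/2^n)) powr (4/3) else 0))
   <= ennreal (h*(1/2^n))"
proof -
 define C1 where "C1 = koebe_C/(1-2 powr (- (1/3-e)))"
 have q1: "(2::real) powr (- (1/3-e)) < 1"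
 proof -
  have "(2::real) powr (- (1/3-e)) < 2 powr 0" using e by (intro powr_less_mono) auto
  then show ?thesis by simp
 qed
 have C1: "0 <= C1" using koebe_C_pos q1 by (simp add: C1_def)
 define D where "D = (%W (w :: 'a) n x. dlW (W w) (Complex x (1/2^n)))"
 define lo where "lo = (%W A n x k (w :: 'a). c <= Im (fl (W w) (Complex x (1/2^n))) & norm (fl (W w) (Complex x (1/2^n))) <= K &
    D W w k x <= (1/2^k) powr (1/3+e)/A)"
 define up where "up = (%W A n x k (w :: 'a). c <= Im (fl (W w) (Complex x (1/2^n))) & norm (fl (W w) (Complex x (1/2^n))) <= K &
    A*(1/2^k) powr (1/3-e) <= D W w k x & norm (fl (W w) (Complex x (1/2^n))-fl (W w) (Complex x (1/2^k))) <= C1*D W w k x)"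
 have e13: "e <= 1/3" using e by simp
 obtain C where C: "0 <= C" and tails: "!!(M :: 'a measure) W x y l A. rbm M W ==> x0 <= x ==> x <= 1 ==> 0 < y ==> 2*y <= l ==> l <= 1 ==> 1 <= A ==>
  (EE M (%w. if c <= Im (fl (W w) (Complex x y)) & norm (fl (W w) (Complex x y)) <= K &
    dlW (W w) (Complex x l) <= l powr (1/3+e)/A then dlW (W w) (Complex x y) powr (4/3) else 0)) <= ennreal (C*y*A powr (- (e/2))*l powr (e^2/4)) &
  (EE M (%w. if c <= Im (fl (W w) (Complex x y)) & norm (fl (W w) (Complex x y)) <= K & A*l powr (1/3-e) <= dlW (W w) (Complex x l) &
    norm (fl (W w) (Complex x y)-fl (W w) (Complex x l)) <= C1*dlW (W w) (Complex x l) then dlW (W w) (Complex x y) powr (4/3) else 0))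
   <= ennreal (C*y*A powr (- (e/2))*l powr (e^2/4))" using two_level_tails[OF c e(1) e13 x0 C1] by blast
 define q where "q = (2::real) powr (- (e^2/4))"
 have q: "0 < q" "q < 1"
 proof -
  have "q < 2 powr 0" unfolding q_def using e by (intro powr_less_mono) auto
  then show "0 < q" "q < 1" by (auto simp: q_def)
 qed
 have qk: "(1/2^k) powr (e^2/4) = q^k" for k by (simp only: q_def half_pow_powr)
 define B where "B = 2*C/(1-q)/h+1"
 have B: "1 <= B" using C q h by (simp add: B_def)
 \<comment> \<open>Gives A powr (- (e/2)) = 1/B.\<close>
 define A where "A = B powr (2/e)"
 have A: "1 <= A" "A powr (- (e/2)) = 1/B" using B e by (auto simp: A_def ge_one_powr_ge_zero powr_powr)
 have "(EE M (%w. if base_ev c K n x (W w) & \<not> good_ev c K A e n x (W w) then D W w n x powr (4/3) else 0))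
   <= ennreal (h*(1/2^n))" if M: "rbm M W" and x: "x0 <= x" "x <= 1" for M :: "'a measure" and W n x
 proof -
  note [measurable] = measurable_fl[OF rbmD(2)[OF M]] measurable_dlW[OF rbmD(2)[OF M]]
  have [measurable]: "Measurable.pred M (lo W A n x k)" "Measurable.pred M (up W A n x k)" for n x k unfolding lo_def up_def D_def by measurable
  define y where "y = 1/(2::real)^n"
  define m where "m = (%w. D W w n x powr (4/3))"
  have [measurable]: "m : borel_measurable M" unfolding m_def D_def by measurable
  have lv: "0 < y" "2*y <= 1/2^k" "1/2^k <= (1::real)" if "k < n" for k
  proof -
   have "(2::real)^Suc k <= 2^n" using that by (intro power_increasing) auto
   then show "0 < y" "2*y <= 1/2^k" "1/2^k <= (1::real)" by (auto simp: y_def field_simps)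
  qed
  have t: "(EE M (%w. if lo W A n x k w then m w else 0)) <= ennreal (C*y/B*q^k)"
   "(EE M (%w. if up W A n x k w then m w else 0)) <= ennreal (C*y/B*q^k)" if "k < n" for k
   using tails[OF M x lv[OF that] A(1)] unfolding lo_def up_def m_def D_def y_def A(2) qk by (simp_all)
  have "(EE M (%w. if base_ev c K n x (W w) & \<not> good_ev c K A e n x (W w) then m w else 0))
   <= (\<integral>\<^sup>+w. (\<Sum>k<n. ennreal (if lo W A n x k w then m w else 0)+ennreal (if up W A n x k w then m w else 0)) \<partial>M)"
  proof (rule nn_integral_mono_AE, use rbmD(3)[OF M] in eventually_elim)
   case (elim w)
   show ?case
   proof (cases "base_ev c K n x (W w) & \<not> good_ev c K A e n x (W w)")
    case True
    then obtain k where k: "k < n" "lo W A n x k w \<or> up W A n x k w"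
     using not_good_cases[OF elim _ _ e, of c K n x A] unfolding lo_def up_def D_def base_ev_def C1_def by blast
    have "ennreal (m w) <= ennreal (if lo W A n x k w then m w else 0)+ennreal (if up W A n x k w then m w else 0)" using k(2) by (auto)
    also have "... <= (\<Sum>k<n. ennreal (if lo W A n x k w then m w else 0)+ennreal (if up W A n x k w then m w else 0))"
     using k(1) by (intro member_le_sum) auto
    finally show ?thesis by simp
   next
    case False
    then show ?thesis by auto
   qed
  qed
  also have "... = (\<Sum>k<n. (EE M (%w. if lo W A n x k w then m w else 0))+(EE M (%w. if up W A n x k w then m w else 0)))"
   by (subst nn_integral_sum) (auto simp: nn_integral_add)
  also have "... <= (\<Sum>k<n. ennreal (C*y/B*q^k)+ennreal (C*y/B*q^k))" by (intro sum_mono add_mono t) auto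
  also have "... = ennreal (2*(C*y/B)*(\<Sum>k<n. q^k))"
  proof -
   define L where "L = C*y/B"
   have L: "0 <= L" using C B by (simp add: L_def y_def)
   have "(\<Sum>k<n. ennreal (L*q^k)+ennreal (L*q^k)) = (\<Sum>k<n. ennreal (2*L*q^k))" using L q by (intro sum.cong refl) (simp flip: ennreal_plus)
   also have "... = ennreal (\<Sum>k<n. 2*L*q^k)" using L q by (intro sum_ennreal) auto
   finally show ?thesis unfolding L_def[symmetric] sum_distrib_left .
  qed
  also have "... <= ennreal (2*(C*y/B)*(1/(1-q)))" using C q B by (intro ennreal_leI mult_left_mono geometric_bound) (auto simp: y_def)
  also have "... <= ennreal (h*y)"
  proof (rule ennreal_leI)
   have "2*C/(1-q) <= B*h" using h by (simp add: B_def distrib_right)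
   then have "2*C/(1-q)*y/B <= B*h*y/B" using B by (intro divide_right_mono mult_right_mono) (auto simp: y_def)
   then show "2*(C*y/B)*(1/(1-q)) <= h*y" using B by (simp add: mult_ac)
  qed
  finally show ?thesis by (simp only: m_def y_def)
 qed
 then show ?thesis using A(1) unfolding D_def by blast
qed

section \<open>Correlations of good points\<close>

text \<open>\<open>cT\<close> and \<open>KT\<close> are the thresholds delivered by
  \<open>one_point_lower\<close>. \<open>xT\<close> is so small that |z| <= 3 xT implies |z| <=
  10^(-18), that is |z| powr (1/6) <= 1/1000, as required there.\<close>

definition cT :: real where "cT = (1/100000) powr 6"
definition KT :: real where "KT = 100000 powr (6/11)"
definition xT :: real where "xT = 1/2^62"

lemma T_pos: "0 < cT" "0 < KT" "0 < xT" "cT <= 1" "xT <= 1/8" by (auto simp: cT_def KT_def xT_def power_divide)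

text \<open>For i < 2^(n - 62) these points fill the interval from xT to 2 xT, near 0 but bounded
  away from it, at a spacing equal to the height of \<open>zt\<close>.\<close>

definition pt :: "nat => nat => real" where
 "pt n i = xT+real i/2^n"

lemma pt_bounds:
 assumes "62 <= n" "i < 2^(n-62)"
 shows "xT <= pt n i" "pt n i <= 2*xT" "1/2^n <= xT"
proof -
 have e: "xT = real (2^(n-62))/2^n" using assms(1) power_add[of "2::real" "n-62" 62] by (simp add: xT_def)
 show "xT <= pt n i" by (simp add: pt_def)
 have "real i <= real (2^(n-62))" using assms(2) by (simp only: of_nat_le_iff)
 then have "real i/2^n <= xT" unfolding e by (rule divide_right_mono) simp
 then show "pt n i <= 2*xT" by (simp add: pt_def)
 have "(1::real) <= real (2^(n-62))" by simp
 then show "1/2^n <= xT" unfolding e by (rule divide_right_mono) simp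
qed

abbreviation zt :: "nat => nat => complex" where
 "zt n i \<equiv> Complex (pt n i) (1/2^n)"

definition ms :: "nat => nat => (real => real) => real" where
 "ms n i W = dlW W (zt n i) powr (4/3)"

lemma ms_nonneg: "0 <= ms n i W" by (simp add: ms_def)

lemma base_mass:
 "EX c3>0. \<forall>(M :: 'a measure) W n i. rbm M W --> 62 <= n --> i < 2^(n-62) -->
   ennreal (c3*(1/2^n)) <= (EE M (%w. if base_ev cT KT n (pt n i) (W w) then ms n i (W w) else 0))"
proof -
 define L where "L = cT powr (- 1/3)*KT powr (2/3)*KT powr (1/6)"
 have L: "0 < L" using T_pos by (simp add: L_def)
 define c3 where "c3 = xT powr (2/3)/10000/L"
 have c3: "0 < c3" using L T_pos by (simp add: c3_def)
 have "ennreal (c3*(1/2^n)) <= (EE M (%w. if base_ev cT KT n (pt n i) (W w) then ms n i (W w) else 0))"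
  if M: "rbm M W" and n: "62 <= n" "i < 2^(n-62)" for M :: "'a measure" and W n i
 proof -
  define y where "y = 1/(2::real)^n"
  let ?z = "zt n i"
  note pb = pt_bounds[OF n]
  have y: "0 < y" "y <= 1" by (auto simp: y_def)
  have im: "0 < Im ?z" "Im ?z = y" by (auto simp: y_def)
  have nz: "norm ?z <= 3*xT" using norm_le_abs_add[of ?z] pb  by simp
  have nz1: "norm ?z <= 1" using nz T_pos by simp
  have nz6: "norm ?z powr (1/6) <= 1/1000"
  proof -
   have "norm ?z powr (1/6) <= (1/10^18) powr (1/6)" using nz by (intro powr_mono2) (auto simp: xT_def)
   also have "(1/10^18) = (1/1000 :: real) powr 6" by (simp add: power_divide)
   finally show ?thesis by (simp only: powr_powr) simp
  qed
  note [measurable] = measurable_good_ev[OF rbmD(2)[OF M]] measurable_dlW[OF rbmD(2)[OF M]]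
  have "ennreal (xT powr (2/3)/10000) <= ennreal (norm ?z powr (2/3)/10000)"
   using abs_Re_le_cmod[of ?z] pb  by (intro ennreal_leI divide_right_mono powr_mono2) auto
  also have "... <= (EE M (%w. if cT <= Im (fl (W w) ?z) & norm (fl (W w) ?z) <= KT
    then norm (qf (W w) ?z ?z) powr (4/3)*norm (qf (W w) ?z (cnj ?z)) powr (- 1/3)*norm (fl (W w) ?z) powr (2/3)*KT powr (1/6) else 0))"
   using one_point_lower[OF M im(1) nz1 nz6] by (simp only: cT_def KT_def)
  also have "... <= (EE M (%w. (L/y)*(if base_ev cT KT n (pt n i) (W w) then ms n i (W w) else 0)))"
  proof (rule nn_integral_mono_AE, use rbmD(3)[OF M] in eventually_elim)
   case (elim w)
   show ?case
   proof (cases "base_ev cT KT n (pt n i) (W w)")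
    case True
    then have b: "cT <= Im (fl (W w) ?z)" "norm (fl (W w) ?z) <= KT" by (auto simp: base_ev_def)
    have "Im ?z <= 1" by simp
    from oc_mass(2)[OF elim im(1) this T_pos(1) b]
    have "oc (2/3) (W w) ?z*y <= cT powr (- 1/3)*KT powr (2/3)*ms n i (W w)" unfolding im(2) ms_def .
    then have "oc (2/3) (W w) ?z*y*KT powr (1/6) <= cT powr (- 1/3)*KT powr (2/3)*ms n i (W w)*KT powr (1/6)" by (rule mult_right_mono) simp
    then have "oc (2/3) (W w) ?z*KT powr (1/6) <= (L/y)*ms n i (W w)" using y by (simp add: L_def field_simps)
    then show ?thesis using True  by (simp add: oc_def pE_qE_two_thirds ennreal_leI)
   next
    case False
    then have "\<not> (cT <= Im (fl (W w) ?z) & norm (fl (W w) ?z) <= KT)" by (simp add: base_ev_def)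
    then show ?thesis by auto
   qed
  qed
  also have "... = ennreal (L/y)*(EE M (%w. if base_ev cT KT n (pt n i) (W w) then ms n i (W w) else 0))"
  proof -
   have D: "0 <= L/y" using L y by simp
   show ?thesis unfolding ennreal_mult'[OF D] ms_def by (rule nn_integral_cmult) measurable
  qed
  finally have *: "ennreal (xT powr (2/3)/10000) <= ennreal (L/y)*(EE M (%w. if base_ev cT KT n (pt n i) (W w) then ms n i (W w) else 0))" .
  have "ennreal (c3*y) = ennreal (y/L)*ennreal (xT powr (2/3)/10000)" using y L by (simp add: c3_def mult_ac flip: ennreal_mult')
  also have "... <= ennreal (y/L)*(ennreal (L/y)*(EE M (%w. if base_ev cT KT n (pt n i) (W w) then ms n i (W w) else 0)))"
   by (intro mult_left_mono *) simp
  also have "... = (EE M (%w. if base_ev cT KT n (pt n i) (W w) then ms n i (W w) else 0))"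
   using y L by (simp add: mult.assoc[symmetric] flip: ennreal_mult')
  finally show ?thesis by (simp add: y_def)
 qed
 then show ?thesis using c3 by blast
qed

lemma good_mass:
 assumes e: "0 < e" "e < 1/3"
 shows "EX A>=1. EX c4>0. \<forall>(M :: 'a measure) W n i. rbm M W --> 62 <= n --> i < 2^(n-62) -->
   ennreal (c4*(1/2^n)) <= (EE M (%w. if good_ev cT KT A e n (pt n i) (W w) then ms n i (W w) else 0))"
proof -
 obtain c3 where c3: "0 < c3" and b: "!!(M :: 'a measure) W n i. rbm M W ==> 62 <= n ==> i < 2^(n-62) ==>
   ennreal (c3*(1/2^n)) <= (EE M (%w. if base_ev cT KT n (pt n i) (W w) then ms n i (W w) else 0))" using base_mass by blast
 have c32: "0 < c3/2" using c3 by simp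
 obtain A where A: "1 <= A" and bad: "!!(M :: 'a measure) W n x. rbm M W ==> xT <= x ==> x <= 1 ==>
  (EE M (%w. if base_ev cT KT n x (W w) & \<not> good_ev cT KT A e n x (W w) then dlW (W w) (Complex x (1/2^n)) powr (4/3) else 0))
   <= ennreal (c3/2*(1/2^n))" using bad_mass[OF T_pos(1) less_imp_le[OF T_pos(2)] e T_pos(3) c32] by blast
 have "ennreal (c3/2*(1/2^n)) <= (EE M (%w. if good_ev cT KT A e n (pt n i) (W w) then ms n i (W w) else 0))"
  if M: "rbm M W" and n: "62 <= n" "i < 2^(n-62)" for M :: "'a measure" and W n i
 proof -
  define t where "t = c3/2*(1/2^n)"
  have t: "0 <= t" using c3 by (simp add: t_def)
  let ?G = "%w. good_ev cT KT A e n (pt n i) (W w)" and ?B = "%w. base_ev cT KT n (pt n i) (W w)"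
  note [measurable] = measurable_good_ev[OF rbmD(2)[OF M]] measurable_dlW[OF rbmD(2)[OF M]]
  have [measurable]: "(%w. ms n i (W w)) : borel_measurable M" unfolding ms_def by measurable
  let ?A = "\<integral>\<^sup>+w. ennreal (if ?G w then ms n i (W w) else 0) \<partial>M"
  let ?C = "\<integral>\<^sup>+w. ennreal (if ?B w & \<not> ?G w then ms n i (W w) else 0) \<partial>M"
  have "ennreal t+ennreal t = ennreal (c3*(1/2^n))" using t by (simp add: t_def flip: ennreal_plus)
  also have "... <= (EE M (%w. if ?B w then ms n i (W w) else 0))" by (rule b[OF M n])
  also have "... <= (\<integral>\<^sup>+w. ennreal (if ?G w then ms n i (W w) else 0)+ennreal (if ?B w & \<not> ?G w then ms n i (W w) else 0) \<partial>M)"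
   by (intro nn_integral_mono) auto
  also have "... = ?A+?C" by (rule nn_integral_add) measurable
  also have "... <= ?A+ennreal t"
  proof (rule add_left_mono)
   have "pt n i <= 1" using pt_bounds[OF n] T_pos by simp
   then show "?C <= ennreal t" using bad[OF M pt_bounds(1)[OF n]] unfolding t_def ms_def by blast
  qed
  finally have "ennreal t+ennreal t <= ennreal t+?A" by simp
  then show ?thesis unfolding ennreal_add_left_cancel_le t_def by simp
 qed
 then show ?thesis using A c32 by blast
qed

text \<open>Two charges 2/3 and a charge -2/3 above them at height l, about their distance, give the
  pair exponents -2/3, 2/3, 2/3. The pair factors form the ratio P1 P2 / (Q |X|), which is at least
  a multiple of dlW at w. Heuristically, given the picture at scale l the two masses become
  independent.\<close>

lemma three_charge_bound:
 fixes x1 x2 y l :: real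
 assumes W: "continuous_on {0..1} W" and y: "0 < y" "2*y <= l" "l <= 1" and d: "l/4 <= abs (x1-x2)" "abs (x1-x2) <= l" and c: "0 < c" "0 < K"
 defines "z \<equiv> Complex x1 y" and "v \<equiv> Complex x2 y" and "w \<equiv> Complex x1 l"
 assumes z: "c <= Im (fl W z)" "norm (fl W z) <= K" and v: "c <= Im (fl W v)" "norm (fl W v) <= K"
 defines "k \<equiv> 4*koebe_C*(K/c+1)*(2*K/c)"
 shows "dlW W z powr (4/3)*dlW W v powr (4/3)*(dlW W w powr (- 4/3)*l)
  <= ((3 powr (1/3) * c powr (- 2/3))^2*3 powr (1/3)*(96*k) powr (2/3)*6 powr (2/3))*y^2 *
   ((oc (2/3) W z * oc (2/3) W v * oc (- 2/3) W w)*(pc (- 2/3) W z v * pc (2/3) W z w*pc (2/3) W v w))"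
proof -
 interpret half_plane_map "cflow W" by (rule cflow_half_plane_map[OF W])
 have lp: "0 < l" using y by simp
 have im: "0 < Im z" "0 < Im v" "0 < Im w" "Im z = y" "Im v = y" "Im w = l" "Im w <= 1" using y by (auto simp: z_def v_def w_def)
 have ne: "z ~= v" "z ~= w" "v ~= w" using d y by (auto simp: z_def v_def w_def)
 define Z where "Z = fl W z"
 define V where "V = fl W v"
 define X where "X = fl W w"
 note cf = fl_continuous(2)[OF W im(1)] fl_continuous(2)[OF W im(2)] fl_continuous(2)[OF W im(3)]
 have X: "0 < Im X" "Im X <= 3" "0 < dlW W w" "dlW W w = dl w" using fl_bounds[OF W im(3,7)] by (auto simp: X_def)
 have Xn: "0 < norm X" using X by auto
 have Zc: "c <= Im Z" "norm Z <= K" "c <= Im V" "norm V <= K" using z v by (auto simp: Z_def V_def)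
 have kc: "0 < koebe_C" by (rule koebe_C_pos)
 have kp: "0 < k" unfolding k_def using c kc by (intro mult_pos_pos add_pos_pos divide_pos_pos) auto
 let ?D = "norm (Z-X)"
 let ?H = "norm (V-X)"
 have sep: "dlW W w <= 2*koebe_C*?D" "dlW W w <= 2*koebe_C*?H"
 proof -
  show "dlW W w <= 2*koebe_C*?D" "dlW W w <= 2*koebe_C*?H" using abs_Im_le_cmod[of "z-w"] abs_Im_le_cmod[of "v-w"]
   using separation[OF im(3,1)] separation[OF im(3,2)] y by (auto simp: X(4) Z_def V_def X_def cf im)
 qed
 let ?B = "norm (Z-cnj X)"
 let ?E = "norm (Z-cnj V)"
 let ?I = "norm (V-cnj X)"
 have bar: "?D <= ?B" "c <= ?B" "c <= ?I" "?E <= 2*K"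
 proof -
  have "(Im Z-Im X)^2 <= (Im Z+Im X)^2" using Zc c X by (intro power2_mono) auto
  then show "?D <= ?B" by (simp add: cmod_def)
  show "c <= ?B" "c <= ?I" using abs_Im_le_cmod[of "Z-cnj X"] abs_Im_le_cmod[of "V-cnj X"] Zc X by auto
  show "?E <= 2*K" using norm_triangle_ineq4[of Z "cnj V"] Zc by simp
 qed
 have n1: "norm X <= (K/c+1)*?B"
 proof -
  have "norm X <= norm Z+?D" using norm_triangle_ineq4[of Z "Z-X"] by simp
  also have "... <= K/c*?B+?B"
  proof (rule add_mono[OF _ bar(1)])
   have "norm Z <= K/c * c" using Zc c by simp
   also have "... <= K/c*?B" using bar c by (intro mult_left_mono) auto
   finally show "norm Z <= K/c*?B" .
  qed
  finally show ?thesis by (simp add: distrib_right)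
 qed
 have n2: "?E <= (2*K/c)*?I"
 proof -
  have "?E <= 2*K/c * c" using bar c by simp
  also have "... <= (2*K/c)*?I" using bar c by (intro mult_left_mono) auto
  finally show ?thesis .
 qed
 \<comment> \<open>Z - V is split at X; in each summand separation bounds dlW W w by the other
   distance.\<close>
 have n3: "dlW W w*norm (Z-V) <= (4*koebe_C)*(?D*?H)"
 proof -
  have "dlW W w*norm (Z-V) <= dlW W w*?D+dlW W w*?H" using norm_triangle_ineq4[of "Z-X" "V-X"] using X by (simp flip: distrib_left)
  also have "... <= (2*koebe_C*?H)*?D+(2*koebe_C*?D)*?H" using sep by (intro add_mono mult_right_mono) auto
  finally show ?thesis by (simp add: mult_ac)
 qed
 define P1 where "P1 = ?D*?B"
 define P2 where "P2 = ?H*?I"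
 define Q where "Q = norm (Z-V)*?E"
 have zv: "Z ~= V" using qf_nonzero(1)[OF W im(1,2)] qf_continuous(3)[OF W im(1,2) ne(1)] by (auto simp: Z_def V_def cf)
 have Qp: "0 < Q"
 proof -
  have "abs (Im (Z-cnj V)) <= ?E" by (rule abs_Im_le_cmod)
  moreover have "0 < abs (Im (Z-cnj V))" using Zc c by simp
  ultimately have "0 < ?E" by auto
  then show ?thesis using zv by (simp add: Q_def)
 qed
 have PQ: "dlW W w/k <= P1*P2/(Q*norm X)"
 proof -
  have "dlW W w*(Q*norm X) = (dlW W w*norm (Z-V))*(?E*norm X)" by (simp add: Q_def)
  also have "... <= ((4*koebe_C)*(?D*?H))*(((2*K/c)*?I)*((K/c+1)*?B))" using c kc by (intro mult_mono n1 n2 n3) auto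
  also have "... = k*(P1*P2)" by (simp add: k_def P1_def P2_def)
  finally have "dlW W w*(Q*norm X) <= k*(P1*P2)" .
  then show ?thesis using Qp Xn kp by (simp add: field_simps)
 qed
 define a where "a = norm (z-v)*norm (z-cnj v)"
 define b1 where "b1 = norm (z-w)*norm (z-cnj w)"
 define b2 where "b2 = norm (v-w)*norm (v-cnj w)"
 have abp: "0 < a" "0 < b1" "0 < b2" using im ne by (auto simp: complex_eq_iff a_def b1_def b2_def)
 have ab: "l^2/16 <= a" "b1 <= 6*l^2" "b2 <= 6*l^2"
 proof -
  have "l/4 <= norm (z-v)" "l/4 <= norm (z-cnj v)" using abs_Re_le_cmod[of "z-v"] abs_Re_le_cmod[of "z-cnj v"] d by (auto simp: z_def v_def)
  then have "(l/4)*(l/4) <= a" unfolding a_def using lp by (intro mult_mono) auto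
  then show "l^2/16 <= a" by (simp add: power2_eq_square)
  have "norm (z-w) <= 2*l" "norm (z-cnj w) <= 3*l" "norm (v-w) <= 2*l" "norm (v-cnj w) <= 3*l"
   using norm_le_abs_add[of "z-w"] norm_le_abs_add[of "z-cnj w"] norm_le_abs_add[of "v-w"] norm_le_abs_add[of "v-cnj w"] d y
   by (auto simp: z_def v_def w_def)
  then have "b1 <= (2*l)*(3*l)" "b2 <= (2*l)*(3*l)" unfolding b1_def b2_def using lp by (intro mult_mono; simp)+
  then show "b1 <= 6*l^2" "b2 <= 6*l^2" by (simp_all add: power2_eq_square)
 qed
 let ?G = "- 4/3"
 have r: "l powr ?G/((96 :: real) powr (2/3)*6 powr (2/3)) <= (a/(b1*b2)) powr (2/3)"
 proof -
  let ?J = "6*l^2"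
  have "b1*b2 <= ?J*?J" using ab abp by (intro mult_mono) auto
  then have "(l^2/16)/(?J*?J) <= a/(b1*b2)" using ab abp  by (intro frac_le) auto
  also have "(l^2/16)/(?J*?J) = 1/(96*6*l^2)" by (simp add: power2_eq_square)
  finally have "(1/(96*6*l^2)) powr (2/3) <= (a/(b1*b2)) powr (2/3)" by (intro powr_mono2) auto
  moreover have "(1/(96*6*l^2)) powr (2/3) = l powr ?G/(96 powr (2/3)*6 powr (2/3))"
  proof -
   have "(l^2) powr (2/3) = l powr (4/3)" using lp by (simp add: powr_powr flip: powr_numeral)
   then show ?thesis by (simp only: powr_divide powr_mult powr_one_eq_one minus_divide_left[symmetric] powr_minus_divide) (simp)
  qed
  ultimately show ?thesis by simp
 qed
 let ?A = "3 powr (1/3)*(96*k) powr (2/3)*6 powr (2/3)"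
 let ?C = "pc (- 2/3) W z v * pc (2/3) W z w*pc (2/3) W v w"
 let ?F = "Im X powr (- 1/3)*((P1*P2/(Q*norm X)) powr (2/3)*(a/(b1*b2)) powr (2/3))"
 have "dlW W w powr ?G*l = ?A * (dlW W w powr (- 2)*l powr (7/3)*(3 powr (- 1/3)*((dlW W w/k) powr (2/3)*(l powr ?G/(96 powr (2/3)*6 powr (2/3))))))"
 proof -
  have 1: "dlW W w powr ?G = dlW W w powr (- 2)*dlW W w powr (2/3)" by (simp flip: powr_add)
  have "l powr (7/3)*l powr ?G = l powr 1" by (simp only: powr_add[symmetric]) simp
  then have 2: "l = l powr (7/3)*l powr ?G" using lp by simp
  have 3: "3 powr (1/3)*3 powr (- 1/3) = (1::real)" by (simp flip: powr_add)
  have "dlW W w powr ?G*l = (3 powr (1/3)*3 powr (- 1/3))*((dlW W w powr (- 2)*dlW W w powr (2/3))*(l powr (7/3)*l powr ?G))"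
   unfolding 3 1[symmetric] 2[symmetric] by simp
  then show ?thesis using kp by (simp add: powr_mult powr_divide)
 qed
 also have "... <= ?A * (dlW W w powr (- 2)*l powr (7/3)*?F)"
 proof (intro mult_left_mono mult_mono r)
  show "3 powr (- 1/3) <= Im X powr (- 1/3)" using X by (intro powr_mono2') auto
  show "(dlW W w/k) powr (2/3) <= (P1*P2/(Q*norm X)) powr (2/3)" using X kp using PQ by (intro powr_mono2) auto
 qed auto
 also have "dlW W w powr (- 2)*l powr (7/3)*?F = oc (- 2/3) W w*?C"
  unfolding oc_eq[OF W im(3)] pc_eq[OF W im(1,2) ne(1)] pc_eq[OF W im(1,3) ne(2)] pc_eq[OF W im(2,3) ne(3)] pE_qE_two_thirds im(6)
   Z_def[symmetric] V_def[symmetric] X_def[symmetric] P1_def[symmetric] P2_def[symmetric] Q_def[symmetric] a_def[symmetric] b1_def[symmetric] b2_def[symmetric]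
  by (simp add: powr_mult powr_divide powr_minus_divide mult_ac)
 finally have B: "dlW W w powr ?G*l <= ?A*(oc (- 2/3) W w*?C)" .
 have "dlW W z powr (4/3)*dlW W v powr (4/3)*(dlW W w powr ?G*l) <=
  ((3 powr (1/3) * c powr (- 2/3)*y * oc (2/3) W z)*(3 powr (1/3) * c powr (- 2/3)*y * oc (2/3) W v)) * (?A*(oc (- 2/3) W w*?C))"
  using oc_mass(1)[OF W im(1) _ c(1) z(1)] oc_mass(1)[OF W im(2) _ c(1) v(1)]  y unfolding im by (intro mult_mono B) (auto simp: oc_pc_nonneg)
 then show ?thesis by (simp only: power2_eq_square mult_ac)
qed

definition gm :: "real => real => nat => nat => (real => real) => real" where
 "gm A e n i W = (if good_ev cT KT A e n (pt n i) W then ms n i W else 0)"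

lemma gm_nonneg: "0 <= gm A e n i W" by (simp add: gm_def ms_nonneg)

lemma measurable_gm:
 assumes W: "!!t. t : {0..1} ==> (%w. W w t) : borel_measurable N"
 shows "(%w. gm A e n i (W w)) : borel_measurable N"
proof -
 note [measurable] = measurable_good_ev[OF W] measurable_dlW[OF W]
 show ?thesis unfolding gm_def ms_def by measurable
qed

text \<open>At a dyadic scale l between two and four times the distance, goodness bounds dlW by A *
  l powr (1/3 - e). Dividing the three-charge bound by its factor at w leaves y^2 times dlW powr
  (4/3) / l, and (1/3 - e) * 4/3 - 1 = - (5/9 + 4 e / 3).\<close>

lemma two_point_off_diagonal:
 assumes M: "rbm M W" and e: "0 < e" "e < 1/3" and A: "1 <= A" and n: "62 <= n" "i < 2^(n-62)" "j < 2^(n-62)" "i ~= j"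
 defines "k \<equiv> 4*koebe_C*(KT/cT+1)*(2*KT/cT)"
 shows "(EE M (%u. gm A e n i (W u)*gm A e n j (W u))) <=
  ennreal ((((3 powr (1/3) * cT powr (- 2/3))^2*3 powr (1/3)*(96*k) powr (2/3)*6 powr (2/3))*A powr (4/3)*xT powr (- 2/3))
   * (1/2^n)^2*(abs (pt n i-pt n j)+1/2^n) powr (- (5/9+4*e/3)))"
proof -
 define y where "y = 1/(2::real)^n"
 define d where "d = abs (pt n i-pt n j)"
 define H where "H = (3 powr (1/3) * cT powr (- 2/3))^2*3 powr (1/3)*(96*k) powr (2/3)*6 powr (2/3)"
 have H: "0 <= H" by (simp add: H_def)
 define t where "t = 5/9+4*e/3"
 have t: "0 <= t" using e by (simp add: t_def)
 have y: "0 < y" by (simp add: y_def)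
 have d: "y <= d" "d <= 1/8"
 proof -
  have "d = abs (real i-real j)/2^n" by (simp add: d_def pt_def flip: diff_divide_distrib)
  moreover have "1 <= abs (real i-real j)" using n(4) by linarith
  ultimately show "y <= d" by (simp add: y_def divide_right_mono)
  show "d <= 1/8" using pt_bounds(1,2)[OF n(1,2)] pt_bounds(1,2)[OF n(1,3)] T_pos unfolding d_def by linarith
 qed
 obtain m where m: "1/2^Suc m <= 2*d" "2*d <= 1/2^m" using dyadic_scale[of "2*d" 0] d y by auto
 define l where "l = 1/(2::real)^m"
 have "l/2 <= 2*d" "2*d <= l" "0 < l" "l <= 1" using m by (simp_all add: l_def)
 then have l: "0 < l" "l <= 1" "l/4 <= d" "d <= l" "2*y <= l" "d+y <= l" using d  by simp_all
 have mn: "m < n"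
 proof -
  have "2*2^m <= (2::real)^n" using l(5) by (simp add: l_def y_def field_simps)
  then have "(2::real)^Suc m <= 2^n" by simp
  then show ?thesis by (simp only: power_increasing_iff)
 qed
 let ?z = "zt n i" and ?v = "zt n j" and ?w = "Complex (pt n i) l"
 have im: "0 < Im ?z" "0 < Im ?v" "0 < Im ?w" using l by auto
 define N where "N = (%u. (oc (2/3) (W u) ?z * oc (2/3) (W u) ?v * oc (- 2/3) (W u) ?w)*(pc (- 2/3) (W u) ?z ?v * pc (2/3) (W u) ?z ?w*pc (2/3) (W u) ?v ?w))"
 have N0: "0 <= N u" for u by (auto simp: N_def oc_pc_nonneg)
 have Nm [measurable]: "N : borel_measurable M" unfolding N_def by (intro borel_measurable_times measurable_oc_pc rbmD(2)[OF M])
 define D where "D = H*A powr (4/3)*y^2*(d+y) powr (- t)"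
 have D: "0 <= D" using H by (simp add: D_def)
 have "(EE M (%u. gm A e n i (W u)*gm A e n j (W u))) <= (EE M (%u. D*N u))"
 proof (rule nn_integral_mono_AE, use rbmD(3)[OF M] in eventually_elim)
  case (elim u)
  show ?case
  proof (cases "good_ev cT KT A e n (pt n i) (W u) & good_ev cT KT A e n (pt n j) (W u)")
   case True
   define X where "X = dlW (W u) ?w"
   have X: "0 < X" using fl_bounds(4)[OF elim, of ?w] l by (simp add: X_def)
   have gi: "base_ev cT KT n (pt n i) (W u)" "X <= A*l powr (1/3-e)" and gj: "base_ev cT KT n (pt n j) (W u)"
    using True mn unfolding good_ev_def X_def l_def by auto
   have b: "ms n i (W u)*ms n j (W u)*(X powr (- 4/3)*l) <= H*y^2*N u"
    using three_charge_bound[OF elim y l(5,2), of "pt n i" "pt n j" cT KT] l gi(1) gj T_pos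
    unfolding base_ev_def N_def H_def k_def ms_def X_def d_def y_def by simp
   have "X powr (4/3)/l <= A powr (4/3)*(d+y) powr (- t)"
   proof -
    have "X powr (4/3)/l <= (A*l powr (1/3-e)) powr (4/3)/l" using gi(2) X l by (intro divide_right_mono powr_mono2) auto
    also have "... = A powr (4/3)*(l powr ((1/3-e)*(4/3))*l powr (- 1))" using l by (simp add: powr_mult powr_powr)
    also have "l powr ((1/3-e)*(4/3))*l powr (- 1) = l powr (- t)"
     unfolding powr_add[symmetric] by (rule arg_cong[where f = "(powr) l"]) (simp add: t_def field_simps)
    also have "A powr (4/3)*l powr (- t) <= A powr (4/3)*(d+y) powr (- t)" using l y t by (intro mult_left_mono powr_mono2') auto
    finally show ?thesis .
   qed
   then have r: "(H*y^2*N u)*(X powr (4/3)/l) <= (H*y^2*N u)*(A powr (4/3)*(d+y) powr (- t))" using H N0 by (intro mult_left_mono) auto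
   have "ms n i (W u)*ms n j (W u) = ms n i (W u)*ms n j (W u)*(X powr (- 4/3)*l)*(X powr (4/3)/l)" using X l by (simp add: powr_minus_divide)
   also have "... <= (H*y^2*N u)*(X powr (4/3)/l)" using b l by (intro mult_right_mono) auto
   also note r
   finally show ?thesis by (simp add: gm_def D_def mult_ac ennreal_leI)
  next
   case False
   then have "gm A e n i (W u)*gm A e n j (W u) = 0" by (auto simp: gm_def)
   then show ?thesis by auto
  qed
 qed
 also have "... = ennreal D*(EE M (%u. N u))" unfolding ennreal_mult'[OF D] by (rule nn_integral_cmult) measurable
 also have "... <= ennreal D*ennreal (norm ?z powr (2/3)*(norm ?v powr (2/3)*norm ?w powr (- 2/3)))"
  using three_charge_expectation[OF M im, of "2/3" "2/3" "- 2/3"] unfolding N_def by (intro mult_left_mono) simp_all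
 also have "... <= ennreal D*ennreal (1*(1*xT powr (- 2/3)))"
 proof (intro mult_left_mono ennreal_leI mult_mono)
  show "norm ?z powr (2/3) <= 1" "norm ?v powr (2/3) <= 1" using norm_le_abs_add[of ?z] norm_le_abs_add[of ?v] pt_bounds[OF n(1,2)] pt_bounds[OF n(1,3)] T_pos by (auto intro!: powr_le1)
  show "norm ?w powr (- 2/3) <= xT powr (- 2/3)" using abs_Re_le_cmod[of ?w] pt_bounds[OF n(1,2)] T_pos by (intro powr_mono2') auto
 qed auto
 also have "... = ennreal ((H*A powr (4/3)*xT powr (- 2/3))*y^2*(d+y) powr (- t))" by (simp add: D_def mult_ac flip: ennreal_mult')
 finally show ?thesis unfolding H_def d_def t_def y_def .
qed

text \<open>Goodness speaks of the scales strictly above the lowest one; the lowest point inherits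
  its bound from the next scale, since separation and growth compare the two.\<close>

lemma good_diagonal:
 assumes W: "continuous_on {0..1} W" and g: "good_ev c K A e n x W" and n: "0 < n" and A: "1 <= A" and e: "0 < e" "e < 1/3"
 shows "dlW W (Complex x (1/2^n)) <= (4*koebe_C^2*A)*(1/2^n) powr (1/3-e)"
proof -
 interpret half_plane_map "cflow W" by (rule cflow_half_plane_map[OF W])
 obtain k where k: "n = Suc k" using n by (cases n) auto
 let ?z = "Complex x (1/2^n)" and ?w = "Complex x (1/2^k)"
 have im: "0 < Im ?z" "0 < Im ?w" "Im ?z <= 1" by auto
 let ?A = "1/3-e"
 have D: "dlW W ?w <= A*(1/2^k) powr ?A" using g k by (auto simp: good_ev_def)
 have "?w-?z = Complex 0 (1/2^n)" by (simp add: complex_eq_iff k)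
 then have "norm (?w-?z) = 1/2^n" by (simp add: complex_norm)
 then have "dl ?z <= 2*koebe_C*norm (cflow W ?w-cflow W ?z)" by (intro separation im) (simp add: field_simps)
 also have "norm (cflow W ?w-cflow W ?z) = norm (fl W ?z-fl W ?w)"
  using fl_continuous(2)[OF W im(1)] fl_continuous(2)[OF W im(2)] by (simp add: norm_minus_commute)
 also have "2*koebe_C*... <= 2*koebe_C*(koebe_C*dlW W ?w)" using vertical_chain[OF W, of k n x] koebe_C_pos by (intro mult_left_mono) (auto simp: k)
 also have "... <= 2*koebe_C*(koebe_C*(A*(1/2^k) powr ?A))" using D koebe_C_pos by (intro mult_left_mono) auto
 also have "(1/2^k) powr ?A = 2 powr ?A*(1/2^n) powr ?A" unfolding powr_mult[symmetric] by (simp add: k)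
 also have "2*koebe_C*(koebe_C*(A*(2 powr ?A*(1/2^n) powr ?A))) <= 2*koebe_C*(koebe_C*(A*(2 powr 1*(1/2^n) powr ?A)))"
  using koebe_C_pos A e by (intro mult_left_mono mult_right_mono powr_mono) auto
 finally show ?thesis using fl_bounds(6)[OF W im(1,3)] by (simp add: power2_eq_square)
qed

text \<open>One factor of the square is bounded by \<open>good_diagonal\<close>, the other by its
  first moment.\<close>

lemma two_point_diagonal:
 assumes M: "rbm M W" and e: "0 < e" "e < 1/3" and A: "1 <= A" and n: "62 <= n" "i < 2^(n-62)"
 shows "(EE M (%w. gm A e n i (W w)*gm A e n i (W w))) <=
  ennreal ((3 powr (1/3) * cT powr (- 2/3)*(4*koebe_C^2*A) powr (4/3))*(1/2^n)^2*(1/2^n) powr (- (5/9+4*e/3)))"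
proof -
 define y where "y = 1/(2::real)^n"
 have y: "0 < y" "y <= 1" by (auto simp: y_def)
 let ?z = "zt n i"
 have im: "0 < Im ?z" "Im ?z <= 1" "Im ?z = y" by (auto simp: y_def)
 define b where "b = (4*koebe_C^2*A) powr (4/3)"
 define L where "L = 3 powr (1/3) * cT powr (- 2/3)"
 define D where "D = L*b*y^2*y powr (- (5/9+4*e/3))"
 have D: "0 <= D" by (simp add: D_def L_def b_def)
 have m: "(%w. oc (2/3) (W w) ?z) : borel_measurable M" by (rule measurable_oc_pc[OF rbmD(2)[OF M]])
 have "(EE M (%w. gm A e n i (W w)*gm A e n i (W w))) <= (EE M (%w. D * oc (2/3) (W w) ?z))"
 proof (rule nn_integral_mono_AE, use rbmD(3)[OF M] in eventually_elim)
  case (elim w)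
  show ?case
  proof (cases "good_ev cT KT A e n (pt n i) (W w)")
   case True
   then have c: "cT <= Im (fl (W w) ?z)" by (simp add: good_ev_def base_ev_def)
   let ?B = "ms n i (W w)"
   have m1: "?B <= L*y * oc (2/3) (W w) ?z" using oc_mass(1)[OF elim im(1,2) T_pos(1) c] unfolding im(3) by (simp add: ms_def L_def)
   let ?A = "(1/3-e)*(4/3)"
   have "dlW (W w) ?z <= (4*koebe_C^2*A)*y powr (1/3-e)" using good_diagonal[OF elim True _ A e] n(1) by (simp add: y_def)
   then have "?B <= ((4*koebe_C^2*A)*y powr (1/3-e)) powr (4/3)" unfolding ms_def using fl_bounds(4)[OF elim im(1,2)] by (intro powr_mono2) auto
   also have "... = b*y powr ?A" by (simp add: powr_mult powr_powr b_def)
   finally have m2: "?B <= b*y powr ?A" .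
   have yy: "y*y powr ?A = y^2*y powr (- (5/9+4*e/3))"
   proof -
    have "y powr 1*y powr ?A = y powr 2*y powr (- (5/9+4*e/3))"
     unfolding powr_add[symmetric] by (rule arg_cong[where f = "(powr) y"]) (simp add: field_simps)
    then show ?thesis using y by simp
   qed
   have "?B*?B <= (L*y * oc (2/3) (W w) ?z)*(b*y powr ?A)" using y by (intro mult_mono m1 m2) (auto simp: ms_nonneg oc_pc_nonneg L_def)
   also have "... = L*b*(y*y powr ?A) * oc (2/3) (W w) ?z" by simp
   also have "... = D * oc (2/3) (W w) ?z" unfolding yy D_def by (simp only: mult_ac)
   finally show ?thesis by (simp add: gm_def ennreal_leI)
  qed (simp add: gm_def)
 qed
 also have "... = ennreal D*(EE M (%w. oc (2/3) (W w) ?z))" unfolding ennreal_mult'[OF D] using m by (intro nn_integral_cmult) measurable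
 also have "... <= ennreal D*ennreal (norm ?z powr (2/3))"
  using one_charge_expectation[OF M im(1), of "2/3"] unfolding oc_def by (intro mult_left_mono) auto
 also have "... <= ennreal D*ennreal 1"
 proof (intro mult_left_mono ennreal_leI)
  show "norm ?z powr (2/3) <= 1" using norm_le_abs_add[of ?z] pt_bounds[OF n] T_pos by (auto intro!: powr_le1)
 qed auto
 finally show ?thesis by (simp add: D_def L_def b_def y_def)
qed

lemma two_point:
 assumes e: "0 < e" "e < 1/3" and A: "1 <= A"
 shows "EX C>=0. \<forall>(M :: 'a measure) W n i j. rbm M W --> 62 <= n --> i < 2^(n-62) --> j < 2^(n-62) -->
  (EE M (%w. gm A e n i (W w)*gm A e n j (W w))) <= ennreal (C*((1/2^n)^2*(abs (pt n i-pt n j)+1/2^n) powr (- (5/9+4*e/3))))"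
proof -
 define k where "k = 4*koebe_C*(KT/cT+1)*(2*KT/cT)"
 define C1 where "C1 = ((3 powr (1/3) * cT powr (- 2/3))^2*3 powr (1/3)*(96*k) powr (2/3)*6 powr (2/3))*A powr (4/3)*xT powr (- 2/3)"
 define C2 where "C2 = 3 powr (1/3) * cT powr (- 2/3)*(4*koebe_C^2*A) powr (4/3)"
 have C: "0 <= C1" "0 <= C2" by (auto simp: C1_def C2_def)
 let ?A = "- (5/9+4*e/3)"
 have "(EE M (%w. gm A e n i (W w)*gm A e n j (W w))) <= ennreal ((C1+C2)*((1/2^n)^2*(abs (pt n i-pt n j)+1/2^n) powr ?A))"
  if M: "rbm M W" and n: "62 <= n" "i < 2^(n-62)" "j < 2^(n-62)" for M :: "'a measure" and W n i j
 proof (cases "i = j")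
  case True
  have "(EE M (%w. gm A e n i (W w)*gm A e n i (W w))) <= ennreal (C2*((1/2^n)^2*(1/2^n) powr ?A))"
   using two_point_diagonal[OF M e A n(1,2)] unfolding C2_def by (simp only: mult.assoc)
  also have "... <= ennreal ((C1+C2)*((1/2^n)^2*(1/2^n) powr ?A))" using C by (intro ennreal_leI mult_right_mono) auto
  finally show ?thesis using True by simp
 next
  case False
  have "(EE M (%w. gm A e n i (W w)*gm A e n j (W w))) <= ennreal (C1*((1/2^n)^2*(abs (pt n i-pt n j)+1/2^n) powr ?A))"
   using two_point_off_diagonal[OF M e A n False] unfolding C1_def k_def by (simp only: mult.assoc)
  also have "... <= ennreal ((C1+C2)*((1/2^n)^2*(abs (pt n i-pt n j)+1/2^n) powr ?A))" using C by (intro ennreal_leI mult_right_mono) auto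
  finally show ?thesis .
 qed
 moreover have "0 <= C1+C2" using C by simp
 ultimately show ?thesis by auto
qed

section \<open>The energy method\<close>

lemma powr_sum_bound:
 fixes w :: real
 assumes k: "0 < w" "w <= 1"
 shows "(\<Sum>d<N. real (Suc d) powr (w-1)) <= real N powr w/w"
proof (induction N)
 case (Suc N)
 let ?A = "real (Suc N)"
 let ?B = "w-1"
 have "w*?A powr ?B <= ?A powr w-real N powr w"
 proof (cases "N = 0")
  case False
  have dv: "((%x. x powr w) has_real_derivative w*x powr ?B) (at x)" if "real N <= x" for x using that False by (intro has_real_derivative_powr) auto
  obtain z :: real where z: "real N < z" "z < ?A" "?A powr w-real N powr w = (?A-real N)*(w*z powr ?B)"
   using MVT2[of "real N" "?A" "%x. x powr w" "%x. w*x powr ?B", OF _ dv] by auto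
  have "?A powr ?B <= z powr ?B" using z k by (intro powr_mono2') auto
  then show ?thesis using z(3) k by (simp)
 qed (use k in simp)
 then have "?A powr ?B <= (?A powr w-real N powr w)/w" using k by (simp add: le_divide_eq mult.commute)
 then show ?case using Suc by (simp add: diff_divide_distrib)
qed simp

lemma sum_distance_le:
 fixes g :: "nat => real"
 assumes g: "!!d. 0 <= g d" and i: "i < N"
 shows "(\<Sum>j<N. g (if j <= i then i-j else j-i)) <= 2*(\<Sum>d<N. g d)"
proof -
 have u: "{..<N} = {..i} \<union> {Suc i..<N}" "{..i} \<inter> {Suc i..<N} = {}" using i by auto
 have "(\<Sum>j<N. g (if j <= i then i-j else j-i)) = (\<Sum>j\<le>i. g (i-j))+(\<Sum>j=Suc i..<N. g (j-i))"
  unfolding u(1) by (subst sum.union_disjoint) auto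
 also have "(\<Sum>j\<le>i. g (i-j)) = (\<Sum>d\<le>i. g d)" by (rule sum.reindex_bij_witness[of _ "%d. i-d" "%j. i-j"]) auto
 also have "... <= (\<Sum>d<N. g d)" using i g by (intro sum_mono2) auto
 also have "(\<Sum>j=Suc i..<N. g (j-i)) = (\<Sum>d=1..<N-i. g d)" by (rule sum.reindex_bij_witness[of _ "%d. d+i" "%j. j-i"]) auto
 also have "... <= (\<Sum>d<N. g d)" using g by (intro sum_mono2) auto
 finally show ?thesis by simp
qed

definition Sn :: "real => real => nat => (real => real) => real" where
 "Sn A e n W = (\<Sum>i<2^(n-62). gm A e n i W)"

text \<open>Riesz energy, regularised at the mesh, of the discrete measure carried by the preimage
  points on the line, not by their images.\<close>

definition En :: "real => real => real => nat => (real => real) => real" where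
 "En A e t n W = (\<Sum>i<2^(n-62). \<Sum>j<2^(n-62). gm A e n i W*gm A e n j W*(abs (pt n i-pt n j)+1/2^n) powr (- t))"

lemma measurable_Sn_En:
 assumes W: "!!t. t : {0..1} ==> (%w. W w t) : borel_measurable N"
 shows "(%w. Sn A e n (W w)) : borel_measurable N" "(%w. En A e t n (W w)) : borel_measurable N"
proof -
 note [measurable] = measurable_gm[OF W]
 show "(%w. Sn A e n (W w)) : borel_measurable N" unfolding Sn_def by measurable
 show "(%w. En A e t n (W w)) : borel_measurable N" unfolding En_def by measurable
qed

lemma pt_diff: "abs (pt n i-pt n j)+1/2^n = real (Suc (if j <= i then i-j else j-i))/2^n"
proof -
 have "abs (pt n i-pt n j) = abs (real i-real j)/2^n" by (simp add: pt_def flip: diff_divide_distrib)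
 also have "abs (real i-real j) = real (if j <= i then i-j else j-i)" by simp
 finally show ?thesis by (simp add: add_divide_distrib)
qed

text \<open>The correlation exponent 5/9 + 4 e / 3 and the energy exponent 4/9 - 2 e add up to 1 - 2
  e / 3, an integrable singularity in dimension one.\<close>

lemma energy_expectation:
 assumes e: "0 < e" "e < 1/3" and A: "1 <= A"
 shows "EX C>=0. \<forall>(M :: 'a measure) W n. rbm M W --> 62 <= n -->
  (EE M (%w. En A e (4/9-2*e) n (W w))) <= ennreal C"
proof -
 define k where "k = 2*e/3"
 have k: "0 < k" "k <= 1" using e by (auto simp: k_def)
 let ?F = "- (5/9+4*e/3)"
 obtain C where C: "0 <= C" and two: "!!(M :: 'a measure) W n i j. rbm M W ==> 62 <= n ==> i < 2^(n-62) ==> j < 2^(n-62) ==>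
  (EE M (%w. gm A e n i (W w)*gm A e n j (W w))) <= ennreal (C*((1/2^n)^2*(abs (pt n i-pt n j)+1/2^n) powr ?F))" using two_point[OF e A] by blast
 let ?E = "2/k"
 have "(EE M (%w. En A e (4/9-2*e) n (W w))) <= ennreal (C*?E)" if M: "rbm M W" and n: "62 <= n" for M :: "'a measure" and W n
 proof -
  define N where "N = (2::nat)^(n-62)"
  define y where "y = 1/(2::real)^n"
  have y: "0 < y" by (simp add: y_def)
  define r where "r = (%i j. abs (pt n i-pt n j)+1/2^n)"
  have rr: "abs (pt n i-pt n j)+1/2^n = r i j" for i j by (simp add: r_def)
  define D where "D = (%i j. if j <= i then i-j else j-i :: nat)"
  have rD: "r i j = real (Suc (D i j))*y" for i j unfolding r_def pt_diff D_def y_def by simp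
  note [measurable] = measurable_gm[OF rbmD(2)[OF M]]
  let ?B = "1+k"
  let ?C = "k-1"
  let ?D = "- (4/9-2*e)"
  have one: "(EE M (%w. gm A e n i (W w)*gm A e n j (W w)*r i j powr ?D))
   <= ennreal (C*(y powr ?B*real (Suc (D i j)) powr ?C))" if ij: "i < N" "j < N" for i j
  proof -
   have "(EE M (%w. gm A e n i (W w)*gm A e n j (W w)*r i j powr ?D))
    = (\<integral>\<^sup>+w. ennreal (gm A e n i (W w)*gm A e n j (W w))*ennreal (r i j powr ?D) \<partial>M)"
    by (intro nn_integral_cong) (simp add: ennreal_mult'')
   also have "... = (EE M (%w. gm A e n i (W w)*gm A e n j (W w)))*ennreal (r i j powr ?D)" by (rule nn_integral_multc) measurable
   also have "... <= ennreal (C*(y^2*r i j powr ?F))*ennreal (r i j powr ?D)"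
    using two[OF M n, of i j] ij unfolding N_def r_def y_def by (intro mult_right_mono) auto
   also have "... = ennreal (C*(y^2*(r i j powr ?F*r i j powr ?D)))" by (simp flip: ennreal_mult'' add: mult.assoc)
   also have "r i j powr ?F*r i j powr ?D = r i j powr ?C"
    unfolding powr_add[symmetric] by (rule arg_cong[where f = "(powr) (r i j)"]) (simp add: k_def)
   also have "y^2*r i j powr ?C = y powr ?B*real (Suc (D i j)) powr ?C"
   proof -
    have "y^2*y powr ?C = y powr 2*y powr ?C" using y by simp
    also have "... = y powr ?B" unfolding powr_add[symmetric] by simp
    finally show ?thesis unfolding rD powr_mult by (simp)
   qed
   finally show ?thesis .
  qed
  let ?A = "\<Sum>i<N. \<Sum>j<N. C*(y powr ?B*real (Suc (D i j)) powr ?C)"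
  have "(EE M (%w. En A e (4/9-2*e) n (W w))) = (\<Sum>i<N. \<Sum>j<N. (EE M (%w. gm A e n i (W w)*gm A e n j (W w)*r i j powr ?D)))"
   unfolding En_def N_def[symmetric] rr by (simp add: sum_nonneg gm_nonneg nn_integral_sum flip: sum_ennreal)
  also have "... <= (\<Sum>i<N. \<Sum>j<N. ennreal (C*(y powr ?B*real (Suc (D i j)) powr ?C)))" by (intro sum_mono one) auto
  also have "... = ennreal ?A" using C by (simp add: sum_nonneg flip: sum_ennreal)
  also have "... <= ennreal (C*?E)"
  proof (rule ennreal_leI)
   have "?A = C*y powr ?B*(\<Sum>i<N. \<Sum>j<N. real (Suc (D i j)) powr ?C)" by (simp add: sum_distrib_left mult.assoc)
   also have "... <= C*y powr ?B*(\<Sum>i<N. 2*(real N powr k/k))"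
   proof (intro mult_left_mono sum_mono)
    fix i assume "i : {..<N}"
    then have "(\<Sum>j<N. real (Suc (D i j)) powr ?C) <= 2*(\<Sum>d<N. real (Suc d) powr ?C)" unfolding D_def by (intro sum_distance_le) auto
    also have "... <= 2*(real N powr k/k)" by (intro mult_left_mono powr_sum_bound k) auto
    finally show "(\<Sum>j<N. real (Suc (D i j)) powr ?C) <= 2*(real N powr k/k)" .
   qed (use C in auto)
   also have "... = C*?E*(y powr ?B*(real N*real N powr k))" by simp
   also have "real N*real N powr k = real N powr ?B" by (simp add: powr_add)
   also have "y powr ?B*real N powr ?B = (y*real N) powr ?B" by (simp add: powr_mult)
   also have "C*?E*(y*real N) powr ?B <= C*?E*1"
   proof (intro mult_left_mono powr_le1)
    show "abs (y*real N) <= 1" by (simp add: y_def N_def)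
   qed (use C k y in "auto simp: N_def")
   finally show "?A <= C*?E" by simp
  qed
  finally show ?thesis .
 qed
 moreover have "0 <= C*?E" using C k by simp
 ultimately show ?thesis by auto
qed

text \<open>Distances are at most 1, so the energy dominates the squared mass. Hence S <= c5/4 + R *
  indicator P + E/R pointwise, where P is the event sought; taking means, with E S >= c5 and R
  large, bounds the probability of P from below.\<close>

lemma mass_energy_event:
 assumes e: "0 < e" "e < 2/9"
 shows "EX A>=1. EX m0>0. EX E0>0. EX p0>0. \<forall>(M :: 'a measure) W n. rbm M W --> 62 <= n -->
  p0 <= measure M {w : space M. m0 <= Sn A e n (W w) & En A e (4/9-2*e) n (W w) <= E0}"
proof -
 have e3: "e < 1/3" using e by simp
 obtain A c4 where A: "1 <= A" and c4: "0 < c4" and low: "!!(M :: 'a measure) W n i. rbm M W ==> 62 <= n ==> i < 2^(n-62) ==>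
   ennreal (c4*(1/2^n)) <= (EE M (%w. if good_ev cT KT A e n (pt n i) (W w) then ms n i (W w) else 0))" using good_mass[OF e(1) e3] by blast
 obtain C where C: "0 <= C" and en: "!!(M :: 'a measure) W n. rbm M W ==> 62 <= n ==> (EE M (%w. En A e (4/9-2*e) n (W w))) <= ennreal C"
  using energy_expectation[OF e(1) e3 A] by blast
 define c5 where "c5 = c4*xT"
 have c5: "0 < c5" using c4 T_pos by (simp add: c5_def)
 define R where "R = 4*(C+1)/c5"
 have R: "0 < R" "C/R <= c5/4" using C c5 by (auto simp: R_def field_simps)
 have "c5/(2 * R) <= measure M {w : space M. c5/4 <= Sn A e n (W w) & En A e (4/9-2*e) n (W w) <= R^2}"
  if M: "rbm M W" and n: "62 <= n" for M :: "'a measure" and W n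
 proof -
  interpret prob_space M by (rule rbmD(1)[OF M])
  define t where "t = 4/9-2*e"
  have t: "0 <= t" using e by (simp add: t_def)
  define S where "S = (%w. Sn A e n (W w))"
  define E where "E = (%w. En A e t n (W w))"
  note [measurable] = measurable_gm[OF rbmD(2)[OF M]]
  have [measurable]: "S : borel_measurable M" "E : borel_measurable M" unfolding S_def E_def by (intro measurable_Sn_En rbmD(2)[OF M]; assumption)+
  have S0: "0 <= S w" "0 <= E w" for w by (auto simp: S_def E_def Sn_def En_def gm_nonneg intro!: sum_nonneg)
  have SE: "(S w)^2 <= E w" for w
  proof -
   have "(S w)^2 = (\<Sum>i<2^(n-62). \<Sum>j<2^(n-62). gm A e n i (W w)*gm A e n j (W w)*1)" by (simp add: S_def Sn_def power2_eq_square sum_product)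
   also have "... <= E w" unfolding E_def En_def
   proof (intro sum_mono mult_left_mono)
    fix i j assume ij: "i : {..<(2::nat)^(n-62)}" "j : {..<(2::nat)^(n-62)}"
    let ?r = "abs (pt n i-pt n j)+1/2^n"
    have "0 < ?r" by (intro add_nonneg_pos) auto
    moreover have "?r <= 1" using pt_bounds[OF n, of i] pt_bounds[OF n, of j] ij T_pos by auto
    ultimately have "1 powr (- t) <= ?r powr (- t)" using t by (intro powr_mono2') auto
    then show "1 <= ?r powr (- t)" by simp
   qed (simp add: gm_nonneg)
   finally show ?thesis .
  qed
  define P where "P = {w : space M. c5/4 <= S w & E w <= R^2}"
  have [measurable]: "P : sets M" unfolding P_def by measurable
  have pw: "S w <= c5/4+(R*indicator P w+E w/R)" if "w : space M" for w
  proof -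
   have "w : P \<or> S w < c5/4 \<or> R^2 < E w" using that by (auto simp: P_def)
   moreover have nn: "0 <= R*indicator P w" "0 <= E w/R" "0 <= c5/4" using R S0(2)[of w] c5 by auto
   ultimately consider "w : P" | "S w < c5/4" | "R^2 < E w" by auto
   then show ?thesis
   proof cases
    case 1
    then have "(S w)^2 <= R^2" using SE[of w] by (simp add: P_def)
    then have "S w <= R" by (rule power2_le_imp_le) (use R in simp)
    moreover have "R*indicator P w = R" using 1 by simp
    ultimately show ?thesis using nn by linarith
   next
    case 2
    then show ?thesis using nn by linarith
   next
    case 3
    have "S w * R <= E w"
    proof (cases "S w <= R")
     case True
     then have "S w * R <= R * R" using R by (intro mult_right_mono) auto
     then show ?thesis using 3 by (simp add: power2_eq_square)
    next
     case False
     then have "S w * R <= S w*S w" using S0(1)[of w] by (intro mult_left_mono) auto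
     then show ?thesis using SE[of w] by (simp add: power2_eq_square)
    qed
    then have "S w <= E w/R" using R by (simp add: le_divide_eq)
    then show ?thesis using nn by linarith
   qed
  qed
  let ?A = "ennreal (c5/4)"
  have "ennreal c5 <= (EE M (%w. S w))"
  proof -
   have "c5 = (\<Sum>i<(2::nat)^(n-62). c4*(1/2^n))" using power_add[of "2::real" "n-62" 62] n by (simp add: c5_def xT_def)
   then have "ennreal c5 = (\<Sum>i<(2::nat)^(n-62). ennreal (c4*(1/2^n)))" using c4 by (simp del: sum_constant)
   also have "... <= (\<Sum>i<2^(n-62). (EE M (%w. gm A e n i (W w))))" unfolding gm_def by (intro sum_mono low M n) auto
   also have "... = (EE M (%w. S w))" unfolding S_def Sn_def by (simp add: gm_nonneg nn_integral_sum flip: sum_ennreal)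
   finally show ?thesis .
  qed
  also have "... <= (\<integral>\<^sup>+w. ?A+(ennreal R*indicator P w+ennreal (1/R)*ennreal (E w)) \<partial>M)"
  proof (rule nn_integral_mono)
   fix w assume "w : space M"
   then have "ennreal (S w) <= ennreal (c5/4+(R*indicator P w+E w/R))" by (intro ennreal_leI pw)
   also have "... = ?A+(ennreal (R*indicator P w)+ennreal (1/R*E w))" using c5 R S0 by (simp)
   also have "... = ?A+(ennreal R*indicator P w+ennreal (1/R)*ennreal (E w))"
    using R  by (simp only: ennreal_mult' divide_nonneg_pos zero_le_one less_imp_le ennreal_indicator[symmetric] ennreal_mult)
   finally show "ennreal (S w) <= ?A+(ennreal R*indicator P w+ennreal (1/R)*ennreal (E w))" .
  qed
  also have "... = ?A+(ennreal R*emeasure M P+ennreal (1/R)*(EE M (%w. E w)))" by (simp add: nn_integral_add nn_integral_cmult emeasure_space_1)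
  also have "... <= ?A+(ennreal R*emeasure M P+ennreal (1/R)*ennreal C)"
   using en[OF M n] unfolding E_def t_def by (intro add_left_mono mult_left_mono) auto
  also have "... = ennreal (c5/4+(R*measure M P+C/R))" using c5 R C by (simp add: emeasure_eq_measure flip: ennreal_mult')
  finally have "c5 <= c5/4+(R*measure M P+C/R)" using c5 R C by (subst (asm) ennreal_le_iff) auto
  then have "c5/2 <= R*measure M P" using R by linarith
  then show ?thesis using R unfolding P_def S_def E_def t_def by (simp add: field_simps)
 qed
 moreover have "0 < c5/(2 * R)" "0 < c5/4" "0 < R^2" using c5 R by auto
 ultimately show ?thesis using A by blast
qed

text \<open>Packing in the plane: round to a grid of mesh \<open>h / 2\<close>.\<close>

lemma packing_bound:
 fixes P :: "'i => complex"
 assumes I: "finite I" and h: "0 < h" "h <= R" and sep: "!!i j. i : I ==> j \<in> I ==> i ~= j ==> h <= norm (P i-P j)"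
  and R: "!!i j. i : I ==> j \<in> I ==> norm (P i-P j) <= R"
 shows "real (card I) <= (6 * R/h)^2"
proof (cases "I = {}")
 case False
 then obtain a where a: "a : I" by auto
 define r where "r = 2 * R/h"
 have r: "2 <= r" using h by (simp add: r_def field_simps)
 define f where "f = (%i. (\<lfloor>2 * Re (P i-P a)/h\<rfloor>, \<lfloor>2*Im (P i-P a)/h\<rfloor>))"
 define B where "B = {\<lfloor>- r\<rfloor>..\<lfloor>r\<rfloor>}"
 have inj: "inj_on f I"
 proof (rule inj_onI, rule ccontr)
  fix i j assume ij: "i : I" "j : I" "f i = f j" "i ~= j"
  have fl: "abs (x-y) < h/2" if "\<lfloor>2*x/h\<rfloor> = \<lfloor>2*y/h\<rfloor>" for x y :: real
  proof -
   have "abs (2*x/h-2*y/h) < 1" using that by linarith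
   moreover have "2*x/h-2*y/h = 2*(x-y)/h" by (simp add: diff_divide_distrib)
   moreover have "abs (2*(x-y)/h) = 2*abs (x-y)/h" unfolding abs_divide abs_mult using h by simp
   ultimately show ?thesis using h by (simp)
  qed
  have "abs (Re (P i-P a)-Re (P j-P a)) < h/2" "abs (Im (P i-P a)-Im (P j-P a)) < h/2" by (rule fl, use ij(3) in "simp only: f_def prod.inject")+
  then have "abs (Re (P i-P j))+abs (Im (P i-P j)) < h" by simp
  then have "norm (P i-P j) < h" using norm_le_abs_add[of "P i-P j"] by linarith
  then show False using sep[OF ij(1,2,4)] by simp
 qed
 have sub: "f ` I <= B \<times> B"
 proof
  fix p assume "p : f ` I"
  then obtain i where i: "i : I" "p = f i" by auto
  have b: "\<lfloor>2*x/h\<rfloor> : B" if "abs x <= R" for x :: real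
  proof -
   have "- r <= 2*x/h" "2*x/h <= r" using that h by (auto simp: r_def field_simps)
   then show ?thesis unfolding B_def by (auto intro!: floor_mono)
  qed
  have "abs (Re (P i-P a)) <= R" "abs (Im (P i-P a)) <= R" using R[OF i(1) a] abs_Re_le_cmod[of "P i-P a"] abs_Im_le_cmod[of "P i-P a"] by linarith+
  then show "p : B \<times> B" unfolding i(2) f_def by (intro SigmaI b)
 qed
 have cB: "real (card B) <= 2*r+2"
 proof -
  have "real_of_int \<lfloor>r\<rfloor> <= r" "- r-1 <= real_of_int \<lfloor>- r\<rfloor>" by auto
  moreover have "0 <= \<lfloor>r\<rfloor>-\<lfloor>- r\<rfloor>+1" using r by linarith
  ultimately show ?thesis unfolding B_def card_atLeastAtMost_int by linarith
 qed
 have "card I <= card (B \<times> B)" using card_inj_on_le[OF inj sub] by (simp add: B_def)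
 then have "real (card I) <= real (card B)*real (card B)" by (simp add: card_cartesian_product flip: of_nat_mult)
 also have "... <= (2*r+2)*(2*r+2)" using cB  by (intro mult_mono) auto
 also have "... <= (3*r)*(3*r)" using r by (intro mult_mono) auto
 also have "... = (6 * R/h)^2" by (simp add: r_def power2_eq_square)
 finally show ?thesis .
qed simp

text \<open>Cauchy-Schwarz over the classes of q; within a class all pairs are close, so B times the
  kernel is at least 1 and the squares are paid for by the energy.\<close>

lemma group_square_bound:
 fixes w :: "'i => real" and k :: "'i => 'i => real"
 assumes T: "finite T" and w: "!!i. i : T ==> 0 <= w i" and k: "!!i j. i : T ==> j \<in> T ==> 0 <= k i j"
  and B: "0 <= B" and close: "!!i j. i : T ==> j \<in> T ==> q i = q j ==> 1 <= B*k i j"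
 shows "(\<Sum>i\<in>T. w i)^2 <= real (card (q ` T))*(B*(\<Sum>i\<in>T. \<Sum>j\<in>T. w i*w j*k i j))"
proof -
 define F where "F = (%a. {i : T. q i = a})"
 have F: "finite (F a)" "F a <= T" for a using T by (auto simp: F_def)
 let ?A = "\<Sum>a\<in>q ` T. (\<Sum>i\<in>F a. w i)^2"
 have "(\<Sum>i\<in>T. w i) = (\<Sum>a\<in>q ` T. \<Sum>i\<in>F a. w i)" unfolding F_def by (rule sum.image_gen[OF T])
 then have "(\<Sum>i\<in>T. w i)^2 <= ?A*real (card (q ` T))" using sum_squared_le_sum_of_squares[of "%a. \<Sum>i\<in>F a. w i" "q ` T"] by simp
 also have "... <= (B*(\<Sum>i\<in>T. \<Sum>j\<in>T. w i*w j*k i j))*real (card (q ` T))"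
 proof (rule mult_right_mono)
  have "?A <= (\<Sum>a\<in>q ` T. \<Sum>i\<in>F a. \<Sum>j\<in>T. B*(w i*w j*k i j))"
  proof (rule sum_mono)
   fix a assume "a : q ` T"
   have "(\<Sum>i\<in>F a. w i)^2 = (\<Sum>i\<in>F a. \<Sum>j\<in>F a. w i*w j)" by (simp add: power2_eq_square sum_product)
   also have "... <= (\<Sum>i\<in>F a. \<Sum>j\<in>F a. B*(w i*w j*k i j))"
   proof (intro sum_mono)
    fix i j assume ij: "i : F a" "j : F a"
    then have "(w i*w j)*1 <= (w i*w j)*(B*k i j)" using w by (intro mult_left_mono close) (auto simp: F_def)
    then show "w i*w j <= B*(w i*w j*k i j)" by (simp add: mult_ac)
   qed
   also have "... <= (\<Sum>i\<in>F a. \<Sum>j\<in>T. B*(w i*w j*k i j))" using T w k B by (intro sum_mono sum_mono2) (auto simp: F_def)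
   finally show "(\<Sum>i\<in>F a. w i)^2 <= (\<Sum>i\<in>F a. \<Sum>j\<in>T. B*(w i*w j*k i j))" .
  qed
  also have "... = (\<Sum>i\<in>T. \<Sum>j\<in>T. B*(w i*w j*k i j))" unfolding F_def by (rule sum.image_gen[OF T, symmetric])
  finally show "?A <= B*(\<Sum>i\<in>T. \<Sum>j\<in>T. w i*w j*k i j)" by (simp add: sum_distrib_left)
 qed simp
 finally show ?thesis by (simp add: mult.commute)
qed

text \<open>A set of diameter \<open>x\<close> in the image meets few boundary intervals of length about \<open>x^3\<close>: the points at height
  \<open>x^3\<close> above these intervals are mapped to separated points near the set.\<close>

lemma good_cells_bound:
 assumes e: "0 < e" "e < 1/12" and A: "1 <= A"
 shows "EX C>0. ALL W n T x k. continuous_on {0..1} W --> T <= {..<2^(n-62)} -->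
  (ALL i:T. good_ev cT KT A e n (pt n i) W) --> 0 < x --> x <= 1 -->
  (ALL i:T. ALL j:T. norm (fl W (zt n i)-fl W (zt n j)) <= x) --> k < n --> 1/2^k <= x^3 --> x^3 <= 2/2^k -->
  real (card ((%i. \<lfloor>pt n i*2^k\<rfloor>) ` T)) <= C*x powr (- 12*e)"
proof -
 define q where "q = (2::real) powr (- (1/3-e))"
 have q: "0 < q" "q < 1"
 proof -
  have "q < 2 powr 0" unfolding q_def using e by (intro powr_less_mono) auto
  then show "0 < q" "q < 1" by (auto simp: q_def)
 qed
 have qk: "(1/2^k) powr (1/3-e) = q^k" for k by (simp only: q_def half_pow_powr)
 define C1 where "C1 = koebe_C*(A/(1-q))"
 have kc: "0 < koebe_C" by (rule koebe_C_pos)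
 have C1: "0 <= C1" using kc q A by (simp add: C1_def)
 define G where "G = (1+2*C1)*(4*koebe_C*A)"
 have k2: "2 <= koebe_C" using koebe_C_ge .
 have G: "1 <= G"
 proof -
  have "1*1 <= koebe_C*A" using k2 A by (intro mult_mono) auto
  then have "1*1 <= (1+2*C1)*(4*(koebe_C*A))" using C1 by (intro mult_mono) auto
  then show ?thesis by (simp add: G_def)
 qed
 define C where "C = 2*(6*G)^2"
 have "real (card ((%i. \<lfloor>pt n i*2^k\<rfloor>) ` T)) <= C*x powr (- 12*e)"
  if W: "continuous_on {0..1} W" and T: "T <= {..<2^(n-62)}" and good: "!!i. i : T ==> good_ev cT KT A e n (pt n i) W"
   and x: "0 < x" "x <= 1" and diam: "!!i j. i : T ==> j \<in> T ==> norm (fl W (zt n i)-fl W (zt n j)) <= x"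
   and k: "k < n" "1/2^k <= x^3" "x^3 <= 2/2^k" for W n T x k
 proof -
  interpret half_plane_map "cflow W" by (rule cflow_half_plane_map[OF W])
  define l where "l = 1/(2::real)^k"
  have l: "0 < l" "l <= 1" "l <= x^3" "x^3 <= 2*l" using k by (auto simp: l_def)
  have r3: "x^3 = x powr 3" using x by simp
  define c where "c = (%i. \<lfloor>pt n i*2^k\<rfloor>)"
  have fT: "finite T" using T by (rule finite_subset) simp
  define rep where "rep = (%a. SOME i. i : T & c i = a)"
  have rep: "rep a : T" "c (rep a) = a" if "a : c ` T" for a
  proof -
   have "EX i. i : T & c i = a" using that by blast
   from someI_ex[OF this] show "rep a : T" "c (rep a) = a" unfolding rep_def by auto
  qed
  define up where "up = (%i. Complex (pt n i) l)"
  define P where "P = (%a. cflow W (up (rep a)))"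
  let ?A = "1-3*e"
  define R where "R = (1+2*C1)*x powr ?A"
  define h where "h = x powr (1+3*e)/(4*koebe_C*A)"
  have h0: "0 < h" using x kc A by (simp add: h_def)
  have Rh: "R/h = G*x powr (- 6*e)"
  proof -
   have "x powr ?A = x powr (- 6*e)*x powr (1+3*e)" unfolding powr_add[symmetric] by simp
   then show ?thesis by (simp add: R_def h_def G_def)
  qed
  have "1 <= R/h"
  proof -
   have "x powr 0 <= x powr (- 6*e)" using x e by (intro powr_mono') auto
   then have "1*1 <= G*x powr (- 6*e)" using G x by (intro mult_mono) auto
   then show ?thesis by (simp add: Rh)
  qed
  then have hR: "h <= R" using h0 by (simp)
  have upim: "0 < Im (up i)" "Im (up i) = l" for i using l by (auto simp: up_def)
  have near: "norm (fl W (zt n i)-cflow W (up i)) <= C1*x powr ?A" if "i : T" for i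
  proof -
   have "norm (fl W (zt n i)-fl W (up i)) <= koebe_C*(\<Sum>j=k..<n. dlW W (Complex (pt n i) (1/2^j)))"
    unfolding up_def l_def using vertical_chain[OF W, of k n "pt n i"] k by simp
   also have "... <= koebe_C*(\<Sum>j=k..<n. A*q^j)" using good[OF that] kc unfolding good_ev_def qk by (intro mult_left_mono sum_mono) auto
   also have "(\<Sum>j=k..<n. A*q^j) = A*q^k*(\<Sum>i<n-k. q^i)" unfolding sum_distrib_left
    by (intro sum.reindex_bij_witness[of _ "%i. i+k" "%j. j-k"]) (auto simp flip: power_add)
   also have "koebe_C*(A*q^k*(\<Sum>i<n-k. q^i)) <= koebe_C*(A*q^k*(1/(1-q)))" using kc A q by (intro mult_left_mono geometric_bound) auto
   also have "... = C1*l powr (1/3-e)" by (simp add: C1_def l_def qk)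
   also have "... <= C1*(x^3) powr (1/3-e)" using l C1 e by (intro mult_left_mono powr_mono2) auto
   also have "(x^3) powr (1/3-e) = x powr ?A" unfolding r3 powr_powr by (simp)
   finally show ?thesis using fl_continuous(2)[OF W upim(1)] by simp
  qed
  have Pdiam: "norm (P a-P b) <= R" if "a : c ` T" "b : c ` T" for a b
  proof -
   let ?i = "rep a" and ?j = "rep b"
   note t = rep(1)[OF that(1)] rep(1)[OF that(2)]
   have "P a-P b = (fl W (zt n ?i)-fl W (zt n ?j))-(fl W (zt n ?i)-P a)+(fl W (zt n ?j)-P b)" by simp
   then have "norm (P a-P b) <= norm (fl W (zt n ?i)-fl W (zt n ?j))+norm (fl W (zt n ?i)-P a)+norm (fl W (zt n ?j)-P b)"
   proof (rule ssubst)
    show "norm (u-v+w) <= norm u+norm v+norm w" for u v w :: complex using norm_triangle_ineq[of "u-v" w] norm_triangle_ineq4[of u v] by linarith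
   qed
   also have "... <= x+C1*x powr ?A+C1*x powr ?A" using near[OF t(1)] near[OF t(2)] diam[OF t] by (intro add_mono) (auto simp: P_def)
   finally have "norm (P a-P b) <= x+C1*x powr ?A+C1*x powr ?A" .
   moreover have "x <= x powr ?A" using powr_mono'[of "1-3*e" 1 x] x e by simp
   ultimately show ?thesis by (simp add: R_def algebra_simps)
  qed
  \<comment> \<open>Adjacent cells may have arbitrarily close representatives. Distinct cells of
    equal parity are at least two apart, so their representatives are at least l apart and
    \<open>separation\<close> applies.\<close>
  have Psep: "h <= norm (P a-P b)" if ab: "a : c ` T" "b : c ` T" "a ~= b" "a mod 2 = b mod 2" for a b
  proof -
   let ?i = "rep a" and ?j = "rep b"
   note t = rep(1)[OF ab(1)] rep(1)[OF ab(2)]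
   have "2 <= abs (a-b)" using ab(3,4) by presburger
   moreover have "a = \<lfloor>pt n ?i*2^k\<rfloor>" "b = \<lfloor>pt n ?j*2^k\<rfloor>" using rep(2)[OF ab(1)] rep(2)[OF ab(2)] by (simp_all add: c_def)
   ultimately have "1 <= abs (pt n ?i*2^k-pt n ?j*2^k)" by linarith
   then have "1 <= abs (pt n ?i-pt n ?j)*2^k" by (simp add: abs_mult flip: left_diff_distrib)
   then have "l <= abs (pt n ?i-pt n ?j)" by (simp add: l_def divide_le_eq)
   then have d: "Im (up ?i)/2 <= norm (up ?j-up ?i)" using abs_Re_le_cmod[of "up ?j-up ?i"]  by (simp add: up_def)
   have "(x^3/2) powr (1/3+e)/A <= l powr (1/3+e)/A" using l x e A by (intro divide_right_mono powr_mono2) auto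
   also have "... <= dlW W (up ?i)" using good[OF t(1)] k unfolding good_ev_def up_def l_def by blast
   also have "... = dl (up ?i)" by (rule fl_bounds(6)[OF W upim(1)]) (simp add: upim l)
   also have "... <= 2*koebe_C*norm (P b-P a)" unfolding P_def by (rule separation[OF upim(1) upim(1) d])
   finally have s: "(x^3/2) powr (1/3+e)/A <= 2*koebe_C*norm (P a-P b)" by (simp add: norm_minus_commute)
   have "(x^3/2) powr (1/3+e) = x powr (1+3*e)/2 powr (1/3+e)" unfolding r3 powr_divide powr_powr by (simp)
   moreover have "x powr (1+3*e)/2 <= x powr (1+3*e)/2 powr (1/3+e)" using powr_mono[of "1/3+e" 1 "2::real"] e by (intro divide_left_mono) auto
   ultimately have "x powr (1+3*e)/2 <= (x^3/2) powr (1/3+e)" by simp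
   then have "x powr (1+3*e)/2/A <= 2*koebe_C*norm (P a-P b)" using A by (intro order_trans[OF divide_right_mono s]) auto
   then show ?thesis using kc A by (simp add: h_def field_simps)
  qed
  define Q where "Q = (%b. {a : c ` T. a mod 2 = b})"
  have "real (card (Q b)) <= (6 * R/h)^2" for b by (rule packing_bound[OF _ h0 hR, of _ P]) (use fT Pdiam Psep in "auto simp: Q_def")
  then have Qb: "real (card (Q b)) <= (6*G)^2*x powr (- 12*e)" for b
  proof -
   have "(6 * R/h)^2 = (6*G)^2*(x powr (- 6*e))^2"
   proof -
    have "6 * R/h = 6*G*x powr (- 6*e)" using Rh by (metis mult.assoc times_divide_eq_right)
    then show ?thesis by (simp only: power_mult_distrib)
   qed
   also have "(x powr (- 6*e))^2 = x powr (- 12*e)" by (simp add: power2_eq_square flip: powr_add)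
   finally show ?thesis using \<open>real (card (Q b)) <= (6 * R/h)\<^sup>2\<close> by simp
  qed
  have "card (c ` T) <= card (Q 0 \<union> Q 1)" using fT by (intro card_mono) (auto simp: Q_def)
  also have "... <= card (Q 0)+card (Q 1)" by (rule card_Un_le)
  finally have "real (card (c ` T)) <= real (card (Q 0))+real (card (Q 1))" by simp
  also have "... <= C*x powr (- 12*e)" using Qb[of 0] Qb[of 1] by (simp add: C_def)
  finally show ?thesis by (simp add: c_def)
 qed
 moreover have "0 < C" using G by (simp add: C_def)
 ultimately show ?thesis by auto
qed

text \<open>The points fall into at most C w powr (- 12 e) cells of length l of order w^3, and
  inside a cell the kernel is at least (2 l) powr (- (4/9 - 2 e)). The exponents combine to 3 * (4/9
  - 2 e) - 12 e = 4/3 - 18 e.\<close>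

lemma mass_in_small_set:
 assumes e: "0 < e" "e < 1/36" and A: "1 <= A"
 shows "EX C>0. ALL W n T w. continuous_on {0..1} W --> 62 <= n --> T <= {..<2^(n-62)} -->
  (ALL i:T. good_ev cT KT A e n (pt n i) W) --> 0 < w --> w <= 1 --> 4/2^n <= w^3 --> (ALL i:T. ALL j:T. norm (fl W (zt n i)-fl W (zt n j)) <= w) -->
  (\<Sum>i\<in>T. gm A e n i W)^2 <= C*w powr (4/3-18*e) *
   (\<Sum>i\<in>T. \<Sum>j\<in>T. gm A e n i W*gm A e n j W*(abs (pt n i-pt n j)+1/2^n) powr (- (4/9-2*e)))"
proof -
 have e12: "e < 1/12" using e by simp
 obtain C where C: "0 < C" and cells: "!!W n T w k. continuous_on {0..1} W ==> T <= {..<2^(n-62)} ==>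
  (ALL i:T. good_ev cT KT A e n (pt n i) W) ==> 0 < w ==> w <= 1 ==>
  (ALL i:T. ALL j:T. norm (fl W (zt n i)-fl W (zt n j)) <= w) ==> k < n ==> 1/2^k <= w^3 ==> w^3 <= 2/2^k ==>
  real (card ((%i. \<lfloor>pt n i*2^k\<rfloor>) ` T)) <= C*w powr (- 12*e)" using good_cells_bound[OF e(1) e12 A] by blast
 define t where "t = 4/9-2*e"
 have t: "0 < t" "t <= 1" using e by (auto simp: t_def)
 have "(\<Sum>i\<in>T. gm A e n i W)^2 <= (2*C)*w powr (4/3-18*e) *
   (\<Sum>i\<in>T. \<Sum>j\<in>T. gm A e n i W*gm A e n j W*(abs (pt n i-pt n j)+1/2^n) powr (- t))"
  if W: "continuous_on {0..1} W" and n: "62 <= n" and T: "T <= {..<2^(n-62)}" and good: "ALL i:T. good_ev cT KT A e n (pt n i) W"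
   and w: "0 < w" "w <= 1" "4/2^n <= w^3" and diam: "ALL i:T. ALL j:T. norm (fl W (zt n i)-fl W (zt n j)) <= w" for W n T w
 proof -
  define k' where "k' = (%i j. (abs (pt n i-pt n j)+1/2^n) powr (- t))"
  have "0 < w^3" "w^3 <= 1/2^0" using w by (auto intro: power_le_one)
  then obtain m where m: "1/2^Suc m <= w^3" "w^3 <= 1/2^m" using dyadic_scale by blast
  define l where "l = 1/(2::real)^Suc m"
  have l: "0 < l" "l <= w^3" "w^3 <= 2*l" using m by (auto simp: l_def)
  have y: "1/2^n <= l/2" using w(3) l by simp
  have mn: "Suc m < n"
  proof -
   have "(2::real)^Suc (Suc m) <= 2^n" using y by (simp add: l_def field_simps)
   then have "Suc (Suc m) <= n" by (rule power_le_imp_le_exp[rotated]) simp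
   then show ?thesis by simp
  qed
  let ?B = "real (card ((%i. \<lfloor>pt n i*2^Suc m\<rfloor>) ` T))"
  have card: "?B <= C*w powr (- 12*e)" using l by (intro cells[OF W T good w(1,2) diam mn]) (auto simp: l_def)
  have fT: "finite T" using T by (rule finite_subset) simp
  let ?A = "\<Sum>i\<in>T. \<Sum>j\<in>T. gm A e n i W*gm A e n j W*k' i j"
  have "(\<Sum>i\<in>T. gm A e n i W)^2 <= ?B*((2*l) powr t*?A)"
  proof (rule group_square_bound[OF fT gm_nonneg])
   fix i j assume q: "\<lfloor>pt n i*2^Suc m\<rfloor> = \<lfloor>pt n j*2^Suc m\<rfloor>"
   let ?r = "abs (pt n i-pt n j)+1/2^n"
   have r0: "0 < ?r" by (intro add_nonneg_pos) auto
   have "abs (pt n i*2^Suc m-pt n j*2^Suc m) < 1" using q by linarith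
   then have "abs (pt n i-pt n j)*2^Suc m < 1" unfolding left_diff_distrib[symmetric] abs_mult by simp
   then have "abs (pt n i-pt n j) <= l" by (simp add: l_def field_simps)
   then have "?r <= 2*l" using y  by simp
   then have "(2*l) powr (- t) <= ?r powr (- t)" using r0 t by (intro powr_mono2') auto
   then have "(2*l) powr t*(2*l) powr (- t) <= (2*l) powr t*?r powr (- t)" by (intro mult_left_mono) auto
   then show "1 <= (2*l) powr t*k' i j" using l by (simp add: k'_def flip: powr_add)
  qed (auto simp: k'_def)
  also have "... <= (C*w powr (- 12*e))*((2*w powr (3*t))*?A)"
  proof (intro mult_mono card order_refl)
   have "(2*l) powr t <= (2*w^3) powr t" using l t by (intro powr_mono2) auto
   also have "... = 2 powr t*w powr (3*t)" using w by (simp add: powr_mult powr_powr flip: powr_numeral)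
   also have "... <= 2 powr 1*w powr (3*t)" using t by (intro mult_right_mono powr_mono) auto
   finally show "(2*l) powr t <= 2*w powr (3*t)" by simp
  qed (use C in "auto simp: k'_def gm_nonneg intro!: sum_nonneg mult_nonneg_nonneg")
  also have "... = (2*C)*(w powr (- 12*e)*w powr (3*t))*?A" by simp
  also have "w powr (- 12*e)*w powr (3*t) = w powr (4/3-18*e)"
   unfolding powr_add[symmetric] by (rule arg_cong[where f = "(powr) w"]) (simp add: t_def)
  finally show ?thesis unfolding k'_def .
 qed
 then show ?thesis using C unfolding t_def by (intro exI[of _ "2*C"] conjI allI impI) auto
qed

text \<open>A cheap cover is tested directly against the discrete measure of one fine level, so no
  limit measure has to be built; compactness makes the cover finite and open, and hence effective at
  all fine levels.\<close>

lemma positive_measure_of_energy: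
 assumes W: "continuous_on {0..1} W" and e: "0 < e" "e < 1/36" and A: "1 <= A" and m0: "0 < m0" and E0: "0 < E0"
  and inf: "\<exists>\<^sub>\<infinity>n. 62 <= n & m0 <= Sn A e n W & En A e (4/9-2*e) n W <= E0"
 shows "hausdorff_measure (4/3-18*e) (frontier (cflow W ` \<H>) \<inter> {w. cT <= Im w}) ~= 0"
proof
 define s where "s = 4/3-18*e"
 have s: "0 < s" using e by (simp add: s_def)
 interpret half_plane_map "cflow W" by (rule cflow_half_plane_map[OF W])
 obtain C where C: "0 < C" and small0: "!!W n T v. continuous_on {0..1} W ==> 62 <= n ==> T <= {..<2^(n-62)} ==>
  (ALL i:T. good_ev cT KT A e n (pt n i) W) ==> 0 < v ==> v <= 1 ==> 4/2^n <= v^3 ==> (ALL i:T. ALL j:T. norm (fl W (zt n i)-fl W (zt n j)) <= v) ==>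
  (\<Sum>i\<in>T. gm A e n i W)^2 <= C * v powr (4/3-18*e) *
   (\<Sum>i\<in>T. \<Sum>j\<in>T. gm A e n i W*gm A e n j W*(abs (pt n i-pt n j)+1/2^n) powr (- (4/9-2*e)))" using mass_in_small_set[OF e A] by blast
 note small = small0[OF W, folded s_def]
 define K where "K = frontier (cflow W ` \<H>) \<inter> {w. cT <= Im w} \<inter> cball 0 KT"
 assume "hausdorff_measure (4/3-18*e) (frontier (cflow W ` \<H>) \<inter> {w. cT <= Im w}) = 0"
 then have "hausdorff_measure s (frontier (cflow W ` \<H>) \<inter> {w. cT <= Im w}) = 0" by (simp only: s_def)
 then have null: "hausdorff_measure s K = 0" by (rule hausdorff_measure_null_subset) (auto simp: K_def)
 have "closed (frontier (cflow W ` \<H>) \<inter> {w. cT <= Im w})" by (intro closed_Int closed_halfspace_Im_ge) simp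
 then have K: "compact K" unfolding K_def by (intro closed_Int_compact) auto
 \<comment> \<open>With this cost the final estimate reads m0/2 for the cover and m0/4 for the
   energy, less than m0 together.\<close>
 define h where "h = m0^2/(2*C*E0)"
 have h: "0 < h" using m0 C E0 by (simp add: h_def)
 obtain F :: "nat set" and V v where F: "finite F" "K <= (\<Union>i\<in>F. V i)" "!!i. i : F ==> open (V i)" "!!i. i : F ==> bounded (V i)"
  and v: "!!i. i : F ==> 0 < v i" "!!i. i : F ==> v i <= 1" "!!i x y. i : F ==> x \<in> V i ==> y \<in> V i ==> dist x y <= v i"
   "(\<Sum>i\<in>F. v i powr s) <= h"
  apply (rule hausdorff_null_compact_open_cover[OF null K s zero_less_one h])
  subgoal premises p by (rule p(1)[OF p(2-9)])
  done
 \<comment> \<open>Otherwise images outside the cover at ever finer levels would accumulate at a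
   point of K, by \<open>limit_in_frontier\<close>, and this point lies in an open set of the
   cover.\<close>
 have "\<forall>\<^sub>F n in sequentially. ALL i<2^(n-62). good_ev cT KT A e n (pt n i) W --> 62 <= n --> fl W (zt n i) : (\<Union>j\<in>F. V j)"
 proof (rule ccontr)
  define bad where "bad = (%n z. 62 <= n & (EX i<2^(n-62). good_ev cT KT A e n (pt n i) W & z = zt n i & fl W (zt n i) ~: (\<Union>j\<in>F. V j)))"
  assume "\<not> ?thesis"
  then have "ALL N. EX n>=N. EX z. bad n z" unfolding eventually_sequentially bad_def by simp blast
  then have "ALL N. EX nz. fst nz >= N & bad (fst nz) (snd nz)" by (metis fst_conv snd_conv)
  then obtain g where g: "!!N. fst (g N) >= N" "!!N. bad (fst (g N)) (snd (g N))" by metis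
  define z where "z = (%N. snd (g N))"
  have zp: "Im (z N) = 1/2^fst (g N)" "cT <= Im (fl W (z N))" "norm (fl W (z N)) <= KT" "fl W (z N) ~: (\<Union>j\<in>F. V j)" for N
   using g(2)[of N] unfolding bad_def z_def good_ev_def base_ev_def by auto
  have z0: "0 < Im (z N)" for N by (simp add: zp)
  have "compact ({w. cT <= Im w} \<inter> cball 0 KT)" by (intro closed_Int_compact closed_halfspace_Im_ge) auto
  then have sc: "seq_compact ({w. cT <= Im w} \<inter> cball 0 KT)" by (rule compact_imp_seq_compact)
  have "ALL N. fl W (z N) : {w. cT <= Im w} \<inter> cball 0 KT" using zp by auto
  then obtain w r where w: "w : {w. cT <= Im w} \<inter> cball 0 KT" "strict_mono r" "((%N. fl W (z N)) \<circ> r) \<longlonglongrightarrow> w"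
   by (rule seq_compactE[OF sc])
  have im0: "(%N. Im (z N)) \<longlonglongrightarrow> 0"
  proof (rule tendsto_sandwich[OF _ _ tendsto_const half_pow_tendsto_0])
   show "\<forall>\<^sub>F N in sequentially. 0 <= Im (z N)" using z0 by (simp add: less_imp_le)
   have "Im (z N) <= 1/2^N" for N unfolding zp(1) using g(1)[of N] by (intro divide_left_mono power_increasing) auto
   then show "\<forall>\<^sub>F N in sequentially. Im (z N) <= 1/2^N" by simp
  qed
  have flc: "fl W (z N) = cflow W (z N)" for N by (rule fl_continuous(2)[OF W z0])
  have "w : frontier (cflow W ` \<H>)"
  proof (rule limit_in_frontier)
   show "0 < Im ((z \<circ> r) N)" for N using z0 by simp
   show "(%N. Im ((z \<circ> r) N)) \<longlonglongrightarrow> 0" using LIMSEQ_subseq_LIMSEQ[OF im0 w(2)] by (simp add: o_def)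
   show "(%N. cflow W ((z \<circ> r) N)) \<longlonglongrightarrow> w" using w(3) by (simp add: o_def flc)
  qed
  then have "w : K" using w(1) by (auto simp: K_def)
  then obtain j where j: "j : F" "w : V j" using F(2) by blast
  have "\<forall>\<^sub>F N in sequentially. ((%N. fl W (z N)) \<circ> r) N : V j" using topological_tendstoD[OF w(3) F(3)[OF j(1)] j(2)] .
  then obtain N where "fl W (z (r N)) : V j" by (auto simp: eventually_sequentially)
  then show False using zp(4)[of "r N"] j(1) by blast
 qed
 moreover have "\<forall>\<^sub>F n in sequentially. ALL j:F. 4/2^n <= v j^3"
 proof (subst eventually_ball_finite_distrib[OF F(1)], rule ballI)
  fix j assume j: "j : F"
  have "(%n. 4*(1/(2::real)^n)) \<longlonglongrightarrow> 4*0" by (intro tendsto_mult tendsto_const half_pow_tendsto_0)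
  then have "\<forall>\<^sub>F n in sequentially. 4*(1/(2::real)^n) < v j^3" by (rule order_tendstoD(2)) (use v(1)[OF j] in simp)
  then show "\<forall>\<^sub>F n in sequentially. 4/2^n <= v j^3" by eventually_elim simp
 qed
 ultimately have "\<forall>\<^sub>F n in sequentially. (ALL i<2^(n-62). good_ev cT KT A e n (pt n i) W --> 62 <= n --> fl W (zt n i) : (\<Union>j\<in>F. V j)) & (ALL j:F. 4/2^n <= v j^3)"
  by (rule eventually_conj)
 then obtain N where N: "!!n. N <= n ==> (ALL i<2^(n-62). good_ev cT KT A e n (pt n i) W --> 62 <= n --> fl W (zt n i) : (\<Union>j\<in>F. V j)) & (ALL j:F. 4/2^n <= v j^3)"
  unfolding eventually_sequentially by blast
 obtain n where nN: "N < n" and n: "62 <= n" "m0 <= Sn A e n W" "En A e (4/9-2*e) n W <= E0" using inf unfolding INFM_nat by blast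
 have cov: "fl W (zt n i) : (\<Union>j\<in>F. V j)" if "i < 2^(n-62)" "good_ev cT KT A e n (pt n i) W" for i
  using N[OF less_imp_le[OF nN]] that n(1) by blast
 have sc: "4/2^n <= v j^3" if "j : F" for j using N[OF less_imp_le[OF nN]] that by blast
 define T where "T = {i : {..<2^(n-62)}. good_ev cT KT A e n (pt n i) W}"
 have fT: "finite T" by (simp add: T_def)
 define f where "f = (%i. SOME j. j : F & fl W (zt n i) : V j)"
 have f: "f i : F" "fl W (zt n i) : V (f i)" if "i : T" for i
 proof -
  have "EX j. j : F & fl W (zt n i) : V j" using cov[of i] that by (auto simp: T_def)
  from someI_ex[OF this] show "f i : F" "fl W (zt n i) : V (f i)" unfolding f_def by auto
 qed
 define k where "k = (%i j. gm A e n i W*gm A e n j W*(abs (pt n i-pt n j)+1/2^n) powr (- (4/9-2*e)))"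
 have k0: "0 <= k i j" for i j by (simp add: k_def gm_nonneg)
 define Tj where "Tj = (%j. {i : T. f i = j})"
 define a where "a = (%j. \<Sum>i\<in>Tj j. gm A e n i W)"
 define b where "b = (%j. \<Sum>i\<in>Tj j. \<Sum>i'\<in>Tj j. k i i')"
 have b0: "0 <= b j" for j unfolding b_def by (intro sum_nonneg k0)
 have ab: "(a j)^2 <= C * v j powr s*b j" if j: "j : F" for j unfolding a_def b_def k_def
 proof (rule small[OF n(1) _ _ v(1)[OF j] v(2)[OF j] sc[OF j]])
  show "Tj j <= {..<2^(n-62)}" "ALL i:Tj j. good_ev cT KT A e n (pt n i) W" by (auto simp: Tj_def T_def)
  show "ALL i:Tj j. ALL i':Tj j. norm (fl W (zt n i)-fl W (zt n i')) <= v j"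
  proof (intro ballI)
   fix i i' assume "i : Tj j" "i' : Tj j"
   then have "fl W (zt n i) : V j" "fl W (zt n i') : V j" using f(2)[of i] f(2)[of i'] by (auto simp: Tj_def)
   then show "norm (fl W (zt n i)-fl W (zt n i')) <= v j" using v(3)[OF j] by (simp only: dist_norm[symmetric])
  qed
 qed
 have "Sn A e n W = (\<Sum>i\<in>T. gm A e n i W)" unfolding Sn_def T_def by (rule sum.mono_neutral_right) (auto simp: gm_def)
 also have "... = (\<Sum>j\<in>F. a j)" unfolding a_def Tj_def by (rule sum.group[symmetric, OF fT F(1)]) (use f in auto)
 finally have S: "Sn A e n W = (\<Sum>j\<in>F. a j)" .
 have "(\<Sum>j\<in>F. b j) <= (\<Sum>j\<in>F. \<Sum>i\<in>Tj j. \<Sum>i'<2^(n-62). k i i')"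
  unfolding b_def by (intro sum_mono sum_mono2 k0) (auto simp: Tj_def T_def)
 also have "... = (\<Sum>i\<in>T. \<Sum>i'<2^(n-62). k i i')" unfolding Tj_def by (rule sum.group[OF fT F(1)]) (use f in auto)
 also have "... <= En A e (4/9-2*e) n W"
 proof -
  have "En A e (4/9-2*e) n W = (\<Sum>i<2^(n-62). \<Sum>i'<2^(n-62). k i i')" by (simp only: En_def k_def)
  then show ?thesis by (simp only:, intro sum_mono2) (auto simp: T_def intro!: sum_nonneg k0)
 qed
 finally have bE: "(\<Sum>j\<in>F. b j) <= E0" using n(3) by simp
 have "(\<Sum>j\<in>F. a j) <= (\<Sum>j\<in>F. (m0/(2*h)) * v j powr s+(h/(2*m0))*C*b j)"
 proof (rule sum_mono)
  fix j assume j: "j : F"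
  define P where "P = v j powr s"
  have P: "0 < P" using v(1)[OF j] by (simp add: P_def)
  \<comment> \<open>Weight for the inequality 2 x y <= x^2 + y^2 applied to a j and u * P.\<close>
  define u where "u = m0/h"
  have u: "0 < u" using m0 h by (simp add: u_def)
  have "0 <= (a j-u*P)^2" by simp
  then have "2*u*P*a j <= (a j)^2+u^2*P^2" by (simp add: power2_eq_square algebra_simps)
  also have "... <= C*P*b j+u^2*P^2" using ab[OF j] by (simp add: P_def)
  finally have "a j*(2*u*P) <= (u/2*P+1/(2*u)*C*b j)*(2*u*P)" using u by (simp add: power2_eq_square algebra_simps)
  then have "a j <= u/2*P+1/(2*u)*C*b j" by (rule mult_right_le_imp_le) (use u P in simp)
  then show "a j <= (m0/(2*h)) * v j powr s+(h/(2*m0))*C*b j" by (simp add: u_def P_def mult.commute)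
 qed
 also have "... = (m0/(2*h))*(\<Sum>j\<in>F. v j powr s)+(h/(2*m0))*C*(\<Sum>j\<in>F. b j)" by (simp add: sum.distrib sum_distrib_left)
 also have "... <= (m0/(2*h))*h+(h/(2*m0))*C*E0" using v(4) bE m0 h C by (intro add_mono mult_left_mono) auto
 also have "... = m0/2+m0/4" using m0 h C E0 by (simp add: h_def power2_eq_square)
 also have "... < m0" using m0 by simp
 finally show False using S n(2) by simp
qed

section \<open>Scaling and germ events\<close>

text \<open>The flow during the first time t is a rescaled copy of the flow of V, and the remaining
  flow is bi-Lipschitz above every positive height. So frontier of positive measure produced by an
  arbitrarily short initial piece of W persists at time 1.\<close>

lemma cflow_start_transfer:
 fixes W :: "real => real"
 assumes W: "continuous_on {0..1} W" and t: "0 < t" "t <= 1" and c: "0 < c" and s: "0 < s"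
 defines "V \<equiv> (%s. W (t * s)/sqrt t)"
 assumes null: "hausdorff_measure s (frontier (cflow W ` \<H>) \<inter> \<H>) = 0"
 shows "hausdorff_measure s (frontier (cflow V ` \<H>) \<inter> {u. c <= Im u}) = 0"
proof -
 have in_t: "t * s : {0..1}" if "s : {0..1}" for s using that t mult_le_one[of t s] by auto
 have "continuous_on {0..1} (%s. W (t * s))" by (rule continuous_on_compose2[OF W]) (use in_t in "auto simp del: atLeastAtMost_iff")
 then have V: "continuous_on {0..1} V" unfolding V_def using t by (intro continuous_intros) auto
 interpret v: half_plane_map "cflow V" by (rule cflow_half_plane_map[OF V])
 have Wt: "continuous_on {0..t} W" "continuous_on {t..1} W" using t by (auto intro: continuous_on_subset[OF W])
 have st: "0 < sqrt t" "sqrt t ~= 0" using t by auto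
 define g where "g = rev_flow W t 1"
 let ?A = "of_real (sqrt t)"
 define a where "a = (%u. ?A*u+complex_of_real (W t))"
 define G where "G = (%u. g (a u) - of_real (W 1))"
 have a_Im: "Im (a u) = sqrt t*Im u" for u by (simp add: a_def)
 have comp: "cflow W (?A*z) = G (cflow V z)" if z: "0 < Im z" for z
 proof -
  let ?z = "?A*z+complex_of_real (W 0)"
  have V0: "?z = ?A*(z + of_real (V 0))" using st by (simp add: V_def distrib_left)
  have "rev_flow W 0 t ?z = ?A*rev_flow V 0 1 (z + of_real (V 0))" unfolding V0 V_def by (rule rev_flow_scale[OF Wt(1) t(1)]) (use z in simp)
  also have "... = a (cflow V z)" using st by (simp add: a_def cflow_def V_def right_diff_distrib)
  finally have "rev_flow W 0 1 ?z = g (a (cflow V z))" using rev_flow_comp[OF W, of t ?z] t z st by (simp add: g_def)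
  then show ?thesis by (simp add: cflow_def G_def)
 qed
 let ?B = "cflow V ` \<H>"
 have image: "cflow W ` \<H> = G ` ?B"
 proof (intro equalityI subsetI)
  fix x assume "x : cflow W ` \<H>"
  then obtain z where z: "0 < Im z" "x = cflow W z" by (auto simp: upper_half_plane_def)
  define w where "w = z/?A"
  have w: "z = ?A*w" "0 < Im w" using z st by (auto simp: w_def)
  then have "x = G (cflow V w)" using comp[of w] z by simp
  then show "x : G ` ?B" using w by (auto simp: upper_half_plane_def)
 next
  fix x assume "x : G ` ?B"
  then obtain w where w: "0 < Im w" "x = G (cflow V w)" by (auto simp: upper_half_plane_def)
  then have "x = cflow W (?A*w)" using comp by simp
  then show "x : cflow W ` \<H>" using w st by (auto simp: upper_half_plane_def)
 qed
 have aa: "norm (a x-a y) = sqrt t*norm (x-y)" for x y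
 proof -
  have "a x-a y = ?A*(x-y)" by (simp add: a_def algebra_simps)
  then show ?thesis using st by (simp add: norm_mult)
 qed
 have lip: "EX L>0. ALL x y. b <= Im x --> b <= Im y --> dist x y <= L*dist (G x) (G y) & dist (G x) (G y) <= L*dist x y" if b: "0 < b" for b
 proof -
  define E where "E = exp (2*(1-t)/(sqrt t*b)^2)"
  have E: "1 <= E" using t by (simp add: E_def)
  define L where "L = E/sqrt t+E * sqrt t"
  have L: "0 < L" "E/sqrt t <= L" "E * sqrt t <= L" using E st by (auto simp: L_def add_pos_pos)
  have "dist x y <= L*dist (G x) (G y) & dist (G x) (G y) <= L*dist x y" if xy: "b <= Im x" "b <= Im y" for x y
  proof
   have i: "sqrt t*b <= Im (a x)" "sqrt t*b <= Im (a y)" "0 < sqrt t*b" using xy b st by (auto simp: a_Im)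
   have G: "dist (G x) (G y) = norm (g (a x)-g (a y))" by (simp add: G_def dist_norm)
   have "sqrt t*dist x y <= E*dist (G x) (G y)" using rev_flow_diff_bounds(1)[OF Wt(2) t(2) i] unfolding G unfolding aa g_def E_def dist_norm .
   then have "dist x y <= E/sqrt t*dist (G x) (G y)" using st by (simp add: field_simps)
   also have "... <= L*dist (G x) (G y)" using L by (intro mult_right_mono) auto
   finally show "dist x y <= L*dist (G x) (G y)" .
   have "dist (G x) (G y) <= E * sqrt t*dist x y"
    using rev_flow_diff_bounds(2)[OF Wt(2) t(2) i] unfolding G unfolding aa g_def E_def dist_norm by (simp)
   also have "... <= L*dist x y" using L by (intro mult_right_mono) auto
   finally show "dist (G x) (G y) <= L*dist x y" .
  qed
  then show ?thesis using L(1) by blast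
 qed
 have GIm: "0 < Im (G u)" if "0 < Im u" for u using that rev_flow_Im[OF Wt(2), of "a u"] t by (simp add: a_Im g_def G_def)
 define A where "A = frontier ?B \<inter> {u. c <= Im u}"
 let ?C = "cflow W ` \<H>"
 have "G ` A <= frontier ?C \<inter> \<H>"
 proof
  fix x assume "x : G ` A"
  then obtain u where u: "u : A" "x = G u" by auto
  then have cl: "u : closure ?B" "u ~: cflow V ` \<H>" "c <= Im u" using v.open_image by (auto simp: A_def frontier_def interior_open)
  obtain L where L: "0 < L" "!!x y. c/2 <= Im x ==> c/2 <= Im y ==> dist x y <= L*dist (G x) (G y) & dist (G x) (G y) <= L*dist x y"
   using lip[of "c/2"] c by auto
  have "x : closure ?C" unfolding closure_approachable
  proof (intro allI impI)
   fix e :: real assume e: "0 < e"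
   define e' where "e' = min (c/2) (e/L)"
   have e': "0 < e'" using e c L by (simp add: e'_def)
   then obtain y where y: "y : cflow V ` \<H>" "dist y u < e'" using cl(1) unfolding closure_approachable by blast
   have "abs (Im y-Im u) < c/2" using y(2) abs_Im_le_cmod[of "y-u"] by (simp add: e'_def dist_norm)
   then have "c/2 <= Im y" "c/2 <= Im u" using cl(3)  by linarith+
   then have "dist (G y) x <= L*dist y u" using L(2) u(2) by blast
   also have "... < L*(e/L)" using y(2) L(1) by (intro mult_strict_left_mono) (auto simp: e'_def)
   finally have "dist (G y) x < e" using L(1) by simp
   then show "EX y:cflow W ` \<H>. dist y x < e" using y(1) unfolding image by blast
  qed
  moreover have "x ~: cflow W ` \<H>"
  proof
   assume "x : cflow W ` \<H>"
   then obtain y where y: "y : cflow V ` \<H>" "G u = G y" unfolding image u(2) by blast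
   have yp: "0 < Im y" using y(1) v.into by (auto simp: upper_half_plane_def)
   define b where "b = min c (Im y)"
   have b: "0 < b" "b <= Im u" "b <= Im y" using c yp cl(3) by (auto simp: b_def)
   then obtain L2 where "dist u y <= L2*dist (G u) (G y)" using lip[OF b(1)] by blast
   then have "u = y" using y(2) by simp
   then show False using cl(2) y(1) by simp
  qed
  ultimately have "x : frontier ?C" using interior_subset by (auto simp: frontier_def)
  moreover have "0 < Im x" unfolding u(2) using cl(3) c by (intro GIm) simp
  ultimately show "x : frontier ?C \<inter> \<H>" by (simp add: upper_half_plane_def)
 qed
 with null have n: "hausdorff_measure s (G ` A) = 0" by (rule hausdorff_measure_null_subset)
 obtain L where L: "0 < L" "!!x y. c <= Im x ==> c <= Im y ==> dist x y <= L*dist (G x) (G y)" using lip[OF c] by blast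
 show ?thesis unfolding A_def[symmetric] by (rule hausdorff_measure_null_expanding[OF n L(1) _ s]) (use L(2) in "auto simp: A_def")
qed

section \<open>Rescaled initial pieces and independence of the germ at time 0\<close>

definition scW :: "nat => (real => real) => real => real" where
 "scW m W s = W (1/2^m * s)/sqrt (1/2^m)"

lemma dyadic_increment:
 assumes "p <= q" "q <= 2^n"
 shows "W (real q/2^n)-W (real p/2^n) = sqrt (6/2^n)*(\<Sum>l=p..<q. nincr W n l)"
proof -
 have "(\<Sum>l=p..<q. nincr W n l) = (\<Sum>l=p..<q. incr W (2^n) l/sqrt (6/2^n))" using assms by (intro sum.cong refl) (auto simp: nincr_def)
 also have "... = (\<Sum>l=p..<q. W (real (Suc l)/2^n)-W (real l/2^n))/sqrt (6/2^n)" by (simp add: sum_divide_distrib incr_def)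
 also have "(\<Sum>l=p..<q. W (real (Suc l)/2^n)-W (real l/2^n)) = W (real q/2^n)-W (real p/2^n)"
  using sum_Suc_diff'[OF assms(1), of "%l. W (real l/2^n)"] by simp
 finally show ?thesis by simp
qed

lemma nincr_scW: "nincr (scW m W) j = restrict (nincr W (m+j)) {..<2^j}"
proof
 fix l
 have "incr (scW m W) (2^j) l/sqrt (6/2^j) = incr W (2^(m+j)) l/sqrt (6/2^(m+j))"
  by (simp add: incr_def scW_def power_add real_sqrt_divide real_sqrt_mult field_simps)
 moreover have "l < 2^(m+j)" if "l < 2^j" by (rule less_le_trans[OF that power_increasing]) auto
 ultimately show "nincr (scW m W) j l = restrict (nincr W (m+j)) {..<2^j} l" by (auto simp: nincr_def)
qed

lemma product_prob_space_stdn: "product_prob_space (%_ :: 'i. stdn)"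
proof -
 interpret prob_space stdn by (rule prob_space_stdn)
 show ?thesis by unfold_locales
qed

lemma continuous_scW:
 assumes "continuous_on {0..1} W"
 shows "continuous_on {0..1} (scW m W)"
proof -
 have "continuous_on {0..1} (%s. W (1/2^m * s))"
  by (rule continuous_on_compose2[OF assms]) (auto intro!: continuous_intros simp del: atLeastAtMost_iff)
 then show ?thesis unfolding scW_def[abs_def] by (intro continuous_intros) auto
qed

lemma rbm_nincr:
 assumes "rbm M W"
 shows "(%w. nincr (W w) j) : measurable M (PiM {..<2^j} (%_. borel))"
  "distr M (PiM {..<2^j} (%_. borel)) (%w. nincr (W w) j) = stdnP (2^j)" using assms by (auto simp: rbm_def intro!: measurable_nincr)

lemma rbm_scW:
 assumes M: "rbm M W"
 shows "rbm M (%w. scW m (W w))"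
proof -
 interpret P: product_prob_space "%_ :: nat. stdn" by (rule product_prob_space_stdn)
 have "(%w. scW m (W w) t) : borel_measurable M" if "t : {0..1}" for t
 proof -
  have "1/2^m*t : {0..1}" using that mult_le_one[of "1/2^m" t] by (auto)
  from rbmD(2)[OF M this] show ?thesis unfolding scW_def by (rule borel_measurable_divide) simp
 qed
 moreover have "AE w in M. continuous_on {0..1} (scW m (W w))" using rbmD(3)[OF M] by eventually_elim (rule continuous_scW)
 moreover have "distr M (PiM {..<2^j} (%_. borel)) (%w. nincr (scW m (W w)) j) = stdnP (2^j)" for j
 proof -
  have sub: "{..<(2::nat)^j} <= {..<2^(m+j)}" by simp
  have "distr M (PiM {..<2^j} (%_. borel)) (%w. nincr (scW m (W w)) j)
   = distr (distr M (PiM {..<2^(m+j)} (%_. borel)) (%w. nincr (W w) (m+j))) (PiM {..<2^j} (%_. borel)) (%f. restrict f {..<2^j})" unfolding nincr_scW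
   by (subst distr_distr[OF measurable_restrict_subset[OF sub] rbm_nincr(1)[OF M]]) (simp add: o_def)
  also have "... = distr (stdnP (2^(m+j))) (PiM {..<2^j} (%_. stdn)) (%f. restrict f {..<2^j})"
   unfolding rbm_nincr(2)[OF M] by (rule distr_cong) (auto simp: sets_stdnP)
  also have "... = stdnP (2^j)" by (rule P.distr_restrict[OF sub, symmetric]) simp
  finally show ?thesis .
 qed
 ultimately show ?thesis using rbmD(1)[OF M] by (simp add: rbm_def)
qed

lemma nincr_component:
 assumes M: "rbm M W" and l: "l < 2^n"
 shows "(%w. nincr (W w) n l) : borel_measurable M" "distr M borel (%w. nincr (W w) n l) = stdn"
proof -
 interpret P: product_prob_space "%_ :: nat. stdn" "{..<2^n}" by (rule product_prob_space_stdn)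
 have c: "(%f. f l) : measurable (PiM {..<2^n} (%_. borel)) (borel :: real measure)" using l by (intro measurable_component_singleton) auto
 let ?A = "%w. nincr (W w) n l"
 show "?A : borel_measurable M" using measurable_compose[OF rbm_nincr(1)[OF M] c] .
 have "distr M borel ?A = distr (distr M (PiM {..<2^n} (%_. borel)) (%w. nincr (W w) n)) borel (%f. f l)"
  by (subst distr_distr[OF c rbm_nincr(1)[OF M]]) (simp add: o_def)
 also have "... = distr (stdnP (2^n)) stdn (%f. f l)" unfolding rbm_nincr(2)[OF M] by (rule distr_cong) auto
 also have "... = stdn" using l by (intro P.PiM_component) auto
 finally show "distr M borel ?A = stdn" .
qed

lemma nincr_indep:
 assumes M: "rbm M W"
 shows "prob_space.indep_vars M (%_. borel) (%l w. nincr (W w) n l) {..<2^n}"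
proof -
 interpret prob_space M by (rule rbmD(1)[OF M])
 have "(%w. \<lambda>l\<in>{..<2^n}. nincr (W w) n l) = (%w. nincr (W w) n)" by (intro ext) (simp add: nincr_def)
 then have "distr M (PiM {..<2^n} (%_. borel)) (%w. \<lambda>l\<in>{..<2^n}. nincr (W w) n l) = PiM {..<2^n} (%l. distr M borel (%w. nincr (W w) n l))"
  using rbm_nincr(2)[OF M, of n] by (simp, intro PiM_cong refl nincr_component(2)[OF M, symmetric]) simp
 then show ?thesis by (subst indep_vars_iff_distr_eq_PiM') (auto simp: lessThan_empty_iff intro!: nincr_component(1)[OF M])
qed

lemma fl_cong_nincr:
 assumes "!!j. nincr V j = nincr V' j"
 shows "fl V = fl V'" "qf V = qf V'" by (auto simp: eulW_nincr[symmetric] assms fl_def[abs_def] qf_def[abs_def])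

lemma Sn_En_cong_nincr:
 assumes "!!j. nincr V j = nincr V' j"
 shows "Sn A e n V = Sn A e n V'" "En A e t n V = En A e t n V'"
 unfolding Sn_def En_def gm_def good_ev_def base_ev_def ms_def dlW_def fl_cong_nincr[OF assms] by (rule refl)+

text \<open>The quantities \<open>Sn\<close> and \<open>En\<close> depend only on dyadic increments, hence are measurable as soon as these are.\<close>

lemma measurable_Sn_En_nincr:
 assumes V: "!!j. (%w. nincr (V w) j) : measurable N (PiM {..<2^j} (%_. borel))"
 shows "(%w. Sn A e n (V w)) : borel_measurable N" "(%w. En A e t n (V w)) : borel_measurable N"
proof -
 \<comment> \<open>A process measurable at every time: V - V 0 at dyadic times, hence with the same
   dyadic increments, and 0 elsewhere.\<close>
 define U where "U = (%w t. if EX j i. i <= 2^j & t = real i/2^j then V w t-V w 0 else 0)"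
 have Ud: "U w (real i/2^j) = V w (real i/2^j)-V w 0" if "i <= 2^j" for w i j using that unfolding U_def by auto
 let ?A = "borel_measurable N"
 have Um: "(%w. U w t) : ?A" for t
 proof (cases "EX j i. i <= 2^j & t = real i/2^j")
  case True
  then obtain j i where i: "i <= 2^j" "t = real i/2^j" by auto
  have "(%w. nincr (V w) j l) : ?A" if "l < i" for l using measurable_compose[OF V[of j] measurable_component_singleton[of l]] that i(1) by auto
  then have "(%w. sqrt (6/2^j)*(\<Sum>l=0..<i. nincr (V w) j l)) : ?A" by simp
  moreover have "U w t = sqrt (6/2^j)*(\<Sum>l=0..<i. nincr (V w) j l)" for w using Ud[OF i(1), of w] dyadic_increment[of 0 i j "V w"] i by simp
  ultimately show ?thesis by simp
 next
  case False
  then have "U w t = 0" for w unfolding U_def by (rule if_not_P)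
  then show ?thesis by simp
 qed
 have eq: "nincr (U w) j = nincr (V w) j" for w j
 proof
  fix l
  have "U w (real (Suc l)/2^j)-U w (real l/2^j) = V w (real (Suc l)/2^j)-V w (real l/2^j)" if "l < 2^j"
   using Ud[of "Suc l" j w] Ud[of l j w] that by simp
  then show "nincr (U w) j l = nincr (V w) j l" by (auto simp: nincr_def incr_def)
 qed
 show "(%w. Sn A e n (V w)) : ?A" "(%w. En A e t n (V w)) : ?A"
  using measurable_Sn_En[of U N, OF Um, of A e n] measurable_Sn_En(2)[of U N, OF Um, of A e t n] Sn_En_cong_nincr[of "U _" "V _", OF eq] by simp_all
qed

definition dyadic_cylinders :: "'a measure => ('a => real => real) => 'a set set" where
 "dyadic_cylinders M V = {(%w. nincr (V w) j) -` B \<inter> space M | j B. B : sets (PiM {..<2^j} (%_. borel))}"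

text \<open>Increments of a coarse level are normalised block sums of those of a finer one, so two
  cylinders can be expressed at a common level.\<close>

lemma Int_stable_dyadic_cylinders: "Int_stable (dyadic_cylinders M V)"
proof (rule Int_stableI)
 fix a b let ?C = "%_. borel" assume "a : dyadic_cylinders M V" "b : dyadic_cylinders M V"
 then obtain j A k B where a: "a = (%w. nincr (V w) j) -` A \<inter> space M" "A : sets (PiM {..<2^j} ?C)"
  and b: "b = (%w. nincr (V w) k) -` B \<inter> space M" "B : sets (PiM {..<2^k} ?C)" unfolding dyadic_cylinders_def by blast
 define n where "n = max j k"
 let ?A = "PiM {..<2^n} ?C"
 let ?B = "%w. nincr (V w) n"
 have lift: "EX A'. A' : sets (PiM {..<2^n} (%_. borel :: real measure)) & (%w. nincr (V w) j) -` A \<inter> space M = ?B -` A' \<inter> space M"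
  if A: "A : sets (PiM {..<2^j} ?C)" and jn: "j <= n" for j and A :: "(nat => real) set"
 proof -
  define c where "c = (%f. \<lambda>k\<in>{..<(2::nat)^j}. sqrt (6/2^n)*(\<Sum>l=k*2^(n-j)..<Suc k*2^(n-j). f l)/sqrt (6/2^j) :: real)"
  have n2: "(2::nat)^n = 2^j*2^(n-j)" "(2::real)^n = 2^j*2^(n-j)" using jn by (simp_all flip: power_add)
  have le: "Suc k*2^(n-j) <= 2^n" if "k < 2^j" for k unfolding n2 using that by (intro mult_le_mono1) simp
  have cm: "c : measurable ?A (PiM {..<2^j} ?C)" unfolding c_def
   by (intro measurable_restrict borel_measurable_divide borel_measurable_times borel_measurable_const borel_measurable_sum measurable_component_singleton)
     (use le in "auto dest: less_le_trans")
  have cn: "nincr (V w) j = c (nincr (V w) n)" for w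
  proof
   fix k
   have "nincr (V w) j k = c (nincr (V w) n) k" if k: "k < 2^j"
   proof -
    have p: "real (i*2^(n-j))/2^n = real i/2^j" for i by (simp add: n2)
    have "V w (real (Suc k)/2^j)-V w (real k/2^j) = sqrt (6/2^n)*(\<Sum>l=k*2^(n-j)..<Suc k*2^(n-j). nincr (V w) n l)"
     using dyadic_increment[OF _ le[OF k], of "k*2^(n-j)" "V w"] unfolding p by simp
    then show ?thesis by (simp add: nincr_def c_def incr_def)
   qed
   then show "nincr (V w) j k = c (nincr (V w) n) k" by (cases "k < 2^j") (auto simp: nincr_def c_def)
  qed
  define A' where "A' = c -` A \<inter> space ?A"
  have "A' : sets ?A" unfolding A'_def by (rule measurable_sets[OF cm A])
  moreover have "nincr (V w) n : space ?A" for w by (auto simp: nincr_def space_PiM)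
  ultimately show ?thesis by (intro exI[of _ A']) (auto simp: A'_def cn)
 qed
 obtain A' B' where "A' : sets ?A" "a = ?B -` A' \<inter> space M"
  "B' : sets ?A" "b = ?B -` B' \<inter> space M" using lift[OF a(2)] lift[OF b(2)] unfolding a(1) b(1) n_def by (metis max.cobounded1 max.cobounded2)
 then have "A' \<inter> B' \<in> sets ?A" "a \<inter> b = ?B -` (A' \<inter> B') \<inter> space M" by auto
 then show "a \<inter> b \<in> dyadic_cylinders M V" unfolding dyadic_cylinders_def by blast
qed

lemma measurable_nincr_cylinders:
 "(%w. nincr (V w) j) : measurable (sigma (space M) (dyadic_cylinders M V)) (PiM {..<2^j} (%_. borel))"
proof (rule measurableI)
 have sub: "dyadic_cylinders M V <= Pow (space M)" by (auto simp: dyadic_cylinders_def)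
 show "nincr (V w) j : space (PiM {..<2^j} (%_. borel))" for w by (auto simp: nincr_def space_PiM)
 fix A :: "(nat => real) set" assume "A : sets (PiM {..<2^j} (%_. borel))"
 then have "(%w. nincr (V w) j) -` A \<inter> space M : dyadic_cylinders M V" by (auto simp: dyadic_cylinders_def)
 then show "(%w. nincr (V w) j) -` A \<inter> space (sigma (space M) (dyadic_cylinders M V)) : sets (sigma (space M) (dyadic_cylinders M V))"
  using sub by (simp)
qed

text \<open>Lower boxes, an intersection-stable generator of the level-J increments. The first
  increment starts at time u: with u = 1/2^m the event avoids the time interval on which the germ is
  observed, with u = 0 it is the true box.\<close>

definition box_ev :: "'a measure => ('a => real => real) => nat => real => (nat => real) => 'a set" where
 "box_ev M W J u a = {w : space M. ALL i<2^J. (W w (real (Suc i)/2^J)-W w (if i = 0 then u else real i/2^J))/sqrt (6/2^J) <= a i}"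

lemma box_ev_0: "box_ev M W J 0 a = {w : space M. ALL i<2^J. nincr (W w) J i <= a i}"
 unfolding box_ev_def by (intro Collect_cong conj_cong refl all_cong imp_cong) (auto simp: nincr_def incr_def)

text \<open>At level n = m + j the cylinder uses the first 2^j increments, which cover the times up
  to 1/2^m, and the box uses later ones only.\<close>

lemma cylinder_box_independent:
 assumes M: "rbm M W" and m: "J <= m" and E: "E : dyadic_cylinders M (%w. scW m (W w))"
 shows "measure M (E \<inter> box_ev M W J (1/2^m) a) = measure M E*measure M (box_ev M W J (1/2^m) a)"
  "E : sets M" "box_ev M W J (1/2^m) a : sets M"
proof -
 interpret prob_space M by (rule rbmD(1)[OF M])
 obtain j B where E: "E = (%w. nincr (scW m (W w)) j) -` B \<inter> space M" and B: "B : sets (PiM {..<2^j} (%_. borel))"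
  using E unfolding dyadic_cylinders_def by blast
 define n where "n = m+j"
 have nJ: "J <= n" "j <= n" using m by (auto simp: n_def)
 define X where "X = (%w. restrict (nincr (W w) n) {..<2^j})"
 define Y where "Y = (%w. restrict (nincr (W w) n) {2^j..<2^n})"
 let ?A = "PiM {2^j..<2^n} (%_. borel)"
 have ind: "indep_var (PiM {..<2^j} (%_. borel)) X ?A Y"
 proof -
  have "{..<2^j} \<inter> {2^j..<2^n} = ({} :: nat set)" "{2^j..<2^n} <= {..<(2::nat)^n}" by auto
  moreover have "{..<2^j} <= {..<(2::nat)^n}" using power_increasing[OF nJ(2), of "2::nat"] by auto
  ultimately show ?thesis unfolding X_def Y_def using indep_var_restrict[OF nincr_indep[OF M, of n]] by blast
 qed
 have rv: "X : measurable M (PiM {..<2^j} (%_. borel))" "Y : measurable M ?A" using ind by (auto dest: indep_var_rv1 indep_var_rv2)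
 have EX: "E = X -` B \<inter> space M" unfolding E X_def n_def nincr_scW ..
 define p where "p = (%i. if i = 0 then 2^j else i*2^(n-J) :: nat)"
 define q where "q = (%i. Suc i*2^(n-J) :: nat)"
 have n2: "(2::nat)^n = 2^J*2^(n-J)" "(2::real)^n = 2^J*2^(n-J)" using nJ by (simp_all flip: power_add)
 have jn: "(2::nat)^j <= 2^(n-J)" using m by (intro power_increasing) (auto simp: n_def)
 have pq: "2^j <= p i" "p i <= q i" for i
 proof -
  have "2^j <= i*2^(n-J)" if "i ~= 0" using jn that by (metis le_trans mult_le_mono1 mult_1 less_one not_less)
  then show "2^j <= p i" by (simp add: p_def)
  show "p i <= q i" using jn by (simp add: p_def q_def)
 qed
 have qn: "q i <= 2^n" if "i < 2^J" for i unfolding n2 q_def using that by (intro mult_le_mono1) simp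
 define D where "D = {f : space (PiM {2^j..<2^n} (%_. borel :: real measure)). ALL i<2^J. sqrt (6/2^n)*(\<Sum>l=p i..<q i. f l)/sqrt (6/2^J) <= a i}"
 have D: "D : sets ?A"
 proof -
  have "(%f. sqrt (6/2^n)*(\<Sum>l=p i..<q i. f l)/sqrt (6/2^J)) : borel_measurable ?A" if "i < 2^J" for i
   by (intro borel_measurable_divide borel_measurable_times borel_measurable_const borel_measurable_sum measurable_component_singleton)
     (use pq[of i] qn[OF that] in auto)
  then have "{f : space (PiM {2^j..<2^n} (%_. borel :: real measure)). ALL i:{..<2^J}. sqrt (6/2^n)*(\<Sum>l=p i..<q i. f l)/sqrt (6/2^J) <= a i} : sets ?A" by simp
  then show ?thesis by (simp only: D_def Ball_def lessThan_iff)
 qed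
 let ?B = "box_ev M W J (1/2^m) a"
 have box: "?B = Y -` D \<inter> space M"
 proof -
  have "(W w (real (Suc i)/2^J)-W w (if i = 0 then 1/2^m else real i/2^J))/sqrt (6/2^J) = sqrt (6/2^n)*(\<Sum>l=p i..<q i. Y w l)/sqrt (6/2^J)"
   if i: "i < 2^J" for w i
  proof -
   have "real (q i)/2^n = real (Suc i)/2^J" by (simp only: q_def n2 of_nat_mult of_nat_power of_nat_numeral) simp
   moreover have "real (p i)/2^n = (if i = 0 then 1/2^m else real i/2^J)"
   proof (cases "i = 0")
    case True
    then show ?thesis by (simp add: p_def n_def power_add)
   next
    case False
    then show ?thesis by (simp add: p_def n2)
   qed
   moreover have "(\<Sum>l=p i..<q i. nincr (W w) n l) = (\<Sum>l=p i..<q i. Y w l)"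
    using pq(1)[of i] qn[OF i] by (intro sum.cong refl) (auto simp: Y_def)
   ultimately show ?thesis using dyadic_increment[OF pq(2) qn[OF i], of "W w"] by simp
  qed
  moreover have "Y w : space ?A" for w by (auto simp: Y_def space_PiM)
  ultimately show ?thesis unfolding box_ev_def D_def by auto
 qed
 have "(%x. (X x, Y x)) -` (B \<times> D) \<inter> space M = E \<inter> ?B" unfolding EX box by auto
 then show "measure M (E \<inter> ?B) = measure M E*measure M (?B)" using indep_varD[OF ind B D] unfolding EX box by simp
 show "E : sets M" unfolding EX by (rule measurable_sets[OF rv(1) B])
 show "?B : sets M" unfolding box by (rule measurable_sets[OF rv(2) D])
qed

lemma box_ev_0_sets:
 assumes M: "rbm M W"
 shows "box_ev M W J 0 a : sets M"
proof -
 have "{w : space M. ALL i:{..<2^J}. nincr (W w) J i <= a i} : sets M"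
  using nincr_component(1)[OF M, of _ J] by (intro sets.sets_Collect_finite_All borel_measurable_le borel_measurable_const) auto
 then show ?thesis by (simp only: box_ev_0 Ball_def lessThan_iff)
qed

text \<open>Only the first increment depends on m, and it converges by continuity of the path at 0;
  indicators converge because the limit is Gaussian and almost surely misses the threshold a
  0.\<close>

lemma box_ev_limit:
 assumes M: "rbm M W" and F: "F : sets M" and m: "!!m. J <= m ==> box_ev M W J (1/2^m) a : sets M"
 shows "(%m. measure M (F \<inter> box_ev M W J (1/2^(m+J)) a)) \<longlonglongrightarrow> measure M (F \<inter> box_ev M W J 0 a)"
proof -
 interpret prob_space M by (rule rbmD(1)[OF M])
 define B where "B = (%u. F \<inter> box_ev M W J u a)"
 have Bm: "B (1/2^(m+J)) : sets M" "B 0 : sets M" for m using F m[of "m+J"] box_ev_0_sets[OF M] by (auto simp: B_def)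
 have ne: "AE v in M. nincr (W v) J 0 ~= a 0"
 proof (rule AE_distrD[OF nincr_component(1)[OF M]])
  have "AE x in stdn. x ~= a 0" using AE_lborel_singleton[of "a 0"] by (subst AE_density) auto
  then show "AE x in distr M borel (%v. nincr (W v) J 0). x ~= a 0" unfolding nincr_component(2)[OF M, of 0 J, simplified] .
 qed simp
 have "(%m. \<integral>v. indicat_real (B (1/2^(m+J))) v \<partial>M) \<longlonglongrightarrow> (LINT v|M. indicat_real (B 0) v)"
 proof (rule integral_dominated_convergence[where w = "%_. 1"])
  show "AE v in M. (%m. indicat_real (B (1/2^(m+J))) v) \<longlonglongrightarrow> indicat_real (B 0) v" using rbmD(3)[OF M] ne
  proof eventually_elim
   case (elim v)
   define y where "y = (%u. (W v (1/2^J)-W v u)/sqrt (6/2^J))"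
   have y0: "y 0 = nincr (W v) J 0" by (simp add: y_def nincr_def incr_def)
   have W0: "(%m. W v (1/2^(m+J))) \<longlonglongrightarrow> W v 0"
    by (rule continuous_on_tendsto_compose[OF elim(1) LIMSEQ_ignore_initial_segment[OF half_pow_tendsto_0]]) (auto)
   have lim: "(%m. y (1/2^(m+J))) \<longlonglongrightarrow> y 0" unfolding y_def by (intro tendsto_divide tendsto_diff tendsto_const W0) simp
   have "\<forall>\<^sub>F m in sequentially. (y (1/2^(m+J)) <= a 0 \<longleftrightarrow> y 0 <= a 0)"
   proof (cases "y 0 < a 0")
    case True
    then show ?thesis using order_tendstoD(2)[OF lim True] by (auto elim: eventually_mono)
   next
    case False
    then have "a 0 < y 0" using elim(2) y0 by simp
    then show ?thesis using order_tendstoD(1)[OF lim, of "a 0"] by (auto elim: eventually_mono)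
   qed
   then have "\<forall>\<^sub>F m in sequentially. indicat_real (B (1/2^(m+J))) v = indicat_real (B 0) v"
   proof eventually_elim
    case (elim m)
    define R where "R = (ALL i<2^J. i ~= 0 --> (W v (real (Suc i)/2^J)-W v (real i/2^J))/sqrt (6/2^J) <= a i)"
    have mem: "v : box_ev M W J u a \<longleftrightarrow> v \<in> space M & y u <= a 0 & R" for u
    proof -
     define Q where "Q = (%i. (W v (real (Suc i)/2^J)-W v (if i = 0 then u else real i/2^J))/sqrt (6/2^J) <= a i)"
     have z: "(0::nat) < 2^J" by simp
     have "(ALL i<2^J. Q i) \<longleftrightarrow> Q 0 & (ALL i<2^J. i ~= 0 --> Q i)" by auto
     moreover have "Q 0 \<longleftrightarrow> y u <= a 0" by (simp add: Q_def y_def)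
     moreover have "(ALL i<2^J. i ~= 0 --> Q i) \<longleftrightarrow> R" unfolding R_def by (intro all_cong imp_cong refl) (simp add: Q_def)
     moreover have "v : box_ev M W J u a \<longleftrightarrow> v \<in> space M & (ALL i<2^J. Q i)" unfolding box_ev_def Q_def by (rule mem_Collect_eq)
     ultimately show ?thesis by simp
    qed
    have "v : B (1/2^(m+J)) \<longleftrightarrow> v \<in> B 0" unfolding B_def Int_iff mem using elim by blast
    then show ?case by auto
   qed
   then show ?case by (rule tendsto_eventually)
  qed
 qed (use Bm in "auto simp: indicator_def")
 then have "(%m. prob (B (1/2^(m+J)))) \<longlonglongrightarrow> prob (B 0)" using Bm by simp
 then show ?thesis by (simp only: B_def)
qed

text \<open>F lies in the sigma-algebra of every initial piece, so it is independent of the boxes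
  starting at 1/2^m for all large m; this product formula passes to the limit.\<close>

lemma germ_box_independent:
 assumes M: "rbm M W" and F: "!!m. F : sigma_sets (space M) (dyadic_cylinders M (%w. scW m (W w)))"
 shows "F : sets M" "measure M (F \<inter> box_ev M W J 0 a) = measure M F*measure M (box_ev M W J 0 a)"
proof -
 interpret prob_space M by (rule rbmD(1)[OF M])
 show Fs: "F : sets M"
  using sets.sigma_sets_subset[of "dyadic_cylinders M (%w. scW 0 (W w))" M] F[of 0] cylinder_box_independent(2)[OF M le0] by blast
 have eq: "measure M (F \<inter> box_ev M W J (1/2^m) a) = measure M F*measure M (box_ev M W J (1/2^m) a)" if m: "J <= m" for m
 proof -
  let ?B = "box_ev M W J (1/2^m) a"
  have "indep_set (dyadic_cylinders M (%w. scW m (W w))) {?B}"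
  proof (rule indep_setI)
   show "dyadic_cylinders M (%w. scW m (W w)) <= sets M" using cylinder_box_independent(2)[OF M m] by blast
   have "{} : dyadic_cylinders M (%w. scW m (W w))" unfolding dyadic_cylinders_def by (auto)
   from cylinder_box_independent(3)[OF M m this] show "{?B} <= sets M" by simp
  qed (use cylinder_box_independent(1)[OF M m] in auto)
  then have "indep_set (sigma_sets (space M) (dyadic_cylinders M (%w. scW m (W w)))) (sigma_sets (space M) {?B})"
   by (rule indep_set_sigma_sets[OF _ Int_stable_dyadic_cylinders]) (auto simp: Int_stable_def)
  then show ?thesis by (rule indep_setD[OF _ F]) (auto)
 qed
 have bs: "box_ev M W J (1/2^m) a : sets M" if m: "J <= m" for m
 proof -
  have "{} : dyadic_cylinders M (%w. scW m (W w))" unfolding dyadic_cylinders_def by (auto)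
  from cylinder_box_independent(3)[OF M m this] show ?thesis .
 qed
 let ?A = "box_ev M W J 0 a"
 let ?C = "%m. measure M (F \<inter> box_ev M W J (1/2^(m+J)) a)"
 have "?C \<longlonglongrightarrow> measure M (F \<inter> ?A)" by (rule box_ev_limit[OF M Fs bs])
 moreover have "?C \<longlonglongrightarrow> measure M F*measure M (?A)"
 proof -
  have "space M \<inter> box_ev M W J u a = box_ev M W J u a" for u unfolding box_ev_def by (rule Int_absorb1[OF Collect_restrict])
  moreover have "(%m. measure M (space M \<inter> box_ev M W J (1/2^(m+J)) a)) \<longlonglongrightarrow> measure M (space M \<inter> ?A)"
   by (rule box_ev_limit[OF M sets.top bs])
  ultimately have "(%m. measure M (box_ev M W J (1/2^(m+J)) a)) \<longlonglongrightarrow> measure M (?A)" by simp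
  from tendsto_mult_left[OF this, of "measure M F"] show ?thesis by (simp only: eq[OF le_add2])
 qed
 ultimately show "measure M (F \<inter> ?A) = measure M F*measure M (?A)" by (rule LIMSEQ_unique)
qed

text \<open>A germ event is independent of all dyadic increments, so conditioning on it preserves
  their joint law; all bounds with uniform constants then hold under the conditional measure
  too.\<close>

lemma rbm_conditioned:
 assumes M: "rbm M W" and F: "!!m. F : sigma_sets (space M) (dyadic_cylinders M (%v. scW m (W v)))" and pos: "emeasure M F ~= 0"
 shows "rbm (uniform_measure M F) W"
proof -
 interpret prob_space M by (rule rbmD(1)[OF M])
 have Fs: "F : sets M" by (rule germ_box_independent(1)[OF M F])
 let ?N = "uniform_measure M F"
 let ?D = "%_. borel"
 have "prob_space ?N" by (rule prob_space_uniform_measure) (use pos in auto)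
 moreover have "(%v. W v t) : borel_measurable ?N" if "t : {0..1}" for t using rbmD(2)[OF M that] by simp
 moreover have "AE v in ?N. continuous_on {0..1} (W v)" by (rule AE_uniform_measureI[OF Fs]) (use rbmD(3)[OF M] in auto)
 moreover have "distr ?N (PiM {..<2^J} ?D) (%v. nincr (W v) J) = stdnP (2^J)" for J
 proof -
  define Q where "Q = range (box_ev M W J 0)"
  have Qs: "Q <= sets M" using box_ev_0_sets[OF M] by (auto simp: Q_def)
  have Qp: "Q <= Pow (space M)" by (auto simp: Q_def box_ev_def)
  have ind: "indep_set (sigma_sets (space M) {F}) (sigma_sets (space M) Q)"
  proof (rule indep_set_sigma_sets)
   show "indep_set {F} Q" by (rule indep_setI) (use Fs Qs germ_box_independent(2)[OF M F] in "auto simp: Q_def")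
   show "Int_stable {F}" by (simp add: Int_stable_def)
   show "Int_stable Q"
   proof (rule Int_stableI)
    fix x y assume "x : Q" "y : Q"
    then obtain a b where "x = box_ev M W J 0 a" "y = box_ev M W J 0 b" by (auto simp: Q_def)
    then have "x \<inter> y = box_ev M W J 0 (%i. min (a i) (b i))" by (auto simp: box_ev_0)
    then show "x \<inter> y \<in> Q" by (auto simp: Q_def)
   qed
  qed
  let ?C = "sigma (space M) Q"
  have cm: "(%v. nincr (W v) J i) : borel_measurable ?C" if i: "i < 2^J" for i unfolding borel_measurable_iff_le
  proof
   fix b
   \<comment> \<open>A constraint on coordinate i alone is the union of boxes whose other bounds
     grow.\<close>
   let ?B = "\<Union>k::nat. box_ev M W J 0 (%l. if l = i then b else real k)"
   have "{v : space M. nincr (W v) J i <= b} = ?B"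
   proof (intro equalityI subsetI)
    fix v assume w: "v : {v : space M. nincr (W v) J i <= b}"
    obtain k :: nat where k: "(\<Sum>l<2^J. abs (nincr (W v) J l)) <= real k" using real_arch_simple by blast
    have "nincr (W v) J l <= real k" if "l < 2^J" for l
    proof -
     have "abs (nincr (W v) J l) <= (\<Sum>l<2^J. abs (nincr (W v) J l))" using that by (intro member_le_sum) auto
     then show ?thesis using k by linarith
    qed
    then show "v : ?B" using w by (auto simp: box_ev_0)
   qed (use i in "auto simp: box_ev_0")
   also have "... : sigma_sets (space M) Q" by (rule sigma_sets.Union) (auto simp: Q_def)
   finally show "{v : space ?C. nincr (W v) J i <= b} : sets ?C" using Qp by (simp)
  qed
  have nm: "(%v. nincr (W v) J) : measurable ?C (PiM {..<2^J} ?D)"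
  proof -
   let ?E = "%v. \<lambda>l\<in>{..<2^J}. nincr (W v) J l"
   have "?E : measurable ?C (PiM {..<2^J} ?D)" by (intro measurable_restrict cm) simp
   moreover have "?E = (%v. nincr (W v) J)" by (intro ext) (simp add: nincr_def)
   ultimately show ?thesis by simp
  qed
  show ?thesis
  proof (rule measure_eqI)
   let ?A = "distr ?N (PiM {..<2^J} ?D) (%v. nincr (W v) J)"
   show "sets ?A = sets (stdnP (2^J))" by (simp add: sets_stdnP)
   fix B assume "B : sets ?A"
   then have B: "B : sets (PiM {..<2^J} ?D)" by simp
   define H where "H = (%v. nincr (W v) J) -` B \<inter> space M"
   have "H : sigma_sets (space M) Q" using measurable_sets[OF nm B] Qp by (simp add: H_def)
   then have "prob (F \<inter> H) = prob F*prob H" by (intro indep_setD[OF ind]) (auto)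
   moreover have Hs: "H : sets M" unfolding H_def by (rule measurable_sets[OF rbm_nincr(1)[OF M] B])
   moreover have "0 < prob F" using pos by (simp add: emeasure_eq_measure zero_less_measure_iff)
   ultimately have "emeasure ?N H = emeasure M H" using Fs by (subst emeasure_uniform_measure) (simp_all add: emeasure_eq_measure divide_ennreal)
   moreover have "emeasure ?A B = emeasure ?N H" using B rbm_nincr(1)[OF M, of J] by (subst emeasure_distr) (auto simp: H_def)
   moreover have "emeasure (stdnP (2^J)) B = emeasure M H"
    unfolding rbm_nincr(2)[OF M, symmetric] H_def by (rule emeasure_distr[OF rbm_nincr(1)[OF M] B])
   ultimately show "emeasure ?A B = emeasure (stdnP (2^J)) B" by simp
  qed
 qed
 ultimately show ?thesis by (simp add: rbm_def)
qed

text \<open>The unions over tails decrease to the limsup event, and each has probability at least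
  p.\<close>

lemma (in prob_space) prob_infinitely_often:
 fixes A :: "nat => 'a set"
 assumes A: "!!n. A n : events" and p: "!!n. n0 <= n ==> p <= prob (A n)"
 shows "{w : space M. \<exists>\<^sub>\<infinity>n. w : A n} : events" "p <= prob {w : space M. \<exists>\<^sub>\<infinity>n. w : A n}"
proof -
 define U where "U = (%N. \<Union>n. A (N+n))"
 have Us: "U N : events" for N unfolding U_def using A by (intro sets.countable_UN) blast
 have "(w : space M & (\<exists>\<^sub>\<infinity>n. w : A n)) \<longleftrightarrow> (ALL N. w : U N)" for w
 proof -
  have "w : space M" if "w : A n" for n using sets.sets_into_space[OF A[of n]] that by blast
  moreover have "(EX n>=N. w : A n) \<longleftrightarrow> w \<in> U N" for N unfolding U_def UN_iff le_iff_add by blast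
  ultimately show ?thesis unfolding INFM_nat_le by blast
 qed
 then have eq: "{w : space M. \<exists>\<^sub>\<infinity>n. w : A n} = (\<Inter>N. U N)" by auto
 show "{w : space M. \<exists>\<^sub>\<infinity>n. w : A n} : events" unfolding eq using Us by auto
 have "(%N. prob (U N)) \<longlonglongrightarrow> prob (\<Inter>N. U N)"
  proof (rule finite_Lim_measure_decseq)
  have "U N <= U K" if "K <= N" for K N
  proof
   fix x assume "x : U N"
   then obtain n where "x : A (N+n)" by (auto simp: U_def)
   then show "x : U K" unfolding U_def using that by (intro UN_I[of "N-K+n"]) simp_all
  qed
  then show "decseq U" by (simp add: decseq_def)
 qed (use Us in blast)
 moreover have "EX N0. ALL N>=N0. p <= prob (U N)"
 proof (intro exI[of _ n0] allI impI)
  fix N assume "n0 <= N"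
  then have "p <= prob (A N)" by (rule p)
  also have "... <= prob (U N)"
  proof (rule finite_measure_mono[OF _ Us])
   show "A N <= U N" unfolding U_def by (rule subset_trans[OF _ UN_upper[of 0]]) simp_all
  qed
  finally show "p <= prob (U N)" .
 qed
 ultimately show "p <= prob {w : space M. \<exists>\<^sub>\<infinity>n. w : A n}" unfolding eq by (rule LIMSEQ_le_const)
qed

text \<open>Call a scale k successful if mass and energy are good at infinitely many levels of the
  rescaled piece. Failure of all but finitely many scales is a germ event F. If F had positive
  probability, then under conditioning on F each scale would still succeed with probability at least
  p0, hence infinitely many would with probability at least p0, contradicting F.\<close>

theorem boundary_dimension_lower:
 fixes M :: "'a measure"
 assumes M: "rbm M W" and s: "0 < s" "s < 4/3"
 shows "AE w in M. hausdorff_measure s (frontier (cflow (W w) ` \<H>) \<inter> \<H>) ~= 0"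
proof -
 \<comment> \<open>18 e is the loss of exponent in \<open>mass_in_small_set\<close>; 1/72 secures
   its condition e < 1/36.\<close>
 define e where "e = min ((4/3-s)/18) (1/72)"
 have "e <= (4/3-s)/18" "e <= 1/72" unfolding e_def by (rule min.cobounded1, rule min.cobounded2)
 moreover have "0 < e" using s by (simp add: e_def)
 ultimately have e: "0 < e" "e < 1/36" "e < 2/9" "s <= 4/3-18*e" by auto
 define s' where "s' = 4/3-18*e"
 have s': "0 < s'" "s <= s'" using e  by (auto simp: s'_def)
 define t where "t = 4/9-2*e"
 obtain A m0 E0 p0 where A: "1 <= A" and p: "0 < m0" "0 < E0" "0 < p0" and ev: "!!(M :: 'a measure) W n. rbm M W ==> 62 <= n ==>
   p0 <= measure M {w : space M. m0 <= Sn A e n (W w) & En A e t n (W w) <= E0}" using mass_energy_event[OF e(1,3)] unfolding t_def by blast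
 define P where "P = (%n V. 62 <= n & m0 <= Sn A e n V & En A e t n V <= E0)"
 define L where "L = (%k w. \<exists>\<^sub>\<infinity>n. P n (scW k (W w)))"
 define F where "F = {w : space M. \<not> (\<exists>\<^sub>\<infinity>k. L k w)}"
 have meas: "Measurable.pred N (%w. P n (V w))" if V: "!!j. (%w. nincr (V w) j) : measurable N (PiM {..<2^j} (%_. borel))" for N :: "'a measure" and V n
 proof -
  note [measurable] = measurable_Sn_En_nincr[OF V]
  show ?thesis unfolding P_def by measurable
 qed
 \<comment> \<open>Infinitely often is insensitive to the first m scales, so F can be read off from
   the piece \<open>scW m\<close> for every m.\<close>
 have germ: "F : sigma_sets (space M) (dyadic_cylinders M (%w. scW m (W w)))" for m
 proof -
  let ?N = "sigma (space M) (dyadic_cylinders M (%w. scW m (W w)))"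
  have sub: "dyadic_cylinders M (%w. scW m (W w)) <= Pow (space M)" by (auto simp: dyadic_cylinders_def)
  have nm: "(%w. nincr (scW (m+r) (W w)) j) : measurable ?N (PiM {..<2^j} (%_. borel))" for r j
  proof -
   have sub: "{..<(2::nat)^j} <= {..<2^(r+j)}" by simp
   have "nincr (scW (m+r) (W w)) j = restrict (nincr (scW m (W w)) (r+j)) {..<2^j}" for w
   proof
    fix x
    show "nincr (scW (m+r) (W w)) j x = restrict (nincr (scW m (W w)) (r+j)) {..<2^j} x"
     using subsetD[OF sub, of x] unfolding nincr_scW by (cases "x < 2^j") (simp_all add: add.assoc)
   qed
   then show ?thesis using measurable_compose[OF measurable_nincr_cylinders[of "%w. scW m (W w)" "r+j" M] measurable_restrict_subset[OF sub]] by simp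
  qed
  have [measurable]: "Measurable.pred ?N (%w. P n (scW (m+r) (W w)))" for n r by (rule meas[OF nm])
  have [measurable]: "Measurable.pred ?N (L (m+r))" for r unfolding L_def INFM_nat_le by measurable
  have "(\<exists>\<^sub>\<infinity>k. L k w) \<longleftrightarrow> (ALL j. EX r>=j. L (m+r) w)" for w
  proof
   assume i: "\<exists>\<^sub>\<infinity>k. L k w"
   show "ALL j. EX r>=j. L (m+r) w"
   proof
    fix j
    obtain k where "m+j <= k" "L k w" using i unfolding INFM_nat_le by (auto dest: spec[of _ "m+j"])
    then show "EX r>=j. L (m+r) w" by (intro exI[of _ "k-m"]) simp
   qed
  next
   assume a: "ALL j. EX r>=j. L (m+r) w"
   show "\<exists>\<^sub>\<infinity>k. L k w" unfolding INFM_nat_le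
   proof
    fix j
    obtain r where "j <= r" "L (m+r) w" using a by (auto dest: spec[of _ j])
    then show "EX n>=j. L n w" by (intro exI[of _ "m+r"]) simp
   qed
  qed
  then have "F = {w : space ?N. \<not> (ALL j. EX r>=j. L (m+r) w)}" using sub by (simp add: F_def)
  also have "... : sets ?N" by simp
  finally show ?thesis using sub by (simp)
 qed
 have Fs: "F : sets M" by (rule germ_box_independent(1)[OF M germ])
 have "emeasure M F = 0"
 proof (rule ccontr)
  assume pos: "emeasure M F ~= 0"
  let ?N = "uniform_measure M F"
  have N: "rbm ?N W" by (rule rbm_conditioned[OF M germ pos])
  interpret N: prob_space ?N by (rule rbmD(1)[OF N])
  have pm: "Measurable.pred ?N (%w. P n (scW k (W w)))" for n k by (rule meas) (rule rbm_nincr(1)[OF rbm_scW[OF N]])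
  have L: "{w : space ?N. L k w} : N.events" "p0 <= N.prob {w : space ?N. L k w}" for k
  proof -
   define G where "G = (%n. {w : space ?N. P n (scW k (W w))})"
   have Gs: "G n : N.events" for n unfolding G_def using pm by measurable
   have "p0 <= N.prob (G n)" if "62 <= n" for n using ev[OF rbm_scW[OF N] that] that by (simp add: G_def P_def)
   note io = N.prob_infinitely_often[of G, OF Gs this]
   have "{w : space ?N. \<exists>\<^sub>\<infinity>n. w : G n} = {w : space ?N. L k w}" by (auto simp: G_def L_def)
   with io show "{w : space ?N. L k w} : N.events" "p0 <= N.prob {w : space ?N. L k w}" by auto
  qed
  define R where "R = {w : space ?N. \<exists>\<^sub>\<infinity>k. w : {w : space ?N. L k w}}"
  have R: "R : N.events" "p0 <= N.prob R" unfolding R_def by (rule N.prob_infinitely_often[of _ 0, OF L(1)]; rule L(2))+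
  have "w ~: F" if "w : R" for w using that by (simp add: R_def F_def)
  then have "F \<inter> R = {}" by auto
  then have "emeasure ?N R = 0" using R(1) Fs by simp
  then show False using R(2) p(3) by (simp add: N.emeasure_eq_measure)
 qed
 then have "AE w in M. w ~: F" using Fs by (intro AE_not_in) (auto)
 then show ?thesis using rbmD(3)[OF M] AE_space
 proof eventually_elim
  case (elim w)
  then have "\<exists>\<^sub>\<infinity>k. L k w" by (simp add: F_def)
  then obtain k where k: "L k w" unfolding INFM_nat by blast
  have "hausdorff_measure s' (frontier (cflow (scW k (W w)) ` \<H>) \<inter> {z. cT <= Im z}) ~= 0" unfolding s'_def
   by (rule positive_measure_of_energy[OF continuous_scW[OF elim(2)] e(1,2) A p(1,2)]) (use k in "simp add: L_def P_def t_def")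
  moreover have "scW k (W w) = (%s. W w (1/2^k * s)/sqrt (1/2^k))" by (simp add: scW_def[abs_def])
  ultimately have "hausdorff_measure s' (frontier (cflow (W w) ` \<H>) \<inter> \<H>) ~= 0"
   using cflow_start_transfer[OF elim(2) _ _ T_pos(1) s'(1), of "1/2^k"] by (auto)
  then show ?case using hausdorff_measure_null_mono_exponent[OF _ s'(2)] by blast
 qed
qed

section \<open>From Brownian motion to the reversed driving function and the hull\<close>

text \<open>Reversal turns increment k of level j into minus the increment 2^j - 1 - k of B;
  symmetry and independence of centred normals leave the law unchanged.\<close>

lemma rbm_reversed_brownian_motion:
 assumes B: "standard_brownian_motion M B"
 shows "rbm M (%w s. sqrt 6*B w (1-s))"
proof -
 interpret prob_space M using B by (simp add: standard_brownian_motion_def)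
 have meas: "(%w. B w t) : borel_measurable M" if "0 <= t" for t using B that by (simp add: standard_brownian_motion_def)
 have cont: "AE w in M. B w 0 = 0 & continuous_on {0..} (B w)" using B by (simp add: standard_brownian_motion_def)
 have normal: "distributed M lborel (%w. B w t-B w s) (%x. ennreal (normal_density 0 (sqrt (t-s)) x))" if "0 <= s" "s < t" for s t
  using B that by (simp add: standard_brownian_motion_def)
 let ?A = "%_. borel"
 have indep: "indep_vars ?A (%i w. B w (ts ! Suc i)-B w (ts ! i)) {..<length ts-1}" if "sorted_wrt (<) ts" "ALL t:set ts. 0 <= t" for ts
  using B that by (simp add: standard_brownian_motion_def)
 define W where "W = (%w s. sqrt 6*B w (1-s))"
 have "(%w. W w t) : borel_measurable M" if "t : {0..1}" for t
  unfolding W_def using that by (intro borel_measurable_times borel_measurable_const meas) simp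
 moreover have "AE w in M. continuous_on {0..1} (W w)" using cont
 proof eventually_elim
  case (elim w)
  have "continuous_on {0..1} (%s. B w (1-s))" by (rule continuous_on_compose2[OF conjunct2[OF elim]]) (simp_all add: continuous_on_diff)
  then show ?case unfolding W_def by (intro continuous_on_mult continuous_on_const)
 qed
 moreover have "distr M (PiM {..<2^j} ?A) (%w. nincr (W w) j) = stdnP (2^j)" for j
 proof -
  let ?I = "{..<(2::nat)^j}"
  define X where "X = (%i w. B w (real (Suc i)/2^j)-B w (real i/2^j))"
  define r where "r = (%k. 2^j-Suc k :: nat)"
  define Y where "Y = (%k w. (- sqrt (2^j))*X (r k) w)"
  define ts where "ts = map (%i. real i/2^j) [0..<Suc (2^j)]"
  have tsn: "ts ! i = real i/2^j" if "i <= 2^j" for i using that by (simp add: ts_def del: upt_Suc)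
  have "sorted_wrt (<) ts" unfolding sorted_wrt_iff_nth_less
  proof (intro allI impI)
   fix i k assume ik: "i < k" "k < length ts"
   then have "k <= 2^j" by (simp add: ts_def del: upt_Suc)
   with ik(1) show "ts ! i < ts ! k" by (simp add: tsn divide_strict_right_mono)
  qed
  moreover have "ALL t:set ts. 0 <= t" by (auto simp: ts_def simp del: upt_Suc)
  ultimately have "indep_vars ?A (%i w. B w (ts ! Suc i)-B w (ts ! i)) {..<length ts-1}" by (rule indep)
  moreover have "length ts-1 = 2^j" by (simp add: ts_def)
  ultimately have "indep_vars ?A (%i w. B w (ts ! Suc i)-B w (ts ! i)) ?I" by simp
  moreover have "(%w. B w (ts ! Suc i)-B w (ts ! i)) = X i" if "i : ?I" for i using that by (simp add: X_def tsn)
  ultimately have iX: "indep_vars ?A X ?I" by (subst (asm) indep_vars_cong[OF refl _ refl, where Y = X])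
  have r: "r k : ?I" if "k : ?I" for k by (simp add: r_def)
  \<comment> \<open>Reindexing of an independent family: the k-th new variable reads the single old
    coordinate r k.\<close>
  have "indep_vars (%k. PiM {r k} ?A) (%k w. restrict (%i. X i w) {r k}) ?I"
   by (rule indep_vars_restrict[OF iX]) (use r in "auto simp: disjoint_family_on_def r_def")
  then have "indep_vars ?A (%k w. (- sqrt (2^j))*restrict (%i. X i w) {r k} (r k)) ?I"
   by (rule indep_vars_compose2[where Y = "%k f. (- sqrt (2^j))*f (r k)"])
     (intro borel_measurable_times borel_measurable_const measurable_component_singleton singletonI)
  then have iY: "indep_vars ?A Y ?I" by (simp add: Y_def[abs_def])
  have mY: "Y k : borel_measurable M" if "k : ?I" for k using iY that unfolding indep_vars_def by blast
  have dY: "distr M borel (Y k) = stdn" if k: "k : ?I" for k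
  proof -
   have s: "0 <= real (r k)/2^j" "real (r k)/2^j < real (Suc (r k))/2^j" by (auto intro: divide_strict_right_mono)
   have "sqrt (real (Suc (r k))/2^j-real (r k)/2^j) = 1/sqrt (2^j)" by (simp add: diff_divide_distrib[symmetric] real_sqrt_divide)
   with normal[OF s] have "distributed M lborel (X (r k)) (%x. ennreal (normal_density 0 (1/sqrt (2^j)) x))" by (simp add: X_def)
   from normal_density_affine[OF this, of "- sqrt (2^j)" 0]
   have "distributed M lborel (Y k) (%x. ennreal (std_normal_density x))" by (simp add: Y_def)
   from distributed_distr_eq_density[OF this] show ?thesis by (simp cong: distr_cong)
  qed
  have Yn: "nincr (W w) j = (\<lambda>k\<in>?I. Y k w)" for w
  proof
   fix k
   show "nincr (W w) j k = (\<lambda>k\<in>?I. Y k w) k"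
   proof (cases "k < 2^j")
    case True
    then have "real (r k) = 2^j-real (Suc k)" by (simp add: r_def)
    then have eq: "1-real (Suc k)/2^j = real (r k)/2^j" "1-real k/2^j = real (Suc (r k))/2^j" by (simp_all add: field_simps)
    have "incr (W w) (2^j) k =-(sqrt 6*X (r k) w)" by (simp add: incr_def W_def X_def eq right_diff_distrib del: of_nat_Suc)
    moreover have "sqrt (6/2^j) = sqrt 6/sqrt (2^j)" by (rule real_sqrt_divide)
    ultimately show ?thesis by (simp add: nincr_def Y_def)
   qed (simp add: nincr_def)
  qed
  have "distr M (PiM ?I ?A) (%w. \<lambda>k\<in>?I. Y k w) = PiM ?I (%k. distr M borel (Y k))"
   using iY by (subst (asm) indep_vars_iff_distr_eq_PiM') (auto simp: lessThan_empty_iff intro: mY)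
  also have "... = stdnP (2^j)" by (intro PiM_cong refl dY)
  finally show ?thesis unfolding Yn .
 qed
 ultimately have "rbm M W" using prob_space_axioms by (simp add: rbm_def)
 then show ?thesis unfolding W_def .
qed

text \<open>The shift at the start translates the half-plane onto itself, and the shift at the end
  is sqrt 6 * B w 0 = 0.\<close>

lemma sle_hull_frontier:
 assumes c: "continuous_on {0..} (B w)" and z: "B w 0 = 0"
 shows "frontier (sle_hull 6 B w 1) \<inter> \<H>
  = frontier (cflow (%s. sqrt 6*B w (1-s)) ` \<H>) \<inter> \<H>"
proof -
 let ?W = "%s. sqrt 6*B w (1-s)"
 have tr: "(%z. z+complex_of_real a) ` \<H> = \<H>" for a
 proof (intro equalityI subsetI)
  fix z assume "z : \<H>"
  then show "z : (%z. z+complex_of_real a) ` \<H>" by (intro image_eqI[of _ _ "z - of_real a"]) (auto simp: upper_half_plane_def)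
 qed (auto simp: upper_half_plane_def)
 have "continuous_on {0..1} (%s. sqrt 6*B w s)" by (intro continuous_on_mult continuous_on_const continuous_on_subset[OF c]) simp
 from loewner_domain_eq[OF this]
 have "loewner_domain (%s. sqrt 6*B w s) 1 = rev_flow ?W 0 1 ` (%z. z + of_real (?W 0)) ` \<H>" unfolding tr .
 also have "... = cflow ?W ` \<H>" unfolding image_image by (rule image_cong) (simp_all add: cflow_def z)
 finally show ?thesis by (simp add: sle_hull_def loewner_hull_def frontier_relative_complement[OF open_upper_half_plane])
qed

theorem theorem2:
  fixes M :: "'a measure" and B :: "'a \<Rightarrow> real \<Rightarrow> real"
  assumes "standard_brownian_motion M B"
  shows "AE w in M. hausdorff_dim (frontier (sle_hull 6 B w 1) \<inter> upper_half_plane) = 4 / 3"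
proof -
 define W where "W = (%v s. sqrt 6*B v (1-s))"
 define D where "D = (%v. frontier (cflow (W v) ` \<H>) \<inter> \<H>)"
 have W: "rbm M W" unfolding W_def by (rule rbm_reversed_brownian_motion[OF assms])
 \<comment> \<open>One null set must serve all exponents below 4/3; a sequence tending to 4/3
   suffices, as null measure passes to larger exponents.\<close>
 have "AE v in M. ALL n::nat. hausdorff_measure (4/3-1/(real n+1)) (D v) ~= 0 \<or> n = 0" unfolding AE_all_countable
 proof
  fix n :: nat
  show "AE v in M. hausdorff_measure (4/3-1/(real n+1)) (D v) ~= 0 \<or> n = 0"
  proof (cases "n = 0")
   case False
   then have "1/(real n+1) <= 1/2" by simp
   moreover have "0 < 1/(real n+1)" by simp
   ultimately have "0 < 4/3-1/(real n+1)" "4/3-1/(real n+1) < 4/3" by linarith+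
   then have "AE v in M. hausdorff_measure (4/3-1/(real n+1)) (D v) ~= 0" unfolding D_def by (rule boundary_dimension_lower[OF W])
   then show ?thesis by eventually_elim blast
  qed simp
 qed
 moreover have "AE v in M. ALL s>4/3. hausdorff_measure s (D v) = 0" unfolding D_def by (rule boundary_dimension_upper[OF W])
 moreover have "AE v in M. B v 0 = 0 & continuous_on {0..} (B v)" using assms by (simp add: standard_brownian_motion_def)
 ultimately show ?thesis
 proof eventually_elim
  case (elim v)
  have "hausdorff_dim (D v) = 4/3"
  proof (rule hausdorff_dim_eqI)
   fix s :: real assume s: "0 < s" "s < 4/3"
   obtain n :: nat where n: "inverse (real (Suc n)) < 4/3-s" using reals_Archimedean[of "4/3-s"] s by auto
   have "1/(real (Suc n)+1) <= inverse (real (Suc n))" by (simp add: field_simps)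
   with n have "s <= 4/3-1/(real (Suc n)+1)" by simp
   moreover have "hausdorff_measure (4/3-1/(real (Suc n)+1)) (D v) ~= 0" using elim(1) by blast
   ultimately show "hausdorff_measure s (D v) ~= 0" using hausdorff_measure_null_mono_exponent by blast
  qed (use elim(2) in simp_all)
  then show ?case using sle_hull_frontier[of B v] elim(3) by (simp add: D_def W_def)
 qed
qed

end
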